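(* Let $n\ge 2$, $N\ge 1$. As $\mathfrak{sl}_n$-modules and graded vector spaces, $$\wedge^N\pi[z^{-1}]\,/\,\mathrm{Im}\,\mathcal H_-\simeq\bigoplus_{\mu\vdash N,\ \ell(\mu)\le n}\pi_\mu\otimes M_{\mu',(1)^N}(\mathcal Z^{-1}),$$ where $\mu'$ is the conjugate partition of $\mu$.
   Context: Let $\pi=\mathbb C^n$ be the fundamental module of $\mathfrak{sl}_n(\mathbb C)$ (also a $\mathfrak{gl}_n$-module). For a partition $\mu$ with $\ell(\mu)\le n$ parts, $\pi_\mu$ is the irreducible $\mathfrak{sl}_n$-module of highest weight $\sum_{i=1}^{n-1}(\mu_i-\mu_{i+1})\omega_i$. Reduced wedge product. $\pi[z^{-1}]=\pi\otimes\mathbb C[z^{-1}]$, and the $N$-fold wedge product is $\wedge^N\pi[z^{-1}]\simeq(\pi^{\otimes N}\otimes\mathbb C[z_1^{-1},\dots,z_N^{-1}])^A$, the subspace on which the diagonal action of $S_N$ (permuting tensor factors and variables simultaneously) is by the sign representation. $\mathfrak{gl}_n\otimes\mathbb C[t^{-1}]$ acts by the coproduct: $x\otimes f(t^{-1})$ acts as $\sum_i x^{(i)}f(z_i^{-1})$, where $x^{(i)}$ is $x$ on the $i$-th factor. $\mathcal H_-$ is spanned by $B_{a}=\mathrm{id}\otimes t^{-a}$, $a>0$; thus $B_a$ acts as multiplication by $z_1^{-a}+\cdots+z_N^{-a}$. $\mathrm{Im}\,\mathcal H_-=\sum_{a>0}B_a(\wedge^N\pi[z^{-1}])$. The grading is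 by degree in the $z_i$, each $z_i$ having degree $1$ (so degrees are $\le 0$). Multiplicity spaces. $R_N(\mathcal Z^{-1})=\mathbb C[z_1^{-1},\dots,z_N^{-1}]/J_N(\mathcal Z^{-1})$, where $J_N(\mathcal Z^{-1})$ is the ideal generated by the elementary symmetric polynomials of positive degree in $z_1^{-1},\dots,z_N^{-1}$. $S_N$ acts by permuting variables and $R_N(\mathcal Z^{-1})\simeq\bigoplus_{\lambda\vdash N}W_\lambda\otimes M_{\lambda,(1)^N}(\mathcal Z^{-1})$, with $W_\lambda$ the irreducible Specht module over $\mathbb C$ ($W_{(N)}$ trivial) and $M_{\lambda,(1)^N}(\mathcal Z^{-1})$ graded multiplicity spaces, graded by degree in the $z_i$. *)

theory Defs
  imports "HOL-Library.Poly_Mapping" "HOL-Algebra.QuotRing" "Jordan_Normal_Form.VS_Connect"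
begin

section \<open>Graded vector spaces and graded modules\<close>

text \<open>
  Complex vector spaces are \<open>module\<close> records over \<open>class_ring\<close>, the field of complex numbers.
  The fields \<open>mult\<close> and \<open>one\<close> of such a record are irrelevant and left \<open>undefined\<close>, except for the
  polynomial ring below.  In \<open>('g, 'v) gmod\<close> the operators (elements of \<open>sl\<^sub>n\<close> or of \<open>S\<^sub>N\<close>) have
  type \<open>'g\<close>.  An ungraded module is regarded as a graded one concentrated in degree 0.
\<close>

record 'v gspace = "(complex, 'v) module" +
  hcomp :: "int \<Rightarrow> 'v set"

record ('g, 'v) gmod = "'v gspace" +
  act :: "'g \<Rightarrow> 'v \<Rightarrow> 'v"

definition graded_space :: "('v, 'x) gspace_scheme \<Rightarrow> bool" where
  "graded_space V \<longleftrightarrow>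
     vectorspace class_ring V \<and>
     (\<forall>d. subspace class_ring (hcomp V d) V) \<and>
     (\<forall>v\<in>carrier V. \<exists>!c. (\<forall>d. c d \<in> hcomp V d) \<and> finite {d. c d \<noteq> \<zero>\<^bsub>V\<^esub>} \<and>
        v = finsum V c {d. c d \<noteq> \<zero>\<^bsub>V\<^esub>})"

definition in_degree_zero :: "('v, 'x) gspace_scheme \<Rightarrow> bool" where
  "in_degree_zero V \<longleftrightarrow> (\<forall>d. hcomp V d = (if d = 0 then carrier V else {\<zero>\<^bsub>V\<^esub>}))"

text \<open>One map is an isomorphism of graded vector spaces and commutes with the operators in \<open>G\<close>.\<close>

definition gmod_iso :: "'g set \<Rightarrow> ('g, 'v) gmod \<Rightarrow> ('g, 'w) gmod \<Rightarrow> bool" where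
  "gmod_iso G V W \<longleftrightarrow>
     (\<exists>f \<in> LinearCombinations.module_hom class_ring V W.
        bij_betw f (carrier V) (carrier W) \<and>
        (\<forall>x\<in>G. \<forall>v\<in>carrier V. f (act V x v) = act W x (f v)) \<and>
        (\<forall>d. f ` hcomp V d = hcomp W d))"

definition quot :: "('g, 'v) gmod \<Rightarrow> 'v set \<Rightarrow> ('g, 'v set) gmod" where
  "quot V U =
     \<lparr>carrier = a_rcosets\<^bsub>V\<^esub> U, mult = undefined, one = undefined,
      zero = U, add = (\<lambda>A B. A <+>\<^bsub>V\<^esub> B),
      smult = (\<lambda>c A. \<Union>a\<in>A. U +>\<^bsub>V\<^esub> (c \<odot>\<^bsub>V\<^esub> a)),
      hcomp = (\<lambda>d. (\<lambda>v. U +>\<^bsub>V\<^esub> v) ` hcomp V d),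
      act = (\<lambda>x A. \<Union>a\<in>A. U +>\<^bsub>V\<^esub> (act V x a))\<rparr>"

text \<open>
  Tensor product, as the free vector space on \<open>V \<times> W\<close> modulo the bilinearity relations, with
  \<open>x (v \<otimes> w) = (x v) \<otimes> w\<close>.  The sets \<open>hcomp (free_prod V W) d\<close> are of interest only through
  their images in the quotient, where they become the total grading
  \<open>(V \<otimes> W)\<^sub>d = (\<Sum>i. V\<^sub>i \<otimes> W\<^sub>d\<^sub>-\<^sub>i)\<close>.
\<close>

definition free_prod ::
    "('g, 'v) gmod \<Rightarrow> 'w gspace \<Rightarrow> ('g, ('v \<times> 'w) \<Rightarrow>\<^sub>0 complex) gmod" where
  "free_prod V W =
     \<lparr>carrier = {p. Poly_Mapping.keys p \<subseteq> carrier V \<times> carrier W}, mult = undefined, one = undefined,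
      zero = 0, add = (+),
      smult = (\<lambda>c. Poly_Mapping.map ((*) c)),
      hcomp = (\<lambda>d. {p. Poly_Mapping.keys p \<subseteq> (\<Union>i. hcomp V i \<times> hcomp W (d - i))}),
      act = (\<lambda>x p. \<Sum>k\<in>Poly_Mapping.keys p. Poly_Mapping.single (act V x (fst k), snd k) (Poly_Mapping.lookup p k))\<rparr>"

definition tensor_rels ::
    "('g, 'v) gmod \<Rightarrow> 'w gspace \<Rightarrow> (('v \<times> 'w) \<Rightarrow>\<^sub>0 complex) set" where
  "tensor_rels V W =
     {Poly_Mapping.single (v \<oplus>\<^bsub>V\<^esub> v', w) 1 - Poly_Mapping.single (v, w) 1
        - Poly_Mapping.single (v', w) 1 | v v' w.
        v \<in> carrier V \<and> v' \<in> carrier V \<and> w \<in> carrier W} \<union>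
     {Poly_Mapping.single (v, w \<oplus>\<^bsub>W\<^esub> w') 1 - Poly_Mapping.single (v, w) 1
        - Poly_Mapping.single (v, w') 1 | v w w'.
        v \<in> carrier V \<and> w \<in> carrier W \<and> w' \<in> carrier W} \<union>
     {Poly_Mapping.single (c \<odot>\<^bsub>V\<^esub> v, w) 1 - Poly_Mapping.single (v, w) c | c v w.
        v \<in> carrier V \<and> w \<in> carrier W} \<union>
     {Poly_Mapping.single (v, c \<odot>\<^bsub>W\<^esub> w) 1 - Poly_Mapping.single (v, w) c | c v w.
        v \<in> carrier V \<and> w \<in> carrier W}"

definition tensor ::
    "('g, 'v) gmod \<Rightarrow> 'w gspace \<Rightarrow> ('g, (('v \<times> 'w) \<Rightarrow>\<^sub>0 complex) set) gmod" where
  "tensor V W =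
     quot (free_prod V W)
       (LinearCombinations.module.span class_ring (free_prod V W) (tensor_rels V W))"

text \<open>Direct sum over a finite index set.\<close>

definition dsum :: "'i set \<Rightarrow> ('i \<Rightarrow> ('g, 'v) gmod) \<Rightarrow> ('g, 'i \<Rightarrow> 'v) gmod" where
  "dsum I V =
     \<lparr>carrier = (\<Pi>\<^sub>E i\<in>I. carrier (V i)), mult = undefined, one = undefined,
      zero = (\<lambda>i\<in>I. \<zero>\<^bsub>V i\<^esub>), add = (\<lambda>x y. \<lambda>i\<in>I. x i \<oplus>\<^bsub>V i\<^esub> y i),
      smult = (\<lambda>c x. \<lambda>i\<in>I. c \<odot>\<^bsub>V i\<^esub> x i),
      hcomp = (\<lambda>d. \<Pi>\<^sub>E i\<in>I. hcomp (V i) d),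
      act = (\<lambda>g x. \<lambda>i\<in>I. act (V i) g (x i))\<rparr>"


section \<open>Partitions and Specht modules\<close>

definition partitions :: "nat \<Rightarrow> nat list set" where
  "partitions N = {\<mu>. sorted_wrt (\<ge>) \<mu> \<and> 0 \<notin> set \<mu> \<and> sum_list \<mu> = N}"

text \<open>\<open>part \<mu> i\<close> is the part \<open>\<mu>\<^sub>i\<close>, numbered from 1 and extended by 0.\<close>

definition part :: "nat list \<Rightarrow> nat \<Rightarrow> nat" where
  "part \<mu> i = (if 1 \<le> i \<and> i \<le> length \<mu> then \<mu> ! (i - 1) else 0)"

definition conjugate_partition :: "nat list \<Rightarrow> nat list" where
  "conjugate_partition \<mu> = map (\<lambda>j. card {i. i < length \<mu> \<and> j < \<mu> ! i}) [0..<part \<mu> 1]"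

text \<open>
  \<open>S\<^sub>N\<close> is realised on \<open>{..<N}\<close>.  A tableau is given by the position (row, column) of each entry,
  a tabloid by the row of each entry.
\<close>

definition sym_group :: "nat \<Rightarrow> (nat \<Rightarrow> nat) set" where
  "sym_group N = {\<sigma>. \<sigma> permutes {..<N}}"

definition tableaux :: "nat \<Rightarrow> nat list \<Rightarrow> (nat \<Rightarrow> nat \<times> nat) set" where
  "tableaux N lam =
     {t \<in> extensional {..<N}. bij_betw t {..<N} {(r, c). r < length lam \<and> c < lam ! r}}"

definition tabloids :: "nat \<Rightarrow> nat list \<Rightarrow> (nat \<Rightarrow> nat) set" where
  "tabloids N lam =
     {T \<in> {..<N} \<rightarrow>\<^sub>E {..<length lam}. \<forall>r<length lam. card {i. i < N \<and> T i = r} = lam ! r}"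

text \<open>
  Functions on tabloids, with \<open>\<sigma>\<close> sending the indicator of \<open>T\<close> to that of \<open>T \<circ> \<sigma>\<^sup>-\<^sup>1\<close>, the tabloid
  in which \<open>\<sigma> i\<close> has the row that \<open>i\<close> has in \<open>T\<close>.
\<close>

definition tabloid_module :: "nat \<Rightarrow> nat list \<Rightarrow> (nat \<Rightarrow> nat, (nat \<Rightarrow> nat) \<Rightarrow> complex) gmod" where
  "tabloid_module N lam =
     (let C = {f. \<forall>T. T \<notin> tabloids N lam \<longrightarrow> f T = 0} in
     \<lparr>carrier = C, mult = undefined, one = undefined,
      zero = (\<lambda>T. 0), add = (\<lambda>f g T. f T + g T),
      smult = (\<lambda>c f T. c * f T),
      hcomp = (\<lambda>d. if d = 0 then C else {\<lambda>T. 0}),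
      act = (\<lambda>\<sigma> f T. f (T \<circ> \<sigma>))\<rparr>)"

text \<open>
  The polytabloid of \<open>t\<close> is the signed sum of the tabloids of \<open>\<sigma> t\<close> over the column stabiliser
  of \<open>t\<close>; the tabloid of \<open>\<sigma> t\<close> is \<open>T\<close> iff \<open>T \<circ> \<sigma>\<close> is the tabloid of \<open>t\<close>.
\<close>

definition polytabloid :: "nat \<Rightarrow> (nat \<Rightarrow> nat \<times> nat) \<Rightarrow> (nat \<Rightarrow> nat) \<Rightarrow> complex" where
  "polytabloid N t T =
     (\<Sum>\<sigma> | \<sigma> \<in> sym_group N \<and> (\<forall>i<N. snd (t (\<sigma> i)) = snd (t i)).
        if T \<circ> \<sigma> = restrict (fst \<circ> t) {..<N} then of_int (sign \<sigma>) else 0)"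

definition specht :: "nat \<Rightarrow> nat list \<Rightarrow> (nat \<Rightarrow> nat, (nat \<Rightarrow> nat) \<Rightarrow> complex) gmod" where
  "specht N lam =
     (let S = LinearCombinations.module.span class_ring (tabloid_module N lam)
                (polytabloid N ` tableaux N lam)
      in (tabloid_module N lam)
           \<lparr>carrier := S, hcomp := (\<lambda>d. if d = 0 then S else {\<zero>\<^bsub>tabloid_module N lam\<^esub>})\<rparr>)"


section \<open>Polynomials in the inverse variables and the multiplicity spaces\<close>

text \<open>
  Polynomials are functions of exponents with finite support.  The \<open>i\<close>-th indeterminate \<open>zinv i\<close>
  stands for \<open>z\<^sub>i\<^sup>-\<^sup>1\<close>, so a monomial of total exponent \<open>k\<close> has degree \<open>-k\<close>.
\<close>

type_synonym zpoly = "(nat \<Rightarrow>\<^sub>0 nat) \<Rightarrow>\<^sub>0 complex"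

definition zinv :: "nat \<Rightarrow> zpoly" where
  "zinv i = Poly_Mapping.single (Poly_Mapping.single i 1) 1"

definition zpolys :: "nat \<Rightarrow> zpoly set" where
  "zpolys N = {p. \<forall>m\<in>Poly_Mapping.keys p. Poly_Mapping.keys m \<subseteq> {..<N}}"

definition homogeneous :: "int \<Rightarrow> zpoly \<Rightarrow> bool" where
  "homogeneous d p \<longleftrightarrow> (\<forall>m\<in>Poly_Mapping.keys p. - int (\<Sum>i\<in>Poly_Mapping.keys m. Poly_Mapping.lookup m i) = d)"

text \<open>For bijective \<open>\<sigma>\<close> this is the algebra automorphism sending \<open>zinv i\<close> to \<open>zinv (\<sigma> i)\<close>.\<close>

definition perm_vars :: "(nat \<Rightarrow> nat) \<Rightarrow> zpoly \<Rightarrow> zpoly" where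
  "perm_vars \<sigma> p = Poly_Mapping.map_key (Poly_Mapping.map_key \<sigma>) p"

definition zpoly_ring :: "nat \<Rightarrow> (nat \<Rightarrow> nat, zpoly) gmod" where
  "zpoly_ring N =
     \<lparr>carrier = zpolys N, mult = (*), one = 1, zero = 0, add = (+),
      smult = (\<lambda>c. Poly_Mapping.map ((*) c)),
      hcomp = (\<lambda>d. {p \<in> zpolys N. homogeneous d p}),
      act = perm_vars\<rparr>"

definition elem_sym :: "nat \<Rightarrow> nat \<Rightarrow> zpoly" where
  "elem_sym N k = (\<Sum>S | S \<subseteq> {..<N} \<and> card S = k. \<Prod>i\<in>S. zinv i)"

definition J_ideal :: "nat \<Rightarrow> zpoly set" where
  "J_ideal N = Idl\<^bsub>zpoly_ring N\<^esub> (elem_sym N ` {1..N})"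

definition R_quot :: "nat \<Rightarrow> (nat \<Rightarrow> nat, zpoly set) gmod" where
  "R_quot N = quot (zpoly_ring N) (J_ideal N)"

text \<open>
  The multiplicity spaces are the graded vector spaces through which the graded \<open>S\<^sub>N\<close>-module
  \<open>R\<^sub>N\<close> decomposes into Specht modules; this determines them up to isomorphism.
\<close>

definition multiplicity_spaces :: "nat \<Rightarrow> (nat list \<Rightarrow> 'm gspace) \<Rightarrow> bool" where
  "multiplicity_spaces N M \<longleftrightarrow>
     (\<forall>lam\<in>partitions N. graded_space (M lam)) \<and>
     gmod_iso (sym_group N) (R_quot N) (dsum (partitions N) (\<lambda>lam. tensor (specht N lam) (M lam)))"


section \<open>Irreducible highest weight modules of \<open>sl\<^sub>n\<close>\<close>

text \<open>Rows and columns of matrices are numbered from 0.\<close>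

definition sl :: "nat \<Rightarrow> complex mat set" where
  "sl n = {X \<in> carrier_mat n n. (\<Sum>i<n. X $$ (i, i)) = 0}"

definition sl_module :: "nat \<Rightarrow> (complex mat, 'v) gmod \<Rightarrow> bool" where
  "sl_module n V \<longleftrightarrow>
     vectorspace class_ring V \<and>
     (\<forall>X\<in>sl n. act V X \<in> LinearCombinations.module_hom class_ring V V) \<and>
     (\<forall>X\<in>sl n. \<forall>Y\<in>sl n. \<forall>v\<in>carrier V. act V (X + Y) v = act V X v \<oplus>\<^bsub>V\<^esub> act V Y v) \<and>
     (\<forall>c. \<forall>X\<in>sl n. \<forall>v\<in>carrier V. act V (c \<cdot>\<^sub>m X) v = c \<odot>\<^bsub>V\<^esub> act V X v) \<and>
     (\<forall>X\<in>sl n. \<forall>Y\<in>sl n. \<forall>v\<in>carrier V.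
        act V (X * Y - Y * X) v = act V X (act V Y v) \<ominus>\<^bsub>V\<^esub> act V Y (act V X v))"

definition sl_irreducible :: "nat \<Rightarrow> (complex mat, 'v) gmod \<Rightarrow> bool" where
  "sl_irreducible n V \<longleftrightarrow>
     sl_module n V \<and> carrier V \<noteq> {\<zero>\<^bsub>V\<^esub>} \<and>
     (\<forall>U. subspace class_ring U V \<and> (\<forall>X\<in>sl n. \<forall>u\<in>U. act V X u \<in> U)
        \<longrightarrow> U = {\<zero>\<^bsub>V\<^esub>} \<or> U = carrier V)"

text \<open>Weights are evaluated on traceless diagonal matrices.\<close>

definition fund_weight :: "nat \<Rightarrow> complex mat \<Rightarrow> complex" where
  "fund_weight i H = (\<Sum>k<i. H $$ (k, k))"

definition partition_weight :: "nat \<Rightarrow> nat list \<Rightarrow> complex mat \<Rightarrow> complex" where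
  "partition_weight n \<mu> H =
     (\<Sum>i = 1..n - 1. (of_nat (part \<mu> i) - of_nat (part \<mu> (i + 1))) * fund_weight i H)"

definition has_highest_weight ::
    "nat \<Rightarrow> (complex mat, 'v) gmod \<Rightarrow> (complex mat \<Rightarrow> complex) \<Rightarrow> bool" where
  "has_highest_weight n V wt \<longleftrightarrow>
     (\<exists>v\<in>carrier V. v \<noteq> \<zero>\<^bsub>V\<^esub> \<and>
        (\<forall>X\<in>sl n. (\<forall>i<n. \<forall>j\<le>i. X $$ (i, j) = 0) \<longrightarrow> act V X v = \<zero>\<^bsub>V\<^esub>) \<and>
        (\<forall>H\<in>sl n. diagonal_mat H \<longrightarrow> act V H v = wt H \<odot>\<^bsub>V\<^esub> v))"

text \<open>\<open>V\<close> is a model of \<open>\<pi>\<^sub>\<mu>\<close>; such a \<open>V\<close> is unique up to isomorphism.\<close>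

definition is_pi :: "nat \<Rightarrow> nat list \<Rightarrow> (complex mat, 'v) gmod \<Rightarrow> bool" where
  "is_pi n \<mu> V \<longleftrightarrow>
     sl_irreducible n V \<and> has_highest_weight n V (partition_weight n \<mu>) \<and> in_degree_zero V"


section \<open>The reduced wedge product\<close>

text \<open>
  An element of \<open>\<pi>\<^bsup>\<otimes>N\<^esup> \<otimes> \<complex>[z\<^sub>1\<^sup>-\<^sup>1, \<dots>, z\<^sub>N\<^sup>-\<^sup>1]\<close> is given by its polynomial coefficients with respect
  to the basis \<open>e\<^bsub>w 0\<^esub> \<otimes> \<dots> \<otimes> e\<^bsub>w (N-1)\<^esub>\<close>, where \<open>w\<close> ranges over the words of length \<open>N\<close> in the
  letters \<open>0, \<dots>, n - 1\<close>.
\<close>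

definition words :: "nat \<Rightarrow> nat \<Rightarrow> (nat \<Rightarrow> nat) set" where
  "words n N = {..<N} \<rightarrow>\<^sub>E {..<n}"

definition tensor_polys :: "nat \<Rightarrow> nat \<Rightarrow> ((nat \<Rightarrow> nat) \<Rightarrow> zpoly) set" where
  "tensor_polys n N =
     {F. (\<forall>w\<in>words n N. F w \<in> zpolys N) \<and> (\<forall>w. w \<notin> words n N \<longrightarrow> F w = 0)}"

text \<open>\<open>\<sigma>\<close> moves the tensor factor at position \<open>i\<close> to position \<open>\<sigma> i\<close>, and \<open>z\<^sub>i\<close> to \<open>z\<^bsub>\<sigma> i\<^esub>\<close>.\<close>

definition diag_perm :: "(nat \<Rightarrow> nat) \<Rightarrow> ((nat \<Rightarrow> nat) \<Rightarrow> zpoly) \<Rightarrow> (nat \<Rightarrow> nat) \<Rightarrow> zpoly" where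
  "diag_perm \<sigma> F = (\<lambda>w. perm_vars \<sigma> (F (w \<circ> \<sigma>)))"

text \<open>\<open>current_act n N X a\<close> is the action \<open>\<Sum>k. X\<^bsup>(k)\<^esup> z\<^sub>k\<^sup>-\<^sup>a\<close> of \<open>X \<otimes> t\<^sup>-\<^sup>a\<close> in \<open>gl\<^sub>n \<otimes> \<complex>[t\<^sup>-\<^sup>1]\<close>.\<close>

definition current_act ::
    "nat \<Rightarrow> nat \<Rightarrow> complex mat \<Rightarrow> nat \<Rightarrow> ((nat \<Rightarrow> nat) \<Rightarrow> zpoly) \<Rightarrow> (nat \<Rightarrow> nat) \<Rightarrow> zpoly" where
  "current_act n N X a F =
     (\<lambda>w. if w \<in> words n N
          then \<Sum>k<N. \<Sum>j<n.
                 Poly_Mapping.map ((*) (X $$ (w k, j))) (zinv k ^ a * F (w(k := j)))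
          else 0)"

definition wedge :: "nat \<Rightarrow> nat \<Rightarrow> (complex mat, (nat \<Rightarrow> nat) \<Rightarrow> zpoly) gmod" where
  "wedge n N =
     (let C = {F \<in> tensor_polys n N. \<forall>\<sigma>\<in>sym_group N. diag_perm \<sigma> F = (\<lambda>w. of_int (sign \<sigma>) * F w)} in
     \<lparr>carrier = C, mult = undefined, one = undefined,
      zero = (\<lambda>w. 0), add = (\<lambda>F G w. F w + G w),
      smult = (\<lambda>c F w. Poly_Mapping.map ((*) c) (F w)),
      hcomp = (\<lambda>d. {F \<in> C. \<forall>w. homogeneous d (F w)}),
      act = (\<lambda>X. current_act n N X 0)\<rparr>)"

definition B_op :: "nat \<Rightarrow> nat \<Rightarrow> nat \<Rightarrow> ((nat \<Rightarrow> nat) \<Rightarrow> zpoly) \<Rightarrow> (nat \<Rightarrow> nat) \<Rightarrow> zpoly" where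
  "B_op n N a = current_act n N (1\<^sub>m n) a"

definition Im_H :: "nat \<Rightarrow> nat \<Rightarrow> ((nat \<Rightarrow> nat) \<Rightarrow> zpoly) set" where
  "Im_H n N =
     LinearCombinations.module.span class_ring (wedge n N)
       (\<Union>a\<in>{0<..}. B_op n N a ` carrier (wedge n N))"

definition reduced_wedge ::
    "nat \<Rightarrow> nat \<Rightarrow> (complex mat, ((nat \<Rightarrow> nat) \<Rightarrow> zpoly) set) gmod" where
  "reduced_wedge n N = quot (wedge n N) (Im_H n N)"

end

theory Submission
  imports Defs "HOL-Computational_Algebra.Formal_Power_Series"
begin

hide_const (open) Multiset.mult Modules.module Real_Vector_Spaces.subspace Polynomial.smult
hide_fact (open) Real_Vector_Spaces.subspace_def

text \<open>
  Newton's identities and averaging over \<open>S\<^sub>N\<close> show that the image of \<open>H\<^sub>-\<close> consists of the antisymmetric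
  elements all of whose coefficients lie in \<open>J\<^sub>N\<close>, so the reduced wedge product is the antisymmetric
  part of \<open>\<pi>\<^bsup>\<otimes>N\<^esup> \<otimes> R\<^sub>N\<close>.  Decomposing \<open>R\<^sub>N\<close> along homogeneous bases of the multiplicity spaces, the
  coefficient of a basis vector of \<open>M\<^sub>\<lambda>\<close> is an antisymmetric element of \<open>\<pi>\<^bsup>\<otimes>N\<^esup> \<otimes> W\<^sub>\<lambda>\<close>.  These elements
  form an \<open>sl\<^sub>n\<close>-module, which vanishes if \<open>\<lambda>\<close> has a row longer than \<open>n\<close>.  Otherwise it is generated by
  the antisymmetrisation of \<open>e\<^sub>c \<otimes> p\<close>, where \<open>p\<close> is the polytabloid of a tableau and \<open>c\<close> the word of its
  column indices.  This is a highest weight vector, of weight \<open>\<lambda>'\<close>, and since the module also carries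
  an invariant positive definite Hermitian form, it is irreducible, hence isomorphic to \<open>\<pi>\<^bsub>\<lambda>'\<^esub>\<close>.
\<close>

section \<open>Graded modules, quotients and direct sums\<close>

text \<open>The multiplicity spaces are known only through an isomorphism with
  \<open>R_quot N\<close>, and the tensor products on both sides are quotients of free vector
  spaces. A homogeneous basis of each \<open>M lam\<close> turns either tensor product into finitely
  supported families of vectors indexed by that basis (\<open>fin_fun\<close>). As the same basis
  serves the Specht side and the \<open>sl n\<close> side, the grading is carried by the index
  alone.

  The conjugate partition comes from the sign in the definition of the wedge product. A polytabloid
  changes by the sign under its column stabiliser, so the antisymmetrisation of a word tensored with
  it is unchanged when letters are permuted within columns, whereas coefficients with a repeated
  letter in a row of the tabloid vanish. Hence the highest weight is reached by writing the letter c
  throughout column c, and the multiplicity of that letter is the length of the column, a part of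
  the conjugate partition.\<close>

lemma module_class_ringI:
  fixes V (structure)
  assumes "abelian_group V"
    and "\<And>c v. v \<in> carrier V \<Longrightarrow> c \<odot> v \<in> carrier V"
    and "\<And>c d v. v \<in> carrier V \<Longrightarrow> (c + d) \<odot> v = c \<odot> v \<oplus> d \<odot> v"
    and "\<And>c v w. v \<in> carrier V \<Longrightarrow> w \<in> carrier V \<Longrightarrow> c \<odot> (v \<oplus> w) = c \<odot> v \<oplus> c \<odot> w"
    and "\<And>c d v. v \<in> carrier V \<Longrightarrow> (c * d) \<odot> v = c \<odot> (d \<odot> v)"
    and "\<And>v. v \<in> carrier V \<Longrightarrow> (1::complex) \<odot> v = v"
  shows "module class_ring V"
proof -
  have "cring (class_ring :: complex ring)"
    using class_field[where 'a = complex] by (simp add: field_def domain_def)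
  then show ?thesis
    by (rule moduleI) (use assms in auto)
qed

lemma vectorspace_class_ring_iff: "vectorspace (class_ring :: complex ring) V \<longleftrightarrow> module class_ring V"
  using class_field by (auto simp: vectorspace_def)

lemma subspace_class_ring_iff:
  fixes V (structure)
  assumes "module (class_ring :: complex ring) V"
  shows "subspace class_ring U V \<longleftrightarrow> U \<subseteq> carrier V \<and> \<zero> \<in> U \<and> (\<forall>u\<in>U. \<forall>v\<in>U. u \<oplus> v \<in> U) \<and>
    (\<forall>c. \<forall>u\<in>U. c \<odot> u \<in> U)"
  using assms by (auto simp: subspace_def VectorSpace.subspace_def submodule_def vectorspace_class_ring_iff)

locale cmodule =
  fixes V :: "(complex, 'v, 'x) module_scheme" (structure)
  assumes is_module: "module class_ring V"
begin

sublocale Module.module class_ring V by (rule is_module)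

lemma cl [simp]: "x \<in> carrier V \<Longrightarrow> c \<odot> x \<in> carrier V"
  by (rule smult_closed) auto

lemma smult_distribs:
  "x \<in> carrier V \<Longrightarrow> (c + d) \<odot> x = c \<odot> x \<oplus> d \<odot> x"
  "x \<in> carrier V \<Longrightarrow> y \<in> carrier V \<Longrightarrow> c \<odot> (x \<oplus> y) = c \<odot> x \<oplus> c \<odot> y"
  "x \<in> carrier V \<Longrightarrow> c \<odot> (d \<odot> x) = (c * d) \<odot> x"
  "x \<in> carrier V \<Longrightarrow> 1 \<odot> x = x"
  "x \<in> carrier V \<Longrightarrow> 0 \<odot> x = \<zero>"
  "c \<odot> \<zero> = \<zero>"
  using smult_l_distr[of c d x] smult_r_distr[of c x y] smult_assoc1[of c d x] smult_one[of x]
    smult_l_null[of x] smult_r_null[of c]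
  by simp_all

lemma ab:
  "x \<in> carrier V \<Longrightarrow> y \<in> carrier V \<Longrightarrow> x \<oplus> y \<in> carrier V"
  "\<zero> \<in> carrier V"
  "x \<in> carrier V \<Longrightarrow> y \<in> carrier V \<Longrightarrow> z \<in> carrier V \<Longrightarrow> x \<oplus> y \<oplus> z = x \<oplus> (y \<oplus> z)"
  "x \<in> carrier V \<Longrightarrow> y \<in> carrier V \<Longrightarrow> x \<oplus> y = y \<oplus> x"
  "x \<in> carrier V \<Longrightarrow> \<zero> \<oplus> x = x"
  "x \<in> carrier V \<Longrightarrow> \<ominus> x \<in> carrier V"
  "x \<in> carrier V \<Longrightarrow> \<ominus> x \<oplus> x = \<zero>"
  by ((rule M.a_comm; assumption) | simp add: M.a_assoc M.l_neg)+

lemma minus_eq_smult: "x \<in> carrier V \<Longrightarrow> \<ominus> x = (-1) \<odot> x"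
proof -
  assume x: "x \<in> carrier V"
  have "(-1) \<odot> x \<oplus> x = ((-1) + 1) \<odot> x"
    using x by (simp only: smult_distribs)
  then show ?thesis using x by (simp add: smult_distribs M.minus_equality)
qed

lemma diff_zero_iff: "x \<in> carrier V \<Longrightarrow> y \<in> carrier V \<Longrightarrow> x \<ominus> y = \<zero> \<longleftrightarrow> x = y"
  by simp

end

section \<open>Linear maps and graded equivariant surjections\<close>

locale clinear = V: cmodule V + W: cmodule W for V :: "(complex, 'v, 'x) module_scheme"
  and W :: "(complex, 'w, 'y) module_scheme" and f +
  assumes hom: "f \<in> LinearCombinations.module_hom class_ring V W"
begin

lemma cl: "v \<in> carrier V \<Longrightarrow> f v \<in> carrier W"
  using hom by (auto simp: LinearCombinations.module_hom_def)

lemma add: "v \<in> carrier V \<Longrightarrow> w \<in> carrier V \<Longrightarrow> f (v \<oplus>\<^bsub>V\<^esub> w) = f v \<oplus>\<^bsub>W\<^esub> f w"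
  using hom by (auto simp: LinearCombinations.module_hom_def)

lemma smult: "v \<in> carrier V \<Longrightarrow> f (c \<odot>\<^bsub>V\<^esub> v) = c \<odot>\<^bsub>W\<^esub> f v"
  using hom by (auto simp: LinearCombinations.module_hom_def)

lemma zero: "f \<zero>\<^bsub>V\<^esub> = \<zero>\<^bsub>W\<^esub>"
  using smult[of "\<zero>\<^bsub>V\<^esub>" 0] by (simp add: V.smult_distribs W.smult_distribs cl)

lemma minus: "v \<in> carrier V \<Longrightarrow> f (\<ominus>\<^bsub>V\<^esub> v) = \<ominus>\<^bsub>W\<^esub> f v"
  by (simp add: V.minus_eq_smult W.minus_eq_smult cl smult)

lemma diff: "v \<in> carrier V \<Longrightarrow> w \<in> carrier V \<Longrightarrow> f (v \<ominus>\<^bsub>V\<^esub> w) = f v \<ominus>\<^bsub>W\<^esub> f w"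
  by (simp add: a_minus_def add minus)

lemma finsum: "finite A \<Longrightarrow> g \<in> A \<rightarrow> carrier V \<Longrightarrow> f (finsum V g A) = finsum W (\<lambda>a. f (g a)) A"
  by (induction A rule: finite_induct) (auto simp: zero add cl V.finsum_insert W.finsum_insert Pi_iff)

end

text \<open>Closure of \<open>V\<close> under the operators and containment of its components in the
  carrier are included because a \<open>gmod\<close> record guarantees neither. That each component
  is mapped onto its counterpart is a separate demand, since neither side is assumed to be the sum
  of its components.\<close>

definition graded_epi :: "'g set \<Rightarrow> ('g, 'v) gmod \<Rightarrow> ('g, 'w) gmod \<Rightarrow> ('v \<Rightarrow> 'w) \<Rightarrow> bool" where
  "graded_epi G V W f \<longleftrightarrow> f \<in> LinearCombinations.module_hom class_ring V W \<and>
     f ` carrier V = carrier W \<and>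
     (\<forall>x\<in>G. \<forall>v\<in>carrier V. act V x v \<in> carrier V \<and> f (act V x v) = act W x (f v)) \<and>
     (\<forall>d. hcomp V d \<subseteq> carrier V \<and> f ` hcomp V d = hcomp W d)"

lemma graded_epiI:
  assumes "\<And>v. v \<in> carrier V \<Longrightarrow> f v \<in> carrier W"
    "\<And>v w. v \<in> carrier V \<Longrightarrow> w \<in> carrier V \<Longrightarrow> f (v \<oplus>\<^bsub>V\<^esub> w) = f v \<oplus>\<^bsub>W\<^esub> f w"
    "\<And>c v. v \<in> carrier V \<Longrightarrow> f (c \<odot>\<^bsub>V\<^esub> v) = c \<odot>\<^bsub>W\<^esub> f v"
    "\<And>w. w \<in> carrier W \<Longrightarrow> \<exists>v\<in>carrier V. f v = w"
    "\<And>x v. x \<in> G \<Longrightarrow> v \<in> carrier V \<Longrightarrow> act V x v \<in> carrier V"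
    "\<And>x v. x \<in> G \<Longrightarrow> v \<in> carrier V \<Longrightarrow> f (act V x v) = act W x (f v)"
    "\<And>d v. v \<in> hcomp V d \<Longrightarrow> v \<in> carrier V \<and> f v \<in> hcomp W d"
    "\<And>d w. w \<in> hcomp W d \<Longrightarrow> \<exists>v\<in>hcomp V d. f v = w"
  shows "graded_epi G V W f"
proof -
  have "f \<in> LinearCombinations.module_hom class_ring V W"
    unfolding LinearCombinations.module_hom_def using assms(1-3) by auto
  moreover have "f ` carrier V = carrier W"
    using assms(1,4) by (auto simp: image_def)
  moreover have "hcomp V d \<subseteq> carrier V \<and> f ` hcomp V d = hcomp W d" for d
    using assms(7,8)[of _ d] by (auto simp: image_def)
  ultimately show ?thesis
    unfolding graded_epi_def using assms(5,6) by simp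
qed

lemma graded_epiD:
  assumes "graded_epi G V W f"
  shows "f \<in> LinearCombinations.module_hom class_ring V W"
    "v \<in> carrier V \<Longrightarrow> f v \<in> carrier W"
    "w \<in> carrier W \<Longrightarrow> \<exists>v\<in>carrier V. f v = w"
    "x \<in> G \<Longrightarrow> v \<in> carrier V \<Longrightarrow> act V x v \<in> carrier V"
    "x \<in> G \<Longrightarrow> v \<in> carrier V \<Longrightarrow> f (act V x v) = act W x (f v)"
    "hcomp V d \<subseteq> carrier V"
    "v \<in> hcomp V d \<Longrightarrow> f v \<in> hcomp W d"
    "w \<in> hcomp W d \<Longrightarrow> \<exists>v\<in>hcomp V d. f v = w"
proof -
  show "f \<in> LinearCombinations.module_hom class_ring V W" using assms by (simp add: graded_epi_def)
  show "v \<in> carrier V \<Longrightarrow> f v \<in> carrier W" using assms by (auto simp: graded_epi_def)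
  show "x \<in> G \<Longrightarrow> v \<in> carrier V \<Longrightarrow> act V x v \<in> carrier V"
    "x \<in> G \<Longrightarrow> v \<in> carrier V \<Longrightarrow> f (act V x v) = act W x (f v)"
    using assms by (simp_all add: graded_epi_def)
  have im: "hcomp W d = f ` hcomp V d" "carrier W = f ` carrier V"
    using assms by (simp_all add: graded_epi_def)
  show "hcomp V d \<subseteq> carrier V"
    using assms by (simp add: graded_epi_def)
  show "v \<in> hcomp V d \<Longrightarrow> f v \<in> hcomp W d" "w \<in> hcomp W d \<Longrightarrow> \<exists>v\<in>hcomp V d. f v = w"
    "w \<in> carrier W \<Longrightarrow> \<exists>v\<in>carrier V. f v = w"
    by (auto simp: im)
qed

lemma graded_epi_clinear:
  assumes "graded_epi G V W f" "module class_ring V" "module class_ring W"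
  shows "clinear V W f"
  using assms by (auto simp: clinear_def clinear_axioms_def cmodule_def graded_epi_def)

lemma gmod_iso_of_graded_epi:
  assumes "graded_epi G V W f" "inj_on f (carrier V)"
  shows "gmod_iso G V W"
  unfolding gmod_iso_def by (rule bexI[of _ f]) (use assms in \<open>simp_all add: graded_epi_def bij_betw_def\<close>)

lemma graded_epi_comp:
  assumes f: "graded_epi G U V f" and g: "graded_epi G V W g"
  shows "graded_epi G U W (g \<circ> f)"
proof -
  have 1: "(\<lambda>x. g (f x)) ` carrier U = carrier W" "(\<lambda>x. g (f x)) ` hcomp U d = hcomp W d" for d
    using f g by (simp_all add: graded_epi_def image_image [symmetric])
  have 2: "g \<circ> f \<in> LinearCombinations.module_hom class_ring U W"
    using f g by (auto simp: graded_epi_def LinearCombinations.module_hom_def Pi_iff)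
  have 3: "f v \<in> carrier V" if "v \<in> carrier U" for v
    using graded_epiD(2)[OF f that] .
  show ?thesis
    unfolding graded_epi_def using 1 2 3 f g by (simp add: graded_epi_def)
qed

text \<open>Formulated with closure under the operations in place of the module axioms, so that it
  applies to \<open>tensor\<close>, for which \<open>tensor_closed\<close> supplies just
  that.\<close>

lemma graded_epi_inverse:
  assumes "graded_epi G V W f" "inj_on f (carrier V)" 
    "\<And>v w. v \<in> carrier V \<Longrightarrow> w \<in> carrier V \<Longrightarrow> v \<oplus>\<^bsub>V\<^esub> w \<in> carrier V"
    "\<And>c v. v \<in> carrier V \<Longrightarrow> c \<odot>\<^bsub>V\<^esub> v \<in> carrier V"
  shows "graded_epi G W V (inv_into (carrier V) f)" "inj_on (inv_into (carrier V) f) (carrier W)"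
proof -
  let ?g = "inv_into (carrier V) f"
  note D = graded_epiD[OF assms(1)]
  have im: "f ` carrier V = carrier W" using assms by (simp add: graded_epi_def)
  have gf: "?g (f v) = v" if "v \<in> carrier V" for v using inv_into_f_f[OF assms(2)] that .
  have lift: "\<exists>v\<in>carrier V. w = f v" if "w \<in> carrier W" for w using D(3)[OF that] by blast
  have hom: "f v \<oplus>\<^bsub>W\<^esub> f w = f (v \<oplus>\<^bsub>V\<^esub> w)" "c \<odot>\<^bsub>W\<^esub> f v = f (c \<odot>\<^bsub>V\<^esub> v)"
    if "v \<in> carrier V" "w \<in> carrier V" for v w c
    using D(1) that by (auto simp: LinearCombinations.module_hom_def)
  show "inj_on ?g (carrier W)" by (rule inj_on_inv_into) (simp add: im)
  have act_eq: "act W x w \<in> carrier W \<and> ?g (act W x w) = act V x (?g w)"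
    if x: "x \<in> G" and w: "w \<in> carrier W" for x w
  proof -
    obtain v where v: "v \<in> carrier V" "w = f v" using lift[OF w] by (elim bexE)
    have e: "act W x w = f (act V x v)" "act V x v \<in> carrier V"
      using D(4,5)[OF x v(1)] v(2) by simp_all
    have "act W x w \<in> carrier W" using D(2)[OF e(2)] e(1) by simp
    moreover have "?g (act W x w) = act V x v" by (simp only: e(1) gf[OF e(2)])
    moreover have "?g w = v" by (simp only: v(2) gf[OF v(1)])
    ultimately show ?thesis by simp
  qed
  have a1: "?g w \<in> carrier V" if "w \<in> carrier W" for w using lift[OF that] by (auto simp: gf)
  have a2: "?g (v \<oplus>\<^bsub>W\<^esub> w) = ?g v \<oplus>\<^bsub>V\<^esub> ?g w" if "v \<in> carrier W" "w \<in> carrier W" for v w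
      using lift[OF that(1)] lift[OF that(2)] by (auto simp: gf hom assms(3,4))
  have a3: "?g (c \<odot>\<^bsub>W\<^esub> w) = c \<odot>\<^bsub>V\<^esub> ?g w" if "w \<in> carrier W" for c w
      using lift[OF that] by (auto simp: gf hom assms(3,4))
  have a4: "\<exists>w\<in>carrier W. ?g w = v" if "v \<in> carrier V" for v
      using D(2)[OF that] gf[OF that] by (intro bexI[where x="f v"])
  have a7: "w \<in> carrier W \<and> ?g w \<in> hcomp V d" if w: "w \<in> hcomp W d" for w d
    proof -
      obtain v where v: "v \<in> hcomp V d" "f v = w" using D(8)[OF w] by (elim bexE)
      have "v \<in> carrier V" by (rule subsetD[OF D(6) v(1)])
      then show ?thesis using v gf[of v] D(2)[of v] by auto
    qed
  have a8: "\<exists>w\<in>hcomp W d. ?g w = v" if v: "v \<in> hcomp V d" for v d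
    proof -
      have "v \<in> carrier V" by (rule subsetD[OF D(6) v])
      then show ?thesis using D(7)[OF v] gf[of v] by auto
    qed
  show "graded_epi G W V ?g"
    by (rule graded_epiI) (simp_all add: a1 a2 a3 a4 act_eq a7 a8)
qed

section \<open>Quotient modules and the first isomorphism theorem\<close>

locale cquot = cmodule V for V :: "('g, 'v) gmod" (structure) +
  fixes U
  assumes sub: "U \<subseteq> carrier V" "\<zero> \<in> U" "\<And>u v. u \<in> U \<Longrightarrow> v \<in> U \<Longrightarrow> u \<oplus> v \<in> U"
    "\<And>c u. u \<in> U \<Longrightarrow> c \<odot> u \<in> U"
begin

lemma subgroup: "abelian_subgroup U V"
proof (rule abelian_subgroupI3)
  show "additive_subgroup U V"
  proof (rule additive_subgroupI, unfold_locales)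
    show "inv\<^bsub>add_monoid V\<^esub> x \<in> U" if "x \<in> U" for x
      using sub(4)[OF that, of "-1"] that sub(1) minus_eq_smult[of x] by (auto simp: a_inv_def)
  qed (use sub in auto)
  show "abelian_group V" ..
qed

sublocale abelian_subgroup U V by (rule subgroup)

lemma coset_eq_iff:
  assumes ab: "a \<in> carrier V" "b \<in> carrier V"
  shows "U +> a = U +> b \<longleftrightarrow> a \<ominus> b \<in> U"
proof
  show "a \<ominus> b \<in> U" if "U +> a = U +> b"
    using a_rcos_self[OF ab(1)] that a_rcos_module[OF ab(2,1)] by (simp add: a_minus_def)
  show "U +> a = U +> b" if "a \<ominus> b \<in> U"
    using a_repr_independence'[OF _ ab(2)] that a_rcos_module[OF ab(2,1)] by (simp add: a_minus_def)
qed

lemma coset_cl: "v \<in> carrier V \<Longrightarrow> U +> v \<in> carrier (quot V U)"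
  by (auto simp: quot_def A_RCOSETS_def')

lemma coset_cases:
  assumes "A \<in> carrier (quot V U)" obtains v where "v \<in> carrier V" "A = U +> v"
  using assms by (auto simp: quot_def A_RCOSETS_def')

lemma coset_add: "v \<in> carrier V \<Longrightarrow> w \<in> carrier V \<Longrightarrow> (U +> v) \<oplus>\<^bsub>quot V U\<^esub> (U +> w) = U +> (v \<oplus> w)"
  by (simp add: quot_def a_rcos_sum)

text \<open>The operations of \<open>quot\<close> are unions of cosets over all representatives.
  Such a union collapses to a single coset once the operation respects congruence modulo
  \<open>U\<close>.\<close>

lemma UN_coset:
  assumes v: "v \<in> carrier V" and "\<And>a. a \<in> carrier V \<Longrightarrow> h a \<in> carrier V"
    "\<And>a. a \<in> carrier V \<Longrightarrow> a \<ominus> v \<in> U \<Longrightarrow> h a \<ominus> h v \<in> U"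
  shows "(\<Union>a\<in>U +> v. U +> (h a)) = U +> (h v)"
proof -
  have "U +> (h a) = U +> (h v)" if "a \<in> U +> v" for a
  proof -
    have a: "a \<in> carrier V" using that v by (meson a_elemrcos_carrier is_abelian_group)
    have "a \<ominus> v \<in> U" using that a_rcos_module[OF v a] by (simp add: a_minus_def)
    then show ?thesis using assms a by (subst coset_eq_iff) auto
  qed
  moreover have "v \<in> U +> v" using v a_rcos_self by blast
  ultimately show ?thesis by blast
qed

lemma coset_smult: "v \<in> carrier V \<Longrightarrow> c \<odot>\<^bsub>quot V U\<^esub> (U +> v) = U +> (c \<odot> v)"
proof -
  assume v: "v \<in> carrier V"
  have "c \<odot> a \<ominus> c \<odot> v \<in> U" if "a \<in> carrier V" "a \<ominus> v \<in> U" for a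
  proof -
    have "c \<odot> (a \<ominus> v) = c \<odot> a \<ominus> c \<odot> v"
      using that v by (simp add: a_minus_def smult_distribs minus_eq_smult mult.commute)
    then show ?thesis using sub(4)[OF that(2), of c] by simp
  qed
  then show ?thesis using UN_coset[OF v, of "\<lambda>a. c \<odot> a"] by (simp add: quot_def)
qed

lemma quot_closed:
  "A \<in> carrier (quot V U) \<Longrightarrow> B \<in> carrier (quot V U) \<Longrightarrow> A \<oplus>\<^bsub>quot V U\<^esub> B \<in> carrier (quot V U)"
  "A \<in> carrier (quot V U) \<Longrightarrow> c \<odot>\<^bsub>quot V U\<^esub> A \<in> carrier (quot V U)"
  by (auto elim!: coset_cases simp: coset_add coset_smult intro!: coset_cl)

lemma coset_act:
  assumes "\<And>a. a \<in> carrier V \<Longrightarrow> act V x a \<in> carrier V"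
    "\<And>a b. a \<in> carrier V \<Longrightarrow> b \<in> carrier V \<Longrightarrow> a \<ominus> b \<in> U \<Longrightarrow> act V x a \<ominus> act V x b \<in> U"
    and "v \<in> carrier V"
  shows "act (quot V U) x (U +> v) = U +> act V x v"
  using UN_coset[of v "act V x"] assms by (simp add: quot_def)

lemma graded_epi_coset:
  assumes "\<And>x a. x \<in> G \<Longrightarrow> a \<in> carrier V \<Longrightarrow> act V x a \<in> carrier V"
    "\<And>x a b. x \<in> G \<Longrightarrow> a \<in> carrier V \<Longrightarrow> b \<in> carrier V \<Longrightarrow> a \<ominus> b \<in> U \<Longrightarrow> act V x a \<ominus> act V x b \<in> U"
    "\<And>d. hcomp V d \<subseteq> carrier V"
  shows "graded_epi G V (quot V U) (\<lambda>v. U +> v)"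
proof (rule graded_epiI)
  show "\<exists>v\<in>carrier V. U +> v = A" if "A \<in> carrier (quot V U)" for A
    using that by (auto elim: coset_cases)
  show "v \<in> carrier V \<and> U +> v \<in> hcomp (quot V U) d" if "v \<in> hcomp V d" for v d
    using that assms(3)[of d] by (auto simp: quot_def)
  show "\<exists>v\<in>hcomp V d. U +> v = A" if "A \<in> hcomp (quot V U) d" for A d
    using that by (auto simp: quot_def)
qed (use assms in \<open>simp_all add: coset_cl coset_add coset_smult coset_act\<close>)

end

lemma cquot_kernel:
  fixes V :: "('g, 'v) gmod"
  assumes "clinear V W f"
  shows "cquot V {v \<in> carrier V. f v = \<zero>\<^bsub>W\<^esub>}"
proof -
  interpret clinear V W f by (rule assms)
  show ?thesis
    by unfold_locales (auto simp: zero add smult W.smult_distribs)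
qed

text \<open>The first isomorphism theorem in graded equivariant form: each isomorphism out of a
  quotient is obtained by computing the kernel of a map on representatives.\<close>

lemma graded_epi_quot_kernel:
  fixes V :: "('g, 'v) gmod" and W :: "('g, 'w) gmod"
  assumes f: "graded_epi G V W f" and V: "module class_ring V" and W: "module class_ring W"
    and U: "U = {v \<in> carrier V. f v = \<zero>\<^bsub>W\<^esub>}"
  obtains g where "graded_epi G (quot V U) W g" "inj_on g (carrier (quot V U))"
proof -
  interpret f: clinear V W f by (rule graded_epi_clinear[OF assms(1-3)])
  interpret cquot V U unfolding U by (rule cquot_kernel[of V W f]) unfold_locales
  note D = graded_epiD[OF f]
  have eq: "U +>\<^bsub>V\<^esub> a = U +>\<^bsub>V\<^esub> b \<longleftrightarrow> f a = f b" if "a \<in> carrier V" "b \<in> carrier V" for a b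
  proof -
    have "a \<ominus>\<^bsub>V\<^esub> b \<in> carrier V" using that by (rule f.V.M.minus_closed)
    then have "U +>\<^bsub>V\<^esub> a = U +>\<^bsub>V\<^esub> b \<longleftrightarrow> f (a \<ominus>\<^bsub>V\<^esub> b) = \<zero>\<^bsub>W\<^esub>"
      unfolding coset_eq_iff[OF that] by (subst U) (simp only: mem_Collect_eq simp_thms)
    also have "\<dots> \<longleftrightarrow> f a = f b"
      using that by (simp only: f.diff f.W.diff_zero_iff f.cl)
    finally show ?thesis .
  qed
  define g where "g A = f (SOME a. a \<in> carrier V \<and> A = U +>\<^bsub>V\<^esub> a)" for A
  have g: "g (U +>\<^bsub>V\<^esub> a) = f a" if "a \<in> carrier V" for a
    unfolding g_def by (rule someI2[of _ a]) (use that in \<open>auto simp: eq\<close>)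
  \<comment> \<open>The kernel is stable under the operators because \<open>f\<close> is
    equivariant: if \<open>f\<close> identifies two vectors, it identifies their images under
    \<open>x\<close>.\<close>
  have act: "act V x a \<ominus>\<^bsub>V\<^esub> act V x b \<in> U"
    if "x \<in> G" "a \<in> carrier V" "b \<in> carrier V" "a \<ominus>\<^bsub>V\<^esub> b \<in> U" for x a b
  proof -
    have "f a = f b" using that by (simp only: coset_eq_iff[symmetric] eq)
    then have "f (act V x a) = f (act V x b)" by (simp only: D(5)[OF that(1,2)] D(5)[OF that(1,3)])
    then show ?thesis
      using D(4)[OF that(1,2)] D(4)[OF that(1,3)] by (simp only: coset_eq_iff[symmetric] eq)
  qed
  have proj: "graded_epi G V (quot V U) (\<lambda>v. U +>\<^bsub>V\<^esub> v)"
    by (rule graded_epi_coset) (erule (1) D(4), erule (3) act, rule D(6))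
  note P = graded_epiD[OF proj]
  have act_quot: "act (quot V U) x A \<in> carrier (quot V U) \<and> g (act (quot V U) x A) = act W x (g A)"
    if x: "x \<in> G" and A: "A \<in> carrier (quot V U)" for x A
  proof -
    obtain v where v: "v \<in> carrier V" "A = U +>\<^bsub>V\<^esub> v" using A by (rule coset_cases)
    have e: "act (quot V U) x A = U +>\<^bsub>V\<^esub> act V x v" "act V x v \<in> carrier V"
      using P(5)[OF x v(1)] D(4)[OF x v(1)] v(2) by simp_all
    show ?thesis
      unfolding e(1) g[OF e(2)] D(5)[OF x v(1)] unfolding v(2) g[OF v(1)] using P(2)[OF e(2)] by simp
  qed
  have "graded_epi G (quot V U) W g"
  proof (rule graded_epiI)
    show "\<exists>A\<in>carrier (quot V U). g A = w" if w: "w \<in> carrier W" for w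
    proof -
      obtain v where "v \<in> carrier V" "f v = w" using D(3)[OF w] by (elim bexE)
      then show ?thesis using P(2)[of v] g[of v] by (intro bexI[of _ "U +>\<^bsub>V\<^esub> v"]) simp_all
    qed
    show "A \<in> carrier (quot V U) \<and> g A \<in> hcomp W d" if A: "A \<in> hcomp (quot V U) d" for A d
    proof -
      obtain v where v: "v \<in> hcomp V d" "U +>\<^bsub>V\<^esub> v = A" using P(8)[OF A] by (elim bexE)
      have "v \<in> carrier V" by (rule subsetD[OF D(6) v(1)])
      then show ?thesis using D(7)[OF v(1)] g[of v] P(2)[of v] v(2) by simp
    qed
    show "\<exists>A\<in>hcomp (quot V U) d. g A = w" if w: "w \<in> hcomp W d" for w d
    proof -
      obtain v where v: "v \<in> hcomp V d" "f v = w" using D(8)[OF w] by (elim bexE)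
      have "v \<in> carrier V" by (rule subsetD[OF D(6) v(1)])
      then have "g (U +>\<^bsub>V\<^esub> v) = w" using g[of v] v(2) by simp
      then show ?thesis using P(7)[OF v(1)] by (rule bexI)
    qed
    show "act (quot V U) x A \<in> carrier (quot V U)" if "x \<in> G" "A \<in> carrier (quot V U)" for x A
      using act_quot[OF that] by (rule conjunct1)
    show "g (act (quot V U) x A) = act W x (g A)" if "x \<in> G" "A \<in> carrier (quot V U)" for x A
      using act_quot[OF that] by (rule conjunct2)
  qed (auto elim!: coset_cases simp: coset_add coset_smult g f.cl f.add f.smult)
  moreover have "inj_on g (carrier (quot V U))"
  proof (rule inj_onI)
    fix A B assume AB: "A \<in> carrier (quot V U)" "B \<in> carrier (quot V U)" "g A = g B"
    obtain a where a: "a \<in> carrier V" "A = U +>\<^bsub>V\<^esub> a" using AB(1) by (rule coset_cases)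
    obtain b where b: "b \<in> carrier V" "B = U +>\<^bsub>V\<^esub> b" using AB(2) by (rule coset_cases)
    show "A = B"
      using AB(3) unfolding a(2) b(2) g[OF a(1)] g[OF b(1)] eq[OF a(1) b(1)] .
  qed
  ultimately show thesis by (rule that)
qed

section \<open>Direct sums\<close>

lemma graded_epi_dsum:
  fixes V :: "'i \<Rightarrow> ('g, 'v) gmod" and W :: "'i \<Rightarrow> ('g, 'w) gmod"
  assumes "\<And>i. i \<in> I \<Longrightarrow> graded_epi G (V i) (W i) (f i)"
  shows "graded_epi G (dsum I V) (dsum I W) (\<lambda>x. \<lambda>i\<in>I. f i (x i))"
proof -
  note D = graded_epiD[OF assms]
  have hom: "f i (v \<oplus>\<^bsub>V i\<^esub> w) = f i v \<oplus>\<^bsub>W i\<^esub> f i w" "f i (c \<odot>\<^bsub>V i\<^esub> v) = c \<odot>\<^bsub>W i\<^esub> f i v"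
    if "i \<in> I" "v \<in> carrier (V i)" "w \<in> carrier (V i)" for i v w c
    using D(1)[OF that(1)] that(2,3) by (auto simp: LinearCombinations.module_hom_def)
  \<comment> \<open>Preimages are chosen index by index; leaving the sets \<open>A\<close> and
    \<open>B\<close> general covers both the whole spaces and their homogeneous components.\<close>
  have lift: "\<exists>v\<in>PiE I A. (\<lambda>i\<in>I. f i (v i)) = w"
    if w: "w \<in> PiE I B" and ex: "\<And>i b. i \<in> I \<Longrightarrow> b \<in> B i \<Longrightarrow> \<exists>a\<in>A i. f i a = b" for A B w
  proof -
    have "\<forall>i\<in>I. \<exists>a. a \<in> A i \<and> f i a = w i" using ex w by (meson PiE_mem)
    then obtain v where v: "\<And>i. i \<in> I \<Longrightarrow> v i \<in> A i \<and> f i (v i) = w i" by metis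
    show ?thesis
      by (rule bexI[of _ "restrict v I"], rule ext) (use v w in \<open>auto simp: PiE_iff extensional_def\<close>)
  qed
  show ?thesis
  proof (rule graded_epiI)
    show "\<exists>v\<in>carrier (dsum I V). (\<lambda>i\<in>I. f i (v i)) = w" if "w \<in> carrier (dsum I W)" for w
      using lift[of w "\<lambda>i. carrier (W i)" "\<lambda>i. carrier (V i)"] that D(3) by (simp add: dsum_def)
    show "\<exists>v\<in>hcomp (dsum I V) d. (\<lambda>i\<in>I. f i (v i)) = w" if "w \<in> hcomp (dsum I W) d" for w d
      using lift[of w "\<lambda>i. hcomp (W i) d" "\<lambda>i. hcomp (V i) d"] that D(8) by (simp add: dsum_def)
    show "v \<in> carrier (dsum I V) \<and> (\<lambda>i\<in>I. f i (v i)) \<in> hcomp (dsum I W) d" if "v \<in> hcomp (dsum I V) d" for v d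
      using that D(6,7) by (force simp: dsum_def PiE_iff)
    show "act (dsum I V) x v \<in> carrier (dsum I V)" if "x \<in> G" "v \<in> carrier (dsum I V)" for x v
      using that D(4) by (auto simp: dsum_def PiE_iff)
    show "(\<lambda>i\<in>I. f i (act (dsum I V) x v i)) = act (dsum I W) x (\<lambda>i\<in>I. f i (v i))"
      if "x \<in> G" "v \<in> carrier (dsum I V)" for x v
      using that D(5) by (auto simp: dsum_def PiE_iff intro!: restrict_ext)
  qed (use D(2) in \<open>auto simp: dsum_def PiE_iff hom intro!: restrict_ext\<close>)
qed

lemma inj_on_dsum:
  assumes "\<And>i. i \<in> I \<Longrightarrow> inj_on (f i) (carrier (V i))"
  shows "inj_on (\<lambda>x. \<lambda>i\<in>I. f i (x i)) (carrier (dsum I V))"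
proof (rule inj_onI)
  fix x y assume xy: "x \<in> carrier (dsum I V)" "y \<in> carrier (dsum I V)"
    "(\<lambda>i\<in>I. f i (x i)) = (\<lambda>i\<in>I. f i (y i))"
  have "x i = y i" if i: "i \<in> I" for i
  proof (rule inj_onD[OF assms[OF i]])
    show "f i (x i) = f i (y i)" using fun_cong[OF xy(3), of i] i by simp
  qed (use xy i in \<open>auto simp: dsum_def\<close>)
  then show "x = y" using xy(1,2) by (auto simp: dsum_def intro: PiE_ext)
qed

lemma module_dsum:
  assumes "\<And>i. i \<in> I \<Longrightarrow> module class_ring (V i)"
  shows "module class_ring (dsum I V)"
proof -
  have V: "cmodule (V i)" if "i \<in> I" for i using assms[OF that] by (rule cmodule.intro)
  have comm: "x \<oplus>\<^bsub>V i\<^esub> y = y \<oplus>\<^bsub>V i\<^esub> x"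
    if "i \<in> I" "x \<in> carrier (V i)" "y \<in> carrier (V i)" for i x y
    by (rule cmodule.ab(4)[OF V[OF that(1)] that(2,3)])
  show ?thesis
  proof (rule module_class_ringI)
    show "abelian_group (dsum I V)"
    proof (rule abelian_groupI)
      show "\<exists>y\<in>carrier (dsum I V). y \<oplus>\<^bsub>dsum I V\<^esub> x = \<zero>\<^bsub>dsum I V\<^esub>" if "x \<in> carrier (dsum I V)" for x
        by (rule bexI[of _ "\<lambda>i\<in>I. \<ominus>\<^bsub>V i\<^esub> x i"])
          (use that V in \<open>auto simp: dsum_def PiE_iff cmodule.ab(6,7) intro!: restrict_ext\<close>)
    qed (use V in \<open>auto simp: dsum_def PiE_iff cmodule.ab(1-3,5) extensional_def intro!: ext comm\<close>)
  qed (use V in \<open>auto simp: dsum_def PiE_iff extensional_def cmodule.cl cmodule.smult_distribs intro!: ext restrict_ext\<close>)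
qed

section \<open>Graded bases and tensor products\<close>

text \<open>A model of \<open>V\<close> tensored with a space that has basis \<open>B\<close>: the
  family \<open>h\<close> stands for the sum of the tensors of \<open>h b\<close> with
  \<open>b\<close>. \<open>D d\<close> collects the basis vectors of degree d. Only the pair
  \<open>B\<close>, \<open>D\<close> remembers the second factor, so that one choice can be combined
  with a Specht module and with an \<open>sl n\<close>-module.\<close>

definition fin_fun :: "('g, 'v) gmod \<Rightarrow> 'b set \<Rightarrow> (int \<Rightarrow> 'b set) \<Rightarrow> ('g, 'b \<Rightarrow> 'v) gmod" where
  "fin_fun V B D =
     (let C = {h \<in> B \<rightarrow>\<^sub>E carrier V. finite {b \<in> B. h b \<noteq> \<zero>\<^bsub>V\<^esub>}} in
     \<lparr>carrier = C, mult = undefined, one = undefined,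
      zero = (\<lambda>b\<in>B. \<zero>\<^bsub>V\<^esub>), add = (\<lambda>g h. \<lambda>b\<in>B. g b \<oplus>\<^bsub>V\<^esub> h b),
      smult = (\<lambda>c h. \<lambda>b\<in>B. c \<odot>\<^bsub>V\<^esub> h b),
      hcomp = (\<lambda>d. {h \<in> C. \<forall>b\<in>B. h b \<noteq> \<zero>\<^bsub>V\<^esub> \<longrightarrow> b \<in> D d}),
      act = (\<lambda>x h. \<lambda>b\<in>B. act V x (h b))\<rparr>)"

lemma fin_fun_simps:
  "carrier (fin_fun V B D) = {h \<in> B \<rightarrow>\<^sub>E carrier V. finite {b \<in> B. h b \<noteq> \<zero>\<^bsub>V\<^esub>}}"
  "\<zero>\<^bsub>fin_fun V B D\<^esub> = (\<lambda>b\<in>B. \<zero>\<^bsub>V\<^esub>)"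
  "g \<oplus>\<^bsub>fin_fun V B D\<^esub> h = (\<lambda>b\<in>B. g b \<oplus>\<^bsub>V\<^esub> h b)"
  "c \<odot>\<^bsub>fin_fun V B D\<^esub> h = (\<lambda>b\<in>B. c \<odot>\<^bsub>V\<^esub> h b)"
  "hcomp (fin_fun V B D) d = {h \<in> carrier (fin_fun V B D). \<forall>b\<in>B. h b \<noteq> \<zero>\<^bsub>V\<^esub> \<longrightarrow> b \<in> D d}"
  "act (fin_fun V B D) x h = (\<lambda>b\<in>B. act V x (h b))"
  by (simp_all add: fin_fun_def Let_def)

lemma module_fin_fun:
  assumes "module class_ring V"
  shows "module class_ring (fin_fun V B D)"
proof -
  interpret cmodule V using assms by (rule cmodule.intro)
  have sub: "finite {b \<in> B. f b \<noteq> \<zero>\<^bsub>V\<^esub>}"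
    if "finite {b \<in> B. g b \<noteq> \<zero>\<^bsub>V\<^esub>}" "finite {b \<in> B. h b \<noteq> \<zero>\<^bsub>V\<^esub>}"
      "\<And>b. b \<in> B \<Longrightarrow> g b = \<zero>\<^bsub>V\<^esub> \<Longrightarrow> h b = \<zero>\<^bsub>V\<^esub> \<Longrightarrow> f b = \<zero>\<^bsub>V\<^esub>" for f g h
    by (rule finite_subset[OF _ finite_UnI[OF that(1,2)]]) (use that(3) in auto)
  show ?thesis
  proof (rule module_class_ringI)
    show "abelian_group (fin_fun V B D)"
    proof (rule abelian_groupI)
      show "x \<oplus>\<^bsub>fin_fun V B D\<^esub> y \<in> carrier (fin_fun V B D)"
        if "x \<in> carrier (fin_fun V B D)" "y \<in> carrier (fin_fun V B D)" for x y
        using that by (auto simp: fin_fun_simps intro: sub[of x y] cong: conj_cong)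
      show "\<exists>y\<in>carrier (fin_fun V B D). y \<oplus>\<^bsub>fin_fun V B D\<^esub> x = \<zero>\<^bsub>fin_fun V B D\<^esub>"
        if "x \<in> carrier (fin_fun V B D)" for x
        by (rule bexI[of _ "\<lambda>b\<in>B. \<ominus>\<^bsub>V\<^esub> x b"])
          (use that in \<open>auto simp: fin_fun_simps PiE_iff ab(7) intro!: restrict_ext intro: sub[of x x] cong: conj_cong\<close>)
    qed (auto simp: fin_fun_simps PiE_iff ab(1-3,5) extensional_def intro!: ext ab(4) cong: conj_cong)
    show "c \<odot>\<^bsub>fin_fun V B D\<^esub> x \<in> carrier (fin_fun V B D)" if "x \<in> carrier (fin_fun V B D)" for c x
      using that by (auto simp: fin_fun_simps smult_distribs intro: sub[of x x] cong: conj_cong)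
  qed (auto simp: fin_fun_simps PiE_iff smult_distribs extensional_def intro!: ext)
qed

text \<open>Coordinates are total functions of the vector, vanishing off the basis, so that
  linearity is an equation at every index. Homogeneity of the basis is recorded in the form of
  \<open>coord_hcomp\<close>: a vector of degree d involves only basis vectors of degree d.\<close>

locale graded_basis = cmodule W for W :: "'w gspace" (structure) +
  fixes B :: "'w set" and coord :: "'w \<Rightarrow> 'w \<Rightarrow> complex"
  assumes basis_carrier: "B \<subseteq> carrier W"
    and coord_outside: "b \<notin> B \<Longrightarrow> coord w b = 0"
    and coord_finite: "w \<in> carrier W \<Longrightarrow> finite {b. coord w b \<noteq> 0}"
    and expand: "w \<in> carrier W \<Longrightarrow> w = finsum W (\<lambda>b. coord w b \<odot> b) {b. coord w b \<noteq> 0}"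
    and coord_add: "v \<in> carrier W \<Longrightarrow> w \<in> carrier W \<Longrightarrow> coord (v \<oplus> w) b = coord v b + coord w b"
    and coord_smult: "w \<in> carrier W \<Longrightarrow> coord (c \<odot> w) b = c * coord w b"
    and coord_basis: "b \<in> B \<Longrightarrow> coord b b' = (if b' = b then 1 else 0)"
    and coord_hcomp: "w \<in> hcomp W d \<Longrightarrow> coord w b \<noteq> 0 \<Longrightarrow> b \<in> hcomp W d"
    and hcomp_carrier: "hcomp W d \<subseteq> carrier W"

section \<open>Existence of homogeneous bases\<close>

lemma (in cmodule) finsum_superset:
  assumes "finite A" "S \<subseteq> A" "\<And>a. a \<in> A \<Longrightarrow> f a \<in> carrier V" "\<And>a. a \<in> A \<Longrightarrow> a \<notin> S \<Longrightarrow> f a = \<zero>"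
  shows "finsum V f A = finsum V f S"
  by (rule M.add.finprod_mono_neutral_cong_left[symmetric]) (use assms in auto)

text \<open>Zorn's lemma, as the space may have infinite dimension. Choosing the independent set
  inside \<open>H\<close> is what later makes the basis of a graded space homogeneous.\<close>

lemma (in cmodule) exists_maximal_independent:
  assumes "H \<subseteq> carrier V"
  obtains B where "B \<subseteq> H" "lin_indpt B" "H \<subseteq> span B"
proof -
  interpret vectorspace class_ring V
    using is_module by (simp add: vectorspace_class_ring_iff)
  let ?A = "{S. S \<subseteq> H \<and> lin_indpt S}"
  have "\<exists>M\<in>?A. \<forall>X\<in>?A. M \<subseteq> X \<longrightarrow> X = M"
  proof (rule subset_Zorn_nonempty)
    have "lin_indpt {}" by (auto simp: lin_dep_def)
    then show "?A \<noteq> {}" by blast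
    fix C assume C: "C \<noteq> {}" "subset.chain ?A C"
    \<comment> \<open>A linear dependency involves finitely many vectors, hence lives in a single
      member of the chain.\<close>
    have "lin_indpt (\<Union>C)"
    proof
      assume "lin_dep (\<Union>C)"
      then obtain F a v where F: "finite F" "F \<subseteq> \<Union>C" "a \<in> F \<rightarrow> carrier class_ring"
        "lincomb a F = \<zero>" "v \<in> F" "a v \<noteq> \<zero>\<^bsub>class_ring\<^esub>"
        unfolding lin_dep_def by (elim exE conjE)
      obtain S where "S \<in> C" "F \<subseteq> S"
        using finite_subset_Union_chain[OF F(1,2) C] by blast
      then have "lin_dep S" using F unfolding lin_dep_def by blast
      then show False using C(2) \<open>S \<in> C\<close> by (auto simp: subset.chain_def)
    qed
    then show "\<Union>C \<in> ?A" using C(2) by (auto simp: subset.chain_def)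
  qed
  then obtain B where B0: "B \<in> ?A" "\<forall>X\<in>?A. B \<subseteq> X \<longrightarrow> X = B" by (elim bexE)
  then have B: "B \<subseteq> H" "lin_indpt B" by simp_all
  have B_max: "X = B" if "X \<subseteq> H" "lin_indpt X" "B \<subseteq> X" for X
    using bspec[OF B0(2), of X] that by simp
  have "h \<in> span B" if h: "h \<in> H" for h
  proof (cases "h \<in> B")
    case True
    then show ?thesis using subsetD[OF in_own_span[OF subset_trans[OF B(1) assms]]] by simp
  next
    case False
    then have "lin_dep (B \<union> {h})" using B_max[of "insert h B"] B(1) h by auto
    then show ?thesis
      using lin_dep_iff_in_span[OF subset_trans[OF B(1) assms] B(2) subsetD[OF assms h] False] by simp
  qed
  then show thesis by (intro that[OF B] subsetI)
qed

context cmodule begin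

text \<open>Linear combinations are encoded by total coefficient functions of finite support, so
  that uniqueness of coordinates becomes an equation between functions.\<close>

definition val :: "('v \<Rightarrow> complex) \<Rightarrow> 'v" where
  "val c = finsum V (\<lambda>b. c b \<odot> b) {b. c b \<noteq> 0}"

lemma val_superset:
  assumes "finite A" "{b. c b \<noteq> 0} \<subseteq> A" "A \<subseteq> carrier V"
  shows "val c = finsum V (\<lambda>b. c b \<odot> b) A"
  unfolding val_def
  by (rule finsum_superset[symmetric]) (use assms in \<open>auto simp: smult_distribs\<close>)

lemma val_add:
  assumes "finite {b. c b \<noteq> 0}" "{b. c b \<noteq> 0} \<subseteq> carrier V" "finite {b. d b \<noteq> 0}" "{b. d b \<noteq> 0} \<subseteq> carrier V"
  shows "val (\<lambda>b. c b + d b) = val c \<oplus> val d"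
proof -
  let ?A = "{b. c b \<noteq> 0} \<union> {b. d b \<noteq> 0}"
  have A: "finite ?A" "?A \<subseteq> carrier V" using assms by auto
  have "val (\<lambda>b. c b + d b) = finsum V (\<lambda>b. (c b + d b) \<odot> b) ?A"
    by (rule val_superset) (use A in auto)
  also have "\<dots> = finsum V (\<lambda>b. c b \<odot> b \<oplus> d b \<odot> b) ?A"
    by (rule M.finsum_cong') (use A in \<open>auto simp: smult_distribs\<close>)
  also have "\<dots> = finsum V (\<lambda>b. c b \<odot> b) ?A \<oplus> finsum V (\<lambda>b. d b \<odot> b) ?A"
    by (rule M.finsum_addf) (use A in auto)
  also have "finsum V (\<lambda>b. c b \<odot> b) ?A = val c"
    by (rule val_superset[symmetric]) (use A in auto)
  also have "finsum V (\<lambda>b. d b \<odot> b) ?A = val d"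
    by (rule val_superset[symmetric]) (use A in auto)
  finally show ?thesis .
qed

lemma finsum_smult_distrib:
  assumes "finite A" "\<And>a. a \<in> A \<Longrightarrow> f a \<in> carrier V"
  shows "k \<odot> finsum V f A = finsum V (\<lambda>a. k \<odot> f a) A"
  using assms by (induction A rule: finite_induct) (auto simp: smult_distribs Pi_iff)

lemma val_smult:
  assumes "finite {b. c b \<noteq> 0}" "{b. c b \<noteq> 0} \<subseteq> carrier V"
  shows "val (\<lambda>b. k * c b) = k \<odot> val c"
proof -
  have "val (\<lambda>b. k * c b) = finsum V (\<lambda>b. (k * c b) \<odot> b) {b. c b \<noteq> 0}"
    by (rule val_superset) (use assms in auto)
  also have "\<dots> = finsum V (\<lambda>b. k \<odot> (c b \<odot> b)) {b. c b \<noteq> 0}"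
    by (rule M.finsum_cong') (use assms in \<open>auto simp: smult_distribs\<close>)
  also have "\<dots> = k \<odot> val c"
    unfolding val_def by (rule finsum_smult_distrib[symmetric]) (use assms in auto)
  finally show ?thesis .
qed

lemma val_inject:
  assumes B: "lin_indpt B" "B \<subseteq> carrier V"
    and c: "finite {b. c b \<noteq> 0}" "{b. c b \<noteq> 0} \<subseteq> B" and d: "finite {b. d b \<noteq> 0}" "{b. d b \<noteq> 0} \<subseteq> B"
    and eq: "val c = val d"
  shows "c = d"
proof (rule ccontr)
  assume "c \<noteq> d"
  then obtain b where b: "c b \<noteq> d b" by blast
  let ?e = "\<lambda>b. c b + (- 1) * d b" and ?A = "{b. c b \<noteq> 0} \<union> {b. d b \<noteq> 0}"
  have d1: "finite {b. (- 1) * d b \<noteq> 0}" "{b. (- 1) * d b \<noteq> 0} \<subseteq> carrier V"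
    using d B by auto
  have "val ?e = val c \<oplus> (- 1) \<odot> val d"
    using val_add[OF c(1) subset_trans[OF c(2) B(2)] d1] val_smult[OF d(1) subset_trans[OF d(2) B(2)], of "- 1"]
    by simp
  moreover have "val c \<in> carrier V"
    unfolding val_def by (rule M.finsum_closed) (use c B in auto)
  ultimately have "val ?e = \<zero>"
    by (simp add: eq minus_eq_smult[symmetric] M.r_neg)
  moreover have "val ?e = finsum V (\<lambda>b. ?e b \<odot> b) ?A"
    by (rule val_superset) (use c d B in auto)
  ultimately have "lincomb ?e ?A = \<zero>" by (simp add: lincomb_def)
  then have "lin_dep B"
    unfolding lin_dep_def using c d b by (intro exI[of _ ?A] exI[of _ ?e] exI[of _ b]) auto
  then show False using B by simp
qed

lemma span_eq_val:
  assumes "B \<subseteq> carrier V" "v \<in> span B"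
  shows "\<exists>c. finite {b. c b \<noteq> 0} \<and> {b. c b \<noteq> 0} \<subseteq> B \<and> v = val c"
proof -
  obtain a A where A: "finite A" "A \<subseteq> B" "v = lincomb a A"
    using assms(2) unfolding span_def by (elim CollectE exE conjE)
  let ?c = "\<lambda>b. if b \<in> A then a b else 0"
  have "v = finsum V (\<lambda>b. ?c b \<odot> b) A"
    unfolding A(3) lincomb_def by (rule M.finsum_cong') (use A assms in auto)
  also have "\<dots> = val ?c" by (rule val_superset[symmetric]) (use A assms in auto)
  finally show ?thesis using A by (intro exI[of _ ?c]) (auto intro: finite_subset[OF _ A(1)])
qed

end

lemma ex1_eq: "\<exists>!x. P x \<Longrightarrow> P a \<Longrightarrow> P b \<Longrightarrow> a = b"
  by blast

text \<open>A maximal independent set of homogeneous vectors spans, since every vector is a sum of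
  homogeneous ones. For \<open>coord_hcomp\<close>, the expansion of a homogeneous vector is grouped
  by degree and compared with the trivial decomposition; uniqueness of homogeneous components forces
  the two to agree.\<close>

lemma exists_graded_basis:
  fixes W :: "'w gspace" (structure)
  assumes "graded_space W"
  shows "\<exists>B coord. graded_basis W B coord"
proof -
  have W: "module class_ring W" and dec: "\<And>v. v \<in> carrier W \<Longrightarrow> \<exists>!c. (\<forall>d. c d \<in> hcomp W d) \<and> finite {d. c d \<noteq> \<zero>} \<and>
        v = finsum W c {d. c d \<noteq> \<zero>}"
    and hs: "\<And>d. subspace class_ring (hcomp W d) W"
    using assms by (simp_all add: graded_space_def vectorspace_class_ring_iff)
  interpret cmodule W using W by (rule cmodule.intro)
  have hc: "hcomp W d \<subseteq> carrier W" and h0: "\<zero> \<in> hcomp W d"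
    and hadd: "u \<in> hcomp W d \<Longrightarrow> v \<in> hcomp W d \<Longrightarrow> u \<oplus> v \<in> hcomp W d"
    and hsm: "u \<in> hcomp W d \<Longrightarrow> k \<odot> u \<in> hcomp W d" for u v d k
    using hs[of d] by (simp_all add: subspace_class_ring_iff[OF W])
  have hsum: "finsum W f A \<in> hcomp W d" if "finite A" "\<And>a. a \<in> A \<Longrightarrow> f a \<in> hcomp W d" for f A d
    using that
  proof (induction A rule: finite_induct)
    case (insert a A)
    then have "f \<in> A \<rightarrow> carrier W" "f a \<in> carrier W" using hc[of d] by auto
    then show ?case using insert by (auto intro: hadd)
  qed (simp add: h0)
  let ?H = "\<Union>d. hcomp W d"
  have H: "?H \<subseteq> carrier W" using hc by blast
  obtain B where B: "B \<subseteq> ?H" "lin_indpt B" "?H \<subseteq> span B"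
    by (rule exists_maximal_independent[OF H])
  have Bc: "B \<subseteq> carrier W" by (rule subset_trans[OF B(1) H])
  have sm: "submodule class_ring (span B) W" by (rule span_is_submodule[OF Bc])
  have "v \<in> span B" if v: "v \<in> carrier W" for v
  proof -
    obtain c where c': "(\<forall>d. c d \<in> hcomp W d) \<and> finite {d. c d \<noteq> \<zero>} \<and> v = finsum W c {d. c d \<noteq> \<zero>}"
      using ex1_implies_ex[OF dec[OF v]] by (rule exE)
    then have c: "c d \<in> hcomp W d" "finite {d. c d \<noteq> \<zero>}" "v = finsum W c {d. c d \<noteq> \<zero>}" for d
      by simp_all
    have cc: "c d \<in> carrier W" for d by (rule subsetD[OF hc c(1)])
    have cs: "c d \<in> span B" for d by (rule subsetD[OF B(3)]) (use c(1) in auto)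
    have "finsum W c A \<in> span B" if "finite A" for A
      using that
    proof (induction A rule: finite_induct)
      case (insert a A)
      have "c \<in> A \<rightarrow> carrier W" by (intro Pi_I) (rule cc)
      then show ?case using insert sm cc[of a] cs[of a] by (simp add: submodule_def)
    qed (use sm in \<open>simp add: submodule_def\<close>)
    then show ?thesis using c(2,3) by simp
  qed
  then have "\<forall>v. v \<in> carrier W \<longrightarrow> (\<exists>c. finite {b. c b \<noteq> 0} \<and> {b. c b \<noteq> 0} \<subseteq> B \<and> v = val c)"
    by (intro allI impI span_eq_val[OF Bc])
  then obtain co where co': "\<forall>v. v \<in> carrier W \<longrightarrow> finite {b. co v b \<noteq> 0} \<and> {b. co v b \<noteq> 0} \<subseteq> B \<and> v = val (co v)"
    by (rule exE[OF choice_iff'[THEN iffD1]])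
  have co: "finite {b. co v b \<noteq> 0} \<and> {b. co v b \<noteq> 0} \<subseteq> B \<and> v = val (co v)" if "v \<in> carrier W" for v
    using co' that by simp
  have co_unique: "co v = c" if "v \<in> carrier W" "finite {b. c b \<noteq> 0}" "{b. c b \<noteq> 0} \<subseteq> B" "v = val c" for v c
    using val_inject[OF B(2) Bc, of "co v" c] co[OF that(1)] that by auto
  \<comment> \<open>Extended by zero off the carrier, because \<open>coord_outside\<close> is
    demanded for every \<open>w\<close>.\<close>
  define coord where "coord v b = (if v \<in> carrier W then co v b else 0)" for v b
  have coord: "coord v = co v" if "v \<in> carrier W" for v using that by (auto simp: coord_def)
  note Bs = subset_trans[OF _ Bc]
  have "\<forall>b\<in>B. \<exists>d. b \<in> hcomp W d" using B(1) by blast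
  then obtain deg where deg: "\<And>b. b \<in> B \<Longrightarrow> b \<in> hcomp W (deg b)" by metis
  have hom: "b \<in> hcomp W d" if w: "w \<in> hcomp W d" and b: "co w b \<noteq> 0" for w d b
  proof -
    have wc: "w \<in> carrier W" by (rule subsetD[OF hc w])
    let ?S = "{b. co w b \<noteq> 0}"
    note cw = co[OF wc]
    \<comment> \<open>The part of the expansion of \<open>w\<close> that comes from basis vectors of
      degree e.\<close>
    define c where "c e = finsum W (\<lambda>b. co w b \<odot> b) {b \<in> ?S. deg b = e}" for e
    have c_h: "c e \<in> hcomp W e" for e
      unfolding c_def by (rule hsum) (use cw deg hsm in auto)
    have c_z: "c e = \<zero>" if "e \<notin> deg ` ?S" for e
    proof -
      have "{b \<in> ?S. deg b = e} = {}" using that by blast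
      then show ?thesis by (simp only: c_def M.finsum_empty)
    qed
    have c_sub: "{e. c e \<noteq> \<zero>} \<subseteq> deg ` ?S"
    proof
      fix e assume "e \<in> {e. c e \<noteq> \<zero>}"
      then show "e \<in> deg ` ?S" using c_z[of e] by (simp only: mem_Collect_eq) argo
    qed
    have fin_S: "finite (deg ` ?S)" using cw by simp
    have fin: "finite {e. c e \<noteq> \<zero>}" by (rule finite_subset[OF c_sub fin_S])
    have "w = finsum W (\<lambda>b. co w b \<odot> b) (\<Union>e\<in>deg ` ?S. {b \<in> ?S. deg b = e})"
    proof -
      have "(\<Union>e\<in>deg ` ?S. {b \<in> ?S. deg b = e}) = ?S" by blast
      then show ?thesis using cw by (simp add: val_def)
    qed
    also have "\<dots> = finsum W c (deg ` ?S)"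
    proof -
      have "finite ?S" "?S \<subseteq> carrier W" using cw Bc by (simp_all only: subset_trans[OF _ Bc])
      then have "finsum W (\<lambda>b. co w b \<odot> b) (\<Union>e\<in>deg ` ?S. {b \<in> ?S. deg b = e}) =
          finsum W (\<lambda>e. finsum W (\<lambda>b. co w b \<odot> b) {b \<in> ?S. deg b = e}) (deg ` ?S)"
        by (intro M.add.finprod_UN_disjoint[where I = "deg ` ?S" and A = "\<lambda>e. {b \<in> ?S. deg b = e}"
              and g = "\<lambda>b. co w b \<odot> b"])
          (auto simp: pairwise_def disjnt_def)
      then show ?thesis unfolding c_def .
    qed
    also have "\<dots> = finsum W c {e. c e \<noteq> \<zero>}"
      by (rule finsum_superset[OF fin_S c_sub]) (use subsetD[OF hc c_h] in auto)
    finally have w_c: "w = finsum W c {e. c e \<noteq> \<zero>}" .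
    \<comment> \<open>The second decomposition of \<open>w\<close>: its only component is
      \<open>w\<close> itself, in degree d.\<close>
    define c' where "c' e = (if e = d then w else \<zero>)" for e
    have "w = finsum W c' {e. c' e \<noteq> \<zero>}"
    proof (cases "w = \<zero>")
      case False
      then have "{e. c' e \<noteq> \<zero>} = {d}" by (auto simp: c'_def)
      then show ?thesis using wc by (simp add: c'_def)
    qed (simp add: c'_def)
    moreover have "c' e \<in> hcomp W e" for e using w h0 by (simp add: c'_def)
    moreover have "finite {e. c' e \<noteq> \<zero>}"
      by (rule finite_subset[of _ "{d}"]) (auto simp: c'_def)
    ultimately have "c = c'"
      using c_h fin w_c by (intro ex1_eq[OF dec[OF wc]] conjI allI)
    then have "w = c d" by (simp add: c'_def)
    also have "\<dots> = finsum W (\<lambda>b. (if deg b = d then co w b else 0) \<odot> b) {b \<in> ?S. deg b = d}"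
      unfolding c_def by (rule M.finsum_cong') (use cw Bc in auto)
    also have "\<dots> = val (\<lambda>b. if deg b = d then co w b else 0)"
      by (rule val_superset[symmetric]) (use cw Bc in auto)
    finally have e: "w = val (\<lambda>b. if deg b = d then co w b else 0)" .
    \<comment> \<open>Now \<open>w\<close> equals its own degree d part, so uniqueness of
      coordinates kills the coefficients at basis vectors of any other degree.\<close>
    have "co w = (\<lambda>b. if deg b = d then co w b else 0)"
    proof -
      have s: "{b. (if deg b = d then co w b else 0) \<noteq> 0} \<subseteq> ?S" by auto
      have f: "finite ?S" "?S \<subseteq> B" using cw by simp_all
      show ?thesis
        by (rule co_unique[OF wc finite_subset[OF s f(1)] subset_trans[OF s f(2)] e])
    qed
    then have "co w b = (if deg b = d then co w b else 0)" by (rule fun_cong)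
    then have "deg b = d" using b by argo
    moreover have "b \<in> B" using b cw by auto
    ultimately show ?thesis using deg[of b] by simp
  qed
  have k1: "coord w b = 0" if "b \<notin> B" for b w
  proof (cases "w \<in> carrier W")
    case True
    then have "{b. co w b \<noteq> 0} \<subseteq> B" using co by simp
    then show ?thesis using that by (auto simp: coord_def)
  qed (simp add: coord_def)
  have k2: "coord (v \<oplus> w) b = coord v b + coord w b" if "v \<in> carrier W" "w \<in> carrier W" for v w b
  proof -
    note cv = co[OF that(1)] and cw = co[OF that(2)]
    have s: "{b. co v b + co w b \<noteq> 0} \<subseteq> {b. co v b \<noteq> 0} \<union> {b. co w b \<noteq> 0}" by auto
    have f: "finite ({b. co v b \<noteq> 0} \<union> {b. co w b \<noteq> 0})" "{b. co v b \<noteq> 0} \<union> {b. co w b \<noteq> 0} \<subseteq> B"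
      using cv cw by (simp_all only: finite_Un Un_subset_iff simp_thms)
    have c: "{b. co v b \<noteq> 0} \<subseteq> carrier W" "{b. co w b \<noteq> 0} \<subseteq> carrier W"
      using cv cw Bc by (simp_all only: Bs simp_thms)
    have "val (\<lambda>b. co v b + co w b) = val (co v) \<oplus> val (co w)"
      by (rule val_add[OF _ c(1) _ c(2)]) (use cv cw in \<open>simp_all only: simp_thms\<close>)
    then have e: "v \<oplus> w = val (\<lambda>b. co v b + co w b)" using cv cw by argo
    have "co (v \<oplus> w) = (\<lambda>b. co v b + co w b)"
      by (rule co_unique[OF _ finite_subset[OF s f(1)] subset_trans[OF s f(2)] e]) (rule ab(1)[OF that])
    then show ?thesis using that by (simp add: coord_def)
  qed
  have k3: "coord (k \<odot> w) b = k * coord w b" if "w \<in> carrier W" for w b k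
  proof -
    note cw = co[OF that]
    have s: "{b. k * co w b \<noteq> 0} \<subseteq> {b. co w b \<noteq> 0}" by auto
    have f: "finite {b. co w b \<noteq> 0}" "{b. co w b \<noteq> 0} \<subseteq> B" using cw by argo+
    have "val (\<lambda>b. k * co w b) = k \<odot> val (co w)"
      by (rule val_smult[OF f(1) subset_trans[OF f(2) Bc]])
    then have e: "k \<odot> w = val (\<lambda>b. k * co w b)" using cw by argo
    have "co (k \<odot> w) = (\<lambda>b. k * co w b)"
      by (rule co_unique[OF _ finite_subset[OF s f(1)] subset_trans[OF s f(2)] e]) (rule cl[OF that])
    then show ?thesis using that by (simp add: coord_def)
  qed
  have k4: "coord b b' = (if b' = b then 1 else 0)" if b: "b \<in> B" for b b'
  proof -
    have bc: "b \<in> carrier W" by (rule subsetD[OF Bc b])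
    have s: "{b'. (if b' = b then 1 else 0) \<noteq> (0::complex)} = {b}" by auto
    have "co b = (\<lambda>b'. if b' = b then 1 else 0)"
    proof (rule co_unique[OF bc])
      show "b = val (\<lambda>b'. if b' = b then 1 else 0)"
        unfolding val_def s using bc by (simp add: smult_distribs)
    qed (use b in \<open>simp_all only: s finite.intros, simp_all\<close>)
    then show ?thesis using bc by (simp add: coord_def)
  qed
  have k5: "b \<in> hcomp W d" if "w \<in> hcomp W d" "coord w b \<noteq> 0" for w b d
    by (rule hom[OF that(1)]) (use that(2) coord[OF subsetD[OF hc that(1)]] in simp)
  have k6: "finite {b. coord w b \<noteq> 0}" "w = finsum W (\<lambda>b. coord w b \<odot> b) {b. coord w b \<noteq> 0}"
    if "w \<in> carrier W" for w
    using co[OF that] by (simp_all only: coord[OF that] val_def[symmetric] simp_thms)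
  have "graded_basis W B coord"
    by (rule graded_basis.intro[OF cmodule.intro[OF W]], rule graded_basis_axioms.intro)
      (fact Bc k1 k6 k2 k3 k4 k5 hc)+
  then show ?thesis by (rule exI[of "\<lambda>B. \<exists>coord. graded_basis W B coord" B, OF exI[of "graded_basis W B" coord]])
qed

section \<open>Coordinates on the free vector space\<close>

lemma lookup_scale [simp]: "Poly_Mapping.lookup (Poly_Mapping.map ((*) c) p) k = c * Poly_Mapping.lookup p k" for c :: complex
  by transfer (simp add: when_def)

lemma keys_scale: "Poly_Mapping.keys (Poly_Mapping.map ((*) c) p) \<subseteq> Poly_Mapping.keys p" for c :: complex
  by (auto simp: in_keys_iff)

lemma module_free_prod: "module class_ring (free_prod V W)"
proof (rule module_class_ringI)
  show "abelian_group (free_prod V W)"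
  proof (rule abelian_groupI)
    show "x \<oplus>\<^bsub>free_prod V W\<^esub> y \<in> carrier (free_prod V W)"
      if "x \<in> carrier (free_prod V W)" "y \<in> carrier (free_prod V W)" for x y
      using that Poly_Mapping.keys_add[of x y] by (auto simp: free_prod_def)
    show "\<exists>y\<in>carrier (free_prod V W). y \<oplus>\<^bsub>free_prod V W\<^esub> x = \<zero>\<^bsub>free_prod V W\<^esub>"
      if "x \<in> carrier (free_prod V W)" for x
      by (rule bexI[of _ "- x"]) (use that in \<open>auto simp: free_prod_def\<close>)
  qed (auto simp: free_prod_def ac_simps)
  show "c \<odot>\<^bsub>free_prod V W\<^esub> x \<in> carrier (free_prod V W)" if "x \<in> carrier (free_prod V W)" for c x
    using that keys_scale[of c x] by (auto simp: free_prod_def)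
qed (auto simp: free_prod_def lookup_add algebra_simps intro!: poly_mapping_eqI)

lemma free_prod_simps:
  "carrier (free_prod V W) = {p. Poly_Mapping.keys p \<subseteq> carrier V \<times> carrier W}"
  "\<zero>\<^bsub>free_prod V W\<^esub> = 0" "p \<oplus>\<^bsub>free_prod V W\<^esub> q = p + q"
  "c \<odot>\<^bsub>free_prod V W\<^esub> p = Poly_Mapping.map ((*) c) p"
  "hcomp (free_prod V W) d = {p. Poly_Mapping.keys p \<subseteq> (\<Union>i. hcomp V i \<times> hcomp W (d - i))}"
  "act (free_prod V W) x p = (\<Sum>k\<in>Poly_Mapping.keys p. Poly_Mapping.single (act V x (fst k), snd k) (Poly_Mapping.lookup p k))"
  by (simp_all add: free_prod_def)

lemma free_prod_sum_closed:
  "finite A \<Longrightarrow> (\<And>a. a \<in> A \<Longrightarrow> f a \<in> carrier (free_prod V W)) \<Longrightarrow> sum f A \<in> carrier (free_prod V W)"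
proof (induction A rule: finite_induct)
  case (insert a A)
  then show ?case using Poly_Mapping.keys_add[of "f a" "sum f A"] by (auto simp: free_prod_simps)
qed (simp add: free_prod_simps)

text \<open>With \<open>V\<close> concentrated in degree zero, the total degree of a tensor is the
  degree of its second factor.\<close>

locale tensor_basis = V: cmodule V + graded_basis W B coord for V :: "('g, 'v) gmod" and W :: "'w gspace" and B coord +
  assumes V_zero: "in_degree_zero V"
begin

text \<open>The map from the tensor product to \<open>V\<close> induced by the coordinate functional
  of \<open>b\<close> on the second factor, written on representatives in the free vector
  space.\<close>

definition coeff :: "'w \<Rightarrow> (('v \<times> 'w) \<Rightarrow>\<^sub>0 complex) \<Rightarrow> 'v" where
  "coeff b p = finsum V (\<lambda>k. (Poly_Mapping.lookup p k * coord (snd k) b) \<odot>\<^bsub>V\<^esub> fst k) (Poly_Mapping.keys p)"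

abbreviation "F \<equiv> free_prod V W"
abbreviation "FF \<equiv> fin_fun V B (\<lambda>d. B \<inter> hcomp W d)"

lemma coeff_superset:
  assumes "finite A" "Poly_Mapping.keys p \<subseteq> A" "A \<subseteq> carrier V \<times> carrier W"
  shows "coeff b p = finsum V (\<lambda>k. (Poly_Mapping.lookup p k * coord (snd k) b) \<odot>\<^bsub>V\<^esub> fst k) A"
  unfolding coeff_def
  by (rule V.finsum_superset[symmetric])
    (use assms in \<open>auto simp: in_keys_iff V.smult_distribs\<close>)

lemma coeff_closed: "p \<in> carrier F \<Longrightarrow> coeff b p \<in> carrier V"
  unfolding coeff_def by (rule V.M.finsum_closed) (auto simp: free_prod_simps)

lemma coeff_add:
  assumes "p \<in> carrier F" "q \<in> carrier F"
  shows "coeff b (p + q) = coeff b p \<oplus>\<^bsub>V\<^esub> coeff b q"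
proof -
  let ?A = "Poly_Mapping.keys p \<union> Poly_Mapping.keys q"
  let ?f = "\<lambda>p k. (Poly_Mapping.lookup p k * coord (snd k) b) \<odot>\<^bsub>V\<^esub> fst k"
  have A: "finite ?A" "?A \<subseteq> carrier V \<times> carrier W" using assms by (auto simp: free_prod_simps)
  have "coeff b (p + q) = finsum V (?f (p + q)) ?A"
    by (rule coeff_superset) (use A keys_add[of p q] in auto)
  also have "\<dots> = finsum V (\<lambda>k. ?f p k \<oplus>\<^bsub>V\<^esub> ?f q k) ?A"
    by (rule V.M.finsum_cong')
      (use A in \<open>auto simp: lookup_add distrib_right V.smult_distribs\<close>)
  also have "\<dots> = finsum V (?f p) ?A \<oplus>\<^bsub>V\<^esub> finsum V (?f q) ?A"
    by (rule V.M.finsum_addf) (use A in auto)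
  finally show ?thesis using A by (simp add: coeff_superset[of ?A])
qed

lemma coeff_scale:
  assumes "p \<in> carrier F"
  shows "coeff b (Poly_Mapping.map ((*) c) p) = c \<odot>\<^bsub>V\<^esub> coeff b p"
proof -
  have A: "Poly_Mapping.keys p \<subseteq> carrier V \<times> carrier W" using assms by (simp add: free_prod_simps)
  have "coeff b (Poly_Mapping.map ((*) c) p) =
      finsum V (\<lambda>k. (Poly_Mapping.lookup (Poly_Mapping.map ((*) c) p) k * coord (snd k) b) \<odot>\<^bsub>V\<^esub> fst k) (Poly_Mapping.keys p)"
    by (rule coeff_superset) (use A keys_scale[of c p] in auto)
  also have "\<dots> = finsum V (\<lambda>k. c \<odot>\<^bsub>V\<^esub> ((Poly_Mapping.lookup p k * coord (snd k) b) \<odot>\<^bsub>V\<^esub> fst k)) (Poly_Mapping.keys p)"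
    by (rule V.M.finsum_cong') (use A in \<open>auto simp: V.smult_distribs mult.assoc\<close>)
  also have "\<dots> = c \<odot>\<^bsub>V\<^esub> coeff b p"
    unfolding coeff_def by (rule V.finsum_smult_distrib[symmetric]) (use A in auto)
  finally show ?thesis .
qed

lemma coeff_single:
  assumes "v \<in> carrier V" "w \<in> carrier W"
  shows "coeff b (Poly_Mapping.single (v, w) c) = (c * coord w b) \<odot>\<^bsub>V\<^esub> v"
  using coeff_superset[of "{(v, w)}" "Poly_Mapping.single (v, w) c" b] assms by (simp split: if_splits)

lemma coeff_minus:
  assumes "p \<in> carrier F" "q \<in> carrier F"
  shows "coeff b (p - q) = coeff b p \<ominus>\<^bsub>V\<^esub> coeff b q"
proof -
  have *: "p - q = p + Poly_Mapping.map ((*) (- 1)) q" by (rule poly_mapping_eqI) (simp add: lookup_minus lookup_add)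
  have "Poly_Mapping.map ((*) (- 1)) q \<in> carrier F"
    using assms(2) keys_scale[of "- 1" q] by (auto simp: free_prod_simps)
  then show ?thesis
    using assms by (simp add: * coeff_add coeff_scale a_minus_def V.minus_eq_smult coeff_closed del: lookup_scale)
qed

lemma coeff_sum:
  "finite A \<Longrightarrow> (\<And>a. a \<in> A \<Longrightarrow> f a \<in> carrier F) \<Longrightarrow> coeff b (sum f A) = finsum V (\<lambda>a. coeff b (f a)) A"
proof (induction A rule: finite_induct)
  case empty
  then show ?case by (simp add: coeff_def)
next
  case (insert a A)
  have "sum f A \<in> carrier F" by (rule free_prod_sum_closed) (use insert in auto)
  then show ?case using insert by (simp add: coeff_add coeff_closed Pi_iff)
qed

lemma coeff_finite: "p \<in> carrier F \<Longrightarrow> finite {b \<in> B. coeff b p \<noteq> \<zero>\<^bsub>V\<^esub>}"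
proof (rule finite_subset[of _ "\<Union>k\<in>Poly_Mapping.keys p. {b. coord (snd k) b \<noteq> 0}"])
  assume p: "p \<in> carrier F"
  show "{b \<in> B. coeff b p \<noteq> \<zero>\<^bsub>V\<^esub>} \<subseteq> (\<Union>k\<in>Poly_Mapping.keys p. {b. coord (snd k) b \<noteq> 0})"
  proof
    fix b assume b: "b \<in> {b \<in> B. coeff b p \<noteq> \<zero>\<^bsub>V\<^esub>}"
    show "b \<in> (\<Union>k\<in>Poly_Mapping.keys p. {b. coord (snd k) b \<noteq> 0})"
    proof (rule ccontr)
      assume "b \<notin> (\<Union>k\<in>Poly_Mapping.keys p. {b. coord (snd k) b \<noteq> 0})"
      then have "finsum V (\<lambda>k. (Poly_Mapping.lookup p k * coord (snd k) b) \<odot>\<^bsub>V\<^esub> fst k) (Poly_Mapping.keys p) = finsum V (\<lambda>k. \<zero>\<^bsub>V\<^esub>) (Poly_Mapping.keys p)"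
        by (intro V.M.finsum_cong') (use p in \<open>auto simp: free_prod_simps V.smult_distribs\<close>)
      then show False using b by (simp add: coeff_def)
    qed
  qed
  show "finite (\<Union>k\<in>Poly_Mapping.keys p. {b. coord (snd k) b \<noteq> 0})"
    using p by (auto simp: free_prod_simps intro!: coord_finite)
qed

definition expansion :: "(('v \<times> 'w) \<Rightarrow>\<^sub>0 complex) \<Rightarrow> 'w \<Rightarrow> 'v" where
  "expansion p = (\<lambda>b\<in>B. coeff b p)"

end

lemma (in cmodule) minus_minus_add:
  "a \<in> carrier V \<Longrightarrow> b \<in> carrier V \<Longrightarrow> a \<oplus> b \<ominus> a \<ominus> b = \<zero>"
proof -
  assume a: "a \<in> carrier V" "b \<in> carrier V"
  then have "a \<oplus> b \<ominus> a \<ominus> b = (a \<oplus> b) \<oplus> \<ominus> (a \<oplus> b)"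
    by (simp add: a_minus_def M.minus_add M.a_assoc)
  then show ?thesis using a by (simp only: M.r_neg ab(1))
qed

lemma poly_mapping_sum_single: "p = (\<Sum>k\<in>Poly_Mapping.keys p. Poly_Mapping.single k (Poly_Mapping.lookup p k))"
  by (rule poly_mapping_eqI) (simp add: lookup_sum lookup_single when_def in_keys_iff)

section \<open>Congruence modulo the bilinearity relations\<close>

context tensor_basis begin

lemma rels_carrier: "tensor_rels V W \<subseteq> carrier F"
proof -
  have s: "Poly_Mapping.single (a, b) c \<in> carrier F" if "a \<in> carrier V" "b \<in> carrier W" for a b c
    using that by (simp add: free_prod_simps)
  have d: "p - q \<in> carrier F" if "p \<in> carrier F" "q \<in> carrier F" for p q
    using that keys_diff[of p q] by (auto simp: free_prod_simps)
  show ?thesis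
    unfolding tensor_rels_def by (auto intro!: s d simp: V.ab ab)
qed

abbreviation N where "N \<equiv> LinearCombinations.module.span class_ring F (tensor_rels V W)"

lemma N_facts:
  shows N_carrier: "N \<subseteq> carrier F" and N_zero: "0 \<in> N"
    and N_add: "p \<in> N \<Longrightarrow> q \<in> N \<Longrightarrow> p + q \<in> N"
    and N_scale: "p \<in> N \<Longrightarrow> Poly_Mapping.map ((*) c) p \<in> N"
    and N_rels: "p \<in> tensor_rels V W \<Longrightarrow> p \<in> N"
proof -
  interpret F: cmodule F by (rule cmodule.intro) (rule module_free_prod)
  have "submodule class_ring N F" by (rule F.span_is_submodule[OF rels_carrier])
  then show "N \<subseteq> carrier F" "0 \<in> N" "p \<in> N \<Longrightarrow> q \<in> N \<Longrightarrow> p + q \<in> N"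
    "p \<in> N \<Longrightarrow> Poly_Mapping.map ((*) c) p \<in> N"
    by (simp_all add: submodule_def free_prod_simps)
  show "p \<in> tensor_rels V W \<Longrightarrow> p \<in> N"
    by (rule subsetD[OF F.in_own_span[OF rels_carrier]])
qed

text \<open>Equality in the tensor product, kept at the level of representatives so that finite sums
  can be manipulated as polynomial mappings.\<close>

definition cong :: "(('v \<times> 'w) \<Rightarrow>\<^sub>0 complex) \<Rightarrow> (('v \<times> 'w) \<Rightarrow>\<^sub>0 complex) \<Rightarrow> bool"  (infix "\<approx>" 50) where
  "p \<approx> q \<longleftrightarrow> p - q \<in> N"

lemma cong_refl: "p \<approx> p" by (simp add: cong_def N_zero)

lemma cong_sym: assumes "p \<approx> q" shows "q \<approx> p"
proof -
  have "q - p = Poly_Mapping.map ((*) (- 1)) (p - q)"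
    by (rule poly_mapping_eqI) (simp add: lookup_minus)
  then show ?thesis using N_scale[of "p - q" "- 1"] assms by (simp add: cong_def)
qed

lemma cong_add: assumes "p \<approx> q" "p' \<approx> q'" shows "p + p' \<approx> q + q'"
proof -
  have "p + p' - (q + q') = (p - q) + (p' - q')" by simp
  then show ?thesis using N_add assms unfolding cong_def by presburger
qed

lemma cong_trans [trans]: assumes "p \<approx> q" "q \<approx> r" shows "p \<approx> r"
proof -
  have "p - r = (p - q) + (q - r)" by simp
  then show ?thesis using N_add assms unfolding cong_def by presburger
qed

lemma cong_sum: "(\<And>a. a \<in> A \<Longrightarrow> f a \<approx> g a) \<Longrightarrow> sum f A \<approx> sum g A"
  by (induction A rule: infinite_finite_induct) (simp_all add: cong_refl cong_add)

text \<open>The relations are stated with coefficient 1; scaling them yields bilinearity for pure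
  tensors with an arbitrary coefficient.\<close>

lemma cong_rel:
  assumes "p - q - r \<in> tensor_rels V W"
  shows "Poly_Mapping.map ((*) c) p \<approx> Poly_Mapping.map ((*) c) q + Poly_Mapping.map ((*) c) r"
proof -
  have "Poly_Mapping.map ((*) c) p - (Poly_Mapping.map ((*) c) q + Poly_Mapping.map ((*) c) r)
      = Poly_Mapping.map ((*) c) (p - q - r)"
    by (rule poly_mapping_eqI) (simp add: lookup_minus lookup_add algebra_simps)
  then show ?thesis using N_scale[OF N_rels[OF assms], of c] by (simp add: cong_def)
qed

lemma cong_rel':
  assumes "p - q \<in> tensor_rels V W"
  shows "Poly_Mapping.map ((*) c) p \<approx> Poly_Mapping.map ((*) c) q"
proof -
  have "Poly_Mapping.map ((*) c) p - Poly_Mapping.map ((*) c) q = Poly_Mapping.map ((*) c) (p - q)"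
    by (rule poly_mapping_eqI) (simp add: lookup_minus algebra_simps)
  then show ?thesis using N_scale[OF N_rels[OF assms], of c] by (simp add: cong_def)
qed

lemma scale_single [simp]: "Poly_Mapping.map ((*) c) (Poly_Mapping.single k d) = Poly_Mapping.single k (c * d)"
  for c d :: complex
  by (rule poly_mapping_eqI) (simp add: lookup_single when_def)

lemma cong_addV:
  assumes "v \<in> carrier V" "v' \<in> carrier V" "w \<in> carrier W"
  shows "Poly_Mapping.single (v \<oplus>\<^bsub>V\<^esub> v', w) c \<approx> Poly_Mapping.single (v, w) c + Poly_Mapping.single (v', w) c"
proof -
  have "Poly_Mapping.single (v \<oplus>\<^bsub>V\<^esub> v', w) 1 - Poly_Mapping.single (v, w) 1 - Poly_Mapping.single (v', w) 1
      \<in> tensor_rels V W"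
    unfolding tensor_rels_def by (intro UnI1 CollectI exI conjI) (rule refl assms)+
  from cong_rel[OF this, of c] show ?thesis by simp
qed

lemma cong_addW:
  assumes "v \<in> carrier V" "w \<in> carrier W" "w' \<in> carrier W"
  shows "Poly_Mapping.single (v, w \<oplus>\<^bsub>W\<^esub> w') c \<approx> Poly_Mapping.single (v, w) c + Poly_Mapping.single (v, w') c"
proof -
  have "Poly_Mapping.single (v, w \<oplus>\<^bsub>W\<^esub> w') 1 - Poly_Mapping.single (v, w) 1 - Poly_Mapping.single (v, w') 1
      \<in> tensor_rels V W"
    unfolding tensor_rels_def
    by (rule UnI1, rule UnI1, rule UnI2, intro CollectI exI conjI) (rule refl assms)+
  from cong_rel[OF this, of c] show ?thesis by simp
qed

lemma cong_smultV:
  assumes "v \<in> carrier V" "w \<in> carrier W"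
  shows "Poly_Mapping.single (k \<odot>\<^bsub>V\<^esub> v, w) c \<approx> Poly_Mapping.single (v, w) (c * k)"
proof -
  have "Poly_Mapping.single (k \<odot>\<^bsub>V\<^esub> v, w) 1 - Poly_Mapping.single (v, w) k \<in> tensor_rels V W"
    unfolding tensor_rels_def
    by (rule UnI1, rule UnI2, intro CollectI exI conjI) (rule refl assms)+
  from cong_rel'[OF this, of c] show ?thesis by simp
qed

lemma cong_smultW:
  assumes "v \<in> carrier V" "w \<in> carrier W"
  shows "Poly_Mapping.single (v, k \<odot>\<^bsub>W\<^esub> w) c \<approx> Poly_Mapping.single (v, w) (c * k)"
proof -
  have "Poly_Mapping.single (v, k \<odot>\<^bsub>W\<^esub> w) 1 - Poly_Mapping.single (v, w) k \<in> tensor_rels V W"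
    unfolding tensor_rels_def by (rule UnI2, intro CollectI exI conjI) (rule refl assms)+
  from cong_rel'[OF this, of c] show ?thesis by simp
qed

lemma cong_zeroV: "w \<in> carrier W \<Longrightarrow> Poly_Mapping.single (\<zero>\<^bsub>V\<^esub>, w) c \<approx> 0"
  using cong_smultV[of "\<zero>\<^bsub>V\<^esub>" w 0 c] by (simp add: V.smult_distribs V.ab)

lemma cong_zeroW: "v \<in> carrier V \<Longrightarrow> Poly_Mapping.single (v, \<zero>\<^bsub>W\<^esub>) c \<approx> 0"
  using cong_smultW[of v "\<zero>\<^bsub>W\<^esub>" 0 c] by (simp add: smult_distribs ab)

lemma cong_finsumV:
  assumes "finite A" "\<And>a. a \<in> A \<Longrightarrow> f a \<in> carrier V" "w \<in> carrier W"
  shows "Poly_Mapping.single (finsum V f A, w) c \<approx> (\<Sum>a\<in>A. Poly_Mapping.single (f a, w) c)"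
  using assms
proof (induction A rule: finite_induct)
  case (insert a A)
  have fA: "finsum V f A \<in> carrier V" by (rule V.M.finsum_closed) (use insert in auto)
  have e: "finsum V f (insert a A) = f a \<oplus>\<^bsub>V\<^esub> finsum V f A"
    by (rule V.M.finsum_insert) (use insert in auto)
  have "Poly_Mapping.single (finsum V f (insert a A), w) c \<approx>
      Poly_Mapping.single (f a, w) c + Poly_Mapping.single (finsum V f A, w) c"
    unfolding e by (rule cong_addV) (use insert fA in auto)
  also have "\<dots> \<approx> Poly_Mapping.single (f a, w) c + (\<Sum>a\<in>A. Poly_Mapping.single (f a, w) c)"
    by (rule cong_add[OF cong_refl]) (use insert in simp)
  finally show ?case using insert by simp
qed (simp add: cong_zeroV)

lemma cong_finsumW:
  assumes "finite A" "\<And>a. a \<in> A \<Longrightarrow> f a \<in> carrier W" "v \<in> carrier V"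
  shows "Poly_Mapping.single (v, finsum W f A) c \<approx> (\<Sum>a\<in>A. Poly_Mapping.single (v, f a) c)"
  using assms
proof (induction A rule: finite_induct)
  case (insert a A)
  have fA: "finsum W f A \<in> carrier W" by (rule M.finsum_closed) (use insert in auto)
  have e: "finsum W f (insert a A) = f a \<oplus>\<^bsub>W\<^esub> finsum W f A"
    by (rule M.finsum_insert) (use insert in auto)
  have "Poly_Mapping.single (v, finsum W f (insert a A)) c \<approx>
      Poly_Mapping.single (v, f a) c + Poly_Mapping.single (v, finsum W f A) c"
    unfolding e by (rule cong_addW) (use insert fA in auto)
  also have "\<dots> \<approx> Poly_Mapping.single (v, f a) c + (\<Sum>a\<in>A. Poly_Mapping.single (v, f a) c)"
    by (rule cong_add[OF cong_refl]) (use insert in simp)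
  finally show ?case using insert by simp
qed (simp add: cong_zeroW)

text \<open>Second factors are expanded in the basis, bilinearity is applied, the two sums are
  exchanged and the first factors are collected again. An element whose coefficients all vanish is
  therefore zero in the tensor product.\<close>

lemma cong_coeff:
  assumes p: "p \<in> carrier F"
  obtains S where "finite S" "S \<subseteq> B" "p \<approx> (\<Sum>b\<in>S. Poly_Mapping.single (coeff b p, b) 1)"
proof
  let ?K = "Poly_Mapping.keys p"
  \<comment> \<open>All basis vectors that occur in the second factor of some pure tensor of
    \<open>p\<close>.\<close>
  define S where "S = (\<Union>k\<in>?K. {b. coord (snd k) b \<noteq> 0})"
  have K: "fst k \<in> carrier V" "snd k \<in> carrier W" if "k \<in> ?K" for k
    using p that by (auto simp: free_prod_simps)
  show fin: "finite S" unfolding S_def by (intro finite_UN_I finite_keys coord_finite K)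
  show SB: "S \<subseteq> B" unfolding S_def using coord_outside by blast
  have Sc: "b \<in> carrier W" if "b \<in> S" for b using that SB basis_carrier by auto
  let ?t = "\<lambda>k b. Poly_Mapping.single (fst k, b) (Poly_Mapping.lookup p k * coord (snd k) b)"
  have 1: "Poly_Mapping.single k (Poly_Mapping.lookup p k) \<approx> (\<Sum>b\<in>S. ?t k b)" if k: "k \<in> ?K" for k
  proof -
    have "snd k = finsum W (\<lambda>b. coord (snd k) b \<odot>\<^bsub>W\<^esub> b) {b. coord (snd k) b \<noteq> 0}"
      by (rule expand[OF K(2)[OF k]])
    also have "\<dots> = finsum W (\<lambda>b. coord (snd k) b \<odot>\<^bsub>W\<^esub> b) S"
      by (rule finsum_superset[symmetric]) (use fin k Sc in \<open>auto simp: S_def smult_distribs\<close>)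
    finally have e: "finsum W (\<lambda>b. coord (snd k) b \<odot>\<^bsub>W\<^esub> b) S = snd k" by (rule sym)
    have "Poly_Mapping.single (fst k, finsum W (\<lambda>b. coord (snd k) b \<odot>\<^bsub>W\<^esub> b) S) (Poly_Mapping.lookup p k) \<approx>
      (\<Sum>b\<in>S. Poly_Mapping.single (fst k, coord (snd k) b \<odot>\<^bsub>W\<^esub> b) (Poly_Mapping.lookup p k))"
      by (rule cong_finsumW) (use fin k Sc K in auto)
    also have "\<dots> \<approx> (\<Sum>b\<in>S. ?t k b)"
      by (rule cong_sum, rule cong_smultW) (use k Sc K in auto)
    finally show ?thesis unfolding e by simp
  qed
  have 2: "Poly_Mapping.single (coeff b p, b) 1 \<approx> (\<Sum>k\<in>?K. ?t k b)" if b: "b \<in> S" for b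
  proof -
    have "Poly_Mapping.single (coeff b p, b) 1 \<approx>
      (\<Sum>k\<in>?K. Poly_Mapping.single ((Poly_Mapping.lookup p k * coord (snd k) b) \<odot>\<^bsub>V\<^esub> fst k, b) 1)"
      unfolding coeff_def by (rule cong_finsumV) (use K Sc[OF b] in auto)
    also have "\<dots> \<approx> (\<Sum>k\<in>?K. Poly_Mapping.single (fst k, b) (1 * (Poly_Mapping.lookup p k * coord (snd k) b)))"
      by (rule cong_sum, rule cong_smultV) (use K Sc[OF b] in auto)
    finally show ?thesis by simp
  qed
  have "p = (\<Sum>k\<in>?K. Poly_Mapping.single k (Poly_Mapping.lookup p k))" by (rule poly_mapping_sum_single)
  also have "\<dots> \<approx> (\<Sum>k\<in>?K. \<Sum>b\<in>S. ?t k b)" by (rule cong_sum) (rule 1)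
  also have "\<dots> = (\<Sum>b\<in>S. \<Sum>k\<in>?K. ?t k b)" by (rule sum.swap)
  also have "\<dots> \<approx> (\<Sum>b\<in>S. Poly_Mapping.single (coeff b p, b) 1)"
    by (rule cong_sum) (rule cong_sym[OF 2])
  finally show "p \<approx> (\<Sum>b\<in>S. Poly_Mapping.single (coeff b p, b) 1)" .
qed

lemma expansion_hom: "expansion \<in> LinearCombinations.module_hom class_ring F FF"
  unfolding LinearCombinations.module_hom_def
  by (auto simp: fin_fun_simps expansion_def coeff_closed coeff_finite free_prod_simps(3,4) coeff_add coeff_scale
      restrict_def simp del: lookup_scale cong: conj_cong)

text \<open>One inclusion is \<open>cong_coeff\<close> with all coefficients zero; for the other,
  \<open>coeff b\<close> is checked to vanish on each of the four kinds of relations.\<close>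

lemma kernel_expansion: "{p \<in> carrier F. expansion p = \<zero>\<^bsub>FF\<^esub>} = N"
proof
  show "{p \<in> carrier F. expansion p = \<zero>\<^bsub>FF\<^esub>} \<subseteq> N"
  proof
    fix p assume "p \<in> {p \<in> carrier F. expansion p = \<zero>\<^bsub>FF\<^esub>}"
    then have p: "p \<in> carrier F" and z: "(\<lambda>b\<in>B. coeff b p) = (\<lambda>b\<in>B. \<zero>\<^bsub>V\<^esub>)"
      by (simp_all add: expansion_def fin_fun_simps)
    have z: "coeff b p = \<zero>\<^bsub>V\<^esub>" if "b \<in> B" for b using fun_cong[OF z, of b] that by simp
    obtain S where S: "finite S" "S \<subseteq> B" "p \<approx> (\<Sum>b\<in>S. Poly_Mapping.single (coeff b p, b) 1)"
      by (rule cong_coeff[OF p])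
    note S(3)
    also have "(\<Sum>b\<in>S. Poly_Mapping.single (coeff b p, b) 1) \<approx> (\<Sum>b\<in>S. 0)"
    proof (rule cong_sum)
      fix b assume "b \<in> S"
      then have "b \<in> B" "b \<in> carrier W" using S(2) basis_carrier by auto
      then show "Poly_Mapping.single (coeff b p, b) 1 \<approx> 0" by (simp add: z cong_zeroV)
    qed
    finally show "p \<in> N" by (simp add: cong_def)
  qed
  interpret F: cmodule F by (rule cmodule.intro) (rule module_free_prod)
  interpret FF: cmodule FF by (rule cmodule.intro) (rule module_fin_fun[OF V.is_module])
  interpret e: clinear F FF expansion
    by (rule clinear.intro[OF F.cmodule_axioms FF.cmodule_axioms]) (rule clinear_axioms.intro[OF expansion_hom])
  show "N \<subseteq> {p \<in> carrier F. expansion p = \<zero>\<^bsub>FF\<^esub>}"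
  proof (rule F.span_is_subset)
    show "submodule class_ring {p \<in> carrier F. expansion p = \<zero>\<^bsub>FF\<^esub>} F"
      using F.is_module by (auto simp: submodule_def e.zero e.add e.smult FF.smult_distribs F.ab FF.ab)
    show "tensor_rels V W \<subseteq> {p \<in> carrier F. expansion p = \<zero>\<^bsub>FF\<^esub>}"
    proof (rule subsetI, rule CollectI, rule conjI)
      fix r assume r: "r \<in> tensor_rels V W"
      show "r \<in> carrier F" by (rule subsetD[OF rels_carrier r])
      have s: "Poly_Mapping.single (a, b) c \<in> carrier F" if "a \<in> carrier V" "b \<in> carrier W" for a b c
        using that by (simp add: free_prod_simps)
      have d: "p - q \<in> carrier F" if "p \<in> carrier F" "q \<in> carrier F" for p q
        using that keys_diff[of p q] by (auto simp: free_prod_simps)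
      have "coeff b r = \<zero>\<^bsub>V\<^esub>" for b
        using r unfolding tensor_rels_def
        by (elim UnE CollectE exE conjE)
          (simp_all add: coeff_minus coeff_single s d V.ab(1) ab(1) coord_add coord_smult V.smult_distribs
            V.minus_minus_add mult.commute)
      then show "expansion r = \<zero>\<^bsub>FF\<^esub>" by (simp add: expansion_def fin_fun_simps)
    qed
  qed
qed

lemma graded_epi_expansion:
  assumes act: "\<And>x. x \<in> S \<Longrightarrow> act V x \<in> LinearCombinations.module_hom class_ring V V"
  shows "graded_epi S F FF expansion"
proof -
  interpret FF: cmodule FF by (rule cmodule.intro) (rule module_fin_fun[OF V.is_module])
  have exp_cl: "expansion p \<in> carrier FF" if "p \<in> carrier F" for p
    using that expansion_hom by (auto simp: LinearCombinations.module_hom_def)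
  have V0: "hcomp V 0 = carrier V" "d \<noteq> 0 \<Longrightarrow> hcomp V d = {\<zero>\<^bsub>V\<^esub>}" for d
    using V_zero by (simp_all add: in_degree_zero_def)
  have Vh: "hcomp V d \<subseteq> carrier V" for d by (cases "d = 0") (simp_all add: V0 V.ab)
  \<comment> \<open>The preimage of \<open>h\<close> is the sum of the pure tensors of
    \<open>h b\<close> with \<open>b\<close> over the support of \<open>h\<close>. The predicate
    \<open>keys_sub\<close> is left free so that the same element serves for the carrier and for
    each homogeneous component.\<close>
  have sect: "\<exists>p. keys_sub p \<and> expansion p = h"
    if h: "h \<in> carrier FF" and ks: "\<And>p. Poly_Mapping.keys p \<subseteq> (\<lambda>b. (h b, b)) ` {b \<in> B. h b \<noteq> \<zero>\<^bsub>V\<^esub>} \<Longrightarrow> keys_sub p"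
    for h keys_sub
  proof (intro exI conjI)
    let ?S = "{b \<in> B. h b \<noteq> \<zero>\<^bsub>V\<^esub>}" and ?f = "\<lambda>b. Poly_Mapping.single (h b, b) (1::complex)"
    have fin: "finite ?S" and hV: "\<And>b. b \<in> B \<Longrightarrow> h b \<in> carrier V" and hext: "h \<in> extensional B"
      using h by (auto simp: fin_fun_simps PiE_iff)
    have "Poly_Mapping.keys (sum ?f ?S) \<subseteq> (\<Union>b\<in>?S. Poly_Mapping.keys (?f b))" by (rule keys_sum)
    then show "keys_sub (sum ?f ?S)" by (intro ks) auto
    have fc: "?f b \<in> carrier F" if "b \<in> ?S" for b
      using that hV basis_carrier by (auto simp: free_prod_simps)
    have "coeff b' (sum ?f ?S) = h b'" if b': "b' \<in> B" for b'
    proof -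
      have "coeff b' (sum ?f ?S) = finsum V (\<lambda>b. coeff b' (?f b)) ?S"
        by (rule coeff_sum[OF fin fc])
      also have "\<dots> = finsum V (\<lambda>b. if b' = b then h b else \<zero>\<^bsub>V\<^esub>) ?S"
        by (rule V.M.finsum_cong')
          (use hV basis_carrier in \<open>auto simp: coeff_single coord_basis V.smult_distribs V.ab\<close>)
      also have "\<dots> = h b'"
      proof (cases "b' \<in> ?S")
        case True
        show ?thesis by (rule V.M.finsum_singleton[OF True fin]) (use hV in auto)
      next
        case False
        then have "finsum V (\<lambda>b. if b' = b then h b else \<zero>\<^bsub>V\<^esub>) ?S = finsum V (\<lambda>b. \<zero>\<^bsub>V\<^esub>) ?S"
          by (intro V.M.finsum_cong') (auto simp: V.ab)
        then show ?thesis using False b' by simp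
      qed
      finally show ?thesis .
    qed
    then show "expansion (sum ?f ?S) = h"
      unfolding expansion_def using hext by (intro extensionalityI[of _ B]) auto
  qed
  show ?thesis
  proof (rule graded_epiI)
    show "expansion p \<in> carrier FF" if "p \<in> carrier F" for p by (rule exp_cl[OF that])
    show "expansion (p \<oplus>\<^bsub>F\<^esub> q) = expansion p \<oplus>\<^bsub>FF\<^esub> expansion q" if "p \<in> carrier F" "q \<in> carrier F" for p q
      using expansion_hom that by (simp add: LinearCombinations.module_hom_def)
    show "expansion (c \<odot>\<^bsub>F\<^esub> p) = c \<odot>\<^bsub>FF\<^esub> expansion p" if "p \<in> carrier F" for c p
      using expansion_hom that by (simp add: LinearCombinations.module_hom_def)
    show "\<exists>p\<in>carrier F. expansion p = h" if h: "h \<in> carrier FF" for h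
    proof -
      have "\<exists>p. p \<in> carrier F \<and> expansion p = h"
        by (rule sect[OF h]) (use h basis_carrier in \<open>auto simp: free_prod_simps fin_fun_simps PiE_iff\<close>)
      then show ?thesis by auto
    qed
    show "\<exists>p\<in>hcomp F d. expansion p = h" if h: "h \<in> hcomp FF d" for h d
    proof -
      have "h b \<in> hcomp V 0" "b \<in> hcomp W (d - 0)" if "b \<in> B" "h b \<noteq> \<zero>\<^bsub>V\<^esub>" for b
        using h that by (auto simp: fin_fun_simps PiE_iff V0)
      then have "(\<lambda>b. (h b, b)) ` {b \<in> B. h b \<noteq> \<zero>\<^bsub>V\<^esub>} \<subseteq> (\<Union>i. hcomp V i \<times> hcomp W (d - i))" by fast
      then have "\<exists>p. p \<in> hcomp F d \<and> expansion p = h"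
        by (intro sect) (use h in \<open>auto simp: free_prod_simps fin_fun_simps\<close>)
      then show ?thesis by auto
    qed
    show "p \<in> carrier F \<and> expansion p \<in> hcomp FF d" if p: "p \<in> hcomp F d" for p d
    proof
      have K: "\<exists>i. fst k \<in> hcomp V i \<and> snd k \<in> hcomp W (d - i)" if "k \<in> Poly_Mapping.keys p" for k
      proof -
        have "k \<in> (\<Union>i. hcomp V i \<times> hcomp W (d - i))" using p that by (auto simp: free_prod_simps)
        then show ?thesis by auto
      qed
      have "fst k \<in> carrier V \<and> snd k \<in> carrier W" if "k \<in> Poly_Mapping.keys p" for k
        using K[OF that] Vh hcomp_carrier by auto
      then show pF: "p \<in> carrier F" by (auto simp: free_prod_simps)
      have "coeff b p = \<zero>\<^bsub>V\<^esub>" if b: "b \<notin> hcomp W d" for b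
      proof -
        have "(Poly_Mapping.lookup p k * coord (snd k) b) \<odot>\<^bsub>V\<^esub> fst k = \<zero>\<^bsub>V\<^esub>" if k: "k \<in> Poly_Mapping.keys p" for k
        proof -
          obtain i where i: "fst k \<in> hcomp V i" "snd k \<in> hcomp W (d - i)" using K[OF k] by auto
          \<comment> \<open>For i = 0 the second factor has degree d and does not involve
            \<open>b\<close>; otherwise the first factor is zero, as \<open>V\<close> sits in degree
            0.\<close>
          show ?thesis
          proof (cases "i = 0")
            case True
            then have "coord (snd k) b = 0" using coord_hcomp[of "snd k" d b] i(2) b by auto
            then show ?thesis using subsetD[OF Vh i(1)] by (simp add: V.smult_distribs)
          next
            case False
            then show ?thesis using i(1) by (simp add: V0 V.smult_distribs)
          qed
        qed
        then have "coeff b p = finsum V (\<lambda>k. \<zero>\<^bsub>V\<^esub>) (Poly_Mapping.keys p)"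
          unfolding coeff_def by (intro V.M.finsum_cong') (auto simp: V.ab)
        then show ?thesis by simp
      qed
      then show "expansion p \<in> hcomp FF d"
        using exp_cl[OF pF] by (auto simp: fin_fun_simps(5) expansion_def)
    qed
    fix x p assume x: "x \<in> S" and p: "p \<in> carrier F"
    interpret a: clinear V V "act V x"
      by (rule clinear.intro[OF V.cmodule_axioms V.cmodule_axioms]) (rule clinear_axioms.intro[OF act[OF x]])
    have K: "fst k \<in> carrier V" "snd k \<in> carrier W" if "k \<in> Poly_Mapping.keys p" for k
      using p that by (auto simp: free_prod_simps)
    have fc: "Poly_Mapping.single (act V x (fst k), snd k) (Poly_Mapping.lookup p k) \<in> carrier F"
      if "k \<in> Poly_Mapping.keys p" for k
      using K[OF that] a.cl by (simp add: free_prod_simps)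
    show "act F x p \<in> carrier F"
      unfolding free_prod_simps(6) by (rule free_prod_sum_closed) (use fc in auto)
    have "coeff b (act F x p) = act V x (coeff b p)" for b
    proof -
      have "coeff b (act F x p) =
          finsum V (\<lambda>k. coeff b (Poly_Mapping.single (act V x (fst k), snd k) (Poly_Mapping.lookup p k))) (Poly_Mapping.keys p)"
        unfolding free_prod_simps(6) by (rule coeff_sum) (use fc in auto)
      also have "\<dots> = finsum V (\<lambda>k. act V x ((Poly_Mapping.lookup p k * coord (snd k) b) \<odot>\<^bsub>V\<^esub> fst k)) (Poly_Mapping.keys p)"
        by (rule V.M.finsum_cong') (use K a.cl in \<open>auto simp: coeff_single a.smult\<close>)
      also have "\<dots> = act V x (coeff b p)"
        unfolding coeff_def by (rule a.finsum[symmetric]) (use K in auto)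
      finally show ?thesis .
    qed
    then show "expansion (act F x p) = act FF x (expansion p)"
      by (auto simp: expansion_def fin_fun_simps)
  qed
qed

lemma tensor_iso_fin_fun:
  assumes act: "\<And>x. x \<in> S \<Longrightarrow> act V x \<in> LinearCombinations.module_hom class_ring V V"
  obtains g where "graded_epi S (tensor V W) FF g" "inj_on g (carrier (tensor V W))"
  unfolding tensor_def
  by (rule graded_epi_quot_kernel[OF graded_epi_expansion[OF act] module_free_prod
      module_fin_fun[OF V.is_module] kernel_expansion[symmetric]])

lemma tensor_closed:
  "a \<in> carrier (tensor V W) \<Longrightarrow> b \<in> carrier (tensor V W) \<Longrightarrow> a \<oplus>\<^bsub>tensor V W\<^esub> b \<in> carrier (tensor V W)"
  "a \<in> carrier (tensor V W) \<Longrightarrow> c \<odot>\<^bsub>tensor V W\<^esub> a \<in> carrier (tensor V W)"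
proof -
  interpret q: cquot F N
    by (intro cquot.intro cmodule.intro cquot_axioms.intro module_free_prod)
      (simp_all only: free_prod_simps(2-4) N_carrier N_zero N_add N_scale)
  show "a \<in> carrier (tensor V W) \<Longrightarrow> b \<in> carrier (tensor V W) \<Longrightarrow> a \<oplus>\<^bsub>tensor V W\<^esub> b \<in> carrier (tensor V W)"
    "a \<in> carrier (tensor V W) \<Longrightarrow> c \<odot>\<^bsub>tensor V W\<^esub> a \<in> carrier (tensor V W)"
    unfolding tensor_def by (fact q.quot_closed)+
qed

end

section \<open>Highest weight modules\<close>

lemma trace_mult_commute:
  fixes X Y :: "complex mat"
  assumes "X \<in> carrier_mat n n" "Y \<in> carrier_mat n n"
  shows "(\<Sum>i<n. (X * Y) $$ (i, i)) = (\<Sum>i<n. (Y * X) $$ (i, i))"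
proof -
  have e: "(\<Sum>i<n. (X * Y) $$ (i, i)) = (\<Sum>i<n. \<Sum>k<n. X $$ (i, k) * Y $$ (k, i))"
    if "X \<in> carrier_mat n n" "Y \<in> carrier_mat n n" for X Y :: "complex mat"
    using that by (auto simp: scalar_prod_def atLeast0LessThan intro!: sum.cong)
  show ?thesis
    unfolding e[OF assms] e[OF assms(2,1)] by (subst sum.swap) (simp add: mult.commute)
qed

lemma sl_add: "X \<in> sl n \<Longrightarrow> Y \<in> sl n \<Longrightarrow> X + Y \<in> sl n"
  by (auto simp: sl_def sum.distrib)

lemma sl_smult: "X \<in> sl n \<Longrightarrow> c \<cdot>\<^sub>m X \<in> sl n"
proof -
  assume X: "X \<in> sl n"
  have "(\<Sum>i<n. (c \<cdot>\<^sub>m X) $$ (i, i)) = (\<Sum>i<n. c * X $$ (i, i))"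
    by (rule sum.cong) (use X in \<open>auto simp: sl_def\<close>)
  then show ?thesis using X by (simp add: sl_def sum_distrib_left[symmetric])
qed

lemma commutator_sl: "X \<in> sl n \<Longrightarrow> Y \<in> sl n \<Longrightarrow> X * Y - Y * X \<in> sl n"
proof -
  assume XY: "X \<in> sl n" "Y \<in> sl n"
  then have c: "X \<in> carrier_mat n n" "Y \<in> carrier_mat n n" by (simp_all add: sl_def)
  have "(\<Sum>i<n. (X * Y - Y * X) $$ (i, i)) = (\<Sum>i<n. (X * Y) $$ (i, i) - (Y * X) $$ (i, i))"
    by (rule sum.cong) (use c in auto)
  then show ?thesis using trace_mult_commute[OF c] minus_carrier_mat[OF mult_carrier_mat[OF c(2,1)], of "X * Y"]
    by (simp only: sl_def sum_subtractf mem_Collect_eq diff_self simp_thms)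
qed

definition unit_mat :: "nat \<Rightarrow> nat \<Rightarrow> nat \<Rightarrow> complex mat" where
  "unit_mat n i j = mat n n (\<lambda>(a, b). if a = i \<and> b = j then 1 else 0)"

text \<open>The sum of the positive coroots, with diagonal n - 1, n - 3, ..., 1 - n. Every strictly
  lower matrix unit lowers its eigenvalue, so this one element separates the top weight from the
  lower ones.\<close>

definition H_rho :: "nat \<Rightarrow> complex mat" where
  "H_rho n = mat n n (\<lambda>(a, b). if a = b then of_nat n - 1 - 2 * of_nat a else 0)"

lemma unit_mat_carrier [simp]: "unit_mat n i j \<in> carrier_mat n n"
  by (simp add: unit_mat_def)

lemma unit_mat_sl: "i \<noteq> j \<Longrightarrow> unit_mat n i j \<in> sl n"
  by (auto simp: sl_def unit_mat_def)

lemma H_rho_sl: "H_rho n \<in> sl n"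
proof -
  have "(\<Sum>i<n. of_nat n - 1 - 2 * of_nat i :: complex) = 0"
  proof -
    \<comment> \<open>The constant n is freed to \<open>c\<close>, so that induction on the number
      of terms goes through.\<close>
    have "(\<Sum>i<m. c - 1 - 2 * of_nat i :: complex) = of_nat m * (c - of_nat m)" for m c
      by (induction m) (simp_all add: algebra_simps)
    then show ?thesis by simp
  qed
  then show ?thesis by (simp add: sl_def H_rho_def)
qed

lemma H_rho_diagonal: "diagonal_mat (H_rho n)"
  by (simp add: diagonal_mat_def H_rho_def)

lemma H_rho_commutator:
  assumes "i < n" "j < n"
  shows "H_rho n * unit_mat n i j - unit_mat n i j * H_rho n = (2 * (of_nat j - of_nat i)) \<cdot>\<^sub>m unit_mat n i j"
proof (rule eq_matI)
  fix a b assume ab: "a < dim_row ((2 * (of_nat j - of_nat i)) \<cdot>\<^sub>m unit_mat n i j)"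
    "b < dim_col ((2 * (of_nat j - of_nat i)) \<cdot>\<^sub>m unit_mat n i j)"
  have 1: "(H_rho n * unit_mat n i j) $$ (a, b) = (\<Sum>k<n. H_rho n $$ (a, k) * unit_mat n i j $$ (k, b))"
    "(unit_mat n i j * H_rho n) $$ (a, b) = (\<Sum>k<n. unit_mat n i j $$ (a, k) * H_rho n $$ (k, b))"
    using ab by (auto simp: scalar_prod_def atLeast0LessThan H_rho_def unit_mat_def intro!: sum.cong)
  have 2: "(\<Sum>k<n. H_rho n $$ (a, k) * unit_mat n i j $$ (k, b)) = (if a = i \<and> b = j then of_nat n - 1 - 2 * of_nat i else 0)"
    using ab assms by (simp add: H_rho_def unit_mat_def if_distrib[of "\<lambda>x. x * _"] if_distrib[of "\<lambda>x. _ * x"] sum.delta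
        cong: if_cong) 
  have 3: "(\<Sum>k<n. unit_mat n i j $$ (a, k) * H_rho n $$ (k, b)) = (if a = i \<and> b = j then of_nat n - 1 - 2 * of_nat j else 0)"
    using ab assms by (simp add: H_rho_def unit_mat_def if_distrib[of "\<lambda>x. x * _"] if_distrib[of "\<lambda>x. _ * x"] sum.delta
        cong: if_cong)
  have d: "(H_rho n * unit_mat n i j - unit_mat n i j * H_rho n) $$ (a, b) =
      (H_rho n * unit_mat n i j) $$ (a, b) - (unit_mat n i j * H_rho n) $$ (a, b)"
    using ab by (simp add: H_rho_def unit_mat_def)
  show "(H_rho n * unit_mat n i j - unit_mat n i j * H_rho n) $$ (a, b) = ((2 * (of_nat j - of_nat i)) \<cdot>\<^sub>m unit_mat n i j) $$ (a, b)"
    unfolding d 1 2 3 using ab by (simp add: unit_mat_def algebra_simps)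
qed (simp_all add: H_rho_def unit_mat_def)

section \<open>The submodule generated by a highest weight vector\<close>

locale hw_module = cmodule Q for n :: nat and Q :: "(complex mat, 'q) gmod" (structure) and y and wt :: "complex mat \<Rightarrow> complex" +
  assumes sl: "sl_module n Q" and y: "y \<in> carrier Q"
    and upper: "X \<in> sl n \<Longrightarrow> (\<forall>i<n. \<forall>j\<le>i. X $$ (i, j) = 0) \<Longrightarrow> act Q X y = \<zero>"
    and diag: "H \<in> sl n \<Longrightarrow> diagonal_mat H \<Longrightarrow> act Q H y = wt H \<odot> y"
begin

lemma a_cl: "X \<in> sl n \<Longrightarrow> u \<in> carrier Q \<Longrightarrow> act Q X u \<in> carrier Q"
  using sl by (auto simp: sl_module_def LinearCombinations.module_hom_def)

lemma a_add: "X \<in> sl n \<Longrightarrow> u \<in> carrier Q \<Longrightarrow> v \<in> carrier Q \<Longrightarrow> act Q X (u \<oplus> v) = act Q X u \<oplus> act Q X v"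
  using sl by (auto simp: sl_module_def LinearCombinations.module_hom_def)

lemma a_smult: "X \<in> sl n \<Longrightarrow> u \<in> carrier Q \<Longrightarrow> act Q X (c \<odot> u) = c \<odot> act Q X u"
  using sl by (auto simp: sl_module_def LinearCombinations.module_hom_def)

lemma a_zero: "X \<in> sl n \<Longrightarrow> act Q X \<zero> = \<zero>"
  using a_smult[of X "\<zero>" 0] by (simp add: smult_distribs ab a_cl)

lemma a_addl: "X \<in> sl n \<Longrightarrow> Y \<in> sl n \<Longrightarrow> u \<in> carrier Q \<Longrightarrow> act Q (X + Y) u = act Q X u \<oplus> act Q Y u"
  using sl by (simp add: sl_module_def)

lemma a_smultl: "X \<in> sl n \<Longrightarrow> u \<in> carrier Q \<Longrightarrow> act Q (c \<cdot>\<^sub>m X) u = c \<odot> act Q X u"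
  using sl by (simp add: sl_module_def)

lemma a_comm: "X \<in> sl n \<Longrightarrow> Y \<in> sl n \<Longrightarrow> u \<in> carrier Q \<Longrightarrow>
    act Q X (act Q Y u) = act Q Y (act Q X u) \<oplus> act Q (X * Y - Y * X) u"
  using sl by (simp add: sl_module_def a_cl a_minus_def ab M.add.m_ac M.r_neg M.r_neg2 M.r_neg1)

text \<open>The span of the vectors of lower weight in the submodule generated by \<open>y\<close>.\<close>

inductive_set D where
  zero: "\<zero> \<in> D"
| add: "a \<in> D \<Longrightarrow> b \<in> D \<Longrightarrow> a \<oplus> b \<in> D"
| smult: "a \<in> D \<Longrightarrow> c \<odot> a \<in> D"
| base: "j < i \<Longrightarrow> i < n \<Longrightarrow> act Q (unit_mat n i j) y \<in> D"
| step: "j < i \<Longrightarrow> i < n \<Longrightarrow> a \<in> D \<Longrightarrow> act Q (unit_mat n i j) a \<in> D"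

lemma D_carrier: "a \<in> D \<Longrightarrow> a \<in> carrier Q"
  by (induction rule: D.induct) (auto simp: ab y intro!: a_cl unit_mat_sl)

text \<open>The submodule generated by \<open>y\<close>: it is built from \<open>y\<close> by lower
  matrix units and linear combinations, and \<open>act_G\<close> shows that it is invariant.\<close>

definition G where "G = {c \<odot> y \<oplus> d | c d. d \<in> D}"

lemma G_I: "d \<in> D \<Longrightarrow> c \<odot> y \<oplus> d \<in> G" by (auto simp: G_def)

lemma G_D: "d \<in> D \<Longrightarrow> d \<in> G"
  using G_I[of d 0] y D_carrier[of d] by (simp add: smult_distribs)

lemma G_y: "y \<in> G"
  using G_I[OF D.zero, of 1] y by (simp add: smult_distribs)

lemma G_carrier: "a \<in> G \<Longrightarrow> a \<in> carrier Q"
  using y by (auto simp: G_def D_carrier)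

lemma G_add: assumes "a \<in> G" "b \<in> G" shows "a \<oplus> b \<in> G"
proof -
  obtain c d c' d' where 1: "a = c \<odot> y \<oplus> d" "d \<in> D" "b = c' \<odot> y \<oplus> d'" "d' \<in> D"
    using assms by (auto simp: G_def)
  have "a \<oplus> b = (c + c') \<odot> y \<oplus> (d \<oplus> d')"
    using 1 y D_carrier[of d] D_carrier[of d'] by (simp add: smult_distribs M.add.m_ac)
  then show ?thesis using G_I[OF D.add[OF 1(2,4)], of "c + c'"] by simp
qed

lemma G_smult: assumes "a \<in> G" shows "k \<odot> a \<in> G"
proof -
  obtain c d where 1: "a = c \<odot> y \<oplus> d" "d \<in> D" using assms by (auto simp: G_def)
  have "k \<odot> a = (k * c) \<odot> y \<oplus> k \<odot> d"
    using 1 y D_carrier[of d] by (simp add: smult_distribs)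
  then show ?thesis using G_I[OF D.smult[OF 1(2), of k], of "k * c"] by simp
qed

text \<open>A strictly lower triangular matrix is assembled one position at a time. Membership in
  \<open>sl n\<close> is carried along because the action is additive in the matrix only
  there.\<close>

lemma act_lower: "finite S \<Longrightarrow> S \<subseteq> {(i, j). j < i \<and> i < n} \<Longrightarrow>
    mat n n (\<lambda>p. if p \<in> S then f p else 0) \<in> sl n \<and> act Q (mat n n (\<lambda>p. if p \<in> S then f p else 0)) y \<in> D"
proof (induction S rule: finite_induct)
  case empty
  \<comment> \<open>The zero matrix is written as a multiple of \<open>H_rho n\<close>, so that
    linearity of the action shows that it annihilates \<open>y\<close>.\<close>
  have z: "mat n n (\<lambda>p. if p \<in> {} then f p else 0) = 0 \<cdot>\<^sub>m H_rho n"
    by (rule eq_matI) (auto simp: H_rho_def)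
  have "act Q (0 \<cdot>\<^sub>m H_rho n) y = \<zero>" using H_rho_sl y by (simp add: a_smultl a_cl smult_distribs)
  moreover have "0 \<cdot>\<^sub>m H_rho n \<in> sl n" by (simp add: sl_def H_rho_def)
  ultimately show ?case unfolding z by (simp add: D.zero)
next
  case (insert p S)
  obtain i j where p: "p = (i, j)" "j < i" "i < n" using insert by auto
  let ?M = "mat n n (\<lambda>p. if p \<in> S then f p else 0)"
  have e: "mat n n (\<lambda>q. if q \<in> insert p S then f q else 0) = ?M + f p \<cdot>\<^sub>m unit_mat n i j"
    by (rule eq_matI) (use insert(2) p in \<open>auto simp: unit_mat_def\<close>)
  have IH: "?M \<in> sl n" "act Q ?M y \<in> D" using insert by simp_all
  have u: "unit_mat n i j \<in> sl n" by (rule unit_mat_sl) (use p in simp)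
  have s: "f p \<cdot>\<^sub>m unit_mat n i j \<in> sl n"
    by (rule sl_smult[OF u])
  have "?M + f p \<cdot>\<^sub>m unit_mat n i j \<in> sl n"
    by (rule sl_add[OF IH(1) s])
  moreover have "act Q (?M + f p \<cdot>\<^sub>m unit_mat n i j) y \<in> D"
    unfolding a_addl[OF IH(1) s y] a_smultl[OF u y]
    by (rule D.add[OF IH(2) D.smult[OF D.base[OF p(2,3)]]])
  ultimately show ?case unfolding e by simp
qed

text \<open>Triangular decomposition of \<open>X\<close>: the strictly upper part annihilates
  \<open>y\<close>, the diagonal part scales it, and the strictly lower part maps it into
  \<open>D\<close>.\<close>

lemma act_y: assumes X: "X \<in> sl n" shows "act Q X y \<in> G"
proof -
  let ?L = "mat n n (\<lambda>p. if p \<in> {(i, j). j < i \<and> i < n} then X $$ p else 0)"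
  let ?U = "mat n n (\<lambda>(i, j). if i < j then X $$ (i, j) else 0)"
  let ?H = "mat n n (\<lambda>(i, j). if i = j then X $$ (i, j) else 0)"
  have Xc: "X \<in> carrier_mat n n" "(\<Sum>i<n. X $$ (i, i)) = 0" using X by (simp_all add: sl_def)
  have "finite {(i, j). j < i \<and> i < n}"
    by (rule finite_subset[of _ "{..<n} \<times> {..<n}"]) auto
  note L = act_lower[OF this subset_refl, of "\<lambda>p. X $$ p"]
  have U: "?U \<in> sl n" by (simp add: sl_def)
  have H: "?H \<in> sl n" "diagonal_mat ?H" using Xc by (simp_all add: sl_def diagonal_mat_def)
  have UH: "?U + ?H \<in> sl n" using U H(1) by (simp add: sl_def sum.distrib)
  have e: "X = ?L + (?U + ?H)" by (rule eq_matI) (use Xc in auto)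
  have "act Q X y = act Q ?L y \<oplus> (act Q ?U y \<oplus> act Q ?H y)"
    by (subst e) (simp only: a_addl[OF conjunct1[OF L] UH y] a_addl[OF U H(1) y])
  also have "act Q ?U y = \<zero>" by (rule upper[OF U]) auto
  also have "act Q ?H y = wt ?H \<odot> y" by (rule diag[OF H])
  finally have "act Q X y = act Q ?L y \<oplus> (\<zero> \<oplus> wt ?H \<odot> y)" .
  also have "\<zero> \<oplus> wt ?H \<odot> y = wt ?H \<odot> y" using y by simp
  finally show ?thesis
    using G_add[OF G_D[OF conjunct2[OF L]] G_smult[OF G_y, of "wt ?H"]] by simp
qed

lemma lower_G: assumes "j < i" "i < n" "a \<in> G" shows "act Q (unit_mat n i j) a \<in> D"
proof -
  obtain c d where 1: "a = c \<odot> y \<oplus> d" "d \<in> D" using assms by (auto simp: G_def)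
  have u: "unit_mat n i j \<in> sl n" by (rule unit_mat_sl) (use assms in simp)
  have "act Q (unit_mat n i j) a = c \<odot> act Q (unit_mat n i j) y \<oplus> act Q (unit_mat n i j) d"
    unfolding 1(1) using u y D_carrier[OF 1(2)] by (simp add: a_add a_smult)
  then show ?thesis
    using D.add[OF D.smult[OF D.base[OF assms(1,2)], of c] D.step[OF assms(1,2) 1(2)]] by simp
qed

text \<open>Moving \<open>X\<close> past a lowering matrix unit leaves that unit applied to
  \<open>X a\<close>, plus the commutator applied to \<open>a\<close>. The hypothesis on
  \<open>a\<close> concerns all of \<open>sl n\<close> at once, and so covers both terms.\<close>

lemma lower_invariant:
  assumes "j < i" "i < n" "a \<in> carrier Q" "\<And>X. X \<in> sl n \<Longrightarrow> act Q X a \<in> G" and X: "X \<in> sl n"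
  shows "act Q X (act Q (unit_mat n i j) a) \<in> G"
proof -
  have u: "unit_mat n i j \<in> sl n" by (rule unit_mat_sl) (use assms in simp)
  show ?thesis
    unfolding a_comm[OF X u assms(3)]
    by (intro G_add G_D lower_G assms(1,2,4) X commutator_sl u)
qed

lemma act_D: "a \<in> D \<Longrightarrow> X \<in> sl n \<Longrightarrow> act Q X a \<in> G"
proof (induction arbitrary: X rule: D.induct)
  case zero
  then show ?case by (simp add: a_zero G_D D.zero)
next
  case (add a b)
  then show ?case by (simp add: a_add D_carrier G_add)
next
  case (smult a c)
  then show ?case by (simp add: a_smult D_carrier G_smult)
next
  case (base j i)
  show ?case by (rule lower_invariant[OF base(1,2) y act_y base(3)])
next
  case (step j i a)
  show ?case by (rule lower_invariant[OF step(1,2) D_carrier[OF step(3)] step(4) step(5)])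
qed

lemma act_G: assumes "a \<in> G" "X \<in> sl n" shows "act Q X a \<in> G"
proof -
  obtain c d where 1: "a = c \<odot> y \<oplus> d" "d \<in> D" using assms by (auto simp: G_def)
  have "act Q X a = c \<odot> act Q X y \<oplus> act Q X d"
    unfolding 1(1) using assms(2) y D_carrier[OF 1(2)] by (simp add: a_add a_smult a_cl)
  then show ?thesis
    using G_add[OF G_smult[OF act_y[OF assms(2)], of c] act_D[OF 1(2) assms(2)]] by simp
qed

text \<open>With \<open>w\<close> the \<open>H_rho\<close>-weight of \<open>y\<close>, \<open>T k\<close> vanishes on vectors of \<open>H_rho\<close>-weight \<open>w - k\<close>.  A product of
  such operators with all \<open>k > 0\<close> kills a given element of \<open>D\<close>, but not \<open>y\<close>.\<close>

definition T :: "nat \<Rightarrow> 'q \<Rightarrow> 'q" where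
  "T k a = act Q (H_rho n) a \<oplus> (of_nat k - wt (H_rho n)) \<odot> a"

lemma T_cl: "a \<in> carrier Q \<Longrightarrow> T k a \<in> carrier Q"
  by (simp add: T_def a_cl H_rho_sl)

lemma T_add: "a \<in> carrier Q \<Longrightarrow> b \<in> carrier Q \<Longrightarrow> T k (a \<oplus> b) = T k a \<oplus> T k b"
  by (simp add: T_def a_add a_cl H_rho_sl smult_distribs M.add.m_ac)

lemma T_smult: "a \<in> carrier Q \<Longrightarrow> T k (c \<odot> a) = c \<odot> T k a"
  by (simp add: T_def a_smult a_cl H_rho_sl smult_distribs mult.commute)

lemma T_commute: "a \<in> carrier Q \<Longrightarrow> T k (T l a) = T l (T k a)"
  by (simp add: T_def a_smult a_add a_cl H_rho_sl smult_distribs M.add.m_ac mult.commute)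

lemma T_weight: "a \<in> carrier Q \<Longrightarrow> act Q (H_rho n) a = wt (H_rho n) \<odot> a \<Longrightarrow> T k a = of_nat k \<odot> a"
  by (simp add: T_def smult_distribs(1)[symmetric])

text \<open>For j < i the matrix unit lowers the \<open>H_rho\<close>-eigenvalue by 2 (i - j), and
  the index of \<open>T\<close> moves by the same amount.\<close>

lemma T_lower:
  assumes "j < i" "i < n" "a \<in> carrier Q"
  shows "T (k + 2 * (i - j)) (act Q (unit_mat n i j) a) = act Q (unit_mat n i j) (T k a)"
proof -
  have u: "unit_mat n i j \<in> sl n" by (rule unit_mat_sl) (use assms in simp)
  let ?E = "act Q (unit_mat n i j)" and ?w = "wt (H_rho n)"
  have "act Q (H_rho n) (?E a) = ?E (act Q (H_rho n) a) \<oplus> (2 * (of_nat j - of_nat i)) \<odot> ?E a"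
    using a_comm[OF H_rho_sl u assms(3)] H_rho_commutator[of i n j] assms u by (simp add: a_smultl)
  then have "T (k + 2 * (i - j)) (?E a) = ?E (act Q (H_rho n) a) \<oplus>
      ((2 * (of_nat j - of_nat i)) \<odot> ?E a \<oplus> (of_nat (k + 2 * (i - j)) - ?w) \<odot> ?E a)"
    using assms u by (simp add: T_def a_cl H_rho_sl M.a_assoc)
  also have "(2 * (of_nat j - of_nat i)) \<odot> ?E a \<oplus> (of_nat (k + 2 * (i - j)) - ?w) \<odot> ?E a
      = (2 * (of_nat j - of_nat i) + (of_nat (k + 2 * (i - j)) - ?w)) \<odot> ?E a"
    using assms u by (intro smult_distribs(1)[symmetric] a_cl)
  also have "2 * (of_nat j - of_nat i) + (of_nat (k + 2 * (i - j)) - ?w) = of_nat k - ?w"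
    using assms(1) by (simp add: of_nat_diff algebra_simps)
  also have "?E (act Q (H_rho n) a) \<oplus> (of_nat k - ?w) \<odot> ?E a = ?E (T k a)"
    using assms u by (simp add: T_def a_cl H_rho_sl a_add a_smult)
  finally show ?thesis .
qed

abbreviation "TT ks a \<equiv> foldr T ks a"

lemma TT_cl: "a \<in> carrier Q \<Longrightarrow> TT ks a \<in> carrier Q"
  by (induction ks) (simp_all add: T_cl)

lemma TT_add: "a \<in> carrier Q \<Longrightarrow> b \<in> carrier Q \<Longrightarrow> TT ks (a \<oplus> b) = TT ks a \<oplus> TT ks b"
  by (induction ks) (simp_all add: T_add TT_cl)

lemma TT_smult: "a \<in> carrier Q \<Longrightarrow> TT ks (c \<odot> a) = c \<odot> TT ks a"
  by (induction ks) (simp_all add: T_smult TT_cl)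

lemma TT_zero: "TT ks \<zero> = \<zero>"
  using TT_smult[of "\<zero>" ks 0] by (simp add: smult_distribs ab TT_cl)

lemma T_TT: "a \<in> carrier Q \<Longrightarrow> T k (TT ks a) = TT ks (T k a)"
  by (induction ks) (simp_all add: T_commute[of _ k] TT_cl)

lemma TT_TT: "a \<in> carrier Q \<Longrightarrow> TT ks (TT ls a) = TT ls (TT ks a)"
  by (induction ks) (simp_all add: T_TT TT_cl)

lemma TT_weight:
  assumes "a \<in> carrier Q" "act Q (H_rho n) a = wt (H_rho n) \<odot> a"
  shows "TT ks a = of_nat (prod_list ks) \<odot> a"
  by (induction ks) (use assms in \<open>simp_all add: T_smult T_weight smult_distribs mult.commute\<close>)

lemma TT_lower:
  assumes "j < i" "i < n" "a \<in> carrier Q"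
  shows "TT (map (\<lambda>k. k + 2 * (i - j)) ks) (act Q (unit_mat n i j) a) = act Q (unit_mat n i j) (TT ks a)"
  by (induction ks) (use assms in \<open>simp_all add: T_lower TT_cl\<close>)

text \<open>Takes the place of a decomposition into weight spaces. Annihilating lists of a sum are
  concatenated, as the \<open>T k\<close> commute; a lowering operator shifts the list upwards, so
  its entries stay positive.\<close>

lemma D_killed: "a \<in> D \<Longrightarrow> \<exists>ks. 0 \<notin> set ks \<and> TT ks a = \<zero>"
proof (induction rule: D.induct)
  case zero
  show ?case by (rule exI[of _ "[]"]) simp
next
  case (add a b)
  then obtain ks ls where kl: "0 \<notin> set ks" "TT ks a = \<zero>" "0 \<notin> set ls" "TT ls b = \<zero>" by auto
  have "TT (ks @ ls) (a \<oplus> b) = TT ls (TT ks a) \<oplus> TT ks (TT ls b)"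
    using add(1,2) by (simp add: TT_add TT_cl D_carrier TT_TT[of a])
  then show ?case using kl by (intro exI[of _ "ks @ ls"]) (simp add: TT_zero)
next
  case (smult a c)
  then obtain ks where "0 \<notin> set ks" "TT ks a = \<zero>" by auto
  then show ?case using smult by (intro exI[of _ ks]) (simp add: TT_smult D_carrier smult_distribs)
next
  case (base j i)
  have u: "unit_mat n i j \<in> sl n" by (rule unit_mat_sl) (use base in simp)
  \<comment> \<open>The vector \<open>y\<close> itself has the weight that \<open>T 0\<close>
    annihilates; after one lowering operator the index becomes positive.\<close>
  have "T 0 y = \<zero>" using T_weight[of y 0] diag[OF H_rho_sl H_rho_diagonal] y by (simp add: smult_distribs)
  then show ?case
    using T_lower[OF base y, of 0] base u by (intro exI[of _ "[2 * (i - j)]"]) (simp add: a_zero)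
next
  case (step j i a)
  have u: "unit_mat n i j \<in> sl n" by (rule unit_mat_sl) (use step in simp)
  obtain ks where ks: "0 \<notin> set ks" "TT ks a = \<zero>" using step by auto
  have "TT (map (\<lambda>k. k + 2 * (i - j)) ks) (act Q (unit_mat n i j) a) = \<zero>"
    using TT_lower[OF step(1,2) D_carrier[OF step(3)], of ks] ks(2) u by (simp add: a_zero)
  then show ?case using step(1) by (intro exI[of _ "map (\<lambda>k. k + 2 * (i - j)) ks"]) auto
qed

lemma smult_eq_zero: "c \<odot> a = \<zero> \<Longrightarrow> a \<in> carrier Q \<Longrightarrow> c \<noteq> 0 \<Longrightarrow> a = \<zero>"
proof -
  assume a: "c \<odot> a = \<zero>" "a \<in> carrier Q" "c \<noteq> 0"
  have "a = (inverse c * c) \<odot> a" using a by (simp add: smult_distribs)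
  also have "\<dots> = inverse c \<odot> (c \<odot> a)" using a(2) by (rule smult_distribs(3)[symmetric])
  finally show ?thesis using a by (simp add: smult_distribs)
qed

lemma prod_list_nonzero: "0 \<notin> set ks \<Longrightarrow> (of_nat (prod_list ks) :: complex) \<noteq> 0"
  by (induction ks) auto

text \<open>On a vector with the \<open>H_rho\<close>-weight of \<open>y\<close>, the product of
  operators that annihilates it acts as a nonzero scalar.\<close>

lemma D_weight:
  assumes "a \<in> D" "act Q (H_rho n) a = wt (H_rho n) \<odot> a"
  shows "a = \<zero>"
proof -
  obtain ks where ks: "0 \<notin> set ks" "TT ks a = \<zero>" using D_killed[OF assms(1)] by auto
  then show ?thesis
    using TT_weight[OF D_carrier[OF assms(1)] assms(2), of ks] smult_eq_zero[OF _ D_carrier[OF assms(1)]]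
      prod_list_nonzero[OF ks(1)] by simp
qed

text \<open>The top \<open>H_rho\<close>-weight space of the generated submodule is spanned by
  \<open>y\<close>: subtracting the multiple of \<open>y\<close> leaves an element of
  \<open>D\<close> of top weight.\<close>

lemma G_weight:
  assumes "a \<in> G" and w: "act Q (H_rho n) a = wt (H_rho n) \<odot> a"
  shows "\<exists>c. a = c \<odot> y"
proof -
  obtain c d where 1: "a = c \<odot> y \<oplus> d" "d \<in> D" using assms by (auto simp: G_def)
  note dc = D_carrier[OF 1(2)] and H = H_rho_sl[of n]
  have "(c * wt (H_rho n)) \<odot> y \<oplus> act Q (H_rho n) d = (c * wt (H_rho n)) \<odot> y \<oplus> wt (H_rho n) \<odot> d"
    using w y dc H diag[OF H H_rho_diagonal]
    by (simp add: 1(1) a_add a_smult smult_distribs mult.commute)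
  then have "act Q (H_rho n) d = wt (H_rho n) \<odot> d"
    using y dc H by (simp add: a_cl)
  then have "d = \<zero>" by (rule D_weight[OF 1(2)])
  then show ?thesis using 1(1) y by auto
qed

text \<open>A submodule is stable under each \<open>T k\<close>, which is \<open>H_rho n\<close>
  plus a scalar. The product that annihilates \<open>d\<close> sends the given element to a nonzero
  multiple of \<open>y\<close>.\<close>

lemma y_in_submodule:
  assumes U: "U \<subseteq> carrier Q" "\<And>a b. a \<in> U \<Longrightarrow> b \<in> U \<Longrightarrow> a \<oplus> b \<in> U" "\<And>c a. a \<in> U \<Longrightarrow> c \<odot> a \<in> U"
    "\<And>X a. X \<in> sl n \<Longrightarrow> a \<in> U \<Longrightarrow> act Q X a \<in> U"
    and u: "c \<odot> y \<oplus> d \<in> U" "d \<in> D" "c \<noteq> 0"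
  shows "y \<in> U"
proof -
  obtain ks where ks: "0 \<notin> set ks" "TT ks d = \<zero>" using D_killed[OF u(2)] by auto
  have "TT ls a \<in> U" if "a \<in> U" for a ls
    by (induction ls) (use that U H_rho_sl in \<open>auto simp: T_def\<close>)
  from this[OF u(1), of ks] have "TT ks (c \<odot> y \<oplus> d) \<in> U" .
  also have "TT ks (c \<odot> y \<oplus> d) = (c * of_nat (prod_list ks)) \<odot> y"
    using y D_carrier[OF u(2)] ks(2) TT_weight[OF y diag[OF H_rho_sl H_rho_diagonal], of ks]
    by (simp add: TT_add TT_smult smult_distribs)
  finally have "inverse (c * of_nat (prod_list ks)) \<odot> ((c * of_nat (prod_list ks)) \<odot> y) \<in> U" by (rule U(3))
  moreover have "inverse (c * of_nat (prod_list ks)) * (c * of_nat (prod_list ks)) = (1 :: complex)"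
    by (rule left_inverse) (use u(3) prod_list_nonzero[OF ks(1)] in simp)
  ultimately show ?thesis by (simp only: smult_distribs(3,4)[OF y])
qed

end

section \<open>Uniqueness of irreducible highest weight modules and a criterion for
  irreducibility\<close>

lemma sl_irreducible_submodule:
  fixes V (structure)
  assumes "sl_irreducible n V" "U \<subseteq> carrier V" "\<zero> \<in> U" "\<And>a b. a \<in> U \<Longrightarrow> b \<in> U \<Longrightarrow> a \<oplus> b \<in> U"
    "\<And>c a. a \<in> U \<Longrightarrow> c \<odot> a \<in> U" "\<And>X a. X \<in> sl n \<Longrightarrow> a \<in> U \<Longrightarrow> act V X a \<in> U"
  shows "U = {\<zero>} \<or> U = carrier V"
proof -
  have V: "module class_ring V"
    using assms(1) by (simp add: sl_irreducible_def sl_module_def vectorspace_class_ring_iff)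
  have "subspace class_ring U V"
    using assms(2-5) by (simp add: subspace_class_ring_iff[OF V])
  then show ?thesis using assms(1,6) by (simp add: sl_irreducible_def)
qed

definition prod_module :: "(complex mat, 'u) gmod \<Rightarrow> (complex mat, 'v) gmod \<Rightarrow> (complex mat, 'u \<times> 'v) gmod" where
  "prod_module L P =
     \<lparr>carrier = carrier L \<times> carrier P, mult = undefined, one = undefined,
      zero = (\<zero>\<^bsub>L\<^esub>, \<zero>\<^bsub>P\<^esub>), add = (\<lambda>a b. (fst a \<oplus>\<^bsub>L\<^esub> fst b, snd a \<oplus>\<^bsub>P\<^esub> snd b)),
      smult = (\<lambda>c a. (c \<odot>\<^bsub>L\<^esub> fst a, c \<odot>\<^bsub>P\<^esub> snd a)), hcomp = undefined,
      act = (\<lambda>X a. (act L X (fst a), act P X (snd a)))\<rparr>"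

lemma prod_module_simps:
  "carrier (prod_module L P) = carrier L \<times> carrier P" "\<zero>\<^bsub>prod_module L P\<^esub> = (\<zero>\<^bsub>L\<^esub>, \<zero>\<^bsub>P\<^esub>)"
  "a \<oplus>\<^bsub>prod_module L P\<^esub> b = (fst a \<oplus>\<^bsub>L\<^esub> fst b, snd a \<oplus>\<^bsub>P\<^esub> snd b)"
  "c \<odot>\<^bsub>prod_module L P\<^esub> a = (c \<odot>\<^bsub>L\<^esub> fst a, c \<odot>\<^bsub>P\<^esub> snd a)"
  "act (prod_module L P) X a = (act L X (fst a), act P X (snd a))"
  by (simp_all add: prod_module_def)

lemma module_prod_module:
  assumes "cmodule L" "cmodule P"
  shows "module class_ring (prod_module L P)"
proof -
  interpret L: cmodule L by (rule assms)
  interpret P: cmodule P by (rule assms)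
  show ?thesis
  proof (rule module_class_ringI)
    show "abelian_group (prod_module L P)"
    proof (rule abelian_groupI)
      show "\<exists>b\<in>carrier (prod_module L P). b \<oplus>\<^bsub>prod_module L P\<^esub> a = \<zero>\<^bsub>prod_module L P\<^esub>"
        if "a \<in> carrier (prod_module L P)" for a
        by (rule bexI[of _ "(\<ominus>\<^bsub>L\<^esub> fst a, \<ominus>\<^bsub>P\<^esub> snd a)"])
          (use that in \<open>auto simp: prod_module_simps L.ab(6,7) P.ab(6,7)\<close>)
    qed (auto simp: prod_module_simps L.ab(1-3,5) P.ab(1-3,5) intro: L.ab(4) P.ab(4))
  qed (auto simp: prod_module_simps L.smult_distribs P.smult_distribs)
qed

text \<open>The submodule of \<open>L \<times> P\<close> generated by the pair of highest weight vectors is the graph of an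
  isomorphism.\<close>

lemma highest_weight_iso:
  fixes L :: "(complex mat, 'u) gmod" and P :: "(complex mat, 'v) gmod"
  assumes L: "sl_irreducible n L" "has_highest_weight n L wt" and P: "sl_irreducible n P" "has_highest_weight n P wt"
  obtains h where "h \<in> LinearCombinations.module_hom class_ring L P" "bij_betw h (carrier L) (carrier P)"
    "\<And>X a. X \<in> sl n \<Longrightarrow> a \<in> carrier L \<Longrightarrow> h (act L X a) = act P X (h a)"
proof -
  have sl: "sl_module n L" "sl_module n P" using L P by (simp_all add: sl_irreducible_def)
  have cm: "cmodule L" "cmodule P"
    using sl by (simp_all add: sl_module_def vectorspace_class_ring_iff cmodule_def)
  interpret L: cmodule L by (rule cm)
  interpret P: cmodule P by (rule cm)
  obtain x where x: "x \<in> carrier L" "x \<noteq> \<zero>\<^bsub>L\<^esub>"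
      "\<And>X. X \<in> sl n \<Longrightarrow> \<forall>i<n. \<forall>j\<le>i. X $$ (i, j) = 0 \<Longrightarrow> act L X x = \<zero>\<^bsub>L\<^esub>"
      "\<And>H. H \<in> sl n \<Longrightarrow> diagonal_mat H \<Longrightarrow> act L H x = wt H \<odot>\<^bsub>L\<^esub> x"
    using L(2) by (auto simp: has_highest_weight_def)
  obtain v where v: "v \<in> carrier P" "v \<noteq> \<zero>\<^bsub>P\<^esub>"
      "\<And>X. X \<in> sl n \<Longrightarrow> \<forall>i<n. \<forall>j\<le>i. X $$ (i, j) = 0 \<Longrightarrow> act P X v = \<zero>\<^bsub>P\<^esub>"
      "\<And>H. H \<in> sl n \<Longrightarrow> diagonal_mat H \<Longrightarrow> act P H v = wt H \<odot>\<^bsub>P\<^esub> v"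
    using P(2) by (auto simp: has_highest_weight_def)
  interpret L1: hw_module n L x wt by (unfold_locales) (use sl x in auto)
  interpret P1: hw_module n P v wt by (unfold_locales) (use sl v in auto)
  let ?Q = "prod_module L P"
  interpret Q0: cmodule ?Q by (rule cmodule.intro) (rule module_prod_module[OF cm])
  have minusQ: "a \<ominus>\<^bsub>?Q\<^esub> b = (fst a \<ominus>\<^bsub>L\<^esub> fst b, snd a \<ominus>\<^bsub>P\<^esub> snd b)" if "a \<in> carrier ?Q" "b \<in> carrier ?Q" for a b
    using that Q0.minus_eq_smult[OF that(2)]
    by (auto simp: a_minus_def prod_module_simps L.minus_eq_smult P.minus_eq_smult)
  have slQ: "sl_module n ?Q"
    unfolding sl_module_def
  proof (intro conjI ballI allI)
    show "vectorspace class_ring ?Q" using Q0.is_module by (simp add: vectorspace_class_ring_iff)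
    show "act ?Q X \<in> LinearCombinations.module_hom class_ring ?Q ?Q" if "X \<in> sl n" for X
      using that by (auto simp: LinearCombinations.module_hom_def prod_module_simps L1.a_cl P1.a_cl L1.a_add P1.a_add
          L1.a_smult P1.a_smult)
    show "act ?Q (X * Y - Y * X) a = act ?Q X (act ?Q Y a) \<ominus>\<^bsub>?Q\<^esub> act ?Q Y (act ?Q X a)"
      if "X \<in> sl n" "Y \<in> sl n" "a \<in> carrier ?Q" for X Y a
    proof -
      have "act ?Q X (act ?Q Y a) \<in> carrier ?Q" "act ?Q Y (act ?Q X a) \<in> carrier ?Q"
        using that by (auto simp: prod_module_simps L1.a_cl P1.a_cl)
      then show ?thesis
        using that sl by (subst minusQ) (auto simp: prod_module_simps sl_module_def)
    qed
  qed (auto simp: prod_module_simps L1.a_addl P1.a_addl L1.a_smultl P1.a_smultl)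
  interpret Q: hw_module n ?Q "(x, v)" wt
  proof unfold_locales
    show "sl_module n ?Q" by (rule slQ)
  qed (use x v in \<open>auto simp: prod_module_simps\<close>)
  have GI: "(a, b) \<in> Q.G \<Longrightarrow> a \<in> carrier L \<and> b \<in> carrier P" for a b
    using Q.G_carrier[of "(a, b)"] by (simp add: prod_module_simps)
  have Gadd: "(a, b) \<in> Q.G \<Longrightarrow> (c, d) \<in> Q.G \<Longrightarrow> (a \<oplus>\<^bsub>L\<^esub> c, b \<oplus>\<^bsub>P\<^esub> d) \<in> Q.G" for a b c d
    using Q.G_add[of "(a, b)" "(c, d)"] by (simp add: prod_module_simps)
  have Gsm: "(a, b) \<in> Q.G \<Longrightarrow> (k \<odot>\<^bsub>L\<^esub> a, k \<odot>\<^bsub>P\<^esub> b) \<in> Q.G" for a b k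
    using Q.G_smult[of "(a, b)" k] by (simp add: prod_module_simps)
  have Gact: "(a, b) \<in> Q.G \<Longrightarrow> X \<in> sl n \<Longrightarrow> (act L X a, act P X b) \<in> Q.G" for a b X
    using Q.act_G[of "(a, b)" X] by (simp add: prod_module_simps)
  have G0: "(\<zero>\<^bsub>L\<^esub>, \<zero>\<^bsub>P\<^esub>) \<in> Q.G"
    using Gsm[OF Q.G_y, of 0] x(1) v(1) by (simp add: L.smult_distribs P.smult_distribs)
  have wx: "act L (H_rho n) x = wt (H_rho n) \<odot>\<^bsub>L\<^esub> x" "act P (H_rho n) v = wt (H_rho n) \<odot>\<^bsub>P\<^esub> v"
    using x(4) v(4) H_rho_sl H_rho_diagonal by simp_all
  \<comment> \<open>This pair would have the top weight, hence be a multiple of the generating pair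
    \<open>(x, v)\<close>; its zero second entry forces the factor 0, contradicting \<open>x\<close>
    nonzero.\<close>
  have x0: "(x, \<zero>\<^bsub>P\<^esub>) \<notin> Q.G"
  proof
    assume "(x, \<zero>\<^bsub>P\<^esub>) \<in> Q.G"
    then have "\<exists>c. (x, \<zero>\<^bsub>P\<^esub>) = c \<odot>\<^bsub>?Q\<^esub> (x, v)"
      by (rule Q.G_weight) (simp add: prod_module_simps wx P1.a_zero H_rho_sl P.smult_distribs)
    then obtain c where c: "x = c \<odot>\<^bsub>L\<^esub> x" "c \<odot>\<^bsub>P\<^esub> v = \<zero>\<^bsub>P\<^esub>" by (auto simp: prod_module_simps)
    then have "c = 0" using P1.smult_eq_zero[of c v] v by auto
    then show False using c(1) x by (simp add: L.smult_distribs)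
  qed
  have v0: "(\<zero>\<^bsub>L\<^esub>, v) \<notin> Q.G"
  proof
    assume "(\<zero>\<^bsub>L\<^esub>, v) \<in> Q.G"
    then have "\<exists>c. (\<zero>\<^bsub>L\<^esub>, v) = c \<odot>\<^bsub>?Q\<^esub> (x, v)"
      by (rule Q.G_weight) (simp add: prod_module_simps wx L1.a_zero H_rho_sl L.smult_distribs)
    then obtain c where c: "v = c \<odot>\<^bsub>P\<^esub> v" "c \<odot>\<^bsub>L\<^esub> x = \<zero>\<^bsub>L\<^esub>" by (auto simp: prod_module_simps)
    then have "c = 0" using L1.smult_eq_zero[of c x] x by auto
    then show False using c(1) v by (simp add: P.smult_distribs)
  qed
  \<comment> \<open>The elements of \<open>L\<close> paired with zero form a submodule that misses
    \<open>x\<close>, which is zero by irreducibility. This gives injectivity; \<open>K2\<close> is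
    the same argument for single-valuedness.\<close>
  have K1: "{a. (a, \<zero>\<^bsub>P\<^esub>) \<in> Q.G} = {\<zero>\<^bsub>L\<^esub>}"
  proof -
    have "{a. (a, \<zero>\<^bsub>P\<^esub>) \<in> Q.G} = {\<zero>\<^bsub>L\<^esub>} \<or> {a. (a, \<zero>\<^bsub>P\<^esub>) \<in> Q.G} = carrier L"
    proof (rule sl_irreducible_submodule[OF L(1)])
      show "a \<oplus>\<^bsub>L\<^esub> b \<in> {a. (a, \<zero>\<^bsub>P\<^esub>) \<in> Q.G}" if "a \<in> {a. (a, \<zero>\<^bsub>P\<^esub>) \<in> Q.G}" "b \<in> {a. (a, \<zero>\<^bsub>P\<^esub>) \<in> Q.G}" for a b
        using that Gadd[of a "\<zero>\<^bsub>P\<^esub>" b "\<zero>\<^bsub>P\<^esub>"] by (simp add: P.ab)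
      show "c \<odot>\<^bsub>L\<^esub> a \<in> {a. (a, \<zero>\<^bsub>P\<^esub>) \<in> Q.G}" if "a \<in> {a. (a, \<zero>\<^bsub>P\<^esub>) \<in> Q.G}" for a c
        using that Gsm[of a "\<zero>\<^bsub>P\<^esub>" c] by (simp add: P.smult_distribs)
      show "act L X a \<in> {a. (a, \<zero>\<^bsub>P\<^esub>) \<in> Q.G}" if "X \<in> sl n" "a \<in> {a. (a, \<zero>\<^bsub>P\<^esub>) \<in> Q.G}" for a X
        using that Gact[of a "\<zero>\<^bsub>P\<^esub>" X] by (simp add: P1.a_zero)
    qed (use GI G0 in auto)
    then show ?thesis using x0 x(1) by auto
  qed
  have K2: "{b. (\<zero>\<^bsub>L\<^esub>, b) \<in> Q.G} = {\<zero>\<^bsub>P\<^esub>}"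
  proof -
    have "{b. (\<zero>\<^bsub>L\<^esub>, b) \<in> Q.G} = {\<zero>\<^bsub>P\<^esub>} \<or> {b. (\<zero>\<^bsub>L\<^esub>, b) \<in> Q.G} = carrier P"
    proof (rule sl_irreducible_submodule[OF P(1)])
      show "a \<oplus>\<^bsub>P\<^esub> b \<in> {b. (\<zero>\<^bsub>L\<^esub>, b) \<in> Q.G}" if "a \<in> {b. (\<zero>\<^bsub>L\<^esub>, b) \<in> Q.G}" "b \<in> {b. (\<zero>\<^bsub>L\<^esub>, b) \<in> Q.G}" for a b
        using that Gadd[of "\<zero>\<^bsub>L\<^esub>" a "\<zero>\<^bsub>L\<^esub>" b] by (simp add: L.ab)
      show "c \<odot>\<^bsub>P\<^esub> a \<in> {b. (\<zero>\<^bsub>L\<^esub>, b) \<in> Q.G}" if "a \<in> {b. (\<zero>\<^bsub>L\<^esub>, b) \<in> Q.G}" for a c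
        using that Gsm[of "\<zero>\<^bsub>L\<^esub>" a c] by (simp add: L.smult_distribs)
      show "act P X a \<in> {b. (\<zero>\<^bsub>L\<^esub>, b) \<in> Q.G}" if "X \<in> sl n" "a \<in> {b. (\<zero>\<^bsub>L\<^esub>, b) \<in> Q.G}" for a X
        using that Gact[of "\<zero>\<^bsub>L\<^esub>" a X] by (simp add: L1.a_zero)
    qed (use GI G0 in auto)
    then show ?thesis using v0 v(1) by auto
  qed
  \<comment> \<open>Both projections of \<open>Q.G\<close> are nonzero submodules of irreducible
    modules, hence everything.\<close>
  have tot: "\<exists>b. (a, b) \<in> Q.G" if "a \<in> carrier L" for a
  proof -
    have "{a. \<exists>b. (a, b) \<in> Q.G} = {\<zero>\<^bsub>L\<^esub>} \<or> {a. \<exists>b. (a, b) \<in> Q.G} = carrier L"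
    proof (rule sl_irreducible_submodule[OF L(1)])
      show "{a. \<exists>b. (a, b) \<in> Q.G} \<subseteq> carrier L" using GI by auto
      show "\<zero>\<^bsub>L\<^esub> \<in> {a. \<exists>b. (a, b) \<in> Q.G}" using G0 by auto
    qed (auto dest: Gadd Gsm Gact)
    moreover have "x \<in> {a. \<exists>b. (a, b) \<in> Q.G}" using Q.G_y by auto
    ultimately show ?thesis using x(2) that by auto
  qed
  have surj: "\<exists>a. (a, b) \<in> Q.G" if "b \<in> carrier P" for b
  proof -
    have "{b. \<exists>a. (a, b) \<in> Q.G} = {\<zero>\<^bsub>P\<^esub>} \<or> {b. \<exists>a. (a, b) \<in> Q.G} = carrier P"
    proof (rule sl_irreducible_submodule[OF P(1)])
      show "{b. \<exists>a. (a, b) \<in> Q.G} \<subseteq> carrier P" using GI by auto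
      show "\<zero>\<^bsub>P\<^esub> \<in> {b. \<exists>a. (a, b) \<in> Q.G}" using G0 by auto
    qed (auto dest: Gadd Gsm Gact)
    moreover have "v \<in> {b. \<exists>a. (a, b) \<in> Q.G}" using Q.G_y by auto
    ultimately show ?thesis using v(2) that by auto
  qed
  have diff: "(a \<ominus>\<^bsub>L\<^esub> c, b \<ominus>\<^bsub>P\<^esub> d) \<in> Q.G" if "(a, b) \<in> Q.G" "(c, d) \<in> Q.G" for a b c d
    using Gadd[OF that(1) Gsm[OF that(2), of "- 1"]] GI[OF that(2)]
    by (simp add: a_minus_def L.minus_eq_smult P.minus_eq_smult)
  have uniq: "b = d" if "(a, b) \<in> Q.G" "(a, d) \<in> Q.G" for a b d
  proof -
    have c: "a \<in> carrier L" "b \<in> carrier P" "d \<in> carrier P" using GI[OF that(1)] GI[OF that(2)] by auto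
    have "a \<ominus>\<^bsub>L\<^esub> a = \<zero>\<^bsub>L\<^esub>" using c by (simp only: L.diff_zero_iff)
    then have "b \<ominus>\<^bsub>P\<^esub> d \<in> {b. (\<zero>\<^bsub>L\<^esub>, b) \<in> Q.G}" using diff[OF that] by simp
    then show ?thesis unfolding K2 using c by (simp only: P.diff_zero_iff singleton_iff)
  qed
  have inj: "a = c" if "(a, b) \<in> Q.G" "(c, b) \<in> Q.G" for a b c
  proof -
    have c: "a \<in> carrier L" "c \<in> carrier L" "b \<in> carrier P" using GI[OF that(1)] GI[OF that(2)] by auto
    have "b \<ominus>\<^bsub>P\<^esub> b = \<zero>\<^bsub>P\<^esub>" using c by (simp only: P.diff_zero_iff)
    then have "a \<ominus>\<^bsub>L\<^esub> c \<in> {a. (a, \<zero>\<^bsub>P\<^esub>) \<in> Q.G}" using diff[OF that] by simp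
    then show ?thesis unfolding K1 using c by (simp only: L.diff_zero_iff singleton_iff)
  qed
  define h where "h a = (SOME b. (a, b) \<in> Q.G)" for a
  have hG: "(a, h a) \<in> Q.G" if "a \<in> carrier L" for a
    unfolding h_def by (rule someI_ex[OF tot[OF that]])
  have hI: "h a = b" if "(a, b) \<in> Q.G" for a b
    using uniq[OF hG that] GI[OF that] by simp
  have hP: "h a \<in> carrier P" if "a \<in> carrier L" for a using GI[OF hG[OF that]] by simp
  show thesis
  proof
    show "h \<in> LinearCombinations.module_hom class_ring L P"
      unfolding LinearCombinations.module_hom_def using hP hI Gadd Gsm hG by simp
    show "bij_betw h (carrier L) (carrier P)"
    proof (rule bij_betwI')
      show "h a = h b \<longleftrightarrow> a = b" if "a \<in> carrier L" "b \<in> carrier L" for a b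
        using inj[OF hG[OF that(1)], of b] hG[OF that(2)] by auto
      show "\<exists>a\<in>carrier L. b = h a" if "b \<in> carrier P" for b
        using surj[OF that] hI GI by force
    qed (rule hP)
    show "h (act L X a) = act P X (h a)" if "X \<in> sl n" "a \<in> carrier L" for X a
      by (rule hI[OF Gact[OF hG[OF that(2)] that(1)]])
  qed
qed

text \<open>A submodule containing \<open>x\<close> is everything by cyclicity. A submodule that
  misses \<open>x\<close> lies in \<open>D\<close>, which is orthogonal to \<open>x\<close>; its
  orthogonal complement is then a submodule containing \<open>x\<close>, hence everything, and
  definiteness leaves only zero.\<close>

lemma sl_irreducible_of_form:
  fixes L :: "(complex mat, 'u) gmod" (structure) and form :: "'u \<Rightarrow> 'u \<Rightarrow> complex"
  assumes hw: "hw_module n L x wt" and x: "x \<noteq> \<zero>"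
    and cyclic: "\<And>U. \<lbrakk>U \<subseteq> carrier L; \<And>a b. a \<in> U \<Longrightarrow> b \<in> U \<Longrightarrow> a \<oplus> b \<in> U; \<And>c a. a \<in> U \<Longrightarrow> c \<odot> a \<in> U;
        \<And>X a. X \<in> sl n \<Longrightarrow> a \<in> U \<Longrightarrow> act L X a \<in> U; x \<in> U\<rbrakk> \<Longrightarrow> carrier L \<subseteq> U"
    and form_add: "\<And>u a b. u \<in> carrier L \<Longrightarrow> a \<in> carrier L \<Longrightarrow> b \<in> carrier L \<Longrightarrow> form u (a \<oplus> b) = form u a + form u b"
      "\<And>u a c. u \<in> carrier L \<Longrightarrow> a \<in> carrier L \<Longrightarrow> form u (c \<odot> a) = cnj c * form u a"
      "\<And>u a b. u \<in> carrier L \<Longrightarrow> a \<in> carrier L \<Longrightarrow> b \<in> carrier L \<Longrightarrow> form (a \<oplus> b) u = form a u + form b u"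
      "\<And>u a c. u \<in> carrier L \<Longrightarrow> a \<in> carrier L \<Longrightarrow> form (c \<odot> a) u = c * form a u"
    and form_act: "\<And>X u a. X \<in> sl n \<Longrightarrow> u \<in> carrier L \<Longrightarrow> a \<in> carrier L \<Longrightarrow>
        form (act L X u) a = form u (act L (mat n n (\<lambda>(i, j). cnj (X $$ (j, i)))) a)"
    and form_pos: "\<And>u. u \<in> carrier L \<Longrightarrow> form u u = 0 \<Longrightarrow> u = \<zero>"
  shows "sl_irreducible n L"
proof -
  interpret hw_module n L x wt by (rule hw)
  have adj: "mat n n (\<lambda>(i, j). cnj (X $$ (j, i))) \<in> sl n" if "X \<in> sl n" for X
    using that by (simp add: sl_def cnj_sum[symmetric] del: cnj_sum)
  have adj_unit: "mat n n (\<lambda>(i, j). cnj (unit_mat n a b $$ (j, i))) = unit_mat n b a" for a b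
    by (rule eq_matI) (auto simp: unit_mat_def)
  have adj_adj: "mat n n (\<lambda>(i, j). cnj (mat n n (\<lambda>(i, j). cnj (X $$ (j, i))) $$ (j, i))) = X" if "X \<in> sl n" for X
    using that by (intro eq_matI) (auto simp: sl_def)
  have form0: "form u \<zero> = 0" "form \<zero> u = 0" if "u \<in> carrier L" for u
    using form_add(2)[OF that, of "\<zero>" 0] form_add(4)[OF that, of "\<zero>" 0] that by (simp_all add: smult_distribs ab)
  have GL: "carrier L \<subseteq> G"
    by (rule cyclic) (use G_carrier G_add G_smult act_G G_y in auto)
  \<comment> \<open>The outermost lowering matrix unit is moved to the other side of the form, where
    it becomes a raising one and annihilates \<open>x\<close>.\<close>
  have Dx: "form d x = 0" if "d \<in> D" for d
    using that
  proof (induction rule: D.induct)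
    case (base j i)
    have u: "unit_mat n i j \<in> sl n" "unit_mat n j i \<in> sl n" by (rule unit_mat_sl; use base in simp)+
    have "act L (unit_mat n j i) x = \<zero>"
      by (rule upper[OF u(2)]) (use base in \<open>auto simp: unit_mat_def\<close>)
    then show ?case using form_act[OF u(1) y y] y by (simp add: adj_unit form0)
  next
    case (step j i a)
    have u: "unit_mat n i j \<in> sl n" "unit_mat n j i \<in> sl n" by (rule unit_mat_sl; use step in simp)+
    have "act L (unit_mat n j i) x = \<zero>"
      by (rule upper[OF u(2)]) (use step in \<open>auto simp: unit_mat_def\<close>)
    then show ?case using form_act[OF u(1) D_carrier[OF step(3)] y] D_carrier[OF step(3)] by (simp add: adj_unit form0)
  qed (simp_all add: form0 y form_add D_carrier)
  show ?thesis
    unfolding sl_irreducible_def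
  proof (intro conjI allI impI)
    show "sl_module n L" by (rule sl)
    show "carrier L \<noteq> {\<zero>}" using x y by auto
    fix U assume U: "subspace class_ring U L \<and> (\<forall>X\<in>sl n. \<forall>u\<in>U. act L X u \<in> U)"
    have U': "U \<subseteq> carrier L" "\<zero> \<in> U" "\<And>a b. a \<in> U \<Longrightarrow> b \<in> U \<Longrightarrow> a \<oplus> b \<in> U" "\<And>c a. a \<in> U \<Longrightarrow> c \<odot> a \<in> U"
      "\<And>X a. X \<in> sl n \<Longrightarrow> a \<in> U \<Longrightarrow> act L X a \<in> U"
      using U by (simp_all add: subspace_class_ring_iff[OF is_module])
    show "U = {\<zero>} \<or> U = carrier L"
    proof (cases "x \<in> U")
      case True
      have "carrier L \<subseteq> U" by (rule cyclic[OF U'(1,3-5) True])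
      then show ?thesis using U'(1) by simp
    next
      case False
      \<comment> \<open>A nonzero component along \<open>x\<close> would put \<open>x\<close> into
        \<open>U\<close> by \<open>y_in_submodule\<close>.\<close>
      have Ux: "form u x = 0" if u: "u \<in> U" for u
      proof -
        have "u \<in> G" using u U'(1) GL by auto
        then obtain c d where cd: "u = c \<odot> x \<oplus> d" "d \<in> D" by (auto simp: G_def)
        have "c = 0" using y_in_submodule[OF U'(1,3-5) _ cd(2)] cd(1) u False by auto
        then have "u = d" using cd y D_carrier[OF cd(2)] by (simp add: smult_distribs)
        then show ?thesis using Dx[OF cd(2)] by simp
      qed
      let ?P = "{a \<in> carrier L. \<forall>u\<in>U. form u a = 0}"
      have Uc: "u \<in> carrier L" if "u \<in> U" for u using that U'(1) by auto
      have P: "carrier L \<subseteq> ?P"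
      proof (rule cyclic)
        show "?P \<subseteq> carrier L" by simp
        show "a \<oplus> b \<in> ?P" if "a \<in> ?P" "b \<in> ?P" for a b
          using that form_add(1)[OF Uc] by simp
        show "c \<odot> a \<in> ?P" if "a \<in> ?P" for a c
          using that form_add(2)[OF Uc] by simp
        show "x \<in> ?P" using Ux y by simp
        \<comment> \<open>The complement of \<open>U\<close> is stable because \<open>U\<close> is
          stable under the adjoint matrix, whose adjoint is again \<open>X\<close>.\<close>
        show "act L X a \<in> ?P" if X: "X \<in> sl n" and a: "a \<in> ?P" for X a
        proof -
          have "form u (act L X a) = 0" if u: "u \<in> U" for u
            using form_act[OF adj[OF X] Uc[OF u], of a] a U'(5)[OF adj[OF X] u] by (simp add: adj_adj[OF X])
          then show ?thesis using a X by (simp add: a_cl)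
        qed
      qed
      have Uz: "u \<in> {\<zero>}" if u: "u \<in> U" for u
      proof -
        have "form u u = 0" using subsetD[OF P Uc[OF u]] u by simp
        from form_pos[OF Uc[OF u] this] show ?thesis by simp
      qed
      have "U = {\<zero>}"
        by (rule subset_antisym[OF subsetI[OF Uz]]) (simp_all only: insert_subset empty_subsetI U'(2) simp_thms)
      then show ?thesis by (rule disjI1)
    qed
  qed
qed

section \<open>Symmetric polynomials and the image of the Heisenberg algebra\<close>

lemma permutes_inv_apply: "\<sigma> \<in> sym_group N \<Longrightarrow> inv_into UNIV \<sigma> \<in> sym_group N"
  by (simp add: sym_group_def permutes_inv)

lemma sym_group_comp: "\<sigma> \<in> sym_group N \<Longrightarrow> \<tau> \<in> sym_group N \<Longrightarrow> \<sigma> \<circ> \<tau> \<in> sym_group N"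
  by (simp add: sym_group_def permutes_compose)

lemma sym_group_bij: "\<sigma> \<in> sym_group N \<Longrightarrow> bij \<sigma>"
  by (simp add: sym_group_def permutes_bij)

lemma finite_sym_group: "finite (sym_group N)"
  unfolding sym_group_def by (rule finite_permutations) simp

lemma card_sym_group: "card (sym_group N) = fact N"
  unfolding sym_group_def by (rule card_permutations) simp_all

lemma sym_group_less: "\<sigma> \<in> sym_group N \<Longrightarrow> i < N \<Longrightarrow> \<sigma> i < N"
  unfolding sym_group_def using permutes_in_image[of \<sigma> "{..<N}" i] by simp

lemma sign_sym_group_comp:
  "\<sigma> \<in> sym_group N \<Longrightarrow> \<tau> \<in> sym_group N \<Longrightarrow> sign (\<sigma> \<circ> \<tau>) = sign \<sigma> * sign \<tau>"
  unfolding sym_group_def by (intro sign_compose) (auto intro: permutes_imp_permutation[of "{..<N}"])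

lemma sign_square: "(of_int (sign \<sigma>) :: 'a :: comm_ring_1) * of_int (sign \<sigma>) = 1"
  by (simp add: of_int_mult[symmetric] sign_idempotent del: of_int_mult)

lemma word_comp_sym_group: "w \<in> words n N \<Longrightarrow> \<sigma> \<in> sym_group N \<Longrightarrow> w \<circ> \<sigma> \<in> words n N"
  unfolding words_def sym_group_def
  using permutes_in_image[of \<sigma> "{..<N}"] by (auto simp: PiE_iff extensional_def)

lemma lookup_map_key: "inj f \<Longrightarrow> Poly_Mapping.lookup (Poly_Mapping.map_key f p) k = Poly_Mapping.lookup p (f k)"
  by (simp add: Poly_Mapping.map_key.rep_eq)

lemma inj_map_key:
  assumes "bij \<sigma>" shows "inj (Poly_Mapping.map_key \<sigma> :: ('a \<Rightarrow>\<^sub>0 'b::zero) \<Rightarrow> _)"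
proof (rule injI)
  fix p q :: "'a \<Rightarrow>\<^sub>0 'b" assume e: "Poly_Mapping.map_key \<sigma> p = Poly_Mapping.map_key \<sigma> q"
  have "Poly_Mapping.lookup p k = Poly_Mapping.lookup q k" for k
    using arg_cong[OF e, of "\<lambda>r. Poly_Mapping.lookup r (inv_into UNIV \<sigma> k)"] assms
    by (simp add: lookup_map_key bij_is_inj surj_f_inv_f bij_is_surj)
  then show "p = q" by (rule poly_mapping_eqI)
qed

lemma lookup_perm_vars:
  "bij \<sigma> \<Longrightarrow> Poly_Mapping.lookup (perm_vars \<sigma> p) m = Poly_Mapping.lookup p (Poly_Mapping.map_key \<sigma> m)"
  by (simp add: perm_vars_def lookup_map_key inj_map_key)

lemma map_key_single_bij:
  assumes "bij \<sigma>"
  shows "Poly_Mapping.map_key \<sigma> (Poly_Mapping.single (\<sigma> i) (c :: 'b :: zero)) = Poly_Mapping.single i c"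
  by (rule poly_mapping_eqI)
    (use assms in \<open>auto simp: lookup_map_key bij_is_inj lookup_single when_def dest: bij_is_inj[THEN injD]\<close>)

lemma perm_vars_single:
  assumes "bij \<sigma>"
  shows "perm_vars \<sigma> (Poly_Mapping.single (Poly_Mapping.map_key \<sigma> m) c) = Poly_Mapping.single m c"
  by (rule poly_mapping_eqI)
    (use assms in \<open>auto simp: lookup_perm_vars lookup_single when_def dest: inj_map_key[THEN injD]\<close>)

lemma map_key_inv:
  assumes "bij \<sigma>" shows "Poly_Mapping.map_key \<sigma> (Poly_Mapping.map_key (inv_into UNIV \<sigma>) m) = m"
  by (rule poly_mapping_eqI)
    (use assms in \<open>simp add: lookup_map_key bij_is_inj bij_imp_bij_inv\<close>)

lemma perm_vars_single':
  assumes "bij \<sigma>"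
  shows "perm_vars \<sigma> (Poly_Mapping.single m c) = Poly_Mapping.single (Poly_Mapping.map_key (inv_into UNIV \<sigma>) m) c"
  using perm_vars_single[OF assms, of "Poly_Mapping.map_key (inv_into UNIV \<sigma>) m" c] by (simp add: map_key_inv assms)

lemma perm_vars_add: "bij \<sigma> \<Longrightarrow> perm_vars \<sigma> (p + q) = perm_vars \<sigma> p + perm_vars \<sigma> q"
  by (rule poly_mapping_eqI) (simp add: lookup_perm_vars lookup_add)

lemma perm_vars_zero: "bij \<sigma> \<Longrightarrow> perm_vars \<sigma> 0 = 0"
  by (rule poly_mapping_eqI) (simp add: lookup_perm_vars)

lemma perm_vars_scale: "bij \<sigma> \<Longrightarrow> perm_vars \<sigma> (Poly_Mapping.map ((*) c) p) = Poly_Mapping.map ((*) c) (perm_vars \<sigma> p)"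
  by (rule poly_mapping_eqI) (simp add: lookup_perm_vars)

lemma perm_vars_sum: "bij \<sigma> \<Longrightarrow> perm_vars \<sigma> (sum f A) = (\<Sum>a\<in>A. perm_vars \<sigma> (f a))"
  by (induction A rule: infinite_finite_induct) (simp_all add: perm_vars_zero perm_vars_add)

text \<open>Both sides are bilinear; on monomials the claim is that pulling exponents back along the
  inverse permutation is additive.\<close>

lemma perm_vars_mult:
  assumes s: "bij \<sigma>" shows "perm_vars \<sigma> (p * q) = perm_vars \<sigma> p * perm_vars \<sigma> q"
proof -
  have ma: "Poly_Mapping.map_key (inv_into UNIV \<sigma>) (m + m') = Poly_Mapping.map_key (inv_into UNIV \<sigma>) m + Poly_Mapping.map_key (inv_into UNIV \<sigma>) m'"
    for m m' :: "nat \<Rightarrow>\<^sub>0 nat"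
    by (rule poly_mapping_eqI) (simp add: lookup_map_key bij_is_inj bij_imp_bij_inv s lookup_add)
  let ?p = "\<lambda>m. Poly_Mapping.single m (Poly_Mapping.lookup p m)" and ?q = "\<lambda>m. Poly_Mapping.single m (Poly_Mapping.lookup q m)"
  have "perm_vars \<sigma> (sum ?p (Poly_Mapping.keys p) * sum ?q (Poly_Mapping.keys q)) =
      perm_vars \<sigma> (sum ?p (Poly_Mapping.keys p)) * perm_vars \<sigma> (sum ?q (Poly_Mapping.keys q))"
    by (simp add: sum_product perm_vars_sum[OF s] mult_single perm_vars_single'[OF s] ma)
  then show ?thesis by (simp only: poly_mapping_sum_single[symmetric])
qed

lemma perm_vars_one: "bij \<sigma> \<Longrightarrow> perm_vars \<sigma> 1 = 1"
proof -
  assume s: "bij \<sigma>"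
  have "Poly_Mapping.map_key (inv_into UNIV \<sigma>) (0 :: nat \<Rightarrow>\<^sub>0 nat) = 0"
    by (rule poly_mapping_eqI) (simp add: lookup_map_key bij_is_inj bij_imp_bij_inv s)
  then show ?thesis using perm_vars_single'[OF s, of 0 1] by simp
qed

lemma perm_vars_prod: "bij \<sigma> \<Longrightarrow> perm_vars \<sigma> (prod f A) = (\<Prod>a\<in>A. perm_vars \<sigma> (f a))"
  by (induction A rule: infinite_finite_induct) (simp_all add: perm_vars_one perm_vars_mult)

lemma perm_vars_of_int: "bij \<sigma> \<Longrightarrow> perm_vars \<sigma> (of_int k * p) = of_int k * perm_vars \<sigma> p"
proof -
  assume s: "bij \<sigma>"
  have "of_int k * q = Poly_Mapping.map ((*) (of_int k)) q" for q :: zpoly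
    by (simp add: mult_map_scale_conv_mult single_of_int)
  then show ?thesis using s by (simp add: perm_vars_scale del: lookup_scale)
qed

lemma perm_vars_comp:
  assumes "bij \<sigma>" "bij \<tau>" shows "perm_vars \<sigma> (perm_vars \<tau> p) = perm_vars (\<sigma> \<circ> \<tau>) p"
proof (rule poly_mapping_eqI)
  fix m :: "nat \<Rightarrow>\<^sub>0 nat"
  have "Poly_Mapping.map_key \<tau> (Poly_Mapping.map_key \<sigma> m) = Poly_Mapping.map_key (\<sigma> \<circ> \<tau>) m"
    by (rule poly_mapping_eqI) (use assms in \<open>simp add: lookup_map_key bij_is_inj inj_compose\<close>)
  then show "Poly_Mapping.lookup (perm_vars \<sigma> (perm_vars \<tau> p)) m = Poly_Mapping.lookup (perm_vars (\<sigma> \<circ> \<tau>) p) m"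
    using assms by (simp add: lookup_perm_vars bij_comp)
qed

lemma perm_vars_zinv: "bij \<sigma> \<Longrightarrow> perm_vars \<sigma> (zinv i) = zinv (\<sigma> i)"
  using perm_vars_single[of \<sigma> "Poly_Mapping.single (\<sigma> i) 1" 1] by (simp add: zinv_def map_key_single_bij)

lemma keys_map_key_bij: "bij \<sigma> \<Longrightarrow> Poly_Mapping.keys (Poly_Mapping.map_key \<sigma> m) = \<sigma> -` Poly_Mapping.keys m"
  by (auto simp: in_keys_iff lookup_map_key bij_is_inj)

lemma perm_vars_zpolys:
  assumes "\<sigma> \<in> sym_group N" "p \<in> zpolys N" shows "perm_vars \<sigma> p \<in> zpolys N"
proof -
  have s: "bij \<sigma>" by (rule sym_group_bij[OF assms(1)])
  have "i < N" if m: "m \<in> Poly_Mapping.keys (perm_vars \<sigma> p)" "i \<in> Poly_Mapping.keys m" for m i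
  proof -
    have "Poly_Mapping.map_key \<sigma> m \<in> Poly_Mapping.keys p" using m(1) by (simp add: in_keys_iff lookup_perm_vars s)
    then have "Poly_Mapping.keys (Poly_Mapping.map_key \<sigma> m) \<subseteq> {..<N}" using assms(2) by (simp add: zpolys_def)
    moreover have "inv_into UNIV \<sigma> i \<in> Poly_Mapping.keys (Poly_Mapping.map_key \<sigma> m)"
      using m(2) s by (simp add: keys_map_key_bij surj_f_inv_f bij_is_surj)
    ultimately have "inv_into UNIV \<sigma> i < N" by auto
    then have "\<sigma> (inv_into UNIV \<sigma> i) < N" by (rule sym_group_less[OF assms(1)])
    then show ?thesis using s by (simp add: surj_f_inv_f bij_is_surj)
  qed
  then show ?thesis by (auto simp: zpolys_def)
qed

lemma perm_vars_homogeneous: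
  assumes s: "bij \<sigma>" and h: "homogeneous d p" shows "homogeneous d (perm_vars \<sigma> p)"
  unfolding homogeneous_def
proof
  fix m assume "m \<in> Poly_Mapping.keys (perm_vars \<sigma> p)"
  then have mk: "Poly_Mapping.map_key \<sigma> m \<in> Poly_Mapping.keys p" by (simp add: in_keys_iff lookup_perm_vars s)
  have "- int (\<Sum>i\<in>\<sigma> -` Poly_Mapping.keys m. Poly_Mapping.lookup m (\<sigma> i)) = d"
    unfolding keys_map_key_bij[OF s, symmetric] lookup_map_key[OF bij_is_inj[OF s], symmetric]
    by (rule bspec[OF h[unfolded homogeneous_def] mk])
  moreover have "(\<Sum>i\<in>\<sigma> -` Poly_Mapping.keys m. Poly_Mapping.lookup m (\<sigma> i)) = (\<Sum>i\<in>Poly_Mapping.keys m. Poly_Mapping.lookup m i)"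
    by (rule sum.reindex_bij_betw) (use s in \<open>auto simp: bij_betw_def inj_on_def bij_def surj_image_vimage_eq\<close>)
  ultimately show "- int (\<Sum>i\<in>Poly_Mapping.keys m. Poly_Mapping.lookup m i) = d" by simp
qed

lemma zpolys_closed:
  "0 \<in> zpolys N" "1 \<in> zpolys N" "p \<in> zpolys N \<Longrightarrow> q \<in> zpolys N \<Longrightarrow> p + q \<in> zpolys N"
  "p \<in> zpolys N \<Longrightarrow> q \<in> zpolys N \<Longrightarrow> p * q \<in> zpolys N"
  "p \<in> zpolys N \<Longrightarrow> - p \<in> zpolys N" "p \<in> zpolys N \<Longrightarrow> Poly_Mapping.map ((*) c) p \<in> zpolys N"
  "i < N \<Longrightarrow> zinv i \<in> zpolys N"
proof -
  show "p \<in> zpolys N \<Longrightarrow> q \<in> zpolys N \<Longrightarrow> p + q \<in> zpolys N"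
    using Poly_Mapping.keys_add[of p q] by (auto simp: zpolys_def)
  show "p * q \<in> zpolys N" if "p \<in> zpolys N" "q \<in> zpolys N"
  proof -
    have "Poly_Mapping.keys m \<subseteq> {..<N}" if m: "m \<in> Poly_Mapping.keys (p * q)" for m
    proof -
      have "m \<in> {a + b | a b. a \<in> Poly_Mapping.keys p \<and> b \<in> Poly_Mapping.keys q}"
        by (rule subsetD[OF keys_mult m])
      then obtain a b where "m = a + b" "a \<in> Poly_Mapping.keys p" "b \<in> Poly_Mapping.keys q" by auto
      then show ?thesis
        using \<open>p \<in> zpolys N\<close> \<open>q \<in> zpolys N\<close> Poly_Mapping.keys_add[of a b] by (fastforce simp: zpolys_def)
    qed
    then show ?thesis by (simp add: zpolys_def)
  qed
  show "p \<in> zpolys N \<Longrightarrow> Poly_Mapping.map ((*) c) p \<in> zpolys N"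
    using keys_scale[of c p] by (auto simp: zpolys_def)
qed (auto simp: zpolys_def zinv_def)

lemma zpolys_sum: "(\<And>a. a \<in> A \<Longrightarrow> f a \<in> zpolys N) \<Longrightarrow> sum f A \<in> zpolys N"
  by (induction A rule: infinite_finite_induct) (simp_all add: zpolys_closed)

lemma zpolys_prod: "(\<And>a. a \<in> A \<Longrightarrow> f a \<in> zpolys N) \<Longrightarrow> prod f A \<in> zpolys N"
  by (induction A rule: infinite_finite_induct) (simp_all add: zpolys_closed)

lemma zpolys_power: "p \<in> zpolys N \<Longrightarrow> p ^ k \<in> zpolys N"
  by (induction k) (simp_all add: zpolys_closed)

lemma elem_sym_zpolys: "elem_sym N k \<in> zpolys N"
  unfolding elem_sym_def by (intro zpolys_sum zpolys_prod zpolys_closed) auto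

lemma perm_vars_elem_sym:
  assumes "\<sigma> \<in> sym_group N" shows "perm_vars \<sigma> (elem_sym N k) = elem_sym N k"
proof -
  have s: "bij \<sigma>" by (rule sym_group_bij[OF assms])
  have si: "inj \<sigma>" using s by (rule bij_is_inj)
  have p: "\<sigma> permutes {..<N}" using assms by (simp add: sym_group_def)
  have "perm_vars \<sigma> (elem_sym N k) = (\<Sum>S | S \<subseteq> {..<N} \<and> card S = k. \<Prod>i\<in>S. zinv (\<sigma> i))"
    unfolding elem_sym_def by (simp add: perm_vars_sum[OF s] perm_vars_prod[OF s] perm_vars_zinv[OF s])
  also have "\<dots> = (\<Sum>S | S \<subseteq> {..<N} \<and> card S = k. \<Prod>i\<in>\<sigma> ` S. zinv i)"
    by (rule sum.cong[OF refl]) (subst prod.reindex, use si in \<open>auto intro: inj_on_subset\<close>)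
  also have "\<dots> = (\<Sum>S | S \<subseteq> {..<N} \<and> card S = k. \<Prod>i\<in>S. zinv i)"
  proof (rule sum.reindex_bij_betw)
    have im: "\<sigma> ` {..<N} = {..<N}" "inv_into UNIV \<sigma> ` {..<N} = {..<N}" using p permutes_inv[OF p] by (auto simp: permutes_image)
    show "bij_betw ((`) \<sigma>) {S. S \<subseteq> {..<N} \<and> card S = k} {S. S \<subseteq> {..<N} \<and> card S = k}"
    proof (rule bij_betw_byWitness[where f' = "(`) (inv_into UNIV \<sigma>)"])
      show "(`) \<sigma> ` {S. S \<subseteq> {..<N} \<and> card S = k} \<subseteq> {S. S \<subseteq> {..<N} \<and> card S = k}"
        using im(1) si by (auto simp: card_image inj_on_subset)
      show "(`) (inv_into UNIV \<sigma>) ` {S. S \<subseteq> {..<N} \<and> card S = k} \<subseteq> {S. S \<subseteq> {..<N} \<and> card S = k}"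
        using im(2) bij_is_inj[OF bij_imp_bij_inv[OF s]] by (auto simp: card_image inj_on_subset)
    qed (auto simp: image_comp[symmetric] image_image inv_f_f[OF si] surj_f_inv_f bij_is_surj[OF s])
  qed
  finally show ?thesis by (simp add: elem_sym_def)
qed

section \<open>Newton's identities\<close>

text \<open>The logarithmic derivative of the generating function of the elementary symmetric
  polynomials has signed power sums as coefficients. It is stated as a product, so that nothing has
  to be inverted.\<close>

lemma newton_fps:
  fixes x :: "'i \<Rightarrow> 'a :: comm_ring_1"
  assumes "finite A"
  defines "E \<equiv> \<Prod>i\<in>A. (1 + fps_const (x i) * fps_X)"
  shows "fps_deriv E = E * Abs_fps (\<lambda>k. (- 1) ^ k * (\<Sum>i\<in>A. x i ^ Suc k))"
  using assms(1) unfolding E_def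
proof (induction A rule: finite_induct)
  case empty
  then show ?case by (simp add: fps_eq_iff)
next
  case (insert a A)
  let ?E = "\<Prod>i\<in>A. (1 + fps_const (x i) * fps_X)" and ?P = "\<lambda>A. Abs_fps (\<lambda>k. (- 1) ^ k * (\<Sum>i\<in>A. x i ^ Suc k))"
  \<comment> \<open>The geometric series of x / (1 + x X) for x = \<open>x a\<close>, the
    contribution of one factor to the logarithmic derivative.\<close>
  let ?G = "Abs_fps (\<lambda>k. (- 1) ^ k * x a ^ Suc k)"
  have G: "(1 + fps_const (x a) * fps_X) * ?G = fps_const (x a)"
  proof (rule fps_ext)
    fix k show "fps_nth ((1 + fps_const (x a) * fps_X) * ?G) k = fps_nth (fps_const (x a)) k"
      by (cases k) (simp_all add: distrib_right mult.assoc)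
  qed
  have P: "?P (insert a A) = ?G + ?P A"
    by (rule fps_ext) (use insert in \<open>simp add: algebra_simps\<close>)
  have "fps_deriv (\<Prod>i\<in>insert a A. (1 + fps_const (x i) * fps_X)) =
      fps_const (x a) * ?E + (1 + fps_const (x a) * fps_X) * (?E * ?P A)"
    using insert by (simp add: algebra_simps)
  also have "\<dots> = ((1 + fps_const (x a) * fps_X) * ?G) * ?E + (1 + fps_const (x a) * fps_X) * (?E * ?P A)"
    unfolding G ..
  also have "\<dots> = ((1 + fps_const (x a) * fps_X) * ?E) * ?P (insert a A)"
    unfolding P by (simp add: algebra_simps)
  finally show ?case using insert by simp
qed

lemma fps_nth_prod_linear:
  fixes x :: "'i \<Rightarrow> 'a :: comm_ring_1"
  assumes "finite A"
  shows "fps_nth (\<Prod>i\<in>A. (1 + fps_const (x i) * fps_X)) k = (\<Sum>S | S \<subseteq> A \<and> card S = k. \<Prod>i\<in>S. x i)"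
proof -
  have "(\<Prod>i\<in>A. (1 + fps_const (x i) * fps_X)) = (\<Prod>i\<in>A. (fps_const (x i) * fps_X + 1))"
    by (simp add: add.commute)
  also have "\<dots> = (\<Sum>S\<in>Pow A. (\<Prod>i\<in>S. fps_const (x i) * fps_X) * (\<Prod>i\<in>A - S. 1))"
    by (rule prod_add[OF assms])
  also have "\<dots> = (\<Sum>S\<in>Pow A. fps_const (\<Prod>i\<in>S. x i) * fps_X ^ card S)"
  proof (rule sum.cong[OF refl])
    fix S assume "S \<in> Pow A"
    then have "finite S" using assms finite_subset by auto
    then have "(\<Prod>i\<in>S. fps_const (x i) * fps_X) = fps_const (\<Prod>i\<in>S. x i) * fps_X ^ card S"
      by (induction S rule: finite_induct) (simp_all add: fps_const_mult[symmetric] mult_ac del: fps_const_mult)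
    then show "(\<Prod>i\<in>S. fps_const (x i) * fps_X) * (\<Prod>i\<in>A - S. 1) = fps_const (\<Prod>i\<in>S. x i) * fps_X ^ card S" by simp
  qed
  finally have "fps_nth (\<Prod>i\<in>A. (1 + fps_const (x i) * fps_X)) k = (\<Sum>S\<in>Pow A. if k = card S then \<Prod>i\<in>S. x i else 0)"
    by (simp add: fps_sum_nth fps_X_power_nth if_distrib[of "\<lambda>y. _ * y"] cong: if_cong)
  also have "\<dots> = (\<Sum>S\<in>{S \<in> Pow A. k = card S}. \<Prod>i\<in>S. x i)"
    by (rule sum.inter_filter[symmetric]) (use assms in simp)
  also have "{S \<in> Pow A. k = card S} = {S. S \<subseteq> A \<and> card S = k}" by auto
  finally show ?thesis .
qed

definition power_sum :: "nat \<Rightarrow> nat \<Rightarrow> zpoly" where "power_sum N a = (\<Sum>i<N. zinv i ^ a)"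

text \<open>Coefficient k of \<open>newton_fps\<close>: differentiation shifts the elementary
  symmetric polynomial to degree k + 1, and the coefficient k - i of the second factor is a power
  sum of exponent k - i + 1.\<close>

lemma newton:
  "of_nat (Suc k) * elem_sym N (Suc k) = (\<Sum>i\<le>k. elem_sym N i * ((- 1) ^ (k - i) * power_sum N (Suc (k - i))))"
proof -
  let ?E = "\<Prod>i\<in>{..<N}. (1 + fps_const (zinv i) * fps_X)"
  have "fps_nth (fps_deriv ?E) k = fps_nth (?E * Abs_fps (\<lambda>k. (- 1) ^ k * (\<Sum>i<N. zinv i ^ Suc k))) k"
    by (subst newton_fps) simp_all
  moreover have "fps_nth ?E j = elem_sym N j" for j
    unfolding elem_sym_def by (rule fps_nth_prod_linear) simp
  ultimately show ?thesis
    by (simp add: fps_mult_nth power_sum_def atLeast0AtMost del: power_Suc)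
qed

section \<open>The polynomial ring and the ideal of positive degree symmetric polynomials\<close>

lemma map_scale_mult: "Poly_Mapping.map ((*) c) p * q = Poly_Mapping.map ((*) c) (p * q)" for p q :: zpoly
  by (simp add: mult_map_scale_conv_mult mult.assoc)

lemma map_scale_mult_right: "p * Poly_Mapping.map ((*) c) q = Poly_Mapping.map ((*) c) (p * q)" for p q :: zpoly
  by (simp add: mult_map_scale_conv_mult mult.left_commute)

lemma zpoly_ring_simps:
  "carrier (zpoly_ring N) = zpolys N" "p \<otimes>\<^bsub>zpoly_ring N\<^esub> q = p * q" "\<one>\<^bsub>zpoly_ring N\<^esub> = 1"
  "\<zero>\<^bsub>zpoly_ring N\<^esub> = 0" "p \<oplus>\<^bsub>zpoly_ring N\<^esub> q = p + q"
  "c \<odot>\<^bsub>zpoly_ring N\<^esub> p = Poly_Mapping.map ((*) c) p"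
  "hcomp (zpoly_ring N) d = {p \<in> zpolys N. homogeneous d p}" "act (zpoly_ring N) = perm_vars"
  by (simp_all add: zpoly_ring_def)

lemma abelian_group_zpoly_ring: "abelian_group (zpoly_ring N)"
proof (rule abelian_groupI)
  show "\<exists>q\<in>carrier (zpoly_ring N). q \<oplus>\<^bsub>zpoly_ring N\<^esub> p = \<zero>\<^bsub>zpoly_ring N\<^esub>" if "p \<in> carrier (zpoly_ring N)" for p
    by (rule bexI[of _ "- p"]) (use that in \<open>simp_all add: zpoly_ring_simps zpolys_closed\<close>)
qed (simp_all add: zpoly_ring_simps zpolys_closed ac_simps)

lemma cring_zpoly_ring: "cring (zpoly_ring N)"
proof (rule cringI)
  show "comm_monoid (zpoly_ring N)"
    by (rule comm_monoidI) (simp_all add: zpoly_ring_simps zpolys_closed ac_simps)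
qed (simp_all add: abelian_group_zpoly_ring zpoly_ring_simps distrib_right)

lemma module_zpoly_ring: "module class_ring (zpoly_ring N)"
  by (rule module_class_ringI[OF abelian_group_zpoly_ring])
    (auto simp: zpoly_ring_simps zpolys_closed lookup_add algebra_simps intro!: poly_mapping_eqI)

text \<open>The ideal in explicit form: having one coefficient per generator makes it possible to
  permute or antisymmetrise the coefficients while the generators stay fixed.\<close>

definition J_sums :: "nat \<Rightarrow> zpoly set" where
  "J_sums N = {(\<Sum>k\<in>{1..N}. elem_sym N k * q k) | q. \<forall>k. q k \<in> zpolys N}"

lemma ideal_J: "ideal (J_ideal N) (zpoly_ring N)"
proof -
  interpret cring "zpoly_ring N" by (rule cring_zpoly_ring)
  show ?thesis unfolding J_ideal_def
    by (rule genideal_ideal) (auto simp: zpoly_ring_simps elem_sym_zpolys)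
qed

lemma J_facts:
  shows J_sub: "J_ideal N \<subseteq> zpolys N" and J_zero: "0 \<in> J_ideal N"
    and J_add: "p \<in> J_ideal N \<Longrightarrow> q \<in> J_ideal N \<Longrightarrow> p + q \<in> J_ideal N"
    and J_mult: "p \<in> J_ideal N \<Longrightarrow> q \<in> zpolys N \<Longrightarrow> q * p \<in> J_ideal N"
    and J_gen: "k \<in> {1..N} \<Longrightarrow> elem_sym N k \<in> J_ideal N"
proof -
  interpret ideal "J_ideal N" "zpoly_ring N" by (rule ideal_J)
  show "J_ideal N \<subseteq> zpolys N" using a_subset by (simp add: zpoly_ring_simps)
  note as = ideal.axioms(1)[OF ideal_J[of N]]
  show "0 \<in> J_ideal N" using additive_subgroup.zero_closed[OF as] by (simp add: zpoly_ring_simps)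
  show "p \<in> J_ideal N \<Longrightarrow> q \<in> J_ideal N \<Longrightarrow> p + q \<in> J_ideal N" using additive_subgroup.a_closed[OF as] by (simp add: zpoly_ring_simps)
  show "p \<in> J_ideal N \<Longrightarrow> q \<in> zpolys N \<Longrightarrow> q * p \<in> J_ideal N" using I_l_closed by (simp add: zpoly_ring_simps)
  show "k \<in> {1..N} \<Longrightarrow> elem_sym N k \<in> J_ideal N"
    unfolding J_ideal_def
    by (rule subsetD[OF ring.genideal_self[OF cring.axioms(1)[OF cring_zpoly_ring]]])
      (auto simp: zpoly_ring_simps elem_sym_zpolys)
qed

lemma J_scale: "p \<in> J_ideal N \<Longrightarrow> Poly_Mapping.map ((*) c) p \<in> J_ideal N"
  using J_mult[of p N "Poly_Mapping.map ((*) c) 1"] by (simp add: zpolys_closed map_scale_mult del: lookup_scale)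

lemma J_sum: "(\<And>a. a \<in> A \<Longrightarrow> f a \<in> J_ideal N) \<Longrightarrow> sum f A \<in> J_ideal N"
  by (induction A rule: infinite_finite_induct) (simp_all add: J_zero J_add)

lemma J_eq_sums: "J_ideal N = J_sums N"
proof
  show "J_sums N \<subseteq> J_ideal N"
    unfolding J_sums_def by (auto intro!: J_sum simp: mult.commute[of "elem_sym N _"] J_mult J_gen)
  have z: "(\<Sum>k\<in>{1..N}. elem_sym N k * q k) \<in> zpolys N" if "\<forall>k. q k \<in> zpolys N" for q
    using that by (intro zpolys_sum zpolys_closed elem_sym_zpolys) simp
  have "ideal (J_sums N) (zpoly_ring N)"
  proof (rule idealI)
    show "ring (zpoly_ring N)" by (rule cring.axioms(1)[OF cring_zpoly_ring])
    interpret cring "zpoly_ring N" by (rule cring_zpoly_ring)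
    have neg: "\<ominus>\<^bsub>zpoly_ring N\<^esub> p = - p" if "p \<in> zpolys N" for p
      by (rule minus_equality) (use that in \<open>simp_all add: zpoly_ring_simps zpolys_closed\<close>)
    show "subgroup (J_sums N) (add_monoid (zpoly_ring N))"
    proof (rule add.subgroupI)
      show "J_sums N \<subseteq> carrier (zpoly_ring N)" using z by (auto simp: J_sums_def zpoly_ring_simps)
      show "J_sums N \<noteq> {}" by (auto simp: J_sums_def intro: exI[of _ "\<lambda>k. 0"] zpolys_closed)
      show "\<ominus>\<^bsub>zpoly_ring N\<^esub> p \<in> J_sums N" if pJ: "p \<in> J_sums N" for p
      proof -
        obtain q where q: "p = (\<Sum>k\<in>{1..N}. elem_sym N k * q k)" "\<forall>k. q k \<in> zpolys N"
          using pJ by (auto simp: J_sums_def simp del: One_nat_def)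
        have "- p = (\<Sum>k\<in>{1..N}. elem_sym N k * (- q k))" by (simp add: q(1) sum_negf)
        then have "- p \<in> J_sums N" using q(2) unfolding J_sums_def by (auto intro!: exI[of _ "\<lambda>k. - q k"] zpolys_closed)
        then show ?thesis using neg z[OF q(2)] q(1) by simp
      qed
      show "p \<oplus>\<^bsub>zpoly_ring N\<^esub> p' \<in> J_sums N" if pJ: "p \<in> J_sums N" "p' \<in> J_sums N" for p p'
      proof -
        obtain q q' where q: "p = (\<Sum>k\<in>{1..N}. elem_sym N k * q k)" "\<forall>k. q k \<in> zpolys N"
          "p' = (\<Sum>k\<in>{1..N}. elem_sym N k * q' k)" "\<forall>k. q' k \<in> zpolys N"
          using pJ by (auto simp: J_sums_def simp del: One_nat_def)
        have "p + p' = (\<Sum>k\<in>{1..N}. elem_sym N k * (q k + q' k))" by (simp add: q sum.distrib distrib_left)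
        then show ?thesis using q(2,4) unfolding J_sums_def zpoly_ring_simps
          by (auto intro!: exI[of _ "\<lambda>k. q k + q' k"] zpolys_closed)
      qed
    qed
    fix p r assume p: "p \<in> J_sums N" and r: "r \<in> carrier (zpoly_ring N)"
    obtain q where q: "p = (\<Sum>k\<in>{1..N}. elem_sym N k * q k)" "\<forall>k. q k \<in> zpolys N"
      using p by (auto simp: J_sums_def simp del: One_nat_def)
    have "r * p = (\<Sum>k\<in>{1..N}. elem_sym N k * (r * q k))" by (simp add: q(1) sum_distrib_left ac_simps)
    then have "r * p \<in> J_sums N" using q(2) r unfolding J_sums_def zpoly_ring_simps
      by (auto intro!: exI[of _ "\<lambda>k. r * q k"] zpolys_closed)
    then show "r \<otimes>\<^bsub>zpoly_ring N\<^esub> p \<in> J_sums N" "p \<otimes>\<^bsub>zpoly_ring N\<^esub> r \<in> J_sums N"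
      by (simp_all add: zpoly_ring_simps mult.commute)
  qed
  moreover have "elem_sym N ` {1..N} \<subseteq> J_sums N"
  proof
    fix p assume "p \<in> elem_sym N ` {1..N}"
    then obtain k where k: "k \<in> {1..N}" "p = elem_sym N k" by auto
    have "p = (\<Sum>j\<in>{1..N}. elem_sym N j * (if j = k then 1 else 0))"
      using k by (simp add: if_distrib[of "\<lambda>x. _ * x"] cong: if_cong)
    then show "p \<in> J_sums N" unfolding J_sums_def
      by (intro CollectI exI[of _ "\<lambda>j. if j = k then 1 else 0"]) (simp add: zpolys_closed)
  qed
  ultimately show "J_ideal N \<subseteq> J_sums N"
    unfolding J_ideal_def by (rule ring.genideal_minimal[OF cring.axioms(1)[OF cring_zpoly_ring]])
qed

lemma elem_sym_0: "elem_sym N 0 = 1"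
proof -
  have "{S. S \<subseteq> {..<N} \<and> card S = 0} = {{}}" by (auto simp: card_eq_0_iff dest: finite_subset[OF _ finite_lessThan])
  then show ?thesis by (simp add: elem_sym_def)
qed

lemma elem_sym_large: "k > N \<Longrightarrow> elem_sym N k = 0"
proof -
  assume k: "k > N"
  have "card S \<le> N" if "S \<subseteq> {..<N}" for S using card_mono[OF _ that] by simp
  then have e: "{S. S \<subseteq> {..<N} \<and> card S = k} = {}" using k by (auto simp: not_le[symmetric])
  show ?thesis unfolding elem_sym_def e by simp
qed

text \<open>Newton's identities are applied in all degrees, because all \<open>B_op n N a\<close>
  with a > 0 occur; beyond N the elementary symmetric polynomial is zero.\<close>

lemma elem_sym_J: "elem_sym N (Suc k) \<in> J_ideal N"
  using J_gen[of "Suc k" N] by (cases "Suc k \<le> N") (simp_all add: elem_sym_large J_zero)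

lemma J_uminus: "p \<in> J_ideal N \<Longrightarrow> - p \<in> J_ideal N"
  using J_mult[of p N "- 1"] by (simp add: zpolys_closed)

lemma zpolys_of_nat: "of_nat k \<in> zpolys N"
  by (induction k) (simp_all add: zpolys_closed)

lemma zpolys_minus1_power: "(- 1) ^ k \<in> zpolys N"
  by (intro zpolys_power zpolys_closed)

lemma power_sum_zpolys: "power_sum N a \<in> zpolys N"
  unfolding power_sum_def by (intro zpolys_sum zpolys_power zpolys_closed) simp

text \<open>In Newton's identity the power sum of highest exponent occurs only for i = 0, with
  coefficient a sign. All other terms contain an elementary symmetric polynomial of positive
  degree.\<close>

lemma power_sum_J: "power_sum N (Suc k) \<in> J_ideal N"
proof -
  have "of_nat (Suc k) * elem_sym N (Suc k) = (- 1) ^ k * power_sum N (Suc k) +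
      (\<Sum>i<k. elem_sym N (Suc i) * ((- 1) ^ (k - Suc i) * power_sum N (Suc (k - Suc i))))"
    unfolding newton by (subst sum.atMost_shift) (simp add: elem_sym_0)
  then have "(- 1) ^ k * power_sum N (Suc k) = of_nat (Suc k) * elem_sym N (Suc k) +
      - (\<Sum>i<k. elem_sym N (Suc i) * ((- 1) ^ (k - Suc i) * power_sum N (Suc (k - Suc i))))"
    by (simp add: algebra_simps)
  moreover have "\<dots> \<in> J_ideal N"
  proof (rule J_add[OF _ J_uminus[OF J_sum]])
    show "of_nat (Suc k) * elem_sym N (Suc k) \<in> J_ideal N" by (rule J_mult[OF elem_sym_J zpolys_of_nat])
    show "elem_sym N (Suc i) * ((- 1) ^ (k - Suc i) * power_sum N (Suc (k - Suc i))) \<in> J_ideal N" for i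
      by (subst mult.commute) (intro J_mult elem_sym_J zpolys_closed zpolys_minus1_power power_sum_zpolys)
  qed
  ultimately have "(- 1) ^ k * power_sum N (Suc k) \<in> J_ideal N" by simp
  then have "(- 1) ^ k * ((- 1) ^ k * power_sum N (Suc k)) \<in> J_ideal N"
    by (rule J_mult[OF _ zpolys_minus1_power])
  then show ?thesis by (simp add: mult.assoc[symmetric] power_mult_distrib[symmetric])
qed

section \<open>The wedge product, antisymmetrisation and the image of the Heisenberg algebra\<close>

lemma wedge_simps:
  "carrier (wedge n N) = {F \<in> tensor_polys n N. \<forall>\<sigma>\<in>sym_group N. diag_perm \<sigma> F = (\<lambda>w. of_int (sign \<sigma>) * F w)}"
  "\<zero>\<^bsub>wedge n N\<^esub> = (\<lambda>w. 0)" "F \<oplus>\<^bsub>wedge n N\<^esub> F' = (\<lambda>w. F w + F' w)"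
  "c \<odot>\<^bsub>wedge n N\<^esub> F = (\<lambda>w. Poly_Mapping.map ((*) c) (F w))"
  "hcomp (wedge n N) d = {F \<in> carrier (wedge n N). \<forall>w. homogeneous d (F w)}"
  "act (wedge n N) X = current_act n N X 0"
  by (simp_all add: wedge_def Let_def)

lemma wedge_iff:
  "F \<in> carrier (wedge n N) \<longleftrightarrow> (\<forall>w. F w \<in> zpolys N) \<and> (\<forall>w. w \<notin> words n N \<longrightarrow> F w = 0) \<and>
     (\<forall>\<sigma>\<in>sym_group N. \<forall>w. perm_vars \<sigma> (F (w \<circ> \<sigma>)) = of_int (sign \<sigma>) * F w)"
  by (auto simp: wedge_simps tensor_polys_def diag_perm_def fun_eq_iff zpolys_closed)

lemma scale_zero [simp]: "Poly_Mapping.map ((*) c) 0 = 0" for c :: complex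
  by (rule poly_mapping_eqI) simp

lemma module_wedge: "module class_ring (wedge n N)"
proof (rule module_class_ringI)
  show "abelian_group (wedge n N)"
  proof (rule abelian_groupI)
    show "\<exists>F'\<in>carrier (wedge n N). F' \<oplus>\<^bsub>wedge n N\<^esub> F = \<zero>\<^bsub>wedge n N\<^esub>" if F: "F \<in> carrier (wedge n N)" for F
    proof (rule bexI[of _ "\<lambda>w. - F w"])
      have "perm_vars \<sigma> (- p) = - perm_vars \<sigma> p" if "\<sigma> \<in> sym_group N" for \<sigma> p
        using sym_group_bij[OF that] by (intro poly_mapping_eqI) (simp add: lookup_perm_vars)
      then show "(\<lambda>w. - F w) \<in> carrier (wedge n N)" using F by (simp add: wedge_iff zpolys_closed)
    qed (simp add: wedge_simps)
  qed (auto simp: wedge_iff wedge_simps(2,3) zpolys_closed perm_vars_add perm_vars_zero sym_group_bij algebra_simps)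
  show "c \<odot>\<^bsub>wedge n N\<^esub> F \<in> carrier (wedge n N)" if "F \<in> carrier (wedge n N)" for c F
    using that by (auto simp: wedge_iff wedge_simps(4) zpolys_closed perm_vars_scale sym_group_bij map_scale_mult_right
        simp del: lookup_scale)
qed (auto simp: wedge_simps(3,4) lookup_add algebra_simps fun_eq_iff intro!: poly_mapping_eqI)

definition alt :: "nat \<Rightarrow> ((nat \<Rightarrow> nat) \<Rightarrow> zpoly) \<Rightarrow> (nat \<Rightarrow> nat) \<Rightarrow> zpoly" where
  "alt N F w = Poly_Mapping.map ((*) (1 / fact N)) (\<Sum>\<sigma>\<in>sym_group N. of_int (sign \<sigma>) * perm_vars \<sigma> (F (w \<circ> \<sigma>)))"

lemma zpolys_of_int: "of_int k * p \<in> zpolys N" if "p \<in> zpolys N"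
proof -
  have "of_int k * p = Poly_Mapping.map ((*) (of_int k)) p"
    by (simp add: mult_map_scale_conv_mult single_of_int)
  then show ?thesis using that by (simp add: zpolys_closed del: lookup_scale)
qed

lemma word_comp_iff: "\<sigma> \<in> sym_group N \<Longrightarrow> w \<circ> \<sigma> \<in> words n N \<longleftrightarrow> w \<in> words n N"
proof
  assume s: "\<sigma> \<in> sym_group N" and w: "w \<circ> \<sigma> \<in> words n N"
  have "(w \<circ> \<sigma>) \<circ> inv_into UNIV \<sigma> \<in> words n N" by (rule word_comp_sym_group[OF w permutes_inv_apply[OF s]])
  then show "w \<in> words n N"
    using surj_iff[THEN iffD1, OF bij_is_surj[OF sym_group_bij[OF s]]] by (simp add: comp_assoc)
qed (rule word_comp_sym_group)

lemma alt_wedge: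
  assumes "\<And>w. F w \<in> zpolys N" "\<And>w. w \<notin> words n N \<Longrightarrow> F w = 0"
  shows "alt N F \<in> carrier (wedge n N)"
  unfolding wedge_iff
proof (intro conjI allI impI ballI)
  show "alt N F w \<in> zpolys N" for w
    unfolding alt_def by (intro zpolys_closed zpolys_sum zpolys_of_int perm_vars_zpolys assms)
  show "alt N F w = 0" if "w \<notin> words n N" for w
  proof -
    have "(\<Sum>\<sigma>\<in>sym_group N. of_int (sign \<sigma>) * perm_vars \<sigma> (F (w \<circ> \<sigma>))) = 0"
      by (rule sum.neutral) (use that in \<open>simp add: word_comp_iff perm_vars_zero sym_group_bij assms(2)\<close>)
    then show ?thesis by (simp add: alt_def)
  qed
  fix \<tau> w assume t: "\<tau> \<in> sym_group N"
  note tb = sym_group_bij[OF t]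
  have "perm_vars \<tau> (\<Sum>\<sigma>\<in>sym_group N. of_int (sign \<sigma>) * perm_vars \<sigma> (F (w \<circ> \<tau> \<circ> \<sigma>))) =
      (\<Sum>\<sigma>\<in>sym_group N. of_int (sign \<sigma>) * perm_vars (\<tau> \<circ> \<sigma>) (F (w \<circ> (\<tau> \<circ> \<sigma>))))"
    by (simp add: perm_vars_sum[OF tb] perm_vars_of_int[OF tb] perm_vars_comp tb sym_group_bij comp_assoc)
  also have "\<dots> = (\<Sum>\<sigma>\<in>sym_group N. of_int (sign \<tau>) * (of_int (sign (\<tau> \<circ> \<sigma>)) * perm_vars (\<tau> \<circ> \<sigma>) (F (w \<circ> (\<tau> \<circ> \<sigma>)))))"
    by (rule sum.cong[OF refl])
      (simp add: sign_sym_group_comp[OF t] mult.assoc[symmetric] sign_square)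
  also have "\<dots> = (\<Sum>\<sigma>\<in>sym_group N. of_int (sign \<tau>) * (of_int (sign \<sigma>) * perm_vars \<sigma> (F (w \<circ> \<sigma>))))"
  proof (rule sum.reindex_bij_betw)
    show "bij_betw (\<lambda>\<sigma>. \<tau> \<circ> \<sigma>) (sym_group N) (sym_group N)"
    proof (rule bij_betw_byWitness[where f' = "\<lambda>\<sigma>. inv_into UNIV \<tau> \<circ> \<sigma>"])
      show "(\<lambda>\<sigma>. \<tau> \<circ> \<sigma>) ` sym_group N \<subseteq> sym_group N" using sym_group_comp[OF t] by auto
      show "(\<lambda>\<sigma>. inv_into UNIV \<tau> \<circ> \<sigma>) ` sym_group N \<subseteq> sym_group N"
        using sym_group_comp[OF permutes_inv_apply[OF t]] by auto
      show "\<forall>\<sigma>\<in>sym_group N. inv_into UNIV \<tau> \<circ> (\<tau> \<circ> \<sigma>) = \<sigma>" "\<forall>\<sigma>\<in>sym_group N. \<tau> \<circ> (inv_into UNIV \<tau> \<circ> \<sigma>) = \<sigma>"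
        using bij_is_inj[OF tb] bij_is_surj[OF tb] by (auto simp: fun_eq_iff surj_f_inv_f)
    qed
  qed
  finally show "perm_vars \<tau> (alt N F (w \<circ> \<tau>)) = of_int (sign \<tau>) * alt N F w"
    unfolding alt_def perm_vars_scale[OF tb] map_scale_mult_right sum_distrib_left[symmetric] by simp
qed

text \<open>Antisymmetrisation is linear over symmetric polynomials, so in a combination of
  symmetric polynomials the cofactors can be antisymmetrised individually.\<close>

lemma alt_sum_mult:
  assumes "\<And>k \<sigma>. k \<in> K \<Longrightarrow> \<sigma> \<in> sym_group N \<Longrightarrow> perm_vars \<sigma> (e k) = e k"
  shows "alt N (\<lambda>w. \<Sum>k\<in>K. e k * Q k w) = (\<lambda>w. \<Sum>k\<in>K. e k * alt N (Q k) w)"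
proof
  fix w
  have "(\<Sum>\<sigma>\<in>sym_group N. of_int (sign \<sigma>) * perm_vars \<sigma> (\<Sum>k\<in>K. e k * Q k (w \<circ> \<sigma>))) =
      (\<Sum>\<sigma>\<in>sym_group N. \<Sum>k\<in>K. e k * (of_int (sign \<sigma>) * perm_vars \<sigma> (Q k (w \<circ> \<sigma>))))"
    by (rule sum.cong[OF refl])
      (simp add: perm_vars_sum perm_vars_mult sym_group_bij assms sum_distrib_left mult.left_commute)
  also have "\<dots> = (\<Sum>k\<in>K. e k * (\<Sum>\<sigma>\<in>sym_group N. of_int (sign \<sigma>) * perm_vars \<sigma> (Q k (w \<circ> \<sigma>))))"
    by (subst sum.swap) (simp add: sum_distrib_left)
  finally show "alt N (\<lambda>w. \<Sum>k\<in>K. e k * Q k w) w = (\<Sum>k\<in>K. e k * alt N (Q k) w)"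
    unfolding alt_def by (simp add: mult_map_scale_conv_mult sum_distrib_left mult.left_commute)
qed

lemma of_nat_scale: "of_nat m * p = Poly_Mapping.map ((*) (of_nat m)) p" for p :: zpoly
  by (simp only: mult_map_scale_conv_mult single_of_nat)

lemma alt_wedge_id:
  assumes "F \<in> carrier (wedge n N)" shows "alt N F = F"
proof
  fix w
  have "(\<Sum>\<sigma>\<in>sym_group N. of_int (sign \<sigma>) * perm_vars \<sigma> (F (w \<circ> \<sigma>))) = (\<Sum>\<sigma>\<in>sym_group N. F w)"
    by (rule sum.cong[OF refl]) (use assms in \<open>simp add: wedge_iff mult.assoc[symmetric] sign_square\<close>)
  also have "\<dots> = Poly_Mapping.map ((*) (fact N)) (F w)"
    by (simp only: sum_constant card_sym_group of_nat_scale) (simp only: of_nat_fact)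
  finally show "alt N F w = F w"
    by (intro poly_mapping_eqI) (simp add: alt_def)
qed

lemma wedge_mult_symmetric:
  assumes "F \<in> carrier (wedge n N)" "e \<in> zpolys N" "\<And>\<sigma>. \<sigma> \<in> sym_group N \<Longrightarrow> perm_vars \<sigma> e = e"
  shows "(\<lambda>w. e * F w) \<in> carrier (wedge n N)"
  using assms by (simp add: wedge_iff zpolys_closed perm_vars_mult sym_group_bij mult.left_commute)

lemma perm_vars_power: "bij \<sigma> \<Longrightarrow> perm_vars \<sigma> (p ^ k) = perm_vars \<sigma> p ^ k"
  by (induction k) (simp_all add: perm_vars_one perm_vars_mult)

lemma perm_vars_power_sum: "\<sigma> \<in> sym_group N \<Longrightarrow> perm_vars \<sigma> (power_sum N a) = power_sum N a"
proof -
  assume s: "\<sigma> \<in> sym_group N"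
  have "perm_vars \<sigma> (power_sum N a) = (\<Sum>i<N. zinv (\<sigma> i) ^ a)"
    unfolding power_sum_def by (simp add: perm_vars_sum perm_vars_power perm_vars_zinv sym_group_bij[OF s])
  also have "\<dots> = power_sum N a"
    unfolding power_sum_def
    by (rule sum.reindex_bij_betw) (use s in \<open>simp add: sym_group_def permutes_imp_bij\<close>)
  finally show ?thesis .
qed

text \<open>For the identity matrix only j = \<open>w k\<close> contributes, and replacing a letter
  by itself does not change the word.\<close>

lemma B_op_wedge:
  assumes F: "F \<in> carrier (wedge n N)"
  shows "B_op n N a F = (\<lambda>w. power_sum N a * F w)"
proof
  fix w
  show "B_op n N a F w = power_sum N a * F w"
  proof (cases "w \<in> words n N")
    case True
    have "(\<Sum>j<n. Poly_Mapping.map ((*) (1\<^sub>m n $$ (w k, j))) (zinv k ^ a * F (w(k := j)))) = zinv k ^ a * F w"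
      if k: "k < N" for k
    proof -
      have wk: "w k < n" using True k by (auto simp: words_def PiE_iff)
      have "(\<Sum>j<n. Poly_Mapping.map ((*) (1\<^sub>m n $$ (w k, j))) (zinv k ^ a * F (w(k := j)))) =
          (\<Sum>j<n. if j = w k then zinv k ^ a * F w else 0)"
        by (rule sum.cong[OF refl]) (use wk in \<open>auto intro!: poly_mapping_eqI\<close>)
      then show ?thesis using wk by simp
    qed
    then show ?thesis using True by (simp add: B_op_def current_act_def power_sum_def sum_distrib_right)
  next
    case False
    then show ?thesis using F by (simp add: B_op_def current_act_def wedge_iff)
  qed
qed

lemma Im_H_facts:
  shows Im_H_sub: "Im_H n N \<subseteq> carrier (wedge n N)" and Im_H_zero: "(\<lambda>w. 0) \<in> Im_H n N"
    and Im_H_add: "F \<in> Im_H n N \<Longrightarrow> F' \<in> Im_H n N \<Longrightarrow> (\<lambda>w. F w + F' w) \<in> Im_H n N"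
    and Im_H_scale: "F \<in> Im_H n N \<Longrightarrow> (\<lambda>w. Poly_Mapping.map ((*) c) (F w)) \<in> Im_H n N"
    and Im_H_gen: "F \<in> carrier (wedge n N) \<Longrightarrow> a > 0 \<Longrightarrow> (\<lambda>w. power_sum N a * F w) \<in> Im_H n N"
    and Im_H_J: "F \<in> Im_H n N \<Longrightarrow> F w \<in> J_ideal N"
proof -
  interpret cmodule "wedge n N" by (rule cmodule.intro) (rule module_wedge)
  let ?S = "\<Union>a\<in>{0<..}. B_op n N a ` carrier (wedge n N)"
  have S: "?S \<subseteq> carrier (wedge n N)"
    by (auto simp: B_op_wedge intro!: wedge_mult_symmetric power_sum_zpolys perm_vars_power_sum)
  have "submodule class_ring (Im_H n N) (wedge n N)" unfolding Im_H_def by (rule span_is_submodule[OF S])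
  then show "Im_H n N \<subseteq> carrier (wedge n N)" "(\<lambda>w. 0) \<in> Im_H n N"
    "F \<in> Im_H n N \<Longrightarrow> F' \<in> Im_H n N \<Longrightarrow> (\<lambda>w. F w + F' w) \<in> Im_H n N"
    "F \<in> Im_H n N \<Longrightarrow> (\<lambda>w. Poly_Mapping.map ((*) c) (F w)) \<in> Im_H n N"
    by (simp_all add: submodule_def wedge_simps(2-4))
  show "(\<lambda>w. power_sum N a * F w) \<in> Im_H n N" if F: "F \<in> carrier (wedge n N)" and a: "a > 0"
  proof -
    have "B_op n N a F \<in> ?S" using F a by auto
    then have "B_op n N a F \<in> Im_H n N" unfolding Im_H_def by (rule subsetD[OF in_own_span[OF S]])
    then show ?thesis by (simp add: B_op_wedge[OF F])
  qed
  have "Im_H n N \<subseteq> {F \<in> carrier (wedge n N). \<forall>w. F w \<in> J_ideal N}"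
    unfolding Im_H_def
  proof (rule span_is_subset)
    show "submodule class_ring {F \<in> carrier (wedge n N). \<forall>w. F w \<in> J_ideal N} (wedge n N)"
      using is_module ab(1,2) cl by (auto simp: submodule_def wedge_simps(2-4) J_add J_zero J_scale simp del: lookup_scale)
    show "?S \<subseteq> {F \<in> carrier (wedge n N). \<forall>w. F w \<in> J_ideal N}"
    proof
      fix F assume "F \<in> ?S"
      then obtain a F' where aF: "a > 0" "F' \<in> carrier (wedge n N)" "F = B_op n N a F'" by auto
      have "power_sum N a * F' w \<in> J_ideal N" for w
      proof -
        have "F' w * power_sum N (Suc (a - 1)) \<in> J_ideal N"
          by (rule J_mult[OF power_sum_J]) (use aF(2) in \<open>simp add: wedge_iff\<close>)
        then show ?thesis using aF(1) by (simp add: mult.commute)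
      qed
      then show "F \<in> {F \<in> carrier (wedge n N). \<forall>w. F w \<in> J_ideal N}"
        using subsetD[OF S \<open>F \<in> ?S\<close>] aF(3) by (simp add: B_op_wedge[OF aF(2)])
    qed
  qed
  then show "F \<in> Im_H n N \<Longrightarrow> F w \<in> J_ideal N" by auto
qed

lemma Im_H_sum:
  "finite A \<Longrightarrow> (\<And>a. a \<in> A \<Longrightarrow> f a \<in> Im_H n N) \<Longrightarrow> (\<lambda>w. \<Sum>a\<in>A. f a w) \<in> Im_H n N"
proof (induction A rule: finite_induct)
  case (insert a A)
  then show ?case using Im_H_add[of "f a" n N "\<lambda>w. \<Sum>a\<in>A. f a w"] by simp
qed (simp add: Im_H_zero)

text \<open>Newton's identity read in the other direction: k + 1 times the elementary symmetric
  polynomial is a sum of power sums whose cofactors are symmetric and thus preserve the wedge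
  product. Dividing by k + 1 uses characteristic zero.\<close>

lemma elem_sym_Im_H:
  assumes F: "F \<in> carrier (wedge n N)"
  shows "(\<lambda>w. elem_sym N (Suc k) * F w) \<in> Im_H n N"
proof -
  have mw: "(\<lambda>w. (- 1) ^ j * (elem_sym N i * F w)) \<in> carrier (wedge n N)" for i j
    using wedge_mult_symmetric[OF F, of "(- 1) ^ j * elem_sym N i"] perm_vars_of_int[of _ "(- 1) ^ j" "elem_sym N i"]
    by (simp add: zpolys_closed zpolys_minus1_power elem_sym_zpolys perm_vars_elem_sym sym_group_bij mult.assoc)
  have "(\<lambda>w. \<Sum>i\<le>k. power_sum N (Suc (k - i)) * ((- 1) ^ (k - i) * (elem_sym N i * F w))) \<in> Im_H n N"
    by (rule Im_H_sum) (simp_all add: Im_H_gen[OF mw])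
  also have "(\<lambda>w. \<Sum>i\<le>k. power_sum N (Suc (k - i)) * ((- 1) ^ (k - i) * (elem_sym N i * F w))) =
      (\<lambda>w. of_nat (Suc k) * elem_sym N (Suc k) * F w)"
    unfolding newton sum_distrib_right by (simp add: ac_simps)
  finally have "(\<lambda>w. Poly_Mapping.map ((*) (1 / of_nat (Suc k))) (of_nat (Suc k) * elem_sym N (Suc k) * F w)) \<in> Im_H n N"
    by (rule Im_H_scale)
  also have "(\<lambda>w. Poly_Mapping.map ((*) (1 / of_nat (Suc k))) (of_nat (Suc k) * elem_sym N (Suc k) * F w)) =
      (\<lambda>w. elem_sym N (Suc k) * F w)"
  proof
    fix w
    show "Poly_Mapping.map ((*) (1 / of_nat (Suc k))) (of_nat (Suc k) * elem_sym N (Suc k) * F w) =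
        elem_sym N (Suc k) * F w"
      unfolding mult.assoc unfolding of_nat_scale by (intro poly_mapping_eqI) (simp del: of_nat_Suc)
  qed
  finally show ?thesis .
qed

text \<open>If every coefficient of an antisymmetric \<open>F\<close> is a combination of elementary
  symmetric polynomials, then \<open>F = alt N F\<close> replaces the arbitrary cofactors by
  antisymmetric ones, to which \<open>elem_sym_Im_H\<close> applies.\<close>

lemma Im_H_eq: "Im_H n N = {F \<in> carrier (wedge n N). \<forall>w. F w \<in> J_ideal N}"
proof
  show "Im_H n N \<subseteq> {F \<in> carrier (wedge n N). \<forall>w. F w \<in> J_ideal N}"
    using Im_H_sub Im_H_J by auto
  show "{F \<in> carrier (wedge n N). \<forall>w. F w \<in> J_ideal N} \<subseteq> Im_H n N"
  proof
    fix F assume "F \<in> {F \<in> carrier (wedge n N). \<forall>w. F w \<in> J_ideal N}"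
    then have F: "F \<in> carrier (wedge n N)" and FJ: "\<And>w. F w \<in> J_ideal N" by auto
    \<comment> \<open>Cofactors are chosen for each word separately, and zero off the words, so that
      their antisymmetrisations lie in the wedge product.\<close>
    have "\<exists>q. F w = (\<Sum>k\<in>{1..N}. elem_sym N k * q k) \<and> (\<forall>k. q k \<in> zpolys N) \<and> (w \<notin> words n N \<longrightarrow> (\<forall>k. q k = 0))" for w
    proof (cases "w \<in> words n N")
      case True
      obtain q where "F w = (\<Sum>k\<in>{1..N}. elem_sym N k * q k)" "\<forall>k. q k \<in> zpolys N"
        using FJ[of w] unfolding J_eq_sums J_sums_def by (elim CollectE exE conjE)
      then show ?thesis using True by (intro exI[of _ q]) simp
    next
      case False
      then show ?thesis using F by (intro exI[of _ "\<lambda>k. 0"]) (simp add: wedge_iff zpolys_closed)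
    qed
    then obtain q where q': "\<forall>w. F w = (\<Sum>k\<in>{1..N}. elem_sym N k * q w k) \<and> (\<forall>k. q w k \<in> zpolys N) \<and>
        (w \<notin> words n N \<longrightarrow> (\<forall>k. q w k = 0))"
      using choice[of "\<lambda>w q. F w = (\<Sum>k\<in>{1..N}. elem_sym N k * q k) \<and> (\<forall>k. q k \<in> zpolys N) \<and>
        (w \<notin> words n N \<longrightarrow> (\<forall>k. q k = 0))"] by (elim meta_impE exE) (rule allI)
    then have q: "F w = (\<Sum>k\<in>{1..N}. elem_sym N k * q w k)" "q w k \<in> zpolys N"
      "w \<notin> words n N \<Longrightarrow> q w k = 0" for w k by simp_all
    have "F = alt N F" by (rule alt_wedge_id[OF F, symmetric])
    also have "alt N F = alt N (\<lambda>w. \<Sum>k\<in>{1..N}. elem_sym N k * q w k)"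
      by (rule arg_cong[of _ _ "alt N"]) (rule ext, rule q(1))
    also have "\<dots> = (\<lambda>w. \<Sum>k\<in>{1..N}. elem_sym N k * alt N (\<lambda>w. q w k) w)"
      by (rule alt_sum_mult) (rule perm_vars_elem_sym)
    finally have e: "F = (\<lambda>w. \<Sum>k\<in>{1..N}. elem_sym N k * alt N (\<lambda>w. q w k) w)" .
    have "(\<lambda>w. elem_sym N k * alt N (\<lambda>w. q w k) w) \<in> Im_H n N" if k: "k \<in> {1..N}" for k
      using elem_sym_Im_H[OF alt_wedge[of "\<lambda>w. q w k" N n, OF q(2,3)], of "k - 1"] k by simp
    then show "F \<in> Im_H n N"
      by (subst e) (rule Im_H_sum, simp_all)
  qed
qed

section \<open>Specht modules\<close>

text \<open>A locale without assumptions: its constants and facts are used from outside for all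
  partitions, with the parameters supplied explicitly.\<close>

locale specht_data =
  fixes n N :: nat and lam :: "nat list"
begin

abbreviation "TM \<equiv> tabloid_module N lam"
definition "S = LinearCombinations.module.span class_ring TM (polytabloid N ` tableaux N lam)"

lemma TM_simps:
  "carrier TM = {f. \<forall>T. T \<notin> tabloids N lam \<longrightarrow> f T = 0}" "\<zero>\<^bsub>TM\<^esub> = (\<lambda>T. 0)"
  "f \<oplus>\<^bsub>TM\<^esub> g = (\<lambda>T. f T + g T)" "c \<odot>\<^bsub>TM\<^esub> f = (\<lambda>T. c * f T)"
  "act TM \<sigma> f = (\<lambda>T. f (T \<circ> \<sigma>))"
  by (simp_all add: tabloid_module_def Let_def)

lemma specht_simps:
  "carrier (specht N lam) = S" "\<zero>\<^bsub>specht N lam\<^esub> = (\<lambda>T. 0)"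
  "f \<oplus>\<^bsub>specht N lam\<^esub> g = (\<lambda>T. f T + g T)" "c \<odot>\<^bsub>specht N lam\<^esub> f = (\<lambda>T. c * f T)"
  "act (specht N lam) \<sigma> f = (\<lambda>T. f (T \<circ> \<sigma>))"
  "in_degree_zero (specht N lam)"
  by (simp_all add: specht_def Let_def S_def tabloid_module_def in_degree_zero_def)

lemma module_TM: "module class_ring TM"
proof (rule module_class_ringI)
  show "abelian_group TM"
  proof (rule abelian_groupI)
    show "\<exists>g\<in>carrier TM. g \<oplus>\<^bsub>TM\<^esub> f = \<zero>\<^bsub>TM\<^esub>" if "f \<in> carrier TM" for f
      by (rule bexI[of _ "\<lambda>T. - f T"]) (use that in \<open>simp_all add: TM_simps\<close>)
  qed (simp_all add: TM_simps ac_simps)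
qed (simp_all add: TM_simps algebra_simps)

lemma tabloid_comp:
  assumes "\<sigma> \<in> sym_group N" shows "T \<circ> \<sigma> \<in> tabloids N lam \<longleftrightarrow> T \<in> tabloids N lam"
proof -
  have *: "T \<circ> \<sigma> \<in> tabloids N lam" if s: "\<sigma> \<in> sym_group N" and T: "T \<in> tabloids N lam" for \<sigma> T
  proof -
    have p: "\<sigma> permutes {..<N}" using s by (simp add: sym_group_def)
    have "T \<circ> \<sigma> \<in> words (length lam) N"
      by (rule word_comp_sym_group[OF _ s]) (use T in \<open>simp add: tabloids_def words_def\<close>)
    moreover have "card {i. i < N \<and> (T \<circ> \<sigma>) i = r} = card {i. i < N \<and> T i = r}" for r
    proof (rule bij_betw_same_card[of \<sigma>])
      show "bij_betw \<sigma> {i. i < N \<and> (T \<circ> \<sigma>) i = r} {i. i < N \<and> T i = r}"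
      proof (rule bij_betw_byWitness[where f' = "inv_into UNIV \<sigma>"])
        show "inv_into UNIV \<sigma> ` {i. i < N \<and> T i = r} \<subseteq> {i. i < N \<and> (T \<circ> \<sigma>) i = r}"
          using sym_group_less[OF permutes_inv_apply[OF s]] permutes_inverses(1)[OF p] by auto
      qed (use sym_group_less[OF s] permutes_inverses[OF p] in auto)
    qed
    ultimately show ?thesis using T by (simp add: tabloids_def words_def)
  qed
  show ?thesis
  proof
    assume "T \<circ> \<sigma> \<in> tabloids N lam"
    from *[OF permutes_inv_apply[OF assms] this] show "T \<in> tabloids N lam"
      using surj_iff[THEN iffD1, OF bij_is_surj[OF sym_group_bij[OF assms]]] by (simp add: comp_assoc)
  qed (rule *[OF assms])
qed

definition col_stab where
  "col_stab t = {\<sigma> \<in> sym_group N. \<forall>i<N. snd (t (\<sigma> i)) = snd (t i)}" for t :: "nat \<Rightarrow> nat \<times> nat"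

definition row_of where "row_of t = restrict (fst \<circ> t) {..<N}" for t :: "nat \<Rightarrow> nat \<times> nat"
text \<open>Read as a word, position i carries as its letter the column of the entry i. The highest
  weight vector is built on this word.\<close>

definition col_of where "col_of t = restrict (snd \<circ> t) {..<N}" for t :: "nat \<Rightarrow> nat \<times> nat"

lemma polytabloid_eq: "polytabloid N t T = (\<Sum>\<sigma>\<in>col_stab t. if T \<circ> \<sigma> = row_of t then of_int (sign \<sigma>) else 0)"
  by (simp add: polytabloid_def col_stab_def row_of_def)

lemma finite_col_stab: "finite (col_stab t)"
  by (rule finite_subset[OF _ finite_sym_group]) (auto simp: col_stab_def)

lemma tableau_less: "t \<in> tableaux N lam \<Longrightarrow> i < N \<Longrightarrow> fst (t i) < length lam \<and> snd (t i) < lam ! fst (t i)"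
proof -
  assume t: "t \<in> tableaux N lam" and i: "i < N"
  have "bij_betw t {..<N} {(r, c). r < length lam \<and> c < lam ! r}" using t by (simp add: tableaux_def)
  from bspec[OF bij_betwE[OF this], of i] show ?thesis using i by (cases "t i") simp
qed

lemma row_of_tabloid:
  assumes t: "t \<in> tableaux N lam" shows "row_of t \<in> tabloids N lam"
  unfolding tabloids_def
proof (intro CollectI conjI allI impI)
  show "row_of t \<in> {..<N} \<rightarrow>\<^sub>E {..<length lam}"
    using tableau_less[OF t] by (auto simp: row_of_def)
  fix r assume r: "r < length lam"
  have b: "bij_betw t {..<N} {(r, c). r < length lam \<and> c < lam ! r}" using t by (simp add: tableaux_def)
  have "bij_betw t {i. i < N \<and> row_of t i = r} {(r', c). r' = r \<and> c < lam ! r}"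
  proof (rule bij_betw_subset[OF b])
    show "t ` {i. i < N \<and> row_of t i = r} = {(r', c). r' = r \<and> c < lam ! r}"
    proof
      show "t ` {i. i < N \<and> row_of t i = r} \<subseteq> {(r', c). r' = r \<and> c < lam ! r}"
      proof
        fix p assume "p \<in> t ` {i. i < N \<and> row_of t i = r}"
        then obtain i where "i < N" "row_of t i = r" "p = t i" by auto
        then show "p \<in> {(r', c). r' = r \<and> c < lam ! r}"
          using tableau_less[OF t, of i] by (cases "t i") (simp add: row_of_def)
      qed
      show "{(r', c). r' = r \<and> c < lam ! r} \<subseteq> t ` {i. i < N \<and> row_of t i = r}"
      proof
        fix p assume p: "p \<in> {(r', c). r' = r \<and> c < lam ! r}"
        then have "p \<in> t ` {..<N}" using b r unfolding bij_betw_def by auto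
        then obtain i where "i < N" "p = t i" by auto
        then show "p \<in> t ` {i. i < N \<and> row_of t i = r}" using p by (auto simp: row_of_def split_beta)
      qed
    qed
  qed auto
  then have "card {i. i < N \<and> row_of t i = r} = card {(r', c). r' = r \<and> c < lam ! r}"
    by (rule bij_betw_same_card)
  also have "{(r', c). r' = r \<and> c < lam ! r} = {r} \<times> {..<lam ! r}" by auto
  finally show "card {i. i < N \<and> row_of t i = r} = lam ! r" by (simp add: card_cartesian_product)
qed

lemma polytabloid_carrier: assumes "t \<in> tableaux N lam" shows "polytabloid N t \<in> carrier TM"
proof -
  have "polytabloid N t T = 0" if T: "T \<notin> tabloids N lam" for T
    unfolding polytabloid_eq
  proof (rule sum.neutral, rule ballI)
    fix \<sigma> assume "\<sigma> \<in> col_stab t"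
    then have "T \<circ> \<sigma> \<notin> tabloids N lam" using T tabloid_comp by (simp add: col_stab_def)
    then show "(if T \<circ> \<sigma> = row_of t then of_int (sign \<sigma>) else 0) = (0::complex)"
      using row_of_tabloid[OF assms] by auto
  qed
  then show ?thesis by (simp add: TM_simps)
qed

lemma S_facts:
  shows S_carrier: "s \<in> S \<Longrightarrow> T \<notin> tabloids N lam \<Longrightarrow> s T = 0" and S_zero: "(\<lambda>T. 0) \<in> S"
    and S_add: "s \<in> S \<Longrightarrow> s' \<in> S \<Longrightarrow> (\<lambda>T. s T + s' T) \<in> S"
    and S_smult: "s \<in> S \<Longrightarrow> (\<lambda>T. c * s T) \<in> S"
    and S_poly: "t \<in> tableaux N lam \<Longrightarrow> polytabloid N t \<in> S"
proof -
  interpret cmodule TM by (rule cmodule.intro) (rule module_TM)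
  have sub: "polytabloid N ` tableaux N lam \<subseteq> carrier TM" using polytabloid_carrier by auto
  have "submodule class_ring S TM" unfolding S_def by (rule span_is_submodule[OF sub])
  then show "s \<in> S \<Longrightarrow> T \<notin> tabloids N lam \<Longrightarrow> s T = 0" "(\<lambda>T. 0) \<in> S"
    "s \<in> S \<Longrightarrow> s' \<in> S \<Longrightarrow> (\<lambda>T. s T + s' T) \<in> S" "s \<in> S \<Longrightarrow> (\<lambda>T. c * s T) \<in> S"
    by (auto simp: submodule_def TM_simps)
  show "t \<in> tableaux N lam \<Longrightarrow> polytabloid N t \<in> S"
    unfolding S_def by (rule subsetD[OF in_own_span[OF sub]]) simp
qed

lemma S_induct [consumes 1, case_names poly zero add smult]:
  assumes s: "s \<in> S" and "\<And>t. t \<in> tableaux N lam \<Longrightarrow> P (polytabloid N t)" "P (\<lambda>T. 0)"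
    "\<And>s s'. s \<in> S \<Longrightarrow> s' \<in> S \<Longrightarrow> P s \<Longrightarrow> P s' \<Longrightarrow> P (\<lambda>T. s T + s' T)" "\<And>c s. s \<in> S \<Longrightarrow> P s \<Longrightarrow> P (\<lambda>T. c * s T)"
  shows "P s"
proof -
  interpret cmodule TM by (rule cmodule.intro) (rule module_TM)
  have "S \<subseteq> {s \<in> S. P s}"
    unfolding S_def
  proof (rule span_is_subset, fold S_def)
    show "polytabloid N ` tableaux N lam \<subseteq> {s \<in> S. P s}" using assms(2) S_poly by auto
    show "submodule class_ring {s \<in> S. P s} TM"
      using is_module assms(3-5) S_facts by (auto simp: submodule_def TM_simps)
  qed
  then show ?thesis using s by auto
qed

lemma S_sum: "finite A \<Longrightarrow> (\<And>a. a \<in> A \<Longrightarrow> f a \<in> S) \<Longrightarrow> (\<lambda>T. \<Sum>a\<in>A. f a T) \<in> S"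
proof (induction A rule: finite_induct)
  case (insert a A)
  then show ?case using S_add[of "f a" "\<lambda>T. \<Sum>a\<in>A. f a T"] by simp
qed (simp add: S_zero)

lemma tableau_comp:
  assumes t: "t \<in> tableaux N lam" and s: "\<sigma> \<in> sym_group N"
  shows "t \<circ> \<sigma> \<in> tableaux N lam"
proof -
  have p: "\<sigma> permutes {..<N}" using s by (simp add: sym_group_def)
  have "bij_betw (t \<circ> \<sigma>) {..<N} {(r, c). r < length lam \<and> c < lam ! r}"
    by (rule bij_betw_trans[OF permutes_imp_bij[OF p]]) (use t in \<open>simp add: tableaux_def\<close>)
  moreover have "t \<circ> \<sigma> \<in> extensional {..<N}"
    using t p by (auto simp: tableaux_def extensional_def permutes_def)
  ultimately show ?thesis by (simp add: tableaux_def)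
qed

lemma restrict_comp:
  assumes "\<sigma> \<in> sym_group N" shows "restrict (f \<circ> (t \<circ> \<sigma>)) {..<N} = restrict (f \<circ> t) {..<N} \<circ> \<sigma>"
proof
  fix i show "restrict (f \<circ> (t \<circ> \<sigma>)) {..<N} i = (restrict (f \<circ> t) {..<N} \<circ> \<sigma>) i"
  proof (cases "i < N")
    case True
    then show ?thesis using sym_group_less[OF assms True] by simp
  next
    case False
    then have "\<sigma> i = i" using assms by (simp add: sym_group_def permutes_def)
    then show ?thesis using False by simp
  qed
qed

text \<open>Relabelling the entries: conjugation by \<sigma> carries the column stabiliser of
  \<open>t \<circ> \<sigma>\<close> to that of \<open>t\<close> and preserves signs. Thus the span
  of the polytabloids is stable under the symmetric group.\<close>

lemma polytabloid_comp:
  assumes s: "\<sigma> \<in> sym_group N"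
  shows "polytabloid N (t \<circ> \<sigma>) (T \<circ> \<sigma>) = polytabloid N t T"
proof -
  have p: "\<sigma> permutes {..<N}" using s by (simp add: sym_group_def)
  let ?i = "inv_into UNIV \<sigma>"
  have i: "?i \<in> sym_group N" by (rule permutes_inv_apply[OF s])
  have inv: "\<sigma> (?i x) = x" "?i (\<sigma> x) = x" for x using permutes_inverses[OF p] by simp_all
  have cs: "\<sigma> \<circ> \<rho> \<circ> ?i \<in> col_stab t \<longleftrightarrow> \<rho> \<in> col_stab (t \<circ> \<sigma>)" if r: "\<rho> \<in> sym_group N" for \<rho>
  proof -
    have "(\<forall>i<N. snd (t ((\<sigma> \<circ> \<rho> \<circ> ?i) i)) = snd (t i)) \<longleftrightarrow> (\<forall>i<N. snd ((t \<circ> \<sigma>) (\<rho> i)) = snd ((t \<circ> \<sigma>) i))"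
    proof (intro iffI allI impI)
      fix i assume "\<forall>i<N. snd (t ((\<sigma> \<circ> \<rho> \<circ> ?i) i)) = snd (t i)" "i < N"
      then show "snd ((t \<circ> \<sigma>) (\<rho> i)) = snd ((t \<circ> \<sigma>) i)"
        using sym_group_less[OF s, of i] inv by (auto dest!: spec[of _ "\<sigma> i"])
    next
      fix i assume "\<forall>i<N. snd ((t \<circ> \<sigma>) (\<rho> i)) = snd ((t \<circ> \<sigma>) i)" "i < N"
      then show "snd (t ((\<sigma> \<circ> \<rho> \<circ> ?i) i)) = snd (t i)"
        using sym_group_less[OF permutes_inv_apply[OF s], of i] inv by (auto dest!: spec[of _ "?i i"])
    qed
    moreover have "\<sigma> \<circ> \<rho> \<circ> ?i \<in> sym_group N" by (intro sym_group_comp s r i)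
    ultimately show ?thesis using r by (simp add: col_stab_def)
  qed
  have sg: "sign (\<sigma> \<circ> \<rho> \<circ> ?i) = sign \<rho>" if r: "\<rho> \<in> sym_group N" for \<rho>
  proof -
    have "sign (\<sigma> \<circ> ?i) = sign \<sigma> * sign ?i" by (rule sign_sym_group_comp[OF s i])
    moreover have "\<sigma> \<circ> ?i = id" using inv by (simp add: fun_eq_iff)
    ultimately have "sign \<sigma> * sign ?i = 1" by (simp add: sign_id)
    then show ?thesis
      by (simp add: sign_sym_group_comp[OF sym_group_comp[OF s r] i] sign_sym_group_comp[OF s r] mult.commute mult.left_commute)
  qed
  have ro: "T \<circ> \<sigma> \<circ> \<rho> = row_of (t \<circ> \<sigma>) \<longleftrightarrow> T \<circ> (\<sigma> \<circ> \<rho> \<circ> ?i) = row_of t" for \<rho>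
  proof -
    have "row_of (t \<circ> \<sigma>) = row_of t \<circ> \<sigma>" unfolding row_of_def by (rule restrict_comp[OF s])
    then show ?thesis using inv by (auto simp: fun_eq_iff) metis+
  qed
  have "polytabloid N (t \<circ> \<sigma>) (T \<circ> \<sigma>) =
      (\<Sum>\<rho>\<in>col_stab (t \<circ> \<sigma>). if T \<circ> (\<sigma> \<circ> \<rho> \<circ> ?i) = row_of t then of_int (sign (\<sigma> \<circ> \<rho> \<circ> ?i)) else 0)"
    unfolding polytabloid_eq by (rule sum.cong[OF refl]) (simp add: ro sg col_stab_def)
  also have "\<dots> = polytabloid N t T"
    unfolding polytabloid_eq
  proof (rule sum.reindex_bij_betw)
    show "bij_betw (\<lambda>\<rho>. \<sigma> \<circ> \<rho> \<circ> ?i) (col_stab (t \<circ> \<sigma>)) (col_stab t)"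
    proof (rule bij_betw_byWitness[where f' = "\<lambda>\<rho>. ?i \<circ> \<rho> \<circ> \<sigma>"])
      show "(\<lambda>\<rho>. \<sigma> \<circ> \<rho> \<circ> ?i) ` col_stab (t \<circ> \<sigma>) \<subseteq> col_stab t"
      proof
        fix \<rho>' assume "\<rho>' \<in> (\<lambda>\<rho>. \<sigma> \<circ> \<rho> \<circ> ?i) ` col_stab (t \<circ> \<sigma>)"
        then obtain \<rho> where r: "\<rho> \<in> col_stab (t \<circ> \<sigma>)" "\<rho>' = \<sigma> \<circ> \<rho> \<circ> ?i" by auto
        then have "\<rho> \<in> sym_group N" by (simp add: col_stab_def)
        then show "\<rho>' \<in> col_stab t" using cs[of \<rho>] r by simp
      qed
      show "(\<lambda>\<rho>. ?i \<circ> \<rho> \<circ> \<sigma>) ` col_stab t \<subseteq> col_stab (t \<circ> \<sigma>)"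
      proof
        fix \<rho>' assume "\<rho>' \<in> (\<lambda>\<rho>. ?i \<circ> \<rho> \<circ> \<sigma>) ` col_stab t"
        then obtain \<rho> where r: "\<rho> \<in> col_stab t" "\<rho>' = ?i \<circ> \<rho> \<circ> \<sigma>" by auto
        have "\<rho>' \<in> sym_group N" unfolding r(2) using r(1) by (intro sym_group_comp s i) (simp add: col_stab_def)
        moreover have "\<sigma> \<circ> \<rho>' \<circ> ?i = \<rho>" by (simp add: fun_eq_iff r(2) inv)
        ultimately show "\<rho>' \<in> col_stab (t \<circ> \<sigma>)" using cs[of \<rho>'] r(1) by simp
      qed
    qed (simp_all add: fun_eq_iff inv)
  qed
  finally show ?thesis .
qed

lemma S_act:
  assumes "\<sigma> \<in> sym_group N" "s \<in> S" shows "(\<lambda>T. s (T \<circ> \<sigma>)) \<in> S"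
  using assms(2)
proof (induction rule: S_induct)
  case (poly t)
  let ?i = "inv_into UNIV \<sigma>"
  have "?i \<circ> \<sigma> = id" "\<sigma> \<circ> ?i = id"
    using sym_group_bij[OF assms(1)] by (simp_all add: fun_eq_iff bij_is_inj surj_f_inv_f bij_is_surj)
  then have "polytabloid N t (T \<circ> \<sigma>) = polytabloid N (t \<circ> ?i) T" for T
    using polytabloid_comp[OF permutes_inv_apply[OF assms(1)], of t "T \<circ> \<sigma>"] by (simp add: comp_assoc)
  then have e: "(\<lambda>T. polytabloid N t (T \<circ> \<sigma>)) = polytabloid N (t \<circ> ?i)" by (rule ext)
  show ?case unfolding e by (rule S_poly[OF tableau_comp[OF poly permutes_inv_apply[OF assms(1)]]])
next
  case zero show ?case by (rule S_zero)
next
  case (add s s') then show ?case by (intro S_add)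
next
  case (smult c s) then show ?case by (intro S_smult)
qed

lemma module_specht: "module class_ring (specht N lam)"
proof (rule module_class_ringI)
  show "abelian_group (specht N lam)"
  proof (rule abelian_groupI)
    show "\<exists>g\<in>carrier (specht N lam). g \<oplus>\<^bsub>specht N lam\<^esub> f = \<zero>\<^bsub>specht N lam\<^esub>" if "f \<in> carrier (specht N lam)" for f
      by (rule bexI[of _ "\<lambda>T. (- 1) * f T"]) (use that in \<open>simp_all only: specht_simps S_smult, simp\<close>)
  qed (simp_all add: specht_simps S_zero S_add ac_simps)
qed (simp_all add: specht_simps S_smult algebra_simps)

lemma specht_act_hom:
  "\<sigma> \<in> sym_group N \<Longrightarrow> act (specht N lam) \<sigma> \<in> LinearCombinations.module_hom class_ring (specht N lam) (specht N lam)"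
  by (auto simp: LinearCombinations.module_hom_def specht_simps S_act)

end

section \<open>Antisymmetric tensors with values in a Specht module\<close>

context specht_data begin

text \<open>The antisymmetric elements of \<open>\<pi>\<^bsup>\<otimes>N\<^esup> \<otimes> W\<^bsub>lam\<^esub>\<close>, given by their coefficients at words.\<close>

definition Lmod :: "(complex mat, (nat \<Rightarrow> nat) \<Rightarrow> (nat \<Rightarrow> nat) \<Rightarrow> complex) gmod" where
  "Lmod =
     (let C = {f. (\<forall>w. f w \<in> S) \<and> (\<forall>w. w \<notin> words n N \<longrightarrow> f w = (\<lambda>T. 0)) \<and>
        (\<forall>\<sigma>\<in>sym_group N. \<forall>w T. f (w \<circ> \<sigma>) (T \<circ> \<sigma>) = of_int (sign \<sigma>) * f w T)} in
     \<lparr>carrier = C, mult = undefined, one = undefined,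
      zero = (\<lambda>w T. 0), add = (\<lambda>f g w T. f w T + g w T), smult = (\<lambda>c f w T. c * f w T),
      hcomp = (\<lambda>d. if d = 0 then C else {\<lambda>w T. 0}),
      act = (\<lambda>X f w T. if w \<in> words n N then \<Sum>k<N. \<Sum>j<n. X $$ (w k, j) * f (w(k := j)) T else 0)\<rparr>)"

lemma Lmod_simps:
  "\<zero>\<^bsub>Lmod\<^esub> = (\<lambda>w T. 0)" "f \<oplus>\<^bsub>Lmod\<^esub> g = (\<lambda>w T. f w T + g w T)" "c \<odot>\<^bsub>Lmod\<^esub> f = (\<lambda>w T. c * f w T)"
  "act Lmod X f = (\<lambda>w T. if w \<in> words n N then \<Sum>k<N. \<Sum>j<n. X $$ (w k, j) * f (w(k := j)) T else 0)"
  by (simp_all add: Lmod_def Let_def)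

lemma Lmod_iff: "f \<in> carrier Lmod \<longleftrightarrow> (\<forall>w. f w \<in> S) \<and> (\<forall>w. w \<notin> words n N \<longrightarrow> f w = (\<lambda>T. 0)) \<and>
        (\<forall>\<sigma>\<in>sym_group N. \<forall>w T. f (w \<circ> \<sigma>) (T \<circ> \<sigma>) = of_int (sign \<sigma>) * f w T)"
  by (simp add: Lmod_def Let_def)

lemma module_Lmod: "module class_ring Lmod"
proof (rule module_class_ringI)
  show "abelian_group Lmod"
  proof (rule abelian_groupI)
    show "\<exists>g\<in>carrier Lmod. g \<oplus>\<^bsub>Lmod\<^esub> f = \<zero>\<^bsub>Lmod\<^esub>" if "f \<in> carrier Lmod" for f
      by (rule bexI[of _ "\<lambda>w T. (- 1) * f w T"])
        (use that in \<open>simp_all only: Lmod_iff Lmod_simps S_smult, simp_all\<close>)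
  qed (simp_all add: Lmod_iff Lmod_simps S_zero S_add algebra_simps)
qed (simp_all add: Lmod_iff Lmod_simps S_smult algebra_simps)

lemma word_upd: "w \<in> words n N \<Longrightarrow> k < N \<Longrightarrow> j < n \<Longrightarrow> w(k := j) \<in> words n N"
  by (auto simp: words_def PiE_iff extensional_def)

lemma word_less: "w \<in> words n N \<Longrightarrow> k < N \<Longrightarrow> w k < n"
  by (auto simp: words_def PiE_iff)

lemma comp_upd: "bij \<sigma> \<Longrightarrow> (w \<circ> \<sigma>)(k := j) = w(\<sigma> k := j) \<circ> \<sigma>"
  by (auto simp: fun_eq_iff dest: bij_is_inj[THEN injD])

lemma sum_permute: "\<sigma> \<in> sym_group N \<Longrightarrow> (\<Sum>k<N. g (\<sigma> k)) = (\<Sum>k<N. g k)"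
  by (rule sum.reindex_bij_betw) (simp add: sym_group_def permutes_imp_bij)

lemma Lmod_act_closed:
  assumes f: "f \<in> carrier Lmod" shows "act Lmod X f \<in> carrier Lmod"
  unfolding Lmod_iff
proof (intro conjI allI impI ballI)
  show "act Lmod X f w \<in> S" for w
  proof (cases "w \<in> words n N")
    case True
    have "(\<lambda>T. \<Sum>k<N. \<Sum>j<n. X $$ (w k, j) * f (w(k := j)) T) \<in> S"
      by (intro S_sum S_smult) (use f in \<open>simp_all add: Lmod_iff\<close>)
    then show ?thesis using True by (simp add: Lmod_simps)
  qed (simp add: Lmod_simps S_zero)
  show "act Lmod X f w = (\<lambda>T. 0)" if "w \<notin> words n N" for w using that by (simp add: Lmod_simps)
  fix \<sigma> w T assume s: "\<sigma> \<in> sym_group N"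
  show "act Lmod X f (w \<circ> \<sigma>) (T \<circ> \<sigma>) = of_int (sign \<sigma>) * act Lmod X f w T"
  proof (cases "w \<in> words n N")
    case True
    have "(\<Sum>k<N. \<Sum>j<n. X $$ ((w \<circ> \<sigma>) k, j) * f ((w \<circ> \<sigma>)(k := j)) (T \<circ> \<sigma>)) =
        (\<Sum>k<N. \<Sum>j<n. X $$ (w (\<sigma> k), j) * (of_int (sign \<sigma>) * f (w(\<sigma> k := j)) T))"
      unfolding comp_upd[OF sym_group_bij[OF s]] using f s by (simp add: Lmod_iff)
    also have "\<dots> = (\<Sum>k<N. \<Sum>j<n. X $$ (w k, j) * (of_int (sign \<sigma>) * f (w(k := j)) T))"
      by (rule sum_permute[OF s])
    finally show ?thesis
      using True word_comp_iff[OF s] by (simp add: Lmod_simps sum_distrib_left mult.left_commute)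
  qed (simp add: Lmod_simps word_comp_iff[OF s])
qed

text \<open>The double sum is split according to whether \<open>X\<close> and \<open>Y\<close> act
  at the same position. Equal positions give the action of the matrix product; distinct positions
  give an expression symmetric in \<open>X\<close> and \<open>Y\<close>, which cancels in the
  commutator.\<close>

lemma Lmod_act_act:
  assumes X: "X \<in> carrier_mat n n" and Y: "Y \<in> carrier_mat n n" and w: "w \<in> words n N"
  shows "act Lmod X (act Lmod Y f) w T = act Lmod (X * Y) f w T +
     (\<Sum>k<N. \<Sum>l<N. if l = k then 0 else \<Sum>j<n. \<Sum>i<n. X $$ (w k, j) * (Y $$ (w l, i) * f (w(k := j, l := i)) T))"
proof -
  have "act Lmod X (act Lmod Y f) w T =
      (\<Sum>k<N. \<Sum>j<n. X $$ (w k, j) * (\<Sum>l<N. \<Sum>i<n. Y $$ ((w(k := j)) l, i) * f (w(k := j, l := i)) T))"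
    using w by (simp add: Lmod_simps word_upd)
  also have "\<dots> = (\<Sum>k<N. \<Sum>l<N. \<Sum>j<n. \<Sum>i<n. X $$ (w k, j) * (Y $$ ((w(k := j)) l, i) * f (w(k := j, l := i)) T))"
    unfolding sum_distrib_left by (rule sum.cong[OF refl]) (rule sum.swap)
  also have "\<dots> = (\<Sum>k<N. \<Sum>l<N. (if l = k then \<Sum>i<n. (X * Y) $$ (w k, i) * f (w(k := i)) T else 0) +
      (if l = k then 0 else \<Sum>j<n. \<Sum>i<n. X $$ (w k, j) * (Y $$ (w l, i) * f (w(k := j, l := i)) T)))"
  proof (intro sum.cong refl)
    fix k l assume kl: "k \<in> {..<N}" "l \<in> {..<N}"
    have "(\<Sum>j<n. \<Sum>i<n. X $$ (w k, j) * (Y $$ (j, i) * f (w(k := i)) T)) = (\<Sum>i<n. (X * Y) $$ (w k, i) * f (w(k := i)) T)"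
    proof -
      have "(X * Y) $$ (w k, i) = (\<Sum>j<n. X $$ (w k, j) * Y $$ (j, i))" if "i < n" for i
        using X Y word_less[OF w, of k] kl that by (auto simp: scalar_prod_def atLeast0LessThan intro!: sum.cong)
      then have "(\<Sum>i<n. (X * Y) $$ (w k, i) * f (w(k := i)) T) = (\<Sum>i<n. \<Sum>j<n. X $$ (w k, j) * Y $$ (j, i) * f (w(k := i)) T)"
        by (simp add: sum_distrib_right)
      then show ?thesis by (subst sum.swap) (simp add: mult.assoc)
    qed
    then show "(\<Sum>j<n. \<Sum>i<n. X $$ (w k, j) * (Y $$ ((w(k := j)) l, i) * f (w(k := j, l := i)) T)) =
      (if l = k then \<Sum>i<n. (X * Y) $$ (w k, i) * f (w(k := i)) T else 0) +
      (if l = k then 0 else \<Sum>j<n. \<Sum>i<n. X $$ (w k, j) * (Y $$ (w l, i) * f (w(k := j, l := i)) T))"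
      by simp
  qed
  finally show ?thesis using w by (simp add: sum.distrib Lmod_simps)
qed

lemma sl_module_Lmod: "sl_module n Lmod"
  unfolding sl_module_def
proof (intro conjI ballI allI)
  interpret cmodule Lmod by (rule cmodule.intro) (rule module_Lmod)
  show "vectorspace class_ring Lmod" using module_Lmod by (simp add: vectorspace_class_ring_iff)
  show "act Lmod X \<in> LinearCombinations.module_hom class_ring Lmod Lmod" for X
    unfolding LinearCombinations.module_hom_def
  proof (intro CollectI conjI allI impI Pi_I)
    show "act Lmod X f \<in> carrier Lmod" if "f \<in> carrier Lmod" for f by (rule Lmod_act_closed[OF that])
    show "act Lmod X (f \<oplus>\<^bsub>Lmod\<^esub> g) = act Lmod X f \<oplus>\<^bsub>Lmod\<^esub> act Lmod X g" for f g
      by (simp add: Lmod_simps(2,4) fun_eq_iff distrib_left sum.distrib)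
    show "act Lmod X (c \<odot>\<^bsub>Lmod\<^esub> f) = c \<odot>\<^bsub>Lmod\<^esub> act Lmod X f" for c f
      by (simp add: Lmod_simps(3,4) fun_eq_iff sum_distrib_left mult.left_commute)
  qed
  show "act Lmod (X + Y) f = act Lmod X f \<oplus>\<^bsub>Lmod\<^esub> act Lmod Y f" if "X \<in> sl n" "Y \<in> sl n" for X Y f
  proof (intro ext)
    fix w T
    have c: "X \<in> carrier_mat n n" "Y \<in> carrier_mat n n" using that by (simp_all add: sl_def)
    show "act Lmod (X + Y) f w T = (act Lmod X f \<oplus>\<^bsub>Lmod\<^esub> act Lmod Y f) w T"
    proof (cases "w \<in> words n N")
      case True
      then show ?thesis
        unfolding Lmod_simps if_P[OF True] sum.distrib[symmetric]
        by (intro sum.cong refl) (use c word_less[OF True] in \<open>simp add: distrib_right\<close>)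
    qed (simp add: Lmod_simps)
  qed
  show "act Lmod (c \<cdot>\<^sub>m X) f = c \<odot>\<^bsub>Lmod\<^esub> act Lmod X f" if "X \<in> sl n" for X f c
  proof (intro ext)
    fix w T
    have c: "X \<in> carrier_mat n n" using that by (simp add: sl_def)
    show "act Lmod (c \<cdot>\<^sub>m X) f w T = (c \<odot>\<^bsub>Lmod\<^esub> act Lmod X f) w T"
    proof (cases "w \<in> words n N")
      case True
      then show ?thesis
        unfolding Lmod_simps if_P[OF True] sum_distrib_left
        by (intro sum.cong refl) (use c word_less[OF True] in simp)
    qed (simp add: Lmod_simps)
  qed
  show "act Lmod (X * Y - Y * X) f = act Lmod X (act Lmod Y f) \<ominus>\<^bsub>Lmod\<^esub> act Lmod Y (act Lmod X f)"
    if XY: "X \<in> sl n" "Y \<in> sl n" and f: "f \<in> carrier Lmod" for X Y f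
  proof -
    have c: "X \<in> carrier_mat n n" "Y \<in> carrier_mat n n" using XY by (simp_all add: sl_def)
    have m: "f \<ominus>\<^bsub>Lmod\<^esub> g = (\<lambda>w T. f w T - g w T)" if "g \<in> carrier Lmod" for f g
      using that by (simp add: a_minus_def minus_eq_smult Lmod_simps)
    have "act Lmod (X * Y - Y * X) f w T = act Lmod X (act Lmod Y f) w T - act Lmod Y (act Lmod X f) w T" for w T
    proof (cases "w \<in> words n N")
      case w: True
      \<comment> \<open>Exchanging the names of the two positions is allowed because updates of a
        word at distinct positions commute.\<close>
      have sw: "(\<Sum>k<N. \<Sum>l<N. if l = k then 0 else \<Sum>j<n. \<Sum>i<n. X $$ (w k, j) * (Y $$ (w l, i) * f (w(k := j, l := i)) T)) =
          (\<Sum>k<N. \<Sum>l<N. if l = k then 0 else \<Sum>j<n. \<Sum>i<n. Y $$ (w k, j) * (X $$ (w l, i) * f (w(k := j, l := i)) T))"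
      proof -
        have e: "(if l = k then 0 else \<Sum>j<n. \<Sum>i<n. X $$ (w k, j) * (Y $$ (w l, i) * f (w(k := j, l := i)) T)) =
          (if k = l then 0 else \<Sum>j<n. \<Sum>i<n. Y $$ (w l, j) * (X $$ (w k, i) * f (w(l := j, k := i)) T))" for k l
        proof (cases "l = k")
          case False
          have "(\<Sum>j<n. \<Sum>i<n. X $$ (w k, j) * (Y $$ (w l, i) * f (w(k := j, l := i)) T)) =
             (\<Sum>i<n. \<Sum>j<n. X $$ (w k, j) * (Y $$ (w l, i) * f (w(k := j, l := i)) T))" by (rule sum.swap)
          also have "\<dots> = (\<Sum>j<n. \<Sum>i<n. Y $$ (w l, j) * (X $$ (w k, i) * f (w(l := j, k := i)) T))"
            by (intro sum.cong refl) (simp add: fun_upd_twist[OF False] mult.left_commute)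
          finally show ?thesis using False by simp
        qed simp
        show ?thesis unfolding e by (rule sum.swap)
      qed
      have "act Lmod (X * Y - Y * X) f w T = (\<Sum>k<N. \<Sum>j<n. ((X * Y) $$ (w k, j) - (Y * X) $$ (w k, j)) * f (w(k := j)) T)"
        unfolding Lmod_simps if_P[OF w]
        by (intro sum.cong refl) (use c word_less[OF w] in \<open>simp del: index_mult_mat(1)\<close>)
      also have "\<dots> = act Lmod (X * Y) f w T - act Lmod (Y * X) f w T"
        using w by (simp add: Lmod_simps left_diff_distrib sum_subtractf)
      also have "\<dots> = act Lmod X (act Lmod Y f) w T - act Lmod Y (act Lmod X f) w T"
        unfolding Lmod_act_act[OF c w] Lmod_act_act[OF c(2,1) w] sw by simp
      finally show ?thesis .
    qed (simp add: Lmod_simps)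
    then show ?thesis unfolding m[OF Lmod_act_closed[OF Lmod_act_closed[OF f]]] by (simp add: fun_eq_iff)
  qed
qed

text \<open>The antisymmetrisation of \<open>e\<^sub>v \<otimes> s\<close>.\<close>

definition Psi :: "(nat \<Rightarrow> nat) \<Rightarrow> ((nat \<Rightarrow> nat) \<Rightarrow> complex) \<Rightarrow> (nat \<Rightarrow> nat) \<Rightarrow> (nat \<Rightarrow> nat) \<Rightarrow> complex" where
  "Psi v s = (\<lambda>w T. \<Sum>\<sigma>\<in>sym_group N. if v = w \<circ> \<sigma> then of_int (sign \<sigma>) * s (T \<circ> \<sigma>) else 0)"

lemma sum_sym_group_comp:
  assumes t: "\<tau> \<in> sym_group N" shows "(\<Sum>\<sigma>\<in>sym_group N. g (\<sigma> \<circ> \<tau>)) = (\<Sum>\<sigma>\<in>sym_group N. g \<sigma>)"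
    "(\<Sum>\<sigma>\<in>sym_group N. g (\<tau> \<circ> \<sigma>)) = (\<Sum>\<sigma>\<in>sym_group N. g \<sigma>)"
proof -
  note i = permutes_inv_apply[OF t]
  have inv: "\<tau> (inv_into UNIV \<tau> x) = x" "inv_into UNIV \<tau> (\<tau> x) = x" for x
    using t permutes_inverses by (auto simp: sym_group_def)
  show "(\<Sum>\<sigma>\<in>sym_group N. g (\<sigma> \<circ> \<tau>)) = (\<Sum>\<sigma>\<in>sym_group N. g \<sigma>)"
    by (rule sum.reindex_bij_witness[of _ "\<lambda>\<sigma>. \<sigma> \<circ> inv_into UNIV \<tau>" "\<lambda>\<sigma>. \<sigma> \<circ> \<tau>"])
      (auto simp: fun_eq_iff inv intro: sym_group_comp t i)
  show "(\<Sum>\<sigma>\<in>sym_group N. g (\<tau> \<circ> \<sigma>)) = (\<Sum>\<sigma>\<in>sym_group N. g \<sigma>)"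
    by (rule sum.reindex_bij_witness[of _ "\<lambda>\<sigma>. inv_into UNIV \<tau> \<circ> \<sigma>" "\<lambda>\<sigma>. \<tau> \<circ> \<sigma>"])
      (auto simp: fun_eq_iff inv intro: sym_group_comp t i)
qed

text \<open>Moving a permutation from the word to the Specht vector costs its sign. This yields both
  the invariance under the column stabiliser and the passage from one tableau to another.\<close>

lemma Psi_comp:
  assumes t: "\<tau> \<in> sym_group N"
  shows "Psi (v \<circ> \<tau>) s w T = of_int (sign \<tau>) * Psi v (\<lambda>T. s (T \<circ> \<tau>)) w T"
proof -
  have c: "v \<circ> \<tau> = w \<circ> (\<sigma> \<circ> \<tau>) \<longleftrightarrow> v = w \<circ> \<sigma>" for \<sigma>
    using bij_is_surj[OF sym_group_bij[OF t]] by (auto simp: fun_eq_iff) (metis surjD)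
  have "Psi (v \<circ> \<tau>) s w T = (\<Sum>\<sigma>\<in>sym_group N. if v \<circ> \<tau> = w \<circ> (\<sigma> \<circ> \<tau>) then of_int (sign (\<sigma> \<circ> \<tau>)) * s (T \<circ> (\<sigma> \<circ> \<tau>)) else 0)"
    unfolding Psi_def by (rule sum_sym_group_comp(1)[OF t, symmetric])
  also have "\<dots> = (\<Sum>\<sigma>\<in>sym_group N. of_int (sign \<tau>) * (if v = w \<circ> \<sigma> then of_int (sign \<sigma>) * s (T \<circ> \<sigma> \<circ> \<tau>) else 0))"
    unfolding c by (rule sum.cong[OF refl]) (simp add: sign_sym_group_comp[OF _ t] comp_assoc)
  finally show ?thesis by (simp add: Psi_def sum_distrib_left)
qed

lemma Psi_closed:
  assumes v: "v \<in> words n N" and s: "s \<in> S" shows "Psi v s \<in> carrier Lmod"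
  unfolding Lmod_iff
proof (intro conjI allI impI ballI)
  have "(\<lambda>T. if v = w \<circ> \<sigma> then of_int (sign \<sigma>) * s (T \<circ> \<sigma>) else 0) \<in> S" if "\<sigma> \<in> sym_group N" for \<sigma> w
    using S_smult[OF S_act[OF that s]] S_zero by (cases "v = w \<circ> \<sigma>") simp_all
  then show "Psi v s w \<in> S" for w
    unfolding Psi_def by (intro S_sum finite_sym_group)
  show "Psi v s w = (\<lambda>T. 0)" if "w \<notin> words n N" for w
  proof -
    have "v \<noteq> w \<circ> \<sigma>" if "\<sigma> \<in> sym_group N" for \<sigma> using word_comp_iff[OF that] v \<open>w \<notin> words n N\<close> by auto
    then show ?thesis unfolding Psi_def by simp
  qed
  fix \<tau> w T assume t: "\<tau> \<in> sym_group N"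
  have "Psi v s (w \<circ> \<tau>) (T \<circ> \<tau>) = (\<Sum>\<sigma>\<in>sym_group N. of_int (sign \<tau>) *
      (if v = w \<circ> (\<tau> \<circ> \<sigma>) then of_int (sign (\<tau> \<circ> \<sigma>)) * s (T \<circ> (\<tau> \<circ> \<sigma>)) else 0))"
    unfolding Psi_def
    by (rule sum.cong[OF refl]) (simp add: sign_sym_group_comp[OF t] comp_assoc mult.assoc[symmetric] sign_square)
  also have "\<dots> = (\<Sum>\<sigma>\<in>sym_group N. of_int (sign \<tau>) * (if v = w \<circ> \<sigma> then of_int (sign \<sigma>) * s (T \<circ> \<sigma>) else 0))"
    by (rule sum_sym_group_comp(2)[OF t])
  finally show "Psi v s (w \<circ> \<tau>) (T \<circ> \<tau>) = of_int (sign \<tau>) * Psi v s w T"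
    by (simp add: Psi_def sum_distrib_left)
qed

lemma finite_words: "finite (words n N)"
  unfolding words_def by (rule finite_PiE) auto

text \<open>An antisymmetric element is reproduced by each of the N! terms of its
  antisymmetrisation, so the elements \<open>Psi v s\<close> span \<open>Lmod\<close>.\<close>

lemma Lmod_expand:
  assumes f: "f \<in> carrier Lmod"
  shows "fact N * f w T = (\<Sum>v\<in>words n N. Psi v (f v) w T)"
proof (cases "w \<in> words n N")
  case True
  have "(\<Sum>v\<in>words n N. Psi v (f v) w T) =
      (\<Sum>\<sigma>\<in>sym_group N. \<Sum>v\<in>words n N. if v = w \<circ> \<sigma> then of_int (sign \<sigma>) * f v (T \<circ> \<sigma>) else 0)"
    unfolding Psi_def by (rule sum.swap)
  also have "\<dots> = (\<Sum>\<sigma>\<in>sym_group N. f w T)"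
  proof (rule sum.cong[OF refl])
    fix \<sigma> assume s: "\<sigma> \<in> sym_group N"
    have "(\<Sum>v\<in>words n N. if v = w \<circ> \<sigma> then of_int (sign \<sigma>) * f v (T \<circ> \<sigma>) else 0) = of_int (sign \<sigma>) * f (w \<circ> \<sigma>) (T \<circ> \<sigma>)"
      using word_comp_sym_group[OF True s] by (simp add: finite_words)
    also have "\<dots> = f w T" using f s by (simp add: Lmod_iff mult.assoc[symmetric] sign_square)
    finally show "(\<Sum>v\<in>words n N. if v = w \<circ> \<sigma> then of_int (sign \<sigma>) * f v (T \<circ> \<sigma>) else 0) = f w T" .
  qed
  finally show ?thesis by (simp add: card_sym_group)
next
  case False
  have "Psi v (f v) w T = 0" if "v \<in> words n N" for v
    using Psi_closed[OF that, of "f v"] f False by (simp add: Lmod_iff)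
  then show ?thesis using f False by (simp add: Lmod_iff)
qed

text \<open>Antisymmetrisation commutes with the action, so \<open>X\<close> acts on
  \<open>Psi v s\<close> through the letters of \<open>v\<close>. The indices of \<open>X\<close>
  are transposed compared with \<open>Lmod\<close>, as here basis vectors are transformed and there
  coefficients.\<close>

lemma act_Psi:
  assumes v: "v \<in> words n N" and s: "s \<in> S"
  shows "act Lmod X (Psi v s) w T = (\<Sum>k<N. \<Sum>a<n. X $$ (a, v k) * Psi (v(k := a)) s w T)"
proof (cases "w \<in> words n N")
  case w: True
  let ?e = "\<lambda>\<sigma>. of_int (sign \<sigma>) * s (T \<circ> \<sigma>)"
  have mid: "(\<Sum>k<N. \<Sum>j<n. X $$ (w k, j) * (if v = w(k := j) \<circ> \<sigma> then ?e \<sigma> else 0)) =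
      (\<Sum>k<N. \<Sum>a<n. X $$ (a, v k) * (if v(k := a) = w \<circ> \<sigma> then ?e \<sigma> else 0))" if sg: "\<sigma> \<in> sym_group N" for \<sigma>
  proof -
    have "(\<Sum>k<N. \<Sum>j<n. X $$ (w k, j) * (if v = w(k := j) \<circ> \<sigma> then ?e \<sigma> else 0)) =
        (\<Sum>k<N. \<Sum>j<n. X $$ (w (\<sigma> k), j) * (if v = w(\<sigma> k := j) \<circ> \<sigma> then ?e \<sigma> else 0))"
      by (rule sum_permute[OF sg, symmetric])
    also have "\<dots> = (\<Sum>k<N. \<Sum>a<n. X $$ (a, v k) * (if v(k := a) = w \<circ> \<sigma> then ?e \<sigma> else 0))"
    proof (rule sum.cong[OF refl])
      fix k assume k: "k \<in> {..<N}"
      let ?u = "w \<circ> \<sigma>"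
      have u: "?u k < n" "v k < n"
        using word_less[OF word_comp_sym_group[OF w sg], of k] word_less[OF v, of k] k by auto
      \<comment> \<open>Either inner sum has at most one nonzero term, and only when
        \<open>v\<close> and \<open>w \<circ> \<sigma>\<close> agree off position k.\<close>
      have 1: "v = w(\<sigma> k := j) \<circ> \<sigma> \<longleftrightarrow> j = v k \<and> v(k := ?u k) = ?u" for j
        unfolding comp_upd[OF sym_group_bij[OF sg], symmetric] by (auto simp: fun_eq_iff)
      have 2: "v(k := a) = ?u \<longleftrightarrow> a = ?u k \<and> v(k := ?u k) = ?u" for a
        by (auto simp: fun_eq_iff)
      have "(\<Sum>j<n. X $$ (w (\<sigma> k), j) * (if v = w(\<sigma> k := j) \<circ> \<sigma> then ?e \<sigma> else 0)) =
          (\<Sum>j<n. if j = v k then X $$ (?u k, v k) * (if v(k := ?u k) = ?u then ?e \<sigma> else 0) else 0)"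
        unfolding 1 by (rule sum.cong[OF refl]) simp
      also have "\<dots> = X $$ (?u k, v k) * (if v(k := ?u k) = ?u then ?e \<sigma> else 0)"
        using u by simp
      also have "\<dots> = (\<Sum>a<n. if a = ?u k then X $$ (?u k, v k) * (if v(k := ?u k) = ?u then ?e \<sigma> else 0) else 0)"
        using u by simp
      also have "\<dots> = (\<Sum>a<n. X $$ (a, v k) * (if v(k := a) = ?u then ?e \<sigma> else 0))"
      proof (rule sum.cong[OF refl])
        fix a
        show "(if a = ?u k then X $$ (?u k, v k) * (if v(k := ?u k) = ?u then ?e \<sigma> else 0) else 0) =
            X $$ (a, v k) * (if v(k := a) = ?u then ?e \<sigma> else 0)"
        proof (cases "a = ?u k")
          case False
          then have "v(k := a) \<noteq> ?u" using 2[of a] by argo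
          then show ?thesis using False by simp
        qed simp
      qed
      finally show "(\<Sum>j<n. X $$ (w (\<sigma> k), j) * (if v = w(\<sigma> k := j) \<circ> \<sigma> then ?e \<sigma> else 0)) =
          (\<Sum>a<n. X $$ (a, v k) * (if v(k := a) = ?u then ?e \<sigma> else 0))" .
    qed
    finally show ?thesis .
  qed
  have l: "act Lmod X (Psi v s) w T =
      (\<Sum>\<sigma>\<in>sym_group N. \<Sum>k<N. \<Sum>j<n. X $$ (w k, j) * (if v = w(k := j) \<circ> \<sigma> then ?e \<sigma> else 0))"
  proof -
    have "act Lmod X (Psi v s) w T =
        (\<Sum>k<N. \<Sum>j<n. \<Sum>\<sigma>\<in>sym_group N. X $$ (w k, j) * (if v = w(k := j) \<circ> \<sigma> then ?e \<sigma> else 0))"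
      using w by (simp add: Lmod_simps Psi_def sum_distrib_left)
    also have "\<dots> = (\<Sum>k<N. \<Sum>\<sigma>\<in>sym_group N. \<Sum>j<n. X $$ (w k, j) * (if v = w(k := j) \<circ> \<sigma> then ?e \<sigma> else 0))"
      by (rule sum.cong[OF refl]) (rule sum.swap)
    also have "\<dots> = (\<Sum>\<sigma>\<in>sym_group N. \<Sum>k<N. \<Sum>j<n. X $$ (w k, j) * (if v = w(k := j) \<circ> \<sigma> then ?e \<sigma> else 0))"
      by (rule sum.swap)
    finally show ?thesis .
  qed
  have r: "(\<Sum>k<N. \<Sum>a<n. X $$ (a, v k) * Psi (v(k := a)) s w T) =
      (\<Sum>\<sigma>\<in>sym_group N. \<Sum>k<N. \<Sum>a<n. X $$ (a, v k) * (if v(k := a) = w \<circ> \<sigma> then ?e \<sigma> else 0))"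
  proof -
    have "(\<Sum>k<N. \<Sum>a<n. X $$ (a, v k) * Psi (v(k := a)) s w T) =
        (\<Sum>k<N. \<Sum>a<n. \<Sum>\<sigma>\<in>sym_group N. X $$ (a, v k) * (if v(k := a) = w \<circ> \<sigma> then ?e \<sigma> else 0))"
      by (simp add: Psi_def sum_distrib_left)
    also have "\<dots> = (\<Sum>k<N. \<Sum>\<sigma>\<in>sym_group N. \<Sum>a<n. X $$ (a, v k) * (if v(k := a) = w \<circ> \<sigma> then ?e \<sigma> else 0))"
      by (rule sum.cong[OF refl]) (rule sum.swap)
    also have "\<dots> = (\<Sum>\<sigma>\<in>sym_group N. \<Sum>k<N. \<Sum>a<n. X $$ (a, v k) * (if v(k := a) = w \<circ> \<sigma> then ?e \<sigma> else 0))"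
      by (rule sum.swap)
    finally show ?thesis .
  qed
  show ?thesis unfolding l r by (rule sum.cong[OF refl]) (rule mid)
next
  case False
  have "Psi (v(k := a)) s w T = 0" if "k < N" "a < n" for k a
    using Psi_closed[OF word_upd[OF v that] s] False by (simp add: Lmod_iff)
  then show ?thesis using False by (simp add: Lmod_simps)
qed

section \<open>The invariant Hermitian form\<close>

text \<open>The standard form for which pairs of a word and a tabloid are orthonormal, restricted to
  \<open>Lmod\<close>; this makes the conjugate transpose the adjoint of a matrix.\<close>

definition form where
  "form f g = (\<Sum>w\<in>words n N. \<Sum>T\<in>tabloids N lam. f w T * cnj (g w T))"
  for f g :: "(nat \<Rightarrow> nat) \<Rightarrow> (nat \<Rightarrow> nat) \<Rightarrow> complex"

lemma form_act:
  assumes X: "X \<in> sl n"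
  shows "form (act Lmod X f) g = form f (act Lmod (mat n n (\<lambda>(i, j). cnj (X $$ (j, i)))) g)"
proof -
  let ?W = "words n N"
  \<comment> \<open>Exchanging the letter at position k with j is an involution on pairs of a word
    and a letter.\<close>
  have sw: "(\<Sum>w\<in>?W. \<Sum>j<n. X $$ (w k, j) * f (w(k := j)) T * cnj (g w T)) =
      (\<Sum>w\<in>?W. \<Sum>j<n. X $$ (j, w k) * f w T * cnj (g (w(k := j)) T))" if k: "k < N" for k T
    unfolding sum.cartesian_product
    by (rule sum.reindex_bij_witness[of _ "\<lambda>(w, j). (w(k := j), w k)" "\<lambda>(w, j). (w(k := j), w k)"])
      (use k in \<open>auto simp: word_upd word_less\<close>)
  have a: "form (act Lmod X f) g =
      (\<Sum>T\<in>tabloids N lam. \<Sum>k<N. \<Sum>w\<in>?W. \<Sum>j<n. X $$ (w k, j) * f (w(k := j)) T * cnj (g w T))"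
  proof -
    have "form (act Lmod X f) g = (\<Sum>w\<in>?W. \<Sum>T\<in>tabloids N lam. \<Sum>k<N. \<Sum>j<n. X $$ (w k, j) * f (w(k := j)) T * cnj (g w T))"
      unfolding form_def by (simp add: Lmod_simps sum_distrib_right)
    also have "\<dots> = (\<Sum>T\<in>tabloids N lam. \<Sum>w\<in>?W. \<Sum>k<N. \<Sum>j<n. X $$ (w k, j) * f (w(k := j)) T * cnj (g w T))"
      by (rule sum.swap)
    also have "\<dots> = (\<Sum>T\<in>tabloids N lam. \<Sum>k<N. \<Sum>w\<in>?W. \<Sum>j<n. X $$ (w k, j) * f (w(k := j)) T * cnj (g w T))"
      by (rule sum.cong[OF refl]) (rule sum.swap)
    finally show ?thesis .
  qed
  have b: "form f (act Lmod (mat n n (\<lambda>(i, j). cnj (X $$ (j, i)))) g) =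
      (\<Sum>T\<in>tabloids N lam. \<Sum>k<N. \<Sum>w\<in>?W. \<Sum>j<n. X $$ (j, w k) * f w T * cnj (g (w(k := j)) T))"
  proof -
    have "form f (act Lmod (mat n n (\<lambda>(i, j). cnj (X $$ (j, i)))) g) =
        (\<Sum>w\<in>?W. \<Sum>T\<in>tabloids N lam. \<Sum>k<N. \<Sum>j<n. X $$ (j, w k) * f w T * cnj (g (w(k := j)) T))"
      unfolding form_def
      by (intro sum.cong refl) (simp add: Lmod_simps sum_distrib_left word_less mult_ac)
    also have "\<dots> = (\<Sum>T\<in>tabloids N lam. \<Sum>w\<in>?W. \<Sum>k<N. \<Sum>j<n. X $$ (j, w k) * f w T * cnj (g (w(k := j)) T))"
      by (rule sum.swap)
    also have "\<dots> = (\<Sum>T\<in>tabloids N lam. \<Sum>k<N. \<Sum>w\<in>?W. \<Sum>j<n. X $$ (j, w k) * f w T * cnj (g (w(k := j)) T))"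
      by (rule sum.cong[OF refl]) (rule sum.swap)
    finally show ?thesis .
  qed
  show ?thesis
    unfolding a b by (rule sum.cong[OF refl], rule sum.cong[OF refl], rule sw) simp
qed

lemma finite_tabloids: "finite (tabloids N lam)"
  by (rule finite_subset[of _ "{..<N} \<rightarrow>\<^sub>E {..<length lam}"]) (auto simp: tabloids_def intro: finite_PiE)

lemma form_pos:
  assumes f: "f \<in> carrier Lmod" and z: "form f f = 0" shows "f = \<zero>\<^bsub>Lmod\<^esub>"
proof -
  have e: "form f f = of_real (\<Sum>w\<in>words n N. \<Sum>T\<in>tabloids N lam. (cmod (f w T))\<^sup>2)"
    unfolding form_def of_real_sum by (intro sum.cong refl) (rule complex_norm_square[symmetric])
  have "(\<Sum>w\<in>words n N. \<Sum>T\<in>tabloids N lam. (cmod (f w T))\<^sup>2) = 0"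
    using z unfolding e by (rule of_real_eq_0_iff[THEN iffD1])
  then have "f w T = 0" if "w \<in> words n N" "T \<in> tabloids N lam" for w T
    using that by (simp add: sum_nonneg_eq_0_iff sum_nonneg finite_words finite_tabloids)
  moreover have "f w T = 0" if "w \<notin> words n N \<or> T \<notin> tabloids N lam" for w T
    using that f S_carrier[of "f w" T] by (auto simp: Lmod_iff)
  ultimately show ?thesis by (auto simp: Lmod_simps fun_eq_iff)
qed

end

section \<open>Polytabloids and the word of column indices\<close>

context specht_data begin

lemma exists_tableau:
  assumes "sum_list lam = N" obtains t where "t \<in> tableaux N lam"
proof -
  let ?D = "{(r, c). r < length lam \<and> c < lam ! r}"
  have D: "?D = Sigma {..<length lam} (\<lambda>r. {..<lam ! r})" by auto
  have "card ?D = N"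
    unfolding D using assms by (simp add: sum_list_sum_nth atLeast0LessThan)
  moreover have "finite ?D" unfolding D by auto
  ultimately obtain f where f: "bij_betw f {..<N} ?D"
    using finite_same_card_bij[of "{..<N}" ?D] by auto
  have "bij_betw (restrict f {..<N}) {..<N} ?D"
    using f by (rule bij_betw_cong[THEN iffD1, rotated]) simp
  then show thesis by (intro that[of "restrict f {..<N}"]) (simp add: tableaux_def)
qed

lemma Psi_smult: "Psi v (\<lambda>T. c * s T) w T = c * Psi v s w T"
  unfolding Psi_def sum_distrib_left by (intro sum.cong refl) simp

lemma Psi_add: "Psi v (\<lambda>T. s T + s' T) w T = Psi v s w T + Psi v s' w T"
  unfolding Psi_def sum.distrib[symmetric] by (intro sum.cong refl) (simp add: distrib_left)

text \<open>Multiplication by \<sigma> permutes the column stabiliser, over which the polytabloid is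
  a signed sum, and changes all signs by that of \<sigma>.\<close>

lemma polytabloid_col_stab:
  assumes s: "\<sigma> \<in> col_stab t"
  shows "polytabloid N t (T \<circ> \<sigma>) = of_int (sign \<sigma>) * polytabloid N t T"
proof -
  have sg: "\<sigma> \<in> sym_group N" using s by (simp add: col_stab_def)
  let ?i = "inv_into UNIV \<sigma>"
  note i = permutes_inv_apply[OF sg]
  have inv: "\<sigma> (?i x) = x" "?i (\<sigma> x) = x" for x
    using sg permutes_inverses by (auto simp: sym_group_def)
  have c1: "\<sigma> \<circ> \<rho> \<in> col_stab t" if "\<rho> \<in> col_stab t" for \<rho>
    using that s sym_group_comp[OF sg] sym_group_less by (simp add: col_stab_def)
  have c2: "?i \<circ> \<rho> \<in> col_stab t" if r: "\<rho> \<in> col_stab t" for \<rho>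
    unfolding col_stab_def
  proof (intro CollectI conjI allI impI)
    show "?i \<circ> \<rho> \<in> sym_group N" by (rule sym_group_comp[OF i]) (use r in \<open>simp add: col_stab_def\<close>)
    fix k assume k: "k < N"
    have "?i (\<rho> k) < N" using sym_group_less[OF i] sym_group_less[of \<rho> N k] r k by (simp add: col_stab_def)
    then have "snd (t (\<sigma> (?i (\<rho> k)))) = snd (t (?i (\<rho> k)))" using s by (simp add: col_stab_def)
    then show "snd (t ((?i \<circ> \<rho>) k)) = snd (t k)" using r k by (simp add: inv col_stab_def)
  qed
  have "polytabloid N t (T \<circ> \<sigma>) =
      (\<Sum>\<rho>\<in>col_stab t. of_int (sign \<sigma>) * (if T \<circ> (\<sigma> \<circ> \<rho>) = row_of t then of_int (sign (\<sigma> \<circ> \<rho>)) else 0))"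
    unfolding polytabloid_eq
  proof (rule sum.cong[OF refl])
    fix \<rho> assume "\<rho> \<in> col_stab t"
    then have "\<rho> \<in> sym_group N" by (simp add: col_stab_def)
    then show "(if T \<circ> \<sigma> \<circ> \<rho> = row_of t then of_int (sign \<rho>) else 0) =
        of_int (sign \<sigma>) * (if T \<circ> (\<sigma> \<circ> \<rho>) = row_of t then of_int (sign (\<sigma> \<circ> \<rho>)) else 0 :: complex)"
      by (simp add: sign_sym_group_comp[OF sg] comp_assoc mult.assoc[symmetric] sign_square)
  qed
  also have "\<dots> = (\<Sum>\<rho>\<in>col_stab t. of_int (sign \<sigma>) * (if T \<circ> \<rho> = row_of t then of_int (sign \<rho>) else 0))"
    by (rule sum.reindex_bij_witness[of _ "\<lambda>\<rho>. ?i \<circ> \<rho>" "\<lambda>\<rho>. \<sigma> \<circ> \<rho>"])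
      (simp_all add: c1 c2 fun_eq_iff inv)
  finally show ?thesis by (simp add: polytabloid_eq sum_distrib_left)
qed

text \<open>The sign from \<open>Psi_comp\<close> cancels against the sign by which the polytabloid
  changes, so letters may be permuted within the columns of \<open>t\<close>.\<close>

lemma Psi_col_stab:
  assumes s: "\<sigma> \<in> col_stab t"
  shows "Psi (v \<circ> \<sigma>) (polytabloid N t) = Psi v (polytabloid N t)"
proof (intro ext)
  fix w T
  have sg: "\<sigma> \<in> sym_group N" using s by (simp add: col_stab_def)
  show "Psi (v \<circ> \<sigma>) (polytabloid N t) w T = Psi v (polytabloid N t) w T"
    unfolding Psi_comp[OF sg] polytabloid_col_stab[OF s] Psi_smult
    by (simp add: mult.assoc[symmetric] sign_square)
qed

lemma col_stab_iff: "\<sigma> \<in> sym_group N \<Longrightarrow> \<sigma> \<in> col_stab t \<longleftrightarrow> col_of t = col_of t \<circ> \<sigma>"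
proof -
  assume s: "\<sigma> \<in> sym_group N"
  have "col_of t \<circ> \<sigma> = col_of (t \<circ> \<sigma>)" unfolding col_of_def by (rule restrict_comp[OF s, symmetric])
  then show ?thesis using s by (auto simp: col_stab_def col_of_def fun_eq_iff restrict_def)
qed

text \<open>A permutation that preserves the row and the column of every entry of \<open>t\<close>
  is the identity, so the tabloid of \<open>t\<close> occurs only once in the sum.\<close>

lemma polytabloid_row:
  assumes t: "t \<in> tableaux N lam" shows "polytabloid N t (row_of t) = 1"
proof -
  have inj: "inj_on t {..<N}" using t by (simp add: tableaux_def bij_betw_def)
  have "\<sigma> = id" if s: "\<sigma> \<in> col_stab t" "row_of t \<circ> \<sigma> = row_of t" for \<sigma>
  proof
    fix i
    have sg: "\<sigma> \<in> sym_group N" using s by (simp add: col_stab_def)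
    show "\<sigma> i = id i"
    proof (cases "i < N")
      case True
      have l: "\<sigma> i < N" by (rule sym_group_less[OF sg True])
      have "snd (t (\<sigma> i)) = snd (t i)" using s(1) True by (simp add: col_stab_def)
      moreover have "fst (t (\<sigma> i)) = fst (t i)" using fun_cong[OF s(2), of i] True l by (simp add: row_of_def)
      ultimately have "t (\<sigma> i) = t i" by (rule prod_eqI[rotated])
      then show ?thesis using inj_onD[OF inj] l True by simp
    next
      case False
      then show ?thesis using sg by (simp add: sym_group_def permutes_def)
    qed
  qed
  moreover have "id \<in> col_stab t" by (simp add: col_stab_def sym_group_def permutes_id)
  ultimately have "polytabloid N t (row_of t) = (\<Sum>\<sigma>\<in>col_stab t. if \<sigma> = id then 1 else 0)"
    unfolding polytabloid_eq by (intro sum.cong refl) (auto simp: sign_id)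
  then show ?thesis using \<open>id \<in> col_stab t\<close> by (simp add: finite_col_stab)
qed

text \<open>The permutations that fix the word of column indices are those of the column stabiliser.
  Each contributes the square of its sign, so the value is the order of that group.\<close>

lemma Psi_nonzero:
  assumes t: "t \<in> tableaux N lam" shows "Psi (col_of t) (polytabloid N t) (col_of t) (row_of t) \<noteq> 0"
proof -
  have "Psi (col_of t) (polytabloid N t) (col_of t) (row_of t) =
      (\<Sum>\<sigma>\<in>sym_group N. if \<sigma> \<in> col_stab t then 1 else 0)"
    unfolding Psi_def
    by (intro sum.cong refl)
      (simp add: col_stab_iff[symmetric] polytabloid_col_stab polytabloid_row[OF t] sign_square)
  also have "\<dots> = of_nat (card (col_stab t))"
  proof -
    have "{\<sigma> \<in> sym_group N. \<sigma> \<in> col_stab t} = col_stab t" by (auto simp: col_stab_def)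
    then show ?thesis by (simp add: sum.inter_filter[OF finite_sym_group, symmetric])
  qed
  also have "\<dots> \<noteq> 0"
  proof -
    have "id \<in> col_stab t" by (simp add: col_stab_def sym_group_def permutes_id)
    then show ?thesis using finite_col_stab[of t] by auto
  qed
  finally show ?thesis .
qed

section \<open>Bounds on the letters and the highest weight property\<close>

text \<open>The transposition of the two positions fixes both the word and the tabloid, but changes
  the sign of the coefficient.\<close>

lemma Lmod_coincidence:
  assumes f: "f \<in> carrier Lmod" and ab: "a \<noteq> b" "a < N" "b < N" "w a = w b" "T a = T b"
  shows "f w T = 0"
proof -
  let ?\<tau> = "Transposition.transpose a b"
  have s: "?\<tau> \<in> sym_group N" using ab by (simp add: sym_group_def permutes_swap_id)
  have "w \<circ> ?\<tau> = w" "T \<circ> ?\<tau> = T" using ab by (auto simp: fun_eq_iff Transposition.transpose_def)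
  moreover have "f (w \<circ> ?\<tau>) (T \<circ> ?\<tau>) = of_int (sign ?\<tau>) * f w T" using f s by (simp add: Lmod_iff)
  ultimately show ?thesis using ab(1) by (simp add: sign_swap_id)
qed

lemma Lmod_inj:
  assumes f: "f \<in> carrier Lmod" and nz: "f w T \<noteq> 0" shows "inj_on w {i. i < N \<and> T i = r}"
proof (rule inj_onI, rule ccontr)
  fix i j assume "i \<in> {i. i < N \<and> T i = r}" "j \<in> {i. i < N \<and> T i = r}" "w i = w j" "i \<noteq> j"
  then show False using Lmod_coincidence[OF f, of i j w T] nz by simp
qed

text \<open>Letters at entries of one row are distinct wherever the coefficient is nonzero, and a
  first row of more than n entries leaves too few letters.\<close>

lemma Lmod_trivial:
  assumes lam: "0 < length lam" "n < lam ! 0" and f: "f \<in> carrier Lmod"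
  shows "f w T = 0"
proof (rule ccontr)
  assume nz: "f w T \<noteq> 0"
  have w: "w \<in> words n N" using f nz by (auto simp: Lmod_iff)
  have T: "T \<in> tabloids N lam" using f nz S_carrier[of "f w" T] by (auto simp: Lmod_iff)
  let ?A = "{i. i < N \<and> T i = 0}"
  have "card ?A = lam ! 0" using T lam(1) by (simp add: tabloids_def)
  moreover have "inj_on w ?A" by (rule Lmod_inj[of f w T, OF f nz])
  then have "card ?A \<le> card {..<n}"
    by (rule card_inj_on_le) (use word_less[OF w] in auto)
  ultimately show False using lam(2) by simp
qed

text \<open>A row of the tabloid carries distinct letters, so at most the smaller of its length and
  a + 1 of them are at most \<open>a\<close>. Summed over the rows, this counts the cells in the
  first a + 1 columns: a dominance bound on the words that occur.\<close>

lemma letter_bound: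
  assumes f: "f \<in> carrier Lmod" and nz: "f w T \<noteq> 0"
  shows "card {i. i < N \<and> w i \<le> a} \<le> card {(r, c). r < length lam \<and> c < lam ! r \<and> c \<le> a}"
proof -
  have T: "T \<in> tabloids N lam" using f nz S_carrier[of "f w" T] by (auto simp: Lmod_iff)
  have Tl: "T i < length lam" if "i < N" for i using T that by (auto simp: tabloids_def)
  have "{i. i < N \<and> w i \<le> a} = (\<Union>r<length lam. {i. i < N \<and> w i \<le> a \<and> T i = r})" using Tl by auto
  then have "card {i. i < N \<and> w i \<le> a} = (\<Sum>r<length lam. card {i. i < N \<and> w i \<le> a \<and> T i = r})"
    by (simp only:) (subst card_UN_disjoint, auto)
  also have "\<dots> \<le> (\<Sum>r<length lam. card {c. c < lam ! r \<and> c \<le> a})"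
  proof (rule sum_mono)
    fix r assume r: "r \<in> {..<length lam}"
    let ?A = "{i. i < N \<and> w i \<le> a \<and> T i = r}"
    have "inj_on w ?A" by (rule inj_on_subset[OF Lmod_inj[of f w T r, OF f nz]]) auto
    then have "card ?A \<le> card {..a}" by (rule card_inj_on_le) auto
    moreover have "card ?A \<le> card {i. i < N \<and> T i = r}" by (rule card_mono) auto
    moreover have "card {i. i < N \<and> T i = r} = lam ! r" using T r by (simp add: tabloids_def)
    moreover have "{c. c < lam ! r \<and> c \<le> a} = {..<min (lam ! r) (Suc a)}" by auto
    ultimately show "card ?A \<le> card {c. c < lam ! r \<and> c \<le> a}" by simp
  qed
  also have "\<dots> = card (Sigma {..<length lam} (\<lambda>r. {c. c < lam ! r \<and> c \<le> a}))" by simp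
  also have "Sigma {..<length lam} (\<lambda>r. {c. c < lam ! r \<and> c \<le> a}) = {(r, c). r < length lam \<and> c < lam ! r \<and> c \<le> a}"
    by auto
  finally show ?thesis .
qed

lemma col_of_count:
  assumes t: "t \<in> tableaux N lam"
  shows "card {i. i < N \<and> P (col_of t i)} = card {(r, c). r < length lam \<and> c < lam ! r \<and> P c}"
proof (rule bij_betw_same_card[of t], rule bij_betw_subset)
  show "bij_betw t {..<N} {(r, c). r < length lam \<and> c < lam ! r}" using t by (simp add: tableaux_def)
  then have im: "t ` {..<N} = {(r, c). r < length lam \<and> c < lam ! r}" by (simp add: bij_betw_def)
  show "t ` {i. i < N \<and> P (col_of t i)} = {(r, c). r < length lam \<and> c < lam ! r \<and> P c}"
  proof
    show "t ` {i. i < N \<and> P (col_of t i)} \<subseteq> {(r, c). r < length lam \<and> c < lam ! r \<and> P c}"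
    proof
      fix p assume "p \<in> t ` {i. i < N \<and> P (col_of t i)}"
      then obtain i where "i < N" "P (col_of t i)" "p = t i" by auto
      then show "p \<in> {(r, c). r < length lam \<and> c < lam ! r \<and> P c}"
        using tableau_less[OF t, of i] by (cases "t i") (simp add: col_of_def)
    qed
    show "{(r, c). r < length lam \<and> c < lam ! r \<and> P c} \<subseteq> t ` {i. i < N \<and> P (col_of t i)}"
    proof
      fix p assume p: "p \<in> {(r, c). r < length lam \<and> c < lam ! r \<and> P c}"
      then have "p \<in> t ` {..<N}" unfolding im by auto
      then obtain i where "i < N" "p = t i" by auto
      moreover from this have "P (col_of t i)" using p by (cases "t i") (simp add: col_of_def)
      ultimately show "p \<in> t ` {i. i < N \<and> P (col_of t i)}" by simp
    qed
  qed
qed auto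

lemma count_comp:
  assumes s: "\<sigma> \<in> sym_group N" and v: "v = w \<circ> \<sigma>"
  shows "card {i. i < N \<and> v i \<le> a} = card {i. i < N \<and> w i \<le> (a :: nat)}"
proof (rule bij_betw_same_card)
  have p: "\<sigma> permutes {..<N}" using s by (simp add: sym_group_def)
  have vi: "v i = w (\<sigma> i)" for i by (simp add: v)
  have l: "inv_into UNIV \<sigma> i < N" if "i < N" for i by (rule sym_group_less[OF permutes_inv_apply[OF s] that])
  show "bij_betw \<sigma> {i. i < N \<and> v i \<le> a} {i. i < N \<and> w i \<le> a}"
  proof (rule bij_betw_imageI)
    show "inj_on \<sigma> {i. i < N \<and> v i \<le> a}" by (rule permutes_inj_on[OF p])
    show "\<sigma> ` {i. i < N \<and> v i \<le> a} = {i. i < N \<and> w i \<le> a}"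
    proof (intro subset_antisym subsetI)
      fix x assume "x \<in> {i. i < N \<and> w i \<le> a}"
      then show "x \<in> \<sigma> ` {i. i < N \<and> v i \<le> a}"
        by (intro image_eqI[of _ _ "inv_into UNIV \<sigma> x"]) (simp_all add: vi l permutes_inverses[OF p])
    next
      fix x assume "x \<in> \<sigma> ` {i. i < N \<and> v i \<le> a}"
      then show "x \<in> {i. i < N \<and> w i \<le> a}" by (elim imageE) (simp add: vi sym_group_less[OF s])
    qed
  qed
qed

text \<open>The word of column indices attains the bound of \<open>letter_bound\<close> for every
  \<open>a\<close>. Replacing a larger letter by \<open>a\<close> exceeds it, and all words in the
  antisymmetrisation have the same letter counts.\<close>

lemma Psi_raised_zero:
  assumes t: "t \<in> tableaux N lam" and w0: "col_of t \<in> words n N" and k: "k < N" "a < col_of t k"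
    and v: "v = (col_of t)(k := a)"
  shows "Psi v (polytabloid N t) w T = 0"
proof (rule ccontr)
  assume nz: "Psi v (polytabloid N t) w T \<noteq> 0"
  have an: "a < n" by (rule less_trans[OF k(2) word_less[OF w0 k(1)]])
  have "v \<in> words n N" unfolding v by (rule word_upd[OF w0 k(1) an])
  then have "Psi v (polytabloid N t) \<in> carrier Lmod" using S_poly[OF t] by (rule Psi_closed)
  then have le: "card {i. i < N \<and> w i \<le> a} \<le> card {i. i < N \<and> col_of t i \<le> a}"
    using letter_bound[of "Psi v (polytabloid N t)" w T a] nz
    by (simp add: col_of_count[OF t, of "\<lambda>c. c \<le> a"])
  have "\<exists>\<sigma>\<in>sym_group N. v = w \<circ> \<sigma>"
  proof (rule ccontr)
    assume "\<not> (\<exists>\<sigma>\<in>sym_group N. v = w \<circ> \<sigma>)"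
    then have "Psi v (polytabloid N t) w T = 0" unfolding Psi_def by (intro sum.neutral) auto
    then show False using nz by simp
  qed
  then obtain \<sigma> where s: "\<sigma> \<in> sym_group N" "v = w \<circ> \<sigma>" by (rule bexE)
  have e: "{i. i < N \<and> v i \<le> a} = insert k {i. i < N \<and> col_of t i \<le> a}" using k v by auto
  have "card {i. i < N \<and> v i \<le> a} = card {i. i < N \<and> w i \<le> a}"
    by (rule count_comp[OF s])
  moreover have "card {i. i < N \<and> v i \<le> a} = Suc (card {i. i < N \<and> col_of t i \<le> a})"
    unfolding e by (rule card_insert_disjoint) (use k in auto)
  ultimately show False using le by simp
qed

lemma Psi_raised:
  assumes "t \<in> tableaux N lam" "col_of t \<in> words n N" "k < N" "a < col_of t k"
  shows "Psi ((col_of t)(k := a)) (polytabloid N t) = (\<lambda>w T. 0)"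
  by (intro ext) (rule Psi_raised_zero[OF assms refl])

lemma act_Psi_diag:
  assumes v: "v \<in> words n N" and s: "s \<in> S" and H: "H \<in> sl n" "diagonal_mat H"
  shows "act Lmod H (Psi v s) = (\<Sum>k<N. H $$ (v k, v k)) \<odot>\<^bsub>Lmod\<^esub> Psi v s"
proof (intro ext)
  fix w T
  have "(\<Sum>a<n. H $$ (a, v k) * Psi (v(k := a)) s w T) = H $$ (v k, v k) * Psi v s w T" if k: "k < N" for k
  proof -
    have "(\<Sum>a<n. H $$ (a, v k) * Psi (v(k := a)) s w T) =
        (\<Sum>a<n. if a = v k then H $$ (v k, v k) * Psi v s w T else 0)"
      by (rule sum.cong[OF refl])
        (use H word_less[OF v k] in \<open>auto simp: diagonal_mat_def sl_def\<close>)
    then show ?thesis using word_less[OF v k] by simp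
  qed
  then show "act Lmod H (Psi v s) w T = ((\<Sum>k<N. H $$ (v k, v k)) \<odot>\<^bsub>Lmod\<^esub> Psi v s) w T"
    by (simp add: act_Psi[OF v s] Lmod_simps(3) sum_distrib_right)
qed

text \<open>Induction on the number of positions where \<open>v\<close> differs from the word of column indices: such a
  letter is corrected to obtain \<open>v'\<close>, and a matrix unit applied to the element of \<open>v'\<close> yields a multiple of
  the element of \<open>v\<close> plus elements of words with fewer differences.\<close>

lemma Psi_cyclic:
  assumes t: "t \<in> tableaux N lam" and w0: "col_of t \<in> words n N"
    and U_add: "\<And>f g. f \<in> U \<Longrightarrow> g \<in> U \<Longrightarrow> (\<lambda>w T. f w T + g w T) \<in> U"
    and U_smult: "\<And>c f. f \<in> U \<Longrightarrow> (\<lambda>w T. c * f w T) \<in> U"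
    and U_act: "\<And>X f. X \<in> sl n \<Longrightarrow> f \<in> U \<Longrightarrow> act Lmod X f \<in> U"
    and x: "Psi (col_of t) (polytabloid N t) \<in> U"
    and v: "v \<in> words n N"
  shows "Psi v (polytabloid N t) \<in> U"
  using v
proof (induction "card {i. i < N \<and> v i \<noteq> col_of t i}" arbitrary: v rule: less_induct)
  case less
  let ?w = "col_of t" and ?e = "polytabloid N t"
  note v = less.prems
  have U_sum: "(\<lambda>w T. \<Sum>a\<in>A. h a w T) \<in> U" if "finite A" "\<And>a. a \<in> A \<Longrightarrow> h a \<in> U" for A and h :: "nat \<Rightarrow> _"
    using that
  proof (induction A rule: finite_induct)
    case empty then show ?case using U_smult[OF x, of 0] by simp
  next
    case (insert a A)
    then show ?case using U_add[of "h a" "\<lambda>w T. \<Sum>a\<in>A. h a w T"] by simp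
  qed
  show ?case
  proof (cases "\<exists>p<N. v p \<noteq> ?w p")
    case False
    then have "v = ?w"
      by (intro PiE_ext[OF v[unfolded words_def] w0[unfolded words_def]]) auto
    then show ?thesis using x by simp
  next
    case True
    then obtain p where p: "p < N" "v p \<noteq> ?w p" by auto
    let ?a = "v p" and ?j = "?w p"
    let ?v' = "v(p := ?j)"
    let ?D = "\<lambda>u. {i. i < N \<and> u i \<noteq> ?w i}"
    have an: "?a < n" "?j < n" using word_less[OF v p(1)] word_less[OF w0 p(1)] by auto
    have v': "?v' \<in> words n N" by (rule word_upd[OF v p(1) an(2)])
    have small: "card (?D u) < card (?D v)" if "?D u \<subseteq> ?D v - {p}" for u
      by (rule psubset_card_mono) (use that p in auto)
    have v'U: "Psi ?v' ?e \<in> U" by (rule less.hyps[OF small v']) auto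
    \<comment> \<open>The matrix unit replaces one letter \<open>?j\<close> of \<open>?v'\<close> by
      \<open>?a\<close>, at any of these positions. \<open>?K1\<close> consists of those positions
      that belong to column \<open>?j\<close> of the tableau.\<close>
    let ?K = "{k \<in> {..<N}. ?v' k = ?j}"
    let ?K1 = "{k \<in> ?K. ?w k = ?j}" and ?K2 = "{k \<in> ?K. ?w k \<noteq> ?j}"
    let ?E = "unit_mat n ?a ?j"
    have E: "?E \<in> sl n" by (rule unit_mat_sl[OF p(2)])
    have act: "act Lmod ?E (Psi ?v' ?e) w T = (\<Sum>k\<in>?K. Psi (?v'(k := ?a)) ?e w T)" for w T
    proof -
      have "(\<Sum>b<n. ?E $$ (b, ?v' k) * Psi (?v'(k := b)) ?e w T) = (if ?v' k = ?j then Psi (?v'(k := ?a)) ?e w T else 0)"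
        if k: "k < N" for k
      proof -
        have "(\<Sum>b<n. ?E $$ (b, ?v' k) * Psi (?v'(k := b)) ?e w T) =
            (\<Sum>b<n. if b = ?a then (if ?v' k = ?j then Psi (?v'(k := ?a)) ?e w T else 0) else 0)"
          by (rule sum.cong[OF refl]) (use word_less[OF v' k] in \<open>simp add: unit_mat_def\<close>)
        then show ?thesis using an by simp
      qed
      then have "act Lmod ?E (Psi ?v' ?e) w T = (\<Sum>k<N. if ?v' k = ?j then Psi (?v'(k := ?a)) ?e w T else 0)"
        unfolding act_Psi[OF v' S_poly[OF t]] by simp
      then show ?thesis by (simp add: sum.inter_filter[symmetric])
    qed
    \<comment> \<open>Changing the letter at k instead of at p differs by a transposition inside one
      column, which \<open>Psi_col_stab\<close> absorbs.\<close>
    have K1: "Psi (?v'(k := ?a)) ?e = Psi v ?e" if k: "k \<in> ?K1" for k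
    proof (cases "k = p")
      case False
      let ?\<tau> = "Transposition.transpose p k"
      have s: "?\<tau> \<in> sym_group N" using p k by (simp add: sym_group_def permutes_swap_id)
      have "?w = ?w \<circ> ?\<tau>" using k by (auto simp: fun_eq_iff Transposition.transpose_def)
      then have "?\<tau> \<in> col_stab t" using col_stab_iff[OF s] by simp
      moreover have "?v'(k := ?a) = v \<circ> ?\<tau>"
        using k False by (auto simp: fun_eq_iff Transposition.transpose_def)
      ultimately show ?thesis by (simp only: Psi_col_stab)
    qed simp
    \<comment> \<open>Position k already disagreed with the column word, so its change creates no
      new difference, while p has been corrected: the induction hypothesis applies.\<close>
    have K2: "Psi (?v'(k := ?a)) ?e \<in> U" if k: "k \<in> ?K2" for k
    proof (rule less.hyps[OF small])
      have kp: "k \<noteq> p" using k by auto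
      then show "?D (?v'(k := ?a)) \<subseteq> ?D v - {p}" using k by auto
      show "?v'(k := ?a) \<in> words n N" by (rule word_upd[OF v' _ an(1)]) (use k in simp)
    qed
    have fin: "finite ?K1" "finite ?K2" by auto
    \<comment> \<open>Since p itself belongs to \<open>?K1\<close>, the multiple of the element of
      \<open>v\<close> is nonzero and can be divided out.\<close>
    have pK: "p \<in> ?K1" using p by simp
    then have m: "of_nat (card ?K1) \<noteq> (0 :: complex)" using fin(1) by auto
    have split: "act Lmod ?E (Psi ?v' ?e) w T = of_nat (card ?K1) * Psi v ?e w T + (\<Sum>k\<in>?K2. Psi (?v'(k := ?a)) ?e w T)" for w T
    proof -
      have e: "?K = ?K1 \<union> ?K2" "?K1 \<inter> ?K2 = {}" by auto
      have "(\<Sum>k\<in>?K. Psi (?v'(k := ?a)) ?e w T) =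
          (\<Sum>k\<in>?K1. Psi (?v'(k := ?a)) ?e w T) + (\<Sum>k\<in>?K2. Psi (?v'(k := ?a)) ?e w T)"
        by (rule trans[OF sum.cong[OF e(1) refl] sum.union_disjoint[OF fin e(2)]])
      moreover have "(\<Sum>k\<in>?K1. Psi (?v'(k := ?a)) ?e w T) = (\<Sum>k\<in>?K1. Psi v ?e w T)"
        by (rule sum.cong[OF refl]) (simp only: K1)
      ultimately show ?thesis unfolding act by simp
    qed
    have "(\<lambda>w T. inverse (of_nat (card ?K1)) * (act Lmod ?E (Psi ?v' ?e) w T + (- 1) * (\<Sum>k\<in>?K2. Psi (?v'(k := ?a)) ?e w T))) \<in> U"
      by (intro U_smult U_add U_act E v'U U_sum fin(2) K2)
    also have "(\<lambda>w T. inverse (of_nat (card ?K1)) * (act Lmod ?E (Psi ?v' ?e) w T + (- 1) * (\<Sum>k\<in>?K2. Psi (?v'(k := ?a)) ?e w T)))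
        = Psi v ?e"
      unfolding split using m by (intro ext) (simp add: mult.assoc[symmetric])
    finally show ?thesis .
  qed
qed

text \<open>Any other tableau is a relabelling of \<open>t\<close>; by \<open>Psi_comp\<close> the
  relabelling moves to the word, so \<open>Psi_cyclic\<close> for the single tableau
  \<open>t\<close> covers all polytabloids. Linearity and \<open>Lmod_expand\<close> give the
  rest.\<close>

lemma Lmod_cyclic:
  assumes t: "t \<in> tableaux N lam" and w0: "col_of t \<in> words n N"
    and U_add: "\<And>f g. f \<in> U \<Longrightarrow> g \<in> U \<Longrightarrow> (\<lambda>w T. f w T + g w T) \<in> U"
    and U_smult: "\<And>c f. f \<in> U \<Longrightarrow> (\<lambda>w T. c * f w T) \<in> U"
    and U_act: "\<And>X f. X \<in> sl n \<Longrightarrow> f \<in> U \<Longrightarrow> act Lmod X f \<in> U"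
    and x: "Psi (col_of t) (polytabloid N t) \<in> U"
  shows "carrier Lmod \<subseteq> U"
proof
  note gen = Psi_cyclic[OF t w0 U_add U_smult U_act x]
  have zero: "(\<lambda>w T. 0) \<in> U" using U_smult[OF x, of 0] by simp
  have poly: "Psi v (polytabloid N t') \<in> U" if t': "t' \<in> tableaux N lam" and v: "v \<in> words n N" for t' v
  proof -
    have b: "bij_betw t {..<N} {(r, c). r < length lam \<and> c < lam ! r}"
      and b': "bij_betw t' {..<N} {(r, c). r < length lam \<and> c < lam ! r}"
      using t t' by (simp_all add: tableaux_def)
    \<comment> \<open>The relabelling with \<open>t \<circ> \<sigma> = t'\<close>, continued by the
      identity so that it permutes the N entries.\<close>
    define \<sigma> where "\<sigma> i = (if i < N then inv_into {..<N} t (t' i) else i)" for i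
    have "bij_betw (inv_into {..<N} t \<circ> t') {..<N} {..<N}"
      by (rule bij_betw_trans[OF b' bij_betw_inv_into[OF b]])
    then have "bij_betw \<sigma> {..<N} {..<N}"
      by (rule bij_betw_cong[THEN iffD1, rotated]) (simp add: \<sigma>_def)
    then have "\<sigma> permutes {..<N}" by (rule bij_imp_permutes) (simp add: \<sigma>_def)
    then have s: "\<sigma> \<in> sym_group N" by (simp add: sym_group_def)
    let ?i = "inv_into UNIV \<sigma>"
    note i = permutes_inv_apply[OF s]
    have "t (\<sigma> i) = t' i" if "i < N" for i
    proof -
      have "t' i \<in> t' ` {..<N}" using that by (intro imageI) simp
      then have "t' i \<in> t ` {..<N}" by (simp only: bij_betw_imp_surj_on[OF b] bij_betw_imp_surj_on[OF b'])
      then show ?thesis using that by (simp add: \<sigma>_def f_inv_into_f)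
    qed
    moreover have "t (\<sigma> i) = t' i" if "\<not> i < N" for i
      using t t' that by (simp add: \<sigma>_def tableaux_def extensional_def)
    ultimately have tt: "t \<circ> \<sigma> = t'" by (intro ext) (metis comp_apply)
    have "?i \<circ> \<sigma> = id" "\<sigma> \<circ> ?i = id"
      using bij_is_inj[OF sym_group_bij[OF s]] bij_is_surj[OF sym_group_bij[OF s]]
      by (simp_all add: fun_eq_iff surj_f_inv_f)
    then have e: "polytabloid N t' = (\<lambda>T. polytabloid N t (T \<circ> ?i))"
      using polytabloid_comp[OF s, of t "T \<circ> ?i" for T] tt by (intro ext) (simp add: comp_assoc)
    have "(\<lambda>w T. of_int (sign ?i) * Psi (v \<circ> ?i) (polytabloid N t) w T) \<in> U"
      by (intro U_smult gen word_comp_sym_group[OF v i])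
    also have "(\<lambda>w T. of_int (sign ?i) * Psi (v \<circ> ?i) (polytabloid N t) w T) = Psi v (polytabloid N t')"
      unfolding e Psi_comp[OF i] by (simp add: mult.assoc[symmetric] sign_square)
    finally show ?thesis .
  qed
  have all: "\<forall>v\<in>words n N. Psi v s \<in> U" if "s \<in> S" for s
    using that
  proof (induction rule: S_induct)
    case (poly t')
    then show ?case using \<open>\<And>v t'. \<lbrakk>t' \<in> tableaux N lam; v \<in> words n N\<rbrakk> \<Longrightarrow> Psi v (polytabloid N t') \<in> U\<close> by blast
  next
    case zero
    have "Psi v (\<lambda>T. 0) = (\<lambda>w T. 0)" for v by (simp add: Psi_def cong: if_cong)
    then show ?case using \<open>(\<lambda>w T. 0) \<in> U\<close> by simp
  next
    case (add s s')
    then show ?case using U_add by (simp add: Psi_add[abs_def])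
  next
    case (smult c s)
    then show ?case using U_smult by (simp add: Psi_smult[abs_def])
  qed
  have U_sum: "(\<lambda>w T. \<Sum>a\<in>A. h a w T) \<in> U" if "finite A" "\<And>a. a \<in> A \<Longrightarrow> h a \<in> U" for A and h :: "(nat \<Rightarrow> nat) \<Rightarrow> _"
    using that
  proof (induction A rule: finite_induct)
    case (insert a A)
    then show ?case using U_add[of "h a" "\<lambda>w T. \<Sum>a\<in>A. h a w T"] by simp
  qed (simp add: zero)
  fix f assume f: "f \<in> carrier Lmod"
  have "(\<lambda>w T. inverse (fact N) * (\<Sum>v\<in>words n N. Psi v (f v) w T)) \<in> U"
    by (intro U_smult U_sum finite_words) (use f all in \<open>auto simp: Lmod_iff\<close>)
  also have "(\<lambda>w T. inverse (fact N) * (\<Sum>v\<in>words n N. Psi v (f v) w T)) = f"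
    by (intro ext) (simp add: Lmod_expand[OF f, symmetric] mult.assoc[symmetric])
  finally show "f \<in> U" .
qed

text \<open>The bound on the rows of \<open>lam\<close> ensures that column indices are admissible
  letters, so that the column word is a word in n letters.\<close>

lemma Lmod_irreducible:
  assumes "sum_list lam = N" and le: "\<And>r. r < length lam \<Longrightarrow> lam ! r \<le> n"
  obtains t where "t \<in> tableaux N lam" "col_of t \<in> words n N" "sl_irreducible n Lmod"
    "has_highest_weight n Lmod (\<lambda>H. \<Sum>k<N. H $$ (col_of t k, col_of t k))"
proof -
  obtain t where t: "t \<in> tableaux N lam" by (rule exists_tableau[OF assms(1)])
  have w0: "col_of t \<in> words n N"
    using tableau_less[OF t] le by (fastforce simp: words_def col_of_def)
  let ?x = "Psi (col_of t) (polytabloid N t)" and ?wt = "\<lambda>H. \<Sum>k<N. H $$ (col_of t k, col_of t k)"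
  note S_poly[OF t, simp]
  \<comment> \<open>An entry of \<open>X\<close> above the diagonal turns a letter of the column
    word into a smaller one, and the result vanishes by \<open>Psi_raised\<close>.\<close>
  have up: "act Lmod X ?x = \<zero>\<^bsub>Lmod\<^esub>" if X: "X \<in> sl n" "\<forall>i<n. \<forall>j\<le>i. X $$ (i, j) = 0" for X
  proof (intro ext)
    fix w T
    have "X $$ (a, col_of t k) * Psi ((col_of t)(k := a)) (polytabloid N t) w T = 0" if "k < N" "a < n" for k a
      using X(2) that Psi_raised[OF t w0 that(1), of a] by (cases "a < col_of t k") (simp_all add: not_less)
    then show "act Lmod X ?x w T = \<zero>\<^bsub>Lmod\<^esub> w T"
      unfolding act_Psi[OF w0 S_poly[OF t]] Lmod_simps(1) by (intro sum.neutral ballI) simp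
  qed
  have hw: "hw_module n Lmod ?x ?wt"
  proof (rule hw_module.intro[OF cmodule.intro[OF module_Lmod]], rule hw_module_axioms.intro)
    show "sl_module n Lmod" by (rule sl_module_Lmod)
    show "?x \<in> carrier Lmod" by (rule Psi_closed[OF w0 S_poly[OF t]])
  qed (rule up act_Psi_diag[OF w0 S_poly[OF t]]; assumption)+
  have x0: "?x \<noteq> \<zero>\<^bsub>Lmod\<^esub>"
  proof
    assume "?x = \<zero>\<^bsub>Lmod\<^esub>"
    from fun_cong[OF fun_cong[OF this, of "col_of t"], of "row_of t"] show False
      using Psi_nonzero[OF t] by (simp add: Lmod_simps(1))
  qed
  have "sl_irreducible n Lmod"
  proof (rule sl_irreducible_of_form[OF hw x0])
    show "carrier Lmod \<subseteq> U" if "U \<subseteq> carrier Lmod" "\<And>a b. a \<in> U \<Longrightarrow> b \<in> U \<Longrightarrow> a \<oplus>\<^bsub>Lmod\<^esub> b \<in> U"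
      "\<And>c a. a \<in> U \<Longrightarrow> c \<odot>\<^bsub>Lmod\<^esub> a \<in> U" "\<And>X a. X \<in> sl n \<Longrightarrow> a \<in> U \<Longrightarrow> act Lmod X a \<in> U" "?x \<in> U" for U
      by (rule Lmod_cyclic[OF t w0 that(2,3)[unfolded Lmod_simps(2,3)] that(4,5)])
    show "form (act Lmod X u) a = form u (act Lmod (mat n n (\<lambda>(i, j). cnj (X $$ (j, i)))) a)" if "X \<in> sl n" for X u a
      by (rule form_act[OF that])
    show "u = \<zero>\<^bsub>Lmod\<^esub>" if "u \<in> carrier Lmod" "form u u = 0" for u by (rule form_pos[OF that])
  qed (simp_all add: form_def Lmod_simps(2,3) distrib_left distrib_right sum.distrib sum_distrib_left mult_ac)
  moreover have "has_highest_weight n Lmod ?wt"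
    unfolding has_highest_weight_def
    by (rule bexI[of _ ?x]) (use x0 up act_Psi_diag[OF w0 S_poly[OF t]] Psi_closed[OF w0 S_poly[OF t]] in auto)
  ultimately show thesis using that t w0 by simp
qed

end

section \<open>Weights and partitions\<close>

lemma downset_eq_lessThan:
  assumes "finite (A :: nat set)" "\<And>i j. i \<in> A \<Longrightarrow> j \<le> i \<Longrightarrow> j \<in> A"
  shows "A = {..<card A}"
  using assms
proof (induction "card A" arbitrary: A)
  case 0
  then show ?case by simp
next
  case (Suc m)
  let ?x = "Max A"
  have ne: "A \<noteq> {}" using Suc(2) by auto
  have x: "?x \<in> A" "\<And>i. i \<in> A \<Longrightarrow> i \<le> ?x" using Suc(3) ne by auto
  have "A = {..?x}" using x Suc(4)[OF x(1)] by auto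
  then have "card A = Suc ?x" by (metis card_atMost)
  then show ?case using \<open>A = {..?x}\<close> by (simp only: lessThan_Suc_atMost)
qed

lemma partition_nth_mono: "\<mu> \<in> partitions N \<Longrightarrow> i \<le> j \<Longrightarrow> j < length \<mu> \<Longrightarrow> \<mu> ! j \<le> \<mu> ! i"
  unfolding partitions_def by (cases "i = j") (auto simp: sorted_wrt_iff_nth_less)

text \<open>The parts decrease, so the rows meeting column j form an initial segment, and being
  below its length is the same as belonging to it.\<close>

lemma conj_less_iff:
  assumes m: "\<mu> \<in> partitions N"
  shows "i < card {i. i < length \<mu> \<and> j < \<mu> ! i} \<longleftrightarrow> i < length \<mu> \<and> j < \<mu> ! i"
proof -
  let ?A = "{i. i < length \<mu> \<and> j < \<mu> ! i}"
  have "?A = {..<card ?A}"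
    by (rule downset_eq_lessThan) (use partition_nth_mono[OF m] in \<open>auto intro: less_le_trans\<close>)
  then have "i \<in> ?A \<longleftrightarrow> i \<in> {..<card ?A}" by (rule arg_cong)
  then show ?thesis by simp
qed

lemma conj_nth: "j < part \<mu> 1 \<Longrightarrow> conjugate_partition \<mu> ! j = card {i. i < length \<mu> \<and> j < \<mu> ! i}"
  by (simp add: conjugate_partition_def)

lemma conj_length: "length (conjugate_partition \<mu>) = part \<mu> 1"
  by (simp add: conjugate_partition_def)

lemma part_bound: "\<mu> \<in> partitions N \<Longrightarrow> i < length \<mu> \<Longrightarrow> \<mu> ! i \<le> part \<mu> 1"
  using partition_nth_mono[of \<mu> N 0 i] by (auto simp: part_def)

lemma conj_partition:
  assumes m: "\<mu> \<in> partitions N" shows "conjugate_partition \<mu> \<in> partitions N"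
  unfolding partitions_def
proof (intro CollectI conjI)
  show "sorted_wrt (\<ge>) (conjugate_partition \<mu>)"
    unfolding sorted_wrt_iff_nth_less conj_length
    by (auto simp: conj_nth intro!: card_mono)
  show "0 \<notin> set (conjugate_partition \<mu>)"
  proof
    assume "0 \<in> set (conjugate_partition \<mu>)"
    then obtain j where j: "j < part \<mu> 1" "card {i. i < length \<mu> \<and> j < \<mu> ! i} = 0"
      by (auto simp: in_set_conv_nth conj_length conj_nth)
    have "0 < length \<mu> \<and> j < \<mu> ! 0" using j(1) by (auto simp: part_def split: if_splits)
    then have "0 < card {i. i < length \<mu> \<and> j < \<mu> ! i}" by (rule iffD2[OF conj_less_iff[OF m]])
    with j(2) show False by linarith
  qed
  have "sum_list (conjugate_partition \<mu>) = (\<Sum>j<part \<mu> 1. card {i. i < length \<mu> \<and> j < \<mu> ! i})"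
    by (simp add: sum_list_sum_nth conj_length conj_nth atLeast0LessThan)
  also have "\<dots> = card (Sigma {..<part \<mu> 1} (\<lambda>j. {i. i < length \<mu> \<and> j < \<mu> ! i}))" by simp
  \<comment> \<open>The cells are counted by columns and by rows; transposing the diagram matches
    the two counts.\<close>
  also have "\<dots> = card (Sigma {..<length \<mu>} (\<lambda>i. {..<\<mu> ! i}))"
    by (rule bij_betw_same_card[of prod.swap], rule bij_betw_byWitness[where f' = prod.swap])
      (use part_bound[OF m] in \<open>auto intro: less_le_trans\<close>)
  also have "\<dots> = sum_list \<mu>" by (simp add: sum_list_sum_nth atLeast0LessThan)
  finally show "sum_list (conjugate_partition \<mu>) = N" using m by (simp add: partitions_def)
qed

lemma conj_conj:
  assumes m: "\<mu> \<in> partitions N" shows "conjugate_partition (conjugate_partition \<mu>) = \<mu>"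
proof (rule nth_equalityI)
  have pos: "0 < \<mu> ! i" if "i < length \<mu>" for i
    using m nth_mem[OF that] by (auto simp: partitions_def intro: ccontr)
  show len: "length (conjugate_partition (conjugate_partition \<mu>)) = length \<mu>"
  proof (cases "\<mu> = []")
    case True
    then show ?thesis by (simp add: conjugate_partition_def part_def)
  next
    case False
    then have p: "0 < part \<mu> 1" using pos[of 0] by (simp add: part_def Suc_le_eq)
    have "part (conjugate_partition \<mu>) 1 = card {i. i < length \<mu> \<and> 0 < \<mu> ! i}"
      using p conj_nth[OF p] by (simp add: part_def[of "conjugate_partition \<mu>"] conj_length)
    also have "{i. i < length \<mu> \<and> 0 < \<mu> ! i} = {..<length \<mu>}" using pos by auto
    finally show ?thesis by (simp add: conj_length)
  qed
  fix i assume "i < length (conjugate_partition (conjugate_partition \<mu>))"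
  then have i: "i < length \<mu>" "i < part (conjugate_partition \<mu>) 1" using len by (simp_all add: conj_length)
  have "conjugate_partition (conjugate_partition \<mu>) ! i =
      card {j. j < part \<mu> 1 \<and> i < conjugate_partition \<mu> ! j}"
    by (simp add: conj_nth[OF i(2)] conj_length)
  also have "{j. j < part \<mu> 1 \<and> i < conjugate_partition \<mu> ! j} = {..<\<mu> ! i}"
    using part_bound[OF m i(1)] i(1) by (auto simp: conj_nth conj_less_iff[OF m])
  finally show "conjugate_partition (conjugate_partition \<mu>) ! i = \<mu> ! i" by simp
qed

section \<open>Weights of partitions and models of the irreducible modules\<close>

text \<open>Summation by parts, converting coefficients of fundamental weights into coefficients of
  diagonal entries.\<close>

lemma abel_fund_weight:
  "(\<Sum>i = 1..m. (of_nat (p i) - of_nat (p (i + 1))) * fund_weight i H) =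
    (\<Sum>k<m. of_nat (p (Suc k)) * H $$ (k, k)) - of_nat (p (Suc m)) * fund_weight m H"
  by (induction m) (simp_all add: fund_weight_def algebra_simps)

text \<open>By tracelessness, the fundamental weight in the boundary term is minus the last diagonal
  entry, which supplies the summand for k = n - 1.\<close>

lemma partition_weight_eq:
  assumes H: "H \<in> sl n" and n: "n > 0"
  shows "partition_weight n \<mu> H = (\<Sum>k<n. of_nat (part \<mu> (Suc k)) * H $$ (k, k))"
proof -
  obtain m where m: "n = Suc m" using n by (cases n) auto
  have "fund_weight m H + H $$ (m, m) = 0" using H by (simp add: sl_def m fund_weight_def)
  then have e: "fund_weight m H = - H $$ (m, m)" by (simp add: eq_neg_iff_add_eq_0)
  show ?thesis unfolding partition_weight_def m diff_Suc_1 abel_fund_weight e by simp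
qed

text \<open>Column c of the conjugate diagram is row c of the diagram of \<mu>, so the letter c
  occurs \<open>part \<mu> (Suc c)\<close> times in the column word.\<close>

lemma tableau_conj_weight:
  assumes mu: "\<mu> \<in> partitions N" and n: "n > 0" and H: "H \<in> sl n"
    and t: "t \<in> tableaux N (conjugate_partition \<mu>)" and w: "specht_data.col_of N t \<in> words n N"
  shows "(\<Sum>k<N. H $$ (specht_data.col_of N t k, specht_data.col_of N t k)) = partition_weight n \<mu> H"
proof -
  let ?c = "specht_data.col_of N t" and ?lam = "conjugate_partition \<mu>"
  have row: "r < length ?lam \<and> c < ?lam ! r \<longleftrightarrow> r < part \<mu> (Suc c)" for r c
  proof (cases "r < part \<mu> 1")
    case True
    then show ?thesis
      unfolding conj_nth[OF True] conj_less_iff[OF mu] conj_length part_def[of \<mu> "Suc c"] by auto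
  next
    case False
    then have "\<not> r < part \<mu> (Suc c)" 
      using part_bound[OF mu, of c] by (cases "c < length \<mu>") (simp_all add: part_def[of \<mu> "Suc c"])
    then show ?thesis using False by (simp add: conj_length)
  qed
  have card: "card {k \<in> {..<N}. ?c k = c} = part \<mu> (Suc c)" for c
  proof -
    have "card {k \<in> {..<N}. ?c k = c} = card {(r, c'). r < length ?lam \<and> c' < ?lam ! r \<and> c' = c}"
      using specht_data.col_of_count[OF t, of "\<lambda>x. x = c"] by simp
    also have "{(r, c'). r < length ?lam \<and> c' < ?lam ! r \<and> c' = c} = (\<lambda>r. (r, c)) ` {..<part \<mu> (Suc c)}"
      (is "?A = ?B")
    proof (rule Set.set_eqI)
      fix x show "x \<in> ?A \<longleftrightarrow> x \<in> ?B" using row[of "fst x" c] by (cases x) auto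
    qed
    also have "card \<dots> = part \<mu> (Suc c)" by (subst card_image) (auto simp: inj_on_def)
    finally show ?thesis .
  qed
  have "?c ` {..<N} \<subseteq> {..<n}" using specht_data.word_less[OF w] by auto
  from sum_fun_comp[OF finite_lessThan finite_lessThan this, of "\<lambda>c. H $$ (c, c)"]
  show ?thesis by (simp only: card partition_weight_eq[OF H n])
qed

text \<open>The rows of the conjugate diagram are the columns of \<mu>, of length at most
  \<open>length \<mu>\<close>; this is where the bound by n enters.\<close>

lemma pi_iso_Lmod:
  fixes P :: "(complex mat, 'v) gmod"
  assumes n: "n > 0" and mu: "\<mu> \<in> partitions N" "length \<mu> \<le> n" and P: "is_pi n \<mu> P"
  obtains h where "h \<in> LinearCombinations.module_hom class_ring (specht_data.Lmod n N (conjugate_partition \<mu>)) P"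
    "bij_betw h (carrier (specht_data.Lmod n N (conjugate_partition \<mu>))) (carrier P)"
    "\<And>X a. X \<in> sl n \<Longrightarrow> a \<in> carrier (specht_data.Lmod n N (conjugate_partition \<mu>)) \<Longrightarrow>
       h (act (specht_data.Lmod n N (conjugate_partition \<mu>)) X a) = act P X (h a)"
proof -
  let ?lam = "conjugate_partition \<mu>"
  have "sum_list ?lam = N" using conj_partition[OF mu(1)] by (simp add: partitions_def)
  moreover have "?lam ! r \<le> n" if "r < length ?lam" for r
  proof -
    have "card {i. i < length \<mu> \<and> r < \<mu> ! i} \<le> card {..<length \<mu>}" by (rule card_mono) auto
    then show ?thesis using that mu(2) by (simp add: conj_length conj_nth)
  qed
  ultimately obtain t where t: "t \<in> tableaux N ?lam" "specht_data.col_of N t \<in> words n N"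
    "sl_irreducible n (specht_data.Lmod n N ?lam)"
    "has_highest_weight n (specht_data.Lmod n N ?lam)
       (\<lambda>H. \<Sum>k<N. H $$ (specht_data.col_of N t k, specht_data.col_of N t k))"
    by (rule specht_data.Lmod_irreducible)
  have wt: "has_highest_weight n (specht_data.Lmod n N ?lam) (partition_weight n \<mu>)"
    using t(4) unfolding has_highest_weight_def by (simp add: tableau_conj_weight[OF mu(1) n _ t(1,2)])
  have P': "sl_irreducible n P" "has_highest_weight n P (partition_weight n \<mu>)"
    using P by (simp_all add: is_pi_def)
  show thesis
  proof (rule highest_weight_iso[OF t(3) wt P'])
    fix h assume "h \<in> LinearCombinations.module_hom class_ring (specht_data.Lmod n N ?lam) P"
      "bij_betw h (carrier (specht_data.Lmod n N ?lam)) (carrier P)"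
      "\<And>X a. X \<in> sl n \<Longrightarrow> a \<in> carrier (specht_data.Lmod n N ?lam) \<Longrightarrow>
        h (act (specht_data.Lmod n N ?lam) X a) = act P X (h a)"
    then show thesis by (rule that)
  qed
qed

section \<open>Degrees and the matrix action on the wedge product\<close>

lemma homogeneous_scale: "homogeneous d p \<Longrightarrow> homogeneous d (Poly_Mapping.map ((*) c) p)"
  using keys_scale[of c p] by (auto simp: homogeneous_def)

lemma homogeneous_sum: "(\<And>a. a \<in> A \<Longrightarrow> homogeneous d (f a)) \<Longrightarrow> homogeneous d (sum f A)"
proof (induction A rule: infinite_finite_induct)
  case (insert a A)
  then show ?case
    using Poly_Mapping.keys_add[of "f a" "sum f A"] unfolding homogeneous_def by (simp add: subset_iff) blast
qed (simp_all add: homogeneous_def)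

lemma of_int_scale: "of_int k * p = Poly_Mapping.map ((*) (of_int k)) p" for p :: zpoly
  by (simp add: mult_map_scale_conv_mult single_of_int)

lemma alt_homogeneous: "(\<And>w. homogeneous d (F w)) \<Longrightarrow> homogeneous d (alt N F w)"
  unfolding alt_def of_int_scale
  by (intro homogeneous_scale homogeneous_sum perm_vars_homogeneous sym_group_bij)

lemma wedge_act_closed:
  assumes F: "F \<in> carrier (wedge n N)" shows "current_act n N X 0 F \<in> carrier (wedge n N)"
  unfolding wedge_iff
proof (intro conjI allI impI ballI)
  note Fi = F[unfolded wedge_iff]
  show "current_act n N X 0 F w \<in> zpolys N" for w
    using Fi unfolding current_act_def by (auto intro!: zpolys_sum zpolys_closed)
  show "current_act n N X 0 F w = 0" if "w \<notin> words n N" for w using that by (simp add: current_act_def)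
  fix \<sigma> w assume s: "\<sigma> \<in> sym_group N"
  note b = sym_group_bij[OF s]
  have P: "perm_vars \<sigma> (F (u \<circ> \<sigma>)) = of_int (sign \<sigma>) * F u" for u using Fi s by simp
  show "perm_vars \<sigma> (current_act n N X 0 F (w \<circ> \<sigma>)) = of_int (sign \<sigma>) * current_act n N X 0 F w"
  proof (cases "w \<in> words n N")
    case True
    have "perm_vars \<sigma> (\<Sum>k<N. \<Sum>j<n. Poly_Mapping.map ((*) (X $$ ((w \<circ> \<sigma>) k, j))) (F ((w \<circ> \<sigma>)(k := j)))) =
        (\<Sum>k<N. \<Sum>j<n. Poly_Mapping.map ((*) (X $$ (w (\<sigma> k), j))) (of_int (sign \<sigma>) * F (w(\<sigma> k := j))))"
      by (simp only: specht_data.comp_upd[OF b] perm_vars_sum[OF b] perm_vars_scale[OF b] P comp_apply)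
    also have "\<dots> = (\<Sum>k<N. \<Sum>j<n. Poly_Mapping.map ((*) (X $$ (w k, j))) (of_int (sign \<sigma>) * F (w(k := j))))"
      by (rule specht_data.sum_permute[OF s])
    finally show ?thesis
      using True word_comp_iff[OF s, of w n]
      by (simp add: current_act_def sum_distrib_left map_scale_mult_right del: lookup_scale)
  next
    case False
    then show ?thesis using word_comp_iff[OF s, of w n] by (simp add: current_act_def perm_vars_zero[OF b])
  qed
qed

section \<open>The map from the wedge product\<close>

lemma dsum_simps:
  "carrier (dsum I V) = (\<Pi>\<^sub>E i\<in>I. carrier (V i))" "\<zero>\<^bsub>dsum I V\<^esub> = (\<lambda>i\<in>I. \<zero>\<^bsub>V i\<^esub>)"
  "x \<oplus>\<^bsub>dsum I V\<^esub> y = (\<lambda>i\<in>I. x i \<oplus>\<^bsub>V i\<^esub> y i)" "c \<odot>\<^bsub>dsum I V\<^esub> x = (\<lambda>i\<in>I. c \<odot>\<^bsub>V i\<^esub> x i)"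
  "hcomp (dsum I V) d = (\<Pi>\<^sub>E i\<in>I. hcomp (V i) d)" "act (dsum I V) g x = (\<lambda>i\<in>I. act (V i) g (x i))"
  by (simp_all add: dsum_def)

text \<open>\<open>\<Phi>\<close> is the decomposition of the polynomial ring modulo its ideal, in
  coordinates; \<open>\<theta> \<mu>\<close> identifies antisymmetric Specht-valued tensors with the
  given model \<open>P \<mu>\<close>. The multiplicity spaces enter through their basis vectors
  \<open>B\<close> and the degrees \<open>D\<close>.\<close>

locale wedge_data =
  fixes n N :: nat and B :: "nat list \<Rightarrow> 'm set" and D :: "nat list \<Rightarrow> int \<Rightarrow> 'm set"
    and \<Phi> :: "zpoly \<Rightarrow> nat list \<Rightarrow> 'm \<Rightarrow> (nat \<Rightarrow> nat) \<Rightarrow> complex"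
    and P :: "nat list \<Rightarrow> (complex mat, 'v) gmod"
    and \<theta> :: "nat list \<Rightarrow> ((nat \<Rightarrow> nat) \<Rightarrow> (nat \<Rightarrow> nat) \<Rightarrow> complex) \<Rightarrow> 'v"
  assumes epi: "graded_epi (sym_group N) (zpoly_ring N)
      (dsum (partitions N) (\<lambda>lam. fin_fun (specht N lam) (B lam) (D lam))) \<Phi>"
    and kernel: "{p \<in> carrier (zpoly_ring N). \<Phi> p =
      \<zero>\<^bsub>dsum (partitions N) (\<lambda>lam. fin_fun (specht N lam) (B lam) (D lam))\<^esub>} = J_ideal N"
    and module_P: "\<And>\<mu>. \<mu> \<in> partitions N \<Longrightarrow> length \<mu> \<le> n \<Longrightarrow> module class_ring (P \<mu>)"
    and theta_hom: "\<And>\<mu>. \<mu> \<in> partitions N \<Longrightarrow> length \<mu> \<le> n \<Longrightarrow>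
      \<theta> \<mu> \<in> LinearCombinations.module_hom class_ring (specht_data.Lmod n N (conjugate_partition \<mu>)) (P \<mu>)"
    and theta_bij: "\<And>\<mu>. \<mu> \<in> partitions N \<Longrightarrow> length \<mu> \<le> n \<Longrightarrow>
      bij_betw (\<theta> \<mu>) (carrier (specht_data.Lmod n N (conjugate_partition \<mu>))) (carrier (P \<mu>))"
    and theta_act: "\<And>\<mu> X f. \<mu> \<in> partitions N \<Longrightarrow> length \<mu> \<le> n \<Longrightarrow> X \<in> sl n \<Longrightarrow>
      f \<in> carrier (specht_data.Lmod n N (conjugate_partition \<mu>)) \<Longrightarrow>
      \<theta> \<mu> (act (specht_data.Lmod n N (conjugate_partition \<mu>)) X f) = act (P \<mu>) X (\<theta> \<mu> f)"
begin

abbreviation "L \<equiv> specht_data.Lmod n N"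
abbreviation "I \<equiv> {\<mu> \<in> partitions N. length \<mu> \<le> n}"
abbreviation "R \<equiv> dsum (partitions N) (\<lambda>lam. fin_fun (specht N lam) (B lam) (D lam))"
abbreviation "W \<equiv> dsum I (\<lambda>\<mu>. fin_fun (P \<mu>) (B (conjugate_partition \<mu>)) (D (conjugate_partition \<mu>)))"

lemmas Lmod_iff = specht_data.Lmod_iff
lemmas Lmod_simps = specht_data.Lmod_simps
lemmas specht_simps = specht_data.specht_simps

lemma R_elem:
  assumes "x \<in> carrier R" "lam \<in> partitions N"
  shows "x lam \<in> B lam \<rightarrow>\<^sub>E specht_data.S N lam" "finite {b \<in> B lam. x lam b \<noteq> (\<lambda>T. 0)}"
proof -
  have "x lam \<in> carrier (fin_fun (specht N lam) (B lam) (D lam))"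
    using assms unfolding dsum_simps by (rule PiE_mem)
  then show "x lam \<in> B lam \<rightarrow>\<^sub>E specht_data.S N lam" "finite {b \<in> B lam. x lam b \<noteq> (\<lambda>T. 0)}"
    by (simp_all add: fin_fun_simps specht_simps)
qed

lemma phi_carrier: "p \<in> zpolys N \<Longrightarrow> \<Phi> p \<in> carrier R"
  using graded_epiD(2)[OF epi, of p] by (simp only: zpoly_ring_simps)

lemma phi_S: "p \<in> zpolys N \<Longrightarrow> lam \<in> partitions N \<Longrightarrow> b \<in> B lam \<Longrightarrow> \<Phi> p lam b \<in> specht_data.S N lam"
  by (rule PiE_mem[OF R_elem(1)[OF phi_carrier]])

lemma phi_add:
  assumes "p \<in> zpolys N" "q \<in> zpolys N" "lam \<in> partitions N" "b \<in> B lam"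
  shows "\<Phi> (p + q) lam b T = \<Phi> p lam b T + \<Phi> q lam b T"
proof -
  have "\<Phi> (p + q) = \<Phi> p \<oplus>\<^bsub>R\<^esub> \<Phi> q"
    using graded_epiD(1)[OF epi] assms by (simp add: LinearCombinations.module_hom_def zpoly_ring_simps)
  then show ?thesis using assms by (simp add: dsum_simps fin_fun_simps specht_simps)
qed

lemma phi_scale:
  assumes "p \<in> zpolys N" "lam \<in> partitions N" "b \<in> B lam"
  shows "\<Phi> (Poly_Mapping.map ((*) c) p) lam b T = c * \<Phi> p lam b T"
proof -
  have "\<Phi> (Poly_Mapping.map ((*) c) p) = c \<odot>\<^bsub>R\<^esub> \<Phi> p"
    using graded_epiD(1)[OF epi] assms by (simp add: LinearCombinations.module_hom_def zpoly_ring_simps)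
  then show ?thesis using assms by (simp add: dsum_simps fin_fun_simps specht_simps)
qed

lemma phi_perm:
  assumes "\<sigma> \<in> sym_group N" "p \<in> zpolys N" "lam \<in> partitions N" "b \<in> B lam"
  shows "\<Phi> (perm_vars \<sigma> p) lam b T = \<Phi> p lam b (T \<circ> \<sigma>)"
proof -
  have "\<Phi> (perm_vars \<sigma> p) = act R \<sigma> (\<Phi> p)"
    using graded_epiD(5)[OF epi, of \<sigma> p] assms by (simp add: zpoly_ring_simps)
  then show ?thesis using assms by (simp add: dsum_simps fin_fun_simps specht_simps)
qed

lemma phi_zero: "lam \<in> partitions N \<Longrightarrow> b \<in> B lam \<Longrightarrow> \<Phi> 0 lam b = (\<lambda>T. 0)"
  using phi_scale[OF zpolys_closed(1), of lam b 0] by (simp add: fun_eq_iff)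

lemma phi_sum:
  assumes "lam \<in> partitions N" "b \<in> B lam" "\<And>a. a \<in> A \<Longrightarrow> f a \<in> zpolys N"
  shows "\<Phi> (sum f A) lam b T = (\<Sum>a\<in>A. \<Phi> (f a) lam b T)"
  using assms(3)
proof (induction A rule: infinite_finite_induct)
  case (insert a A)
  then show ?case by (simp add: phi_add[OF _ zpolys_sum assms(1,2)])
qed (simp_all add: phi_zero assms(1,2))

lemma phi_hcomp:
  assumes "p \<in> zpolys N" "homogeneous d p" "lam \<in> partitions N" "b \<in> B lam" "b \<notin> D lam d"
  shows "\<Phi> p lam b = (\<lambda>T. 0)"
proof -
  have "\<Phi> p \<in> hcomp R d" using graded_epiD(7)[OF epi, of p d] assms(1,2) by (simp add: zpoly_ring_simps)
  then have "\<Phi> p lam \<in> hcomp (fin_fun (specht N lam) (B lam) (D lam)) d"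
    using assms(3) unfolding dsum_simps by (rule PiE_mem)
  then show ?thesis using assms(4,5) by (auto simp: fin_fun_simps specht_simps)
qed

lemma phi_J:
  assumes p: "p \<in> zpolys N"
  shows "p \<in> J_ideal N \<longleftrightarrow> (\<forall>lam\<in>partitions N. \<forall>b\<in>B lam. \<Phi> p lam b = (\<lambda>T. 0))"
proof -
  have "p \<in> J_ideal N \<longleftrightarrow> \<Phi> p = \<zero>\<^bsub>R\<^esub>"
    unfolding kernel[symmetric] using p by (simp add: zpoly_ring_simps)
  also have "\<dots> \<longleftrightarrow> (\<forall>lam\<in>partitions N. \<forall>b\<in>B lam. \<Phi> p lam b = (\<lambda>T. 0))"
  proof
    assume "\<Phi> p = \<zero>\<^bsub>R\<^esub>"
    then show "\<forall>lam\<in>partitions N. \<forall>b\<in>B lam. \<Phi> p lam b = (\<lambda>T. 0)"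
      by (simp add: dsum_simps fin_fun_simps specht_simps)
  next
    assume z: "\<forall>lam\<in>partitions N. \<forall>b\<in>B lam. \<Phi> p lam b = (\<lambda>T. 0)"
    have "\<Phi> p lam = (\<lambda>b\<in>B lam. \<lambda>T. 0)" if l: "lam \<in> partitions N" for lam
    proof
      fix b
      show "\<Phi> p lam b = (\<lambda>b\<in>B lam. \<lambda>T. 0) b"
        using z l PiE_arb[OF R_elem(1)[OF phi_carrier[OF p] l], of b] by (cases "b \<in> B lam") simp_all
    qed
    moreover have "\<Phi> p lam = undefined" if "lam \<notin> partitions N" for lam
      using phi_carrier[OF p] that unfolding dsum_simps by (rule PiE_arb)
    ultimately show "\<Phi> p = \<zero>\<^bsub>R\<^esub>"
      by (intro ext) (simp add: dsum_simps fin_fun_simps specht_simps restrict_def)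
  qed
  finally show ?thesis .
qed

definition X where "X F lam b = (\<lambda>w T. \<Phi> (F w) lam b T)"
  for F :: "(nat \<Rightarrow> nat) \<Rightarrow> zpoly"

text \<open>Only partitions \<mu> with at most n parts index the target; the coordinates at the
  remaining Specht modules vanish by \<open>Lmod_trivial\<close>.\<close>

definition Psi where
  "Psi F = (\<lambda>\<mu>\<in>I. \<lambda>b\<in>B (conjugate_partition \<mu>). \<theta> \<mu> (X F (conjugate_partition \<mu>) b))"

text \<open>Equivariance of \<open>\<Phi>\<close> turns a permutation of the variables into one of
  the tabloids, so antisymmetry in words and variables becomes antisymmetry in words and
  tabloids.\<close>

lemma X_closed:
  assumes F: "F \<in> carrier (wedge n N)" and l: "lam \<in> partitions N" "b \<in> B lam"
  shows "X F lam b \<in> carrier (L lam)"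
  unfolding Lmod_iff
proof (intro conjI allI impI ballI)
  note Fi = F[unfolded wedge_iff]
  show "X F lam b w \<in> specht_data.S N lam" for w using phi_S[OF _ l, of "F w"] Fi by (simp add: X_def)
  show "X F lam b w = (\<lambda>T. 0)" if "w \<notin> words n N" for w using Fi that phi_zero[OF l] by (simp add: X_def)
  fix \<sigma> w T assume s: "\<sigma> \<in> sym_group N"
  have "\<Phi> (F (w \<circ> \<sigma>)) lam b (T \<circ> \<sigma>) = \<Phi> (perm_vars \<sigma> (F (w \<circ> \<sigma>))) lam b T"
    using phi_perm[OF s _ l, of "F (w \<circ> \<sigma>)" T] Fi by simp
  also have "perm_vars \<sigma> (F (w \<circ> \<sigma>)) = Poly_Mapping.map ((*) (of_int (sign \<sigma>))) (F w)"
    using Fi s by (simp add: of_int_scale)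
  also have "\<Phi> (Poly_Mapping.map ((*) (of_int (sign \<sigma>))) (F w)) lam b T = of_int (sign \<sigma>) * \<Phi> (F w) lam b T"
    by (rule phi_scale[OF _ l]) (use Fi in simp)
  finally show "X F lam b (w \<circ> \<sigma>) (T \<circ> \<sigma>) = of_int (sign \<sigma>) * X F lam b w T" unfolding X_def .
qed

lemma X_add:
  assumes "F \<in> carrier (wedge n N)" "G \<in> carrier (wedge n N)" "lam \<in> partitions N" "b \<in> B lam"
  shows "X (F \<oplus>\<^bsub>wedge n N\<^esub> G) lam b = X F lam b \<oplus>\<^bsub>L lam\<^esub> X G lam b"
  unfolding X_def wedge_simps Lmod_simps using assms by (intro ext phi_add) (simp_all add: wedge_iff)

lemma X_smult:
  assumes "F \<in> carrier (wedge n N)" "lam \<in> partitions N" "b \<in> B lam"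
  shows "X (c \<odot>\<^bsub>wedge n N\<^esub> F) lam b = c \<odot>\<^bsub>L lam\<^esub> X F lam b"
  unfolding X_def wedge_simps Lmod_simps using assms by (intro ext phi_scale) (simp_all add: wedge_iff)

lemma X_act:
  assumes F: "F \<in> carrier (wedge n N)" and l: "lam \<in> partitions N" "b \<in> B lam"
  shows "X (act (wedge n N) Y F) lam b = act (L lam) Y (X F lam b)"
proof (intro ext)
  fix w T
  have Fz: "F u \<in> zpolys N" for u using F by (simp add: wedge_iff)
  show "X (act (wedge n N) Y F) lam b w T = act (L lam) Y (X F lam b) w T"
  proof (cases "w \<in> words n N")
    case True
    have "\<Phi> (\<Sum>k<N. \<Sum>j<n. Poly_Mapping.map ((*) (Y $$ (w k, j))) (F (w(k := j)))) lam b T =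
        (\<Sum>k<N. \<Sum>j<n. Y $$ (w k, j) * \<Phi> (F (w(k := j))) lam b T)"
      by (simp only: phi_sum[OF l] phi_scale[OF _ l] Fz zpolys_sum zpolys_closed)
    then show ?thesis
      using True by (simp add: X_def wedge_simps current_act_def Lmod_simps del: lookup_scale)
  next
    case False
    then show ?thesis using phi_zero[OF l] by (simp add: X_def wedge_simps current_act_def Lmod_simps)
  qed
qed

text \<open>There are finitely many words, and the polynomial at each of them has only finitely many
  nonzero coordinates.\<close>

lemma X_finite:
  assumes F: "F \<in> carrier (wedge n N)" and l: "lam \<in> partitions N"
  shows "finite {b \<in> B lam. X F lam b \<noteq> \<zero>\<^bsub>L lam\<^esub>}"
proof (rule finite_subset)
  show "finite (\<Union>w\<in>words n N. {b \<in> B lam. \<Phi> (F w) lam b \<noteq> (\<lambda>T. 0)})"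
    using F R_elem(2)[OF phi_carrier l] specht_data.finite_words by (simp add: wedge_iff)
  show "{b \<in> B lam. X F lam b \<noteq> \<zero>\<^bsub>L lam\<^esub>} \<subseteq> (\<Union>w\<in>words n N. {b \<in> B lam. \<Phi> (F w) lam b \<noteq> (\<lambda>T. 0)})"
  proof
    fix b assume "b \<in> {b \<in> B lam. X F lam b \<noteq> \<zero>\<^bsub>L lam\<^esub>}"
    then have b: "b \<in> B lam" "X F lam b \<noteq> \<zero>\<^bsub>L lam\<^esub>" by simp_all
    have "\<exists>w. X F lam b w \<noteq> (\<lambda>T. 0)"
    proof (rule ccontr)
      assume "\<nexists>w. X F lam b w \<noteq> (\<lambda>T. 0)"
      then have "X F lam b = \<zero>\<^bsub>L lam\<^esub>" unfolding Lmod_simps by (intro ext) simp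
      then show False using b(2) by simp
    qed
    then obtain w where w: "X F lam b w \<noteq> (\<lambda>T. 0)" by (rule exE)
    have "w \<in> words n N" using X_closed[OF F l b(1)] w by (auto simp: Lmod_iff)
    then show "b \<in> (\<Union>w\<in>words n N. {b \<in> B lam. \<Phi> (F w) lam b \<noteq> (\<lambda>T. 0)})"
      using w b(1) by (intro UN_I[of w]) (simp_all add: X_def)
  qed
qed

context fixes \<mu> assumes mu: "\<mu> \<in> partitions N" "length \<mu> \<le> n" begin

interpretation th: clinear "L (conjugate_partition \<mu>)" "P \<mu>" "\<theta> \<mu>"
  by (intro clinear.intro cmodule.intro clinear_axioms.intro specht_data.module_Lmod module_P theta_hom mu)

lemmas theta_facts = th.cl th.add th.smult th.zero

lemma theta_zero_iff:
  assumes f: "f \<in> carrier (L (conjugate_partition \<mu>))"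
  shows "\<theta> \<mu> f = \<zero>\<^bsub>P \<mu>\<^esub> \<longleftrightarrow> f = \<zero>\<^bsub>L (conjugate_partition \<mu>)\<^esub>"
  using inj_onD[OF bij_betw_imp_inj_on[OF theta_bij[OF mu]] _ f th.V.ab(2)] th.zero by auto

lemma theta_inv:
  assumes y: "y \<in> carrier (P \<mu>)"
  shows "inv_into (carrier (L (conjugate_partition \<mu>))) (\<theta> \<mu>) y \<in> carrier (L (conjugate_partition \<mu>))"
    "\<theta> \<mu> (inv_into (carrier (L (conjugate_partition \<mu>))) (\<theta> \<mu>) y) = y"
proof -
  have "y \<in> \<theta> \<mu> ` carrier (L (conjugate_partition \<mu>))" using y bij_betw_imp_surj_on[OF theta_bij[OF mu]] by simp
  then show "inv_into (carrier (L (conjugate_partition \<mu>))) (\<theta> \<mu>) y \<in> carrier (L (conjugate_partition \<mu>))"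
    "\<theta> \<mu> (inv_into (carrier (L (conjugate_partition \<mu>))) (\<theta> \<mu>) y) = y"
    by (rule inv_into_into, rule f_inv_into_f)
qed

end

text \<open>Elements of \<open>W\<close> are extensional both in the partition and in the basis
  vector, so comparison at genuine indices suffices.\<close>

lemma Psi_eqI:
  assumes "y \<in> carrier W"
    and "\<And>\<mu> b. \<mu> \<in> I \<Longrightarrow> b \<in> B (conjugate_partition \<mu>) \<Longrightarrow> \<theta> \<mu> (X F (conjugate_partition \<mu>) b) = y \<mu> b"
  shows "Psi F = y"
proof
  fix \<mu>
  show "Psi F \<mu> = y \<mu>"
  proof (cases "\<mu> \<in> I")
    case True
    have "y \<mu> \<in> carrier (fin_fun (P \<mu>) (B (conjugate_partition \<mu>)) (D (conjugate_partition \<mu>)))"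
      using assms(1) True unfolding dsum_simps by (rule PiE_mem)
    then have "y \<mu> b = undefined" if "b \<notin> B (conjugate_partition \<mu>)" for b
      using that by (auto simp: fin_fun_simps)
    then show ?thesis using True assms(2)[OF True] by (intro ext) (simp add: Psi_def restrict_def)
  next
    case False
    then have "y \<mu> = undefined" using assms(1) unfolding dsum_simps by (rule PiE_arb[rotated])
    then show ?thesis using False unfolding Psi_def by (simp only: restrict_def if_False)
  qed
qed

lemma Psi_apply: "\<mu> \<in> I \<Longrightarrow> b \<in> B (conjugate_partition \<mu>) \<Longrightarrow>
    Psi F \<mu> b = \<theta> \<mu> (X F (conjugate_partition \<mu>) b)"
  by (simp add: Psi_def)

lemma Psi_fin_fun:
  assumes F: "F \<in> carrier (wedge n N)" and mu: "\<mu> \<in> I"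
  shows "(\<lambda>b\<in>B (conjugate_partition \<mu>). \<theta> \<mu> (X F (conjugate_partition \<mu>) b))
      \<in> carrier (fin_fun (P \<mu>) (B (conjugate_partition \<mu>)) (D (conjugate_partition \<mu>)))"
proof -
  let ?lam = "conjugate_partition \<mu>"
  have m: "\<mu> \<in> partitions N" "length \<mu> \<le> n" using mu by simp_all
  note l = conj_partition[OF m(1)]
  have "{b \<in> B ?lam. \<theta> \<mu> (X F ?lam b) \<noteq> \<zero>\<^bsub>P \<mu>\<^esub>} = {b \<in> B ?lam. X F ?lam b \<noteq> \<zero>\<^bsub>L ?lam\<^esub>}"
    using theta_zero_iff[OF m X_closed[OF F l]] by (intro Collect_cong conj_cong refl) simp
  then have "finite {b \<in> B ?lam. \<theta> \<mu> (X F ?lam b) \<noteq> \<zero>\<^bsub>P \<mu>\<^esub>}" using X_finite[OF F l] by simp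
  moreover have "\<theta> \<mu> (X F ?lam b) \<in> carrier (P \<mu>)" if "b \<in> B ?lam" for b
    by (rule theta_facts(1)[OF m X_closed[OF F l that]])
  ultimately show ?thesis by (simp add: fin_fun_simps cong: conj_cong)
qed

lemma Psi_closed: "F \<in> carrier (wedge n N) \<Longrightarrow> Psi F \<in> carrier W"
  unfolding dsum_simps Psi_def by (intro restrict_PiE_iff[THEN iffD2] ballI Psi_fin_fun)

lemma Psi_hcomp:
  assumes F: "F \<in> hcomp (wedge n N) d" shows "Psi F \<in> hcomp W d"
  unfolding dsum_simps Psi_def
proof (intro restrict_PiE_iff[THEN iffD2] ballI)
  fix \<mu> assume mu: "\<mu> \<in> I"
  let ?lam = "conjugate_partition \<mu>"
  have m: "\<mu> \<in> partitions N" "length \<mu> \<le> n" using mu by simp_all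
  have Fc: "F \<in> carrier (wedge n N)" and h: "homogeneous d (F w)" "F w \<in> zpolys N" for w
    using F by (simp_all add: wedge_simps(5) wedge_iff)
  note l = conj_partition[OF m(1)]
  have "\<theta> \<mu> (X F ?lam b) = \<zero>\<^bsub>P \<mu>\<^esub>" if b: "b \<in> B ?lam" "b \<notin> D ?lam d" for b
  proof -
    have "X F ?lam b = \<zero>\<^bsub>L ?lam\<^esub>" using phi_hcomp[OF h(2,1) l b] by (simp add: X_def Lmod_simps)
    then show ?thesis using theta_facts(4)[OF m] by simp
  qed
  then show "(\<lambda>b\<in>B ?lam. \<theta> \<mu> (X F ?lam b)) \<in> hcomp (fin_fun (P \<mu>) (B ?lam) (D ?lam)) d"
    using Psi_fin_fun[OF Fc mu] by (auto simp: fin_fun_simps(5))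
qed

text \<open>The element of the sum of the \<open>W\<^sub>\<lambda> \<otimes> M\<^sub>\<lambda>\<close> that the coefficient at the word \<open>w\<close> of a preimage of \<open>y\<close> must map to.\<close>

definition Z where
  "Z y w = (\<lambda>lam\<in>partitions N. \<lambda>b\<in>B lam. if length (conjugate_partition lam) \<le> n
     then inv_into (carrier (L lam)) (\<theta> (conjugate_partition lam)) (y (conjugate_partition lam) b) w else (\<lambda>T. 0))"

text \<open>The second claim bounds the support of \<open>Z y w\<close> by that of \<open>y\<close>,
  which transfers finiteness here and homogeneity in \<open>Z_hcomp\<close>.\<close>

lemma Z_fin_fun:
  assumes y: "y \<in> carrier W" and l: "lam \<in> partitions N"
  shows "Z y w lam \<in> carrier (fin_fun (specht N lam) (B lam) (D lam))"
    and "b \<in> B lam \<Longrightarrow> Z y w lam b \<noteq> (\<lambda>T. 0) \<Longrightarrow>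
      conjugate_partition lam \<in> I \<and> y (conjugate_partition lam) b \<noteq> \<zero>\<^bsub>P (conjugate_partition lam)\<^esub>"
proof -
  let ?mu = "conjugate_partition lam"
  note l' = conj_partition[OF l]
  note cc = conj_conj[OF l]
  have g: "inv_into (carrier (L lam)) (\<theta> ?mu) (y ?mu b) w \<in> specht_data.S N lam"
    "finite {b \<in> B lam. y ?mu b \<noteq> \<zero>\<^bsub>P ?mu\<^esub>}"
    "y ?mu b = \<zero>\<^bsub>P ?mu\<^esub> \<Longrightarrow> inv_into (carrier (L lam)) (\<theta> ?mu) (y ?mu b) w = (\<lambda>T. 0)"
    if n: "length ?mu \<le> n" and b: "b \<in> B lam" for b
  proof -
    have "y ?mu \<in> carrier (fin_fun (P ?mu) (B (conjugate_partition ?mu)) (D (conjugate_partition ?mu)))"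
      using y l' n unfolding dsum_simps by (intro PiE_mem[of y I]) simp_all
    then have yf: "y ?mu \<in> B lam \<rightarrow>\<^sub>E carrier (P ?mu)" "finite {b \<in> B lam. y ?mu b \<noteq> \<zero>\<^bsub>P ?mu\<^esub>}"
      by (simp_all add: fin_fun_simps cc)
    note i = theta_inv[OF l' n PiE_mem[OF yf(1) b], unfolded cc]
    show "inv_into (carrier (L lam)) (\<theta> ?mu) (y ?mu b) w \<in> specht_data.S N lam"
      using i(1) by (simp add: Lmod_iff)
    show "finite {b \<in> B lam. y ?mu b \<noteq> \<zero>\<^bsub>P ?mu\<^esub>}" by (rule yf(2))
    assume "y ?mu b = \<zero>\<^bsub>P ?mu\<^esub>"
    then have "inv_into (carrier (L lam)) (\<theta> ?mu) (y ?mu b) = \<zero>\<^bsub>L lam\<^esub>"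
      using theta_zero_iff[OF l' n, unfolded cc, OF i(1)] i(2) by simp
    then show "inv_into (carrier (L lam)) (\<theta> ?mu) (y ?mu b) w = (\<lambda>T. 0)" by (simp add: Lmod_simps)
  qed
  show nz: "?mu \<in> I \<and> y ?mu b \<noteq> \<zero>\<^bsub>P ?mu\<^esub>" if "b \<in> B lam" "Z y w lam b \<noteq> (\<lambda>T. 0)" for b
    using that g(3)[of b] l l' by (auto simp: Z_def split: if_splits)
  have "Z y w lam b \<in> specht_data.S N lam" if "b \<in> B lam" for b
    using that l g(1) by (simp add: Z_def specht_data.S_zero)
  moreover have "finite {b \<in> B lam. Z y w lam b \<noteq> (\<lambda>T. 0)}"
  proof (cases "length ?mu \<le> n \<and> B lam \<noteq> {}")
    case True
    then have "finite {b \<in> B lam. y ?mu b \<noteq> \<zero>\<^bsub>P ?mu\<^esub>}" using g(2) by auto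
    then show ?thesis by (rule finite_subset[rotated]) (use nz in auto)
  next
    case False
    then have "{b \<in> B lam. Z y w lam b \<noteq> (\<lambda>T. 0)} = {}" using nz by auto
    then show ?thesis by (simp only: finite.emptyI)
  qed
  moreover have "Z y w lam = restrict (Z y w lam) (B lam)" using l by (simp add: Z_def)
  ultimately show "Z y w lam \<in> carrier (fin_fun (specht N lam) (B lam) (D lam))"
    by (simp add: fin_fun_simps specht_simps PiE_iff extensional_restrict) (metis restrict_extensional)
qed

lemma Z_closed: assumes "y \<in> carrier W" shows "Z y w \<in> carrier R"
proof -
  have "Z y w = restrict (Z y w) (partitions N)" by (simp add: Z_def)
  moreover have "restrict (Z y w) (partitions N) \<in> carrier R"
    unfolding dsum_simps by (intro restrict_PiE_iff[THEN iffD2] ballI Z_fin_fun(1)[OF assms])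
  ultimately show ?thesis by (simp only:)
qed

lemma hcomp_W_carrier: "hcomp W d \<subseteq> carrier W"
  unfolding dsum_simps by (rule PiE_mono) (auto simp: fin_fun_simps(5))

lemma Z_hcomp: assumes y: "y \<in> hcomp W d" shows "Z y w \<in> hcomp R d"
proof -
  have yc: "y \<in> carrier W" using y hcomp_W_carrier by (rule subsetD[rotated])
  have "Z y w = restrict (Z y w) (partitions N)" by (simp add: Z_def)
  moreover have "restrict (Z y w) (partitions N) \<in> hcomp R d"
    unfolding dsum_simps
  proof (intro restrict_PiE_iff[THEN iffD2] ballI)
    fix lam assume l: "lam \<in> partitions N"
    let ?mu = "conjugate_partition lam"
    have "b \<in> D lam d" if b: "b \<in> B lam" "Z y w lam b \<noteq> (\<lambda>T. 0)" for b
    proof -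
      note nz = Z_fin_fun(2)[OF yc l b]
      have "y ?mu \<in> hcomp (fin_fun (P ?mu) (B (conjugate_partition ?mu)) (D (conjugate_partition ?mu))) d"
        using y nz unfolding dsum_simps by (intro PiE_mem[of y I]) simp_all
      then show ?thesis using nz b(1) by (simp add: fin_fun_simps(5) conj_conj[OF l])
    qed
    then show "Z y w lam \<in> hcomp (fin_fun (specht N lam) (B lam) (D lam)) d"
      using Z_fin_fun(1)[OF yc l, of w] by (simp add: fin_fun_simps(5) specht_simps)
  qed
  ultimately show ?thesis by (simp only:)
qed

section \<open>Surjectivity and kernel of the map\<close>

text \<open>Preimages under \<open>\<Phi>\<close> are prescribed word by word, with no regard to
  antisymmetry. Antisymmetrising them repairs this without changing the relevant coordinates,
  because the prescribed values are already antisymmetric and each summand of the average reproduces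
  them.\<close>

lemma Psi_alt:
  assumes y: "y \<in> carrier W" and p: "\<And>w. p w \<in> zpolys N" "\<And>w. w \<notin> words n N \<Longrightarrow> p w = 0"
    "\<And>w. w \<in> words n N \<Longrightarrow> \<Phi> (p w) = Z y w"
  shows "Psi (alt N p) = y"
proof (rule Psi_eqI[OF y])
  fix \<mu> b assume mu: "\<mu> \<in> I" and b: "b \<in> B (conjugate_partition \<mu>)"
  let ?lam = "conjugate_partition \<mu>"
  have m: "\<mu> \<in> partitions N" "length \<mu> \<le> n" using mu by simp_all
  note l = conj_partition[OF m(1)] and cc = conj_conj[OF m(1)]
  have "y \<mu> \<in> carrier (fin_fun (P \<mu>) (B ?lam) (D ?lam))"
    using y mu unfolding dsum_simps by (rule PiE_mem)
  then have "y \<mu> b \<in> carrier (P \<mu>)" using b by (auto simp: fin_fun_simps)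
  note i = theta_inv[OF m this]
  let ?g = "inv_into (carrier (L ?lam)) (\<theta> \<mu>) (y \<mu> b)"
  have pg: "\<Phi> (p u) ?lam b = ?g u" for u
  proof (cases "u \<in> words n N")
    case True
    then show ?thesis using l b m(2) by (simp add: p(3) Z_def cc)
  next
    case False
    then show ?thesis using i(1) phi_zero[OF l b] by (simp add: p(2) Lmod_iff)
  qed
  have "X (alt N p) ?lam b w T = ?g w T" for w T
  proof -
    have "X (alt N p) ?lam b w T =
        1 / fact N * (\<Sum>\<sigma>\<in>sym_group N. of_int (sign \<sigma>) * \<Phi> (p (w \<circ> \<sigma>)) ?lam b (T \<circ> \<sigma>))"
      unfolding X_def alt_def of_int_scale
      by (simp only: phi_scale[OF _ l b] phi_sum[OF l b] phi_perm[OF _ _ l b] zpolys_sum zpolys_closed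
        perm_vars_zpolys p(1) cong: sum.cong)
    also have "\<dots> = 1 / fact N * (\<Sum>\<sigma>\<in>sym_group N. ?g w T)"
      using i(1) by (simp add: pg Lmod_iff mult.assoc[symmetric] sign_square)
    also have "\<dots> = ?g w T" by (simp add: card_sym_group)
    finally show ?thesis .
  qed
  then have "X (alt N p) ?lam b = ?g" by (intro ext)
  then show "\<theta> \<mu> (X (alt N p) ?lam b) = y \<mu> b" using i(2) by simp
qed

text \<open>If the image vanishes, all coordinates of each \<open>F w\<close> vanish: those with
  conjugate of at most n parts by injectivity of \<open>\<theta>\<close>, the others by
  \<open>Lmod_trivial\<close>. Then \<open>F w\<close> lies in the kernel of \<open>\<Phi>\<close>,
  and \<open>Im_H_eq\<close> applies.\<close>

lemma Psi_kernel: "{F \<in> carrier (wedge n N). Psi F = \<zero>\<^bsub>W\<^esub>} = Im_H n N"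
  unfolding Im_H_eq
proof (intro Collect_cong conj_cong refl)
  fix F assume F: "F \<in> carrier (wedge n N)"
  have Fz: "F w \<in> zpolys N" for w using F by (simp add: wedge_iff)
  have W0: "\<zero>\<^bsub>W\<^esub> \<in> carrier W" 
    by (rule abelian_groupE(2)[OF module.axioms(2)[OF module_dsum[OF module_fin_fun]]]) (simp add: module_P)
  show "Psi F = \<zero>\<^bsub>W\<^esub> \<longleftrightarrow> (\<forall>w. F w \<in> J_ideal N)"
  proof
    assume z: "Psi F = \<zero>\<^bsub>W\<^esub>"
    have "\<Phi> (F w) lam b = (\<lambda>T. 0)" if l: "lam \<in> partitions N" and b: "b \<in> B lam" for w lam b
    proof (cases "length (conjugate_partition lam) \<le> n")
      case True
      let ?mu = "conjugate_partition lam"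
      note m = conj_partition[OF l] True and cc = conj_conj[OF l]
      have "\<theta> ?mu (X F lam b) = \<zero>\<^bsub>P ?mu\<^esub>"
        using Psi_apply[of ?mu b F] m b fun_cong[OF fun_cong[OF z], of ?mu b]
        by (simp add: cc dsum_simps fin_fun_simps)
      then have "X F lam b = \<zero>\<^bsub>L lam\<^esub>"
        using theta_zero_iff[OF m, unfolded cc, OF X_closed[OF F l b]] by simp
      from fun_cong[OF this, of w] show ?thesis by (simp add: X_def Lmod_simps)
    next
      case False
      then have "0 < length lam" "n < lam ! 0" by (auto simp: conj_length part_def split: if_splits)
      from specht_data.Lmod_trivial[OF this X_closed[OF F l b]] show ?thesis
        by (intro ext) (simp add: X_def)
    qed
    then show "\<forall>w. F w \<in> J_ideal N" using phi_J[OF Fz] by simp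
  next
    assume J: "\<forall>w. F w \<in> J_ideal N"
    show "Psi F = \<zero>\<^bsub>W\<^esub>"
    proof (rule Psi_eqI[OF W0])
      fix \<mu> b assume mu: "\<mu> \<in> I" and b: "b \<in> B (conjugate_partition \<mu>)"
      have m: "\<mu> \<in> partitions N" "length \<mu> \<le> n" using mu by simp_all
      have "X F (conjugate_partition \<mu>) b = \<zero>\<^bsub>L (conjugate_partition \<mu>)\<^esub>"
        using J phi_J[OF Fz] conj_partition[OF m(1)] b by (simp add: X_def Lmod_simps)
      then show "\<theta> \<mu> (X F (conjugate_partition \<mu>) b) = \<zero>\<^bsub>W\<^esub> \<mu> b"
        using theta_facts(4)[OF m] m b by (simp add: dsum_simps fin_fun_simps)
    qed
  qed
qed

lemma graded_epi_Psi: "graded_epi (sl n) (wedge n N) W Psi"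
proof (rule graded_epiI)
  show "Psi F \<in> carrier W" if "F \<in> carrier (wedge n N)" for F by (rule Psi_closed[OF that])
  have mW: "module class_ring W" by (rule module_dsum[OF module_fin_fun]) (simp add: module_P)
  show "Psi (F \<oplus>\<^bsub>wedge n N\<^esub> G) = Psi F \<oplus>\<^bsub>W\<^esub> Psi G"
    if F: "F \<in> carrier (wedge n N)" and G: "G \<in> carrier (wedge n N)" for F G
  proof (rule Psi_eqI)
    show "Psi F \<oplus>\<^bsub>W\<^esub> Psi G \<in> carrier W"
      by (rule cmodule.ab(1)[OF cmodule.intro[OF mW] Psi_closed[OF F] Psi_closed[OF G]])
    fix \<mu> b assume mu: "\<mu> \<in> I" and b: "b \<in> B (conjugate_partition \<mu>)"
    have m: "\<mu> \<in> partitions N" "length \<mu> \<le> n" using mu by simp_all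
    note l = conj_partition[OF m(1)]
    show "\<theta> \<mu> (X (F \<oplus>\<^bsub>wedge n N\<^esub> G) (conjugate_partition \<mu>) b) = (Psi F \<oplus>\<^bsub>W\<^esub> Psi G) \<mu> b"
      using m b by (simp add: X_add[OF F G l b] theta_facts(2)[OF m X_closed[OF F l b] X_closed[OF G l b]]
        Psi_def dsum_simps fin_fun_simps)
  qed
  show "Psi (c \<odot>\<^bsub>wedge n N\<^esub> F) = c \<odot>\<^bsub>W\<^esub> Psi F" if F: "F \<in> carrier (wedge n N)" for c F
  proof (rule Psi_eqI)
    show "c \<odot>\<^bsub>W\<^esub> Psi F \<in> carrier W" by (rule cmodule.cl[OF cmodule.intro[OF mW] Psi_closed[OF F]])
    fix \<mu> b assume mu: "\<mu> \<in> I" and b: "b \<in> B (conjugate_partition \<mu>)"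
    have m: "\<mu> \<in> partitions N" "length \<mu> \<le> n" using mu by simp_all
    note l = conj_partition[OF m(1)]
    show "\<theta> \<mu> (X (c \<odot>\<^bsub>wedge n N\<^esub> F) (conjugate_partition \<mu>) b) = (c \<odot>\<^bsub>W\<^esub> Psi F) \<mu> b"
      using m b by (simp add: X_smult[OF F l b] theta_facts(3)[OF m X_closed[OF F l b]]
        Psi_def dsum_simps fin_fun_simps)
  qed
  show "act (wedge n N) Y F \<in> carrier (wedge n N)" if "F \<in> carrier (wedge n N)" for Y F
    using wedge_act_closed[OF that] by (simp only: wedge_simps(6))
  show "Psi (act (wedge n N) Y F) = act W Y (Psi F)" if Y: "Y \<in> sl n" and F: "F \<in> carrier (wedge n N)" for Y F
  proof -
    have "\<theta> \<mu> (X (act (wedge n N) Y F) (conjugate_partition \<mu>) b) = act (P \<mu>) Y (\<theta> \<mu> (X F (conjugate_partition \<mu>) b))"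
      if mu: "\<mu> \<in> I" and b: "b \<in> B (conjugate_partition \<mu>)" for \<mu> b
    proof -
      have m: "\<mu> \<in> partitions N" "length \<mu> \<le> n" using mu by simp_all
      note l = conj_partition[OF m(1)]
      show ?thesis unfolding X_act[OF F l b] by (rule theta_act[OF m Y X_closed[OF F l b]])
    qed
    then show ?thesis
      by (simp add: Psi_def dsum_simps fin_fun_simps cong: restrict_cong)
  qed
  show "F \<in> carrier (wedge n N) \<and> Psi F \<in> hcomp W d" if "F \<in> hcomp (wedge n N) d" for d F
    using Psi_hcomp[OF that] that by (simp add: wedge_simps(5))
  show "\<exists>F\<in>carrier (wedge n N). Psi F = y" if y: "y \<in> carrier W" for y
  proof -
    have "\<exists>p\<in>zpolys N. \<Phi> p = Z y w" for w
      by (rule graded_epiD(3)[OF epi Z_closed[OF y], unfolded zpoly_ring_simps])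
    then obtain p where p: "p w \<in> zpolys N" "\<Phi> (p w) = Z y w" for w by metis
    let ?q = "\<lambda>w. if w \<in> words n N then p w else 0"
    have q: "?q w \<in> zpolys N" for w using p(1) by (simp add: zpolys_closed)
    have "Psi (alt N ?q) = y" by (rule Psi_alt[OF y q]) (simp_all add: p)
    moreover have "alt N ?q \<in> carrier (wedge n N)" by (rule alt_wedge[OF q]) simp
    ultimately show ?thesis by (rule bexI)
  qed
  show "\<exists>F\<in>hcomp (wedge n N) d. Psi F = y" if y: "y \<in> hcomp W d" for d y
  proof -
    \<comment> \<open>As \<open>\<Phi>\<close> maps homogeneous polynomials of degree d onto the
      component of degree d, the lifts can be chosen homogeneous, and antisymmetrisation keeps the
      degree.\<close>
    have "\<forall>w. \<exists>p. p \<in> zpolys N \<and> homogeneous d p \<and> \<Phi> p = Z y w"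
      using graded_epiD(8)[OF epi Z_hcomp[OF y]] by (simp add: zpoly_ring_simps Bex_def conj_assoc)
    then obtain p where p: "p w \<in> zpolys N" "homogeneous d (p w)" "\<Phi> (p w) = Z y w" for w by metis
    let ?q = "\<lambda>w. if w \<in> words n N then p w else 0"
    have q: "?q w \<in> zpolys N" for w using p(1) by (simp add: zpolys_closed)
    have h: "homogeneous d (?q w)" for w using p(2) by (simp add: homogeneous_def)
    have "Psi (alt N ?q) = y"
      by (rule Psi_alt[OF subsetD[OF hcomp_W_carrier y] q]) (simp_all add: p)
    moreover have "alt N ?q \<in> hcomp (wedge n N) d"
      unfolding wedge_simps(5) using alt_wedge[OF q, of n] alt_homogeneous[OF h] by simp
    ultimately show ?thesis by (rule bexI)
  qed
qed

end

section \<open>Coordinates on the coinvariant algebra\<close>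

lemma perm_vars_J:
  assumes s: "\<sigma> \<in> sym_group N" and p: "p \<in> J_ideal N" shows "perm_vars \<sigma> p \<in> J_ideal N"
proof -
  note b = sym_group_bij[OF s]
  obtain q where q: "p = (\<Sum>k\<in>{1..N}. elem_sym N k * q k)" "\<forall>k. q k \<in> zpolys N"
    using p unfolding J_eq_sums J_sums_def by auto
  have "perm_vars \<sigma> p = (\<Sum>k\<in>{1..N}. elem_sym N k * perm_vars \<sigma> (q k))"
    by (simp only: q(1) perm_vars_sum[OF b] perm_vars_mult[OF b] perm_vars_elem_sym[OF s])
  moreover have "perm_vars \<sigma> (q k) \<in> zpolys N" for k by (rule perm_vars_zpolys[OF s]) (use q(2) in simp)
  ultimately show ?thesis unfolding J_eq_sums J_sums_def by (intro CollectI exI conjI) (assumption, simp)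
qed

lemma zpoly_ring_minus:
  "b \<in> zpolys N \<Longrightarrow> a \<ominus>\<^bsub>zpoly_ring N\<^esub> b = a + Poly_Mapping.map ((*) (- 1)) b"
  using cmodule.minus_eq_smult[OF cmodule.intro[OF module_zpoly_ring], of b N]
  by (simp add: a_minus_def zpoly_ring_simps del: lookup_scale)

lemma cquot_J: "cquot (zpoly_ring N) (J_ideal N)"
  by (intro cquot.intro cmodule.intro cquot_axioms.intro module_zpoly_ring)
    (auto simp: zpoly_ring_simps J_zero J_add J_scale intro: subsetD[OF J_sub])

lemma graded_epi_R_quot:
  "graded_epi (sym_group N) (zpoly_ring N) (R_quot N) (\<lambda>p. J_ideal N +>\<^bsub>zpoly_ring N\<^esub> p)"
  unfolding R_quot_def
proof (rule cquot.graded_epi_coset[OF cquot_J])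
  show "act (zpoly_ring N) \<sigma> p \<in> carrier (zpoly_ring N)"
    if "\<sigma> \<in> sym_group N" "p \<in> carrier (zpoly_ring N)" for \<sigma> p
    using perm_vars_zpolys[of \<sigma> N p] that by (simp add: zpoly_ring_simps)
  show "act (zpoly_ring N) \<sigma> p \<ominus>\<^bsub>zpoly_ring N\<^esub> act (zpoly_ring N) \<sigma> q \<in> J_ideal N"
    if s: "\<sigma> \<in> sym_group N" and pq: "p \<in> carrier (zpoly_ring N)" "q \<in> carrier (zpoly_ring N)"
      "p \<ominus>\<^bsub>zpoly_ring N\<^esub> q \<in> J_ideal N" for \<sigma> p q
  proof -
    note b = sym_group_bij[OF s]
    have z: "p \<in> zpolys N" "q \<in> zpolys N" using pq by (simp_all only: zpoly_ring_simps)
    have "perm_vars \<sigma> (p + Poly_Mapping.map ((*) (- 1)) q) \<in> J_ideal N"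
      by (rule perm_vars_J[OF s pq(3)[unfolded zpoly_ring_minus[OF z(2)]]])
    then show ?thesis
      unfolding zpoly_ring_simps(8) zpoly_ring_minus[OF perm_vars_zpolys[OF s z(2)]]
      by (simp only: perm_vars_add[OF b] perm_vars_scale[OF b])
  qed
  show "hcomp (zpoly_ring N) d \<subseteq> carrier (zpoly_ring N)" for d by (auto simp: zpoly_ring_simps)
qed

text \<open>The composite of the projection onto \<open>R_quot N\<close>, the given isomorphism and
  the coordinate isomorphisms of the tensor products. Everything after the projection is injective,
  so the kernel is that of the projection.\<close>

lemma multiplicity_spaces_epi:
  assumes M: "multiplicity_spaces N M"
    and gb: "\<And>lam. lam \<in> partitions N \<Longrightarrow> graded_basis (M lam) (B lam) (coord lam)"
  defines "R \<equiv> dsum (partitions N) (\<lambda>lam. fin_fun (specht N lam) (B lam) (\<lambda>d. B lam \<inter> hcomp (M lam) d))"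
  obtains \<Phi> where "graded_epi (sym_group N) (zpoly_ring N) R \<Phi>"
    "{p \<in> carrier (zpoly_ring N). \<Phi> p = \<zero>\<^bsub>R\<^esub>} = J_ideal N"
proof -
  let ?G = "sym_group N" and ?T = "\<lambda>lam. tensor (specht N lam) (M lam)"
  let ?pi = "\<lambda>p. J_ideal N +>\<^bsub>zpoly_ring N\<^esub> p"
  note pi = graded_epi_R_quot[of N]
  obtain f where f: "f \<in> LinearCombinations.module_hom class_ring (R_quot N) (dsum (partitions N) ?T)"
    "bij_betw f (carrier (R_quot N)) (carrier (dsum (partitions N) ?T))"
    "\<And>x v. x \<in> ?G \<Longrightarrow> v \<in> carrier (R_quot N) \<Longrightarrow> f (act (R_quot N) x v) = act (dsum (partitions N) ?T) x (f v)"
    "\<And>d. f ` hcomp (R_quot N) d = hcomp (dsum (partitions N) ?T) d"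
    using M unfolding multiplicity_spaces_def gmod_iso_def by blast
  \<comment> \<open>Closure under the operators is not part of \<open>gmod_iso\<close>; it is
    inherited from the polynomial ring through the projection.\<close>
  have act_closed: "act (R_quot N) x v \<in> carrier (R_quot N)" if x: "x \<in> ?G" and v: "v \<in> carrier (R_quot N)" for x v
  proof -
    obtain p where p: "p \<in> carrier (zpoly_ring N)" "?pi p = v" using graded_epiD(3)[OF pi v] by (rule bexE)
    show ?thesis
      using graded_epiD(2)[OF pi graded_epiD(4)[OF pi x p(1)]] graded_epiD(5)[OF pi x p(1)] p(2) by simp
  qed
  have "hcomp (R_quot N) d \<subseteq> carrier (R_quot N)" for d
    using graded_epiD(2,6,8)[OF pi] by blast
  then have fe: "graded_epi ?G (R_quot N) (dsum (partitions N) ?T) f"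
    unfolding graded_epi_def using f act_closed bij_betw_imp_surj_on[OF f(2)] by simp
  have "\<exists>g. graded_epi ?G (?T lam) (fin_fun (specht N lam) (B lam) (\<lambda>d. B lam \<inter> hcomp (M lam) d)) g \<and>
      inj_on g (carrier (?T lam))" if l: "lam \<in> partitions N" for lam
  proof -
    interpret tensor_basis "specht N lam" "M lam" "B lam" "coord lam"
      by (intro tensor_basis.intro cmodule.intro specht_data.module_specht gb l tensor_basis_axioms.intro
        specht_data.specht_simps(6))
    show ?thesis
      using tensor_iso_fin_fun[of ?G] specht_data.specht_act_hom by metis
  qed
  then obtain g where g: "\<And>lam. lam \<in> partitions N \<Longrightarrow>
      graded_epi ?G (?T lam) (fin_fun (specht N lam) (B lam) (\<lambda>d. B lam \<inter> hcomp (M lam) d)) (g lam)"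
    "\<And>lam. lam \<in> partitions N \<Longrightarrow> inj_on (g lam) (carrier (?T lam))"
    by metis
  let ?g = "\<lambda>x. \<lambda>lam\<in>partitions N. g lam (x lam)"
  have ge: "graded_epi ?G (dsum (partitions N) ?T) R ?g"
    unfolding R_def by (rule graded_epi_dsum[OF g(1)])
  note he = graded_epi_comp[OF fe ge]
  have hinj: "inj_on (?g \<circ> f) (carrier (R_quot N))"
  proof (rule comp_inj_on)
    show "inj_on f (carrier (R_quot N))" by (rule bij_betw_imp_inj_on[OF f(2)])
    show "inj_on ?g (f ` carrier (R_quot N))"
      unfolding bij_betw_imp_surj_on[OF f(2)] by (rule inj_on_dsum[OF g(2)])
  qed
  note Phi = graded_epi_comp[OF pi he]
  let ?Phi = "(?g \<circ> f) \<circ> ?pi"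
  have mR: "module class_ring R"
    unfolding R_def by (rule module_dsum[OF module_fin_fun[OF specht_data.module_specht]])
  have z: "?Phi 0 = \<zero>\<^bsub>R\<^esub>"
    using clinear.zero[OF graded_epi_clinear[OF Phi module_zpoly_ring mR]] by (simp only: zpoly_ring_simps)
  have "?Phi p = \<zero>\<^bsub>R\<^esub> \<longleftrightarrow> p \<in> J_ideal N" if p: "p \<in> zpolys N" for p
  proof -
    have c: "p \<in> carrier (zpoly_ring N)" "0 \<in> carrier (zpoly_ring N)"
      using p by (simp_all add: zpoly_ring_simps zpolys_closed)
    have "?Phi p = \<zero>\<^bsub>R\<^esub> \<longleftrightarrow> ?pi p = ?pi 0"
      unfolding z[symmetric] comp_apply[of "?g \<circ> f" ?pi]
      by (rule inj_on_eq_iff[OF hinj graded_epiD(2)[OF pi c(1)] graded_epiD(2)[OF pi c(2)]])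
    also have "\<dots> \<longleftrightarrow> p \<in> J_ideal N"
      unfolding cquot.coset_eq_iff[OF cquot_J c] by (simp add: zpoly_ring_minus zpolys_closed)
    finally show ?thesis .
  qed
  then have "{p \<in> carrier (zpoly_ring N). ?Phi p = \<zero>\<^bsub>R\<^esub>} = J_ideal N"
    using J_sub[of N] unfolding zpoly_ring_simps by blast
  with Phi show thesis by (rule that)
qed

theorem lemma5p1:
  fixes n N :: nat
    and P :: "nat list \<Rightarrow> (complex mat, 'v) gmod"
    and M :: "nat list \<Rightarrow> 'm gspace"
  assumes "n \<ge> 2" and "N \<ge> 1"
    and "\<And>\<mu>. \<mu> \<in> partitions N \<Longrightarrow> length \<mu> \<le> n \<Longrightarrow> is_pi n \<mu> (P \<mu>)"
    and "multiplicity_spaces N M"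
  shows "gmod_iso (sl n) (reduced_wedge n N)
           (dsum {\<mu> \<in> partitions N. length \<mu> \<le> n}
              (\<lambda>\<mu>. tensor (P \<mu>) (M (conjugate_partition \<mu>))))"
proof -
  have "\<forall>lam. \<exists>B coord. lam \<in> partitions N \<longrightarrow> graded_basis (M lam) B coord"
    using assms(4) exists_graded_basis unfolding multiplicity_spaces_def by metis
  then obtain B coord where gb: "\<And>lam. lam \<in> partitions N \<Longrightarrow> graded_basis (M lam) (B lam) (coord lam)"
    by metis
  define D where "D lam d = B lam \<inter> hcomp (M lam) d" for lam d
  have D: "D lam = (\<lambda>d. B lam \<inter> hcomp (M lam) d)" for lam by (simp add: D_def fun_eq_iff)
  obtain \<Phi> where Phi: "graded_epi (sym_group N) (zpoly_ring N)
      (dsum (partitions N) (\<lambda>lam. fin_fun (specht N lam) (B lam) (D lam))) \<Phi>"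
    "{p \<in> carrier (zpoly_ring N). \<Phi> p =
      \<zero>\<^bsub>dsum (partitions N) (\<lambda>lam. fin_fun (specht N lam) (B lam) (D lam))\<^esub>} = J_ideal N"
    unfolding D by (rule multiplicity_spaces_epi[OF assms(4) gb])
  have sl: "sl_module n (P \<mu>)" "module class_ring (P \<mu>)" "in_degree_zero (P \<mu>)"
    if "\<mu> \<in> partitions N" "length \<mu> \<le> n" for \<mu>
    using assms(3)[OF that]
    by (simp_all add: is_pi_def sl_irreducible_def sl_module_def vectorspace_class_ring_iff)
  let ?Q = "\<lambda>\<mu> h. h \<in> LinearCombinations.module_hom class_ring (specht_data.Lmod n N (conjugate_partition \<mu>)) (P \<mu>) \<and>
      bij_betw h (carrier (specht_data.Lmod n N (conjugate_partition \<mu>))) (carrier (P \<mu>)) \<and>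
      (\<forall>X f. X \<in> sl n \<longrightarrow> f \<in> carrier (specht_data.Lmod n N (conjugate_partition \<mu>)) \<longrightarrow>
        h (act (specht_data.Lmod n N (conjugate_partition \<mu>)) X f) = act (P \<mu>) X (h f))"
  have "\<exists>h. ?Q \<mu> h" if mu: "\<mu> \<in> partitions N" "length \<mu> \<le> n" for \<mu>
  proof -
    have "n > 0" using assms(1) by simp
    then show ?thesis
    proof (rule pi_iso_Lmod[OF _ mu assms(3)[OF mu]])
      fix h assume "h \<in> LinearCombinations.module_hom class_ring (specht_data.Lmod n N (conjugate_partition \<mu>)) (P \<mu>)"
        "bij_betw h (carrier (specht_data.Lmod n N (conjugate_partition \<mu>))) (carrier (P \<mu>))"
        "\<And>X a. X \<in> sl n \<Longrightarrow> a \<in> carrier (specht_data.Lmod n N (conjugate_partition \<mu>)) \<Longrightarrow>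
          h (act (specht_data.Lmod n N (conjugate_partition \<mu>)) X a) = act (P \<mu>) X (h a)"
      then have "?Q \<mu> h" by simp
      then show ?thesis by (rule exI[of "?Q \<mu>"])
    qed
  qed
  then have "\<forall>\<mu>. \<exists>h. \<mu> \<in> partitions N \<longrightarrow> length \<mu> \<le> n \<longrightarrow> ?Q \<mu> h" by blast
  from choice[OF this] obtain \<theta> where th: "\<And>\<mu>. \<mu> \<in> partitions N \<Longrightarrow> length \<mu> \<le> n \<Longrightarrow> ?Q \<mu> (\<theta> \<mu>)"
    by blast
  interpret wedge_data n N B D \<Phi> P \<theta>
    by (rule wedge_data.intro[OF Phi sl(2)]) (use th in simp_all)
  have mW: "module class_ring W" by (rule module_dsum[OF module_fin_fun]) (simp add: sl(2))
  \<comment> \<open>The reduced wedge product is the quotient by the kernel of \<open>Psi\<close>,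
    hence isomorphic to the target in coordinates.\<close>
  obtain h where h: "graded_epi (sl n) (reduced_wedge n N) W h" "inj_on h (carrier (reduced_wedge n N))"
    unfolding reduced_wedge_def
    by (rule graded_epi_quot_kernel[OF graded_epi_Psi module_wedge mW Psi_kernel[symmetric]])
  let ?T = "\<lambda>\<mu>. tensor (P \<mu>) (M (conjugate_partition \<mu>))"
  let ?F = "\<lambda>\<mu>. fin_fun (P \<mu>) (B (conjugate_partition \<mu>)) (D (conjugate_partition \<mu>))"
  \<comment> \<open>Coordinates are given back: the coordinate map leads out of the tensor product,
    so its inverse is taken for each summand.\<close>
  have "\<exists>k. graded_epi (sl n) (?F \<mu>) (?T \<mu>) k \<and> inj_on k (carrier (?F \<mu>))" if mu: "\<mu> \<in> I" for \<mu>
  proof -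
    have m: "\<mu> \<in> partitions N" "length \<mu> \<le> n" using mu by simp_all
    interpret tensor_basis "P \<mu>" "M (conjugate_partition \<mu>)" "B (conjugate_partition \<mu>)" "coord (conjugate_partition \<mu>)"
      by (intro tensor_basis.intro cmodule.intro sl gb tensor_basis_axioms.intro conj_partition m)
    have "act (P \<mu>) X \<in> LinearCombinations.module_hom class_ring (P \<mu>) (P \<mu>)" if "X \<in> sl n" for X
      using sl(1)[OF m] that by (simp add: sl_module_def)
    then obtain g where g: "graded_epi (sl n) (?T \<mu>) (?F \<mu>) g" "inj_on g (carrier (?T \<mu>))"
      unfolding D by (rule tensor_iso_fin_fun)
    show ?thesis using graded_epi_inverse[OF g tensor_closed] by (intro exI conjI)
  qed
  then have "\<forall>\<mu>\<in>I. \<exists>k. graded_epi (sl n) (?F \<mu>) (?T \<mu>) k \<and> inj_on k (carrier (?F \<mu>))" by (rule ballI)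
  from bchoice[OF this] obtain k
    where "\<forall>\<mu>\<in>I. graded_epi (sl n) (?F \<mu>) (?T \<mu>) (k \<mu>) \<and> inj_on (k \<mu>) (carrier (?F \<mu>))"
    by (rule exE)
  then have k: "\<And>\<mu>. \<mu> \<in> I \<Longrightarrow> graded_epi (sl n) (?F \<mu>) (?T \<mu>) (k \<mu>)"
    "\<And>\<mu>. \<mu> \<in> I \<Longrightarrow> inj_on (k \<mu>) (carrier (?F \<mu>))"
    by simp_all
  let ?k = "\<lambda>x. \<lambda>\<mu>\<in>I. k \<mu> (x \<mu>)"
  have "graded_epi (sl n) (reduced_wedge n N) (dsum I ?T) (?k \<circ> h)"
    by (rule graded_epi_comp[OF h(1) graded_epi_dsum[OF k(1)]])
  moreover have "inj_on (?k \<circ> h) (carrier (reduced_wedge n N))"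
  proof (rule comp_inj_on[OF h(2)])
    have "inj_on ?k (carrier W)" by (rule inj_on_dsum) (rule k(2))
    moreover have "h ` carrier (reduced_wedge n N) \<subseteq> carrier W" using graded_epiD(2)[OF h(1)] by (rule image_subsetI)
    ultimately show "inj_on ?k (h ` carrier (reduced_wedge n N))" by (rule inj_on_subset)
  qed
  ultimately show ?thesis by (rule gmod_iso_of_graded_epi)
qed

end
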